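(* Let $(\mathcal{Y}_i,\mathbf{x}_i,Z_i)_{i=1}^n$ be a random sample from the joint distribution of $(\mathcal{Y},\mathbf{x},Z)$, where $\mathcal{Y}$ is an $L^2([0,1],\mathbb{R})$-valued random element with mean function $\mu_y=\mathbb{E}(\mathcal{Y})$, $\mathbf{x}$ is a $p\times 1$ random vector with mean $\boldsymbol{\mu}_{\mathbf{x}}$ and covariance matrix $\boldsymbol{\Sigma}_{\mathbf{x}}$, and $Z\in\{0,1\}$ indicates whether $\mathcal{Y}$ is observed ($Z=1$) or missing ($Z=0$). Assume that $\Pr[Z_i=1\mid \mathbf{x}_i,\mathcal{Y}_i]=\Pr[Z_i=1\mid\mathbf{x}_i]$. Assume that the outcome working model $\mathcal{Y}_i=\mathbf{x}_i^\top\boldsymbol{\beta}+\epsilon_i$ is correctly specified, i.e. $\mathbb{E}(\mathcal{Y}_i\mid\mathbf{x}_i)=\mathbf{x}_i^\top\boldsymbol{\beta}$, where $\boldsymbol{\beta}=(\beta_1,\dots,\beta_p)$ consists of non-stochastic functions in $L^2([0,1],\mathbb{R})$ and $\epsilon_i$ is an $L^2([0,1],\mathbb{R})$-valued random element with zero mean and covariance function $\sigma_\epsilon(s,t)$. Assume the regularity conditions for M-estimators listed in the context. Let $\hat\mu_{OR}=n^{-1}\sum_{i=1}^n\mathbf{x}_i^\top\hat{\boldsymbol{\beta}}$ be the functional outcome regression estimator. Then, as $n\to\infty$, $\sqrt{n}(\hat\mu_{OR}-\mu_y)$ converges in distribution to a Gaussian process: $$\sqrt{n}(\hat\mu_{OR}-\mu_y)\overset{d}{\rightarrow}\mathcal{GP}\left(0,\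 \boldsymbol{\beta}(s)^\top\boldsymbol{\Sigma}_{\mathbf{x}}\boldsymbol{\beta}(t)+\boldsymbol{\mu}_{\mathbf{x}}^\top\boldsymbol{\Pi}^{-1}\boldsymbol{\mu}_{\mathbf{x}}\cdot\sigma_\epsilon(s,t)\right),$$ where $\boldsymbol{\Pi}=\mathbb{E}[Z_i\mathbf{x}_i\mathbf{x}_i^\top]$.
   Context: $\mathcal{GP}(0,C(s,t))$ denotes the Gaussian process on $[0,1]$ with zero mean function and covariance function $C$; convergence in distribution is of random elements of $L^2([0,1],\mathbb{R})$. $\boldsymbol{\beta}(t)=(\beta_1(t),\dots,\beta_p(t))^\top$. Estimator: $\hat{\boldsymbol{\beta}}=(\mathbf{X}^\top\mathbf{X})^{-1}\mathbf{X}^\top\boldsymbol{\mathcal{Y}}$ with $\boldsymbol{\mathcal{Y}}=(\mathcal{Y}_1,\dots,\mathcal{Y}_n)^\top$ and $\mathbf{X}=(Z_1\mathbf{x}_1,\dots,Z_n\mathbf{x}_n)^\top$, i.e. $\hat{\boldsymbol{\beta}}=\left(\sum_i Z_i\mathbf{x}_i\mathbf{x}_i^\top\right)^{-1}\sum_i Z_i\mathbf{x}_i\mathcal{Y}_i$, a $p$-vector of functions. Regularity conditions. For every finite set of points $t_1,\dots,t_T\in[0,1]$, let $\mathbf{y}_i=(\mathcal{Y}_i(t_1),\dots,\mathcal{Y}_i(t_T))^\top$, let $\mathbf{B}$ range over $p\times T$ matrices, and let $\boldsymbol{\theta}=(\boldsymbol{\mu},\mathrm{vec}(\mathbf{B}))$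 and $\psi_i(\boldsymbol{\theta})=(\psi_{1,i},\psi_{2,i})$ with $\psi_{1,i}=\mathbf{B}^\top\mathbf{x}_i-\boldsymbol{\mu}$ and $\psi_{2,i}=(\mathbf{y}_i-\mathbf{B}^\top\mathbf{x}_i)\otimes Z_i\mathbf{x}_i$. The discretized estimator $\hat{\boldsymbol{\theta}}$ solves $n^{-1}\sum_i\psi_i(\boldsymbol{\theta})=0$. The usual regularity conditions are: (i) there is an interior point $\boldsymbol{\theta}_0$ of the parameter space with $\mathbb{E}\psi_i(\boldsymbol{\theta}_0)=0$ and $\hat{\boldsymbol{\theta}}\to\boldsymbol{\theta}_0$ in probability; (ii) $\psi_i$ is continuously differentiable in a neighbourhood $N$ of $\boldsymbol{\theta}_0$ with probability one; (iii) $\mathbb{E}\|\psi_i(\boldsymbol{\theta}_0)\|^2<\infty$ and $\mathbb{E}\sup_{\boldsymbol{\theta}\in N}\|\partial\psi_i(\boldsymbol{\theta})/\partial\boldsymbol{\theta}^\top\|<\infty$; (iv) $\mathbb{E}[\partial\psi_i(\boldsymbol{\theta}_0)/\partial\boldsymbol{\theta}^\top]$ is nonsingular.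
   Formalization: The error's covariance function is additionally assumed to equal σ_ε conditionally on x_i (homoscedastic errors), not only unconditionally; with error variance depending on x_i the stated limit covariance is false in general. *)

theory Defs
  imports "HOL-Probability.Probability"
begin

section \<open>The Hilbert space of square-integrable functions on the unit interval\<close>

abbreviation I01 :: "real measure" where
  "I01 \<equiv> restrict_space lborel {0..1}"

definition sq_int :: "(real \<Rightarrow> real) \<Rightarrow> bool" where
  "sq_int f \<longleftrightarrow> f \<in> borel_measurable I01 \<and> integrable I01 (\<lambda>t. (f t)\<^sup>2)"

definition L2_rel :: "(real \<Rightarrow> real) \<Rightarrow> (real \<Rightarrow> real) \<Rightarrow> bool" where
  "L2_rel f g \<longleftrightarrow> sq_int f \<and> sq_int g \<and> (AE t in I01. f t = g t)"

lemma sq_int_meas [measurable_dest]: "sq_int f \<Longrightarrow> f \<in> borel_measurable I01"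
  by (simp add: sq_int_def)

lemma sq_int_zero: "sq_int (\<lambda>_. 0)"
  by (simp add: sq_int_def)

lemma sq_int_mult:
  assumes "sq_int f" "sq_int g"
  shows "integrable I01 (\<lambda>t. f t * g t)"
proof (rule Bochner_Integration.integrable_bound)
  show "integrable I01 (\<lambda>t. (f t)\<^sup>2 + (g t)\<^sup>2)"
    using assms by (auto simp: sq_int_def)
  show "(\<lambda>t. f t * g t) \<in> borel_measurable I01"
    using assms by (auto simp: sq_int_def)
  have "\<bar>a * b\<bar> \<le> a\<^sup>2 + b\<^sup>2" for a b :: real
  proof -
    have "2 * (\<bar>a\<bar> * \<bar>b\<bar>) \<le> a\<^sup>2 + b\<^sup>2"
      using sum_squares_bound[of "\<bar>a\<bar>" "\<bar>b\<bar>"] by simp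
    moreover have "0 \<le> \<bar>a\<bar> * \<bar>b\<bar>"
      by simp
    ultimately show ?thesis
      unfolding abs_mult by linarith
  qed
  then show "AE t in I01. norm (f t * g t) \<le> norm ((f t)\<^sup>2 + (g t)\<^sup>2)"
    by simp
qed

lemma sq_int_add:
  assumes "sq_int f" "sq_int g"
  shows "sq_int (\<lambda>t. f t + g t)"
proof -
  have "integrable I01 (\<lambda>t. (f t)\<^sup>2 + (g t)\<^sup>2 + 2 * (f t * g t))"
    using assms sq_int_mult[OF assms] by (auto simp: sq_int_def)
  then show ?thesis
    using assms by (auto simp: sq_int_def power2_sum algebra_simps)
qed

lemma sq_int_scale: "sq_int f \<Longrightarrow> sq_int (\<lambda>t. c * f t)"
  by (auto simp: sq_int_def power_mult_distrib)

lemma sq_int_uminus: "sq_int f \<Longrightarrow> sq_int (\<lambda>t. - f t)"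
  by (auto simp: sq_int_def)

lemma sq_int_diff: "sq_int f \<Longrightarrow> sq_int g \<Longrightarrow> sq_int (\<lambda>t. f t - g t)"
  using sq_int_add[of f "\<lambda>t. - g t"] sq_int_uminus[of g] by simp

quotient_type L2 = "real \<Rightarrow> real" / partial: L2_rel
proof (rule part_equivpI)
  show "\<exists>f. L2_rel f f"
    using sq_int_zero by (auto simp: L2_rel_def)
  show "symp L2_rel"
    by (auto simp: symp_def L2_rel_def elim: AE_mp)
  show "transp L2_rel"
  proof (rule transpI)
    fix f g h
    assume "L2_rel f g" "L2_rel g h"
    then show "L2_rel f h"
      unfolding L2_rel_def by (auto elim: AE_mp)
  qed
qed

text \<open>
  The class of a square-integrable function. The values of the function outside the unit interval
  play no role; the result is unspecified if the function is not square-integrable.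
\<close>

definition to_L2 :: "(real \<Rightarrow> real) \<Rightarrow> L2" where
  "to_L2 f = abs_L2 f"

instantiation L2 :: real_inner
begin

lift_definition zero_L2 :: L2 is "\<lambda>_. 0"
  by (simp add: L2_rel_def sq_int_zero)

lift_definition plus_L2 :: "L2 \<Rightarrow> L2 \<Rightarrow> L2" is "\<lambda>f g t. f t + g t"
  by (auto simp: L2_rel_def sq_int_add elim: AE_mp)

lift_definition uminus_L2 :: "L2 \<Rightarrow> L2" is "\<lambda>f t. - f t"
  by (auto simp: L2_rel_def sq_int_uminus elim: AE_mp)

lift_definition minus_L2 :: "L2 \<Rightarrow> L2 \<Rightarrow> L2" is "\<lambda>f g t. f t - g t"
  by (auto simp: L2_rel_def sq_int_diff elim: AE_mp)

lift_definition scaleR_L2 :: "real \<Rightarrow> L2 \<Rightarrow> L2" is "\<lambda>c f t. c * f t"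
  by (auto simp: L2_rel_def sq_int_scale elim: AE_mp)

lift_definition inner_L2 :: "L2 \<Rightarrow> L2 \<Rightarrow> real" is "\<lambda>f g. \<integral>t. f t * g t \<partial>I01"
proof -
  fix f f' g g'
  assume *: "L2_rel f f'" "L2_rel g g'"
  show "(\<integral>t. f t * g t \<partial>I01) = (\<integral>t. f' t * g' t \<partial>I01)"
  proof (rule integral_cong_AE)
    show "(\<lambda>t. f t * g t) \<in> borel_measurable I01" "(\<lambda>t. f' t * g' t) \<in> borel_measurable I01"
      using * by (auto simp: L2_rel_def sq_int_def)
    show "AE t in I01. f t * g t = f' t * g' t"
      using * unfolding L2_rel_def by (auto elim: AE_mp)
  qed
qed

definition norm_L2 :: "L2 \<Rightarrow> real" where
  "norm_L2 f = sqrt (inner f f)"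

definition sgn_L2 :: "L2 \<Rightarrow> L2" where
  "sgn_L2 f = scaleR (inverse (norm f)) f"

definition dist_L2 :: "L2 \<Rightarrow> L2 \<Rightarrow> real" where
  "dist_L2 f g = norm (f - g)"

definition uniformity_L2 :: "(L2 \<times> L2) filter" where
  "uniformity_L2 = (INF e\<in>{0<..}. principal {(f, g). dist f g < e})"

definition open_L2 :: "L2 set \<Rightarrow> bool" where
  "open_L2 U \<longleftrightarrow> (\<forall>f\<in>U. eventually (\<lambda>(f', g). f' = f \<longrightarrow> g \<in> U) uniformity)"

instance
proof
  fix f g h :: L2 and a b c :: real and U :: "L2 set"
  show "f + g + h = f + (g + h)"
    by transfer (auto simp: L2_rel_def sq_int_add algebra_simps)
  show "f + g = g + f"
    by transfer (auto simp: L2_rel_def sq_int_add algebra_simps)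
  show "0 + f = f"
    by transfer (auto simp: L2_rel_def)
  show "- f + f = 0"
    by transfer (auto simp: L2_rel_def sq_int_zero)
  show "f - g = f + - g"
    by transfer (auto simp: L2_rel_def sq_int_diff)
  show "a *\<^sub>R (f + g) = a *\<^sub>R f + a *\<^sub>R g"
    by transfer (auto simp: L2_rel_def sq_int_add sq_int_scale distrib_left)
  show "(a + b) *\<^sub>R f = a *\<^sub>R f + b *\<^sub>R f"
    by transfer (auto simp: L2_rel_def sq_int_add sq_int_scale distrib_right
        intro!: sq_int_add sq_int_scale)
  show "a *\<^sub>R b *\<^sub>R f = (a * b) *\<^sub>R f"
    by transfer (auto simp: L2_rel_def sq_int_scale mult.assoc intro!: sq_int_scale)
  show "1 *\<^sub>R f = f"
    by transfer (auto simp: L2_rel_def)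
  show "dist f g = norm (f - g)"
    by (rule dist_L2_def)
  show "sgn f = inverse (norm f) *\<^sub>R f"
    by (rule sgn_L2_def)
  show "uniformity = (INF e\<in>{0<..}. principal {(f, g::L2). dist f g < e})"
    by (rule uniformity_L2_def)
  show "open U \<longleftrightarrow> (\<forall>f\<in>U. \<forall>\<^sub>F (f', g) in uniformity. f' = f \<longrightarrow> g \<in> U)"
    by (rule open_L2_def)
  show "norm f = sqrt (inner f f)"
    by (rule norm_L2_def)
  show "inner f g = inner g f"
    by transfer (simp add: mult.commute)
  show "inner (f + g) h = inner f h + inner g h"
    by transfer (auto simp: L2_rel_def distrib_right sq_int_mult)
  show "inner (a *\<^sub>R f) g = a * inner f g"
    by transfer (auto simp: mult.assoc)
  show "0 \<le> inner f f"
    by transfer (auto intro!: integral_nonneg_AE)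
  show "inner f f = 0 \<longleftrightarrow> f = 0"
  proof transfer
    fix f
    assume "L2_rel f f"
    then have f: "sq_int f"
      by (simp add: L2_rel_def)
    have "(\<integral>t. f t * f t \<partial>I01) = 0 \<longleftrightarrow> (AE t in I01. f t * f t = 0)"
      by (rule integral_nonneg_eq_0_iff_AE) (auto intro: sq_int_mult f)
    then show "(\<integral>t. f t * f t \<partial>I01) = 0 \<longleftrightarrow> L2_rel f (\<lambda>_. 0)"
      using f by (auto simp: L2_rel_def sq_int_zero)
  qed
qed

end

section \<open>Random elements, Gaussian processes and convergence in distribution\<close>

text \<open>
  A random element of the space \<open>L2\<close> whose values at fixed time points and whose covariance function
  are meaningful: a jointly measurable process with square-integrable paths. The random element
  proper is \<open>\<lambda>\<omega>. to_L2 (X \<omega>)\<close>.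
\<close>

definition L2_process :: "'a measure \<Rightarrow> ('a \<Rightarrow> real \<Rightarrow> real) \<Rightarrow> bool" where
  "L2_process M X \<longleftrightarrow>
     (\<lambda>(\<omega>, t). X \<omega> t) \<in> borel_measurable (M \<Otimes>\<^sub>M I01) \<and> (\<forall>\<omega>\<in>space M. sq_int (X \<omega>))"

text \<open>Point masses count as (degenerate) normal distributions.\<close>

definition normal_rv :: "'a measure \<Rightarrow> ('a \<Rightarrow> real) \<Rightarrow> bool" where
  "normal_rv M X \<longleftrightarrow> X \<in> borel_measurable M \<and>
     (\<exists>m s. 0 \<le> s \<and>
        distr M borel X = (if s = 0 then return borel m else density lborel (normal_density m s)))"

text \<open>
  The process \<open>G\<close> is \<open>GP(0, C)\<close> on the unit interval: every vector \<open>(G(t))\<^sub>t\<^sub>\<in>\<^sub>S\<close> with \<open>S\<close> finite is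
  multivariate normal (all linear combinations of its components are normal), the mean function
  vanishes and the covariance function is \<open>C\<close>.
\<close>

definition gaussian_process_0 ::
    "'a measure \<Rightarrow> ('a \<Rightarrow> real \<Rightarrow> real) \<Rightarrow> (real \<Rightarrow> real \<Rightarrow> real) \<Rightarrow> bool" where
  "gaussian_process_0 M G C \<longleftrightarrow>
     (\<forall>S a. finite S \<and> S \<subseteq> {0..1} \<longrightarrow> normal_rv M (\<lambda>\<omega>. \<Sum>t\<in>S. a t * G \<omega> t)) \<and>
     (\<forall>t\<in>{0..1}. (\<integral>\<omega>. G \<omega> t \<partial>M) = 0) \<and>
     (\<forall>s\<in>{0..1}. \<forall>t\<in>{0..1}. (\<integral>\<omega>. G \<omega> s * G \<omega> t \<partial>M) = C s t)"

definition conv_in_distr ::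
    "'a measure \<Rightarrow> (nat \<Rightarrow> 'a \<Rightarrow> 'c::metric_space) \<Rightarrow> 'b measure \<Rightarrow> ('b \<Rightarrow> 'c) \<Rightarrow> bool" where
  "conv_in_distr M X N L \<longleftrightarrow>
     (\<forall>n. X n \<in> borel_measurable M) \<and> L \<in> borel_measurable N \<and>
     (\<forall>f :: 'c \<Rightarrow> real. continuous_on UNIV f \<and> bounded (range f) \<longrightarrow>
        (\<lambda>n. \<integral>\<omega>. f (X n \<omega>) \<partial>M) \<longlonglongrightarrow> (\<integral>w. f (L w) \<partial>N))"

definition gen_by :: "'a measure \<Rightarrow> ('a \<Rightarrow> 'b) \<Rightarrow> 'b measure \<Rightarrow> 'a measure" where
  "gen_by M X K = vimage_algebra (space M) X K"

section \<open>The outcome regression estimator\<close>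

definition outer :: "real ^ 'p \<Rightarrow> real ^ 'p \<Rightarrow> real ^ 'p ^ 'p" where
  "outer u v = (\<chi> j k. u $ j * v $ k)"

text \<open>
  The sample of size \<open>n\<close> consists of the observations with indices \<open>0, \<dots>, n - 1\<close>. On the event that
  the Gram matrix is singular, \<open>matrix_inv\<close> is a fixed unspecified matrix.
\<close>

definition beta_hat ::
    "(nat \<Rightarrow> 'a \<Rightarrow> real ^ 'p) \<Rightarrow> (nat \<Rightarrow> 'a \<Rightarrow> real) \<Rightarrow> (nat \<Rightarrow> 'a \<Rightarrow> real \<Rightarrow> real) \<Rightarrow>
     nat \<Rightarrow> 'a \<Rightarrow> real \<Rightarrow> real ^ 'p" where
  "beta_hat x Z Y n \<omega> t =
     matrix_inv (\<Sum>i<n. Z i \<omega> *\<^sub>R outer (x i \<omega>) (x i \<omega>)) *v (\<Sum>i<n. (Z i \<omega> * Y i \<omega> t) *\<^sub>R x i \<omega>)"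

definition mu_OR ::
    "(nat \<Rightarrow> 'a \<Rightarrow> real ^ 'p) \<Rightarrow> (nat \<Rightarrow> 'a \<Rightarrow> real) \<Rightarrow> (nat \<Rightarrow> 'a \<Rightarrow> real \<Rightarrow> real) \<Rightarrow>
     nat \<Rightarrow> 'a \<Rightarrow> real \<Rightarrow> real" where
  "mu_OR x Z Y n \<omega> t = (1 / real n) * (\<Sum>i<n. x i \<omega> \<bullet> beta_hat x Z Y n \<omega> t)"

section \<open>Regularity conditions for M-estimators\<close>

text \<open>
  The number of time points varies, so the parameter \<open>\<theta> = (\<mu>, vec B)\<close> for a finite set \<open>S\<close> of time
  points is a real function on the finite index set \<open>S <+> (S \<times> UNIV)\<close>: the value at \<open>Inl t\<close> is the
  component of \<open>\<mu>\<close> belonging to \<open>t\<close>, the value at \<open>Inr (t, j)\<close> is the entry of \<open>B\<close> in row \<open>j\<close> and the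
  column belonging to \<open>t\<close>. The components of \<open>\<psi>\<close> carry the same indices.
\<close>

type_synonym 'p par = "real + real \<times> 'p \<Rightarrow> real"

definition par_idx :: "real set \<Rightarrow> (real + real \<times> 'p) set" where
  "par_idx S = S <+> (S \<times> UNIV)"

fun psi :: "real ^ 'p \<Rightarrow> real \<Rightarrow> (real \<Rightarrow> real) \<Rightarrow> 'p par \<Rightarrow> 'p par" where
  "psi x z y \<theta> (Inl t) = (\<Sum>j\<in>UNIV. \<theta> (Inr (t, j)) * x $ j) - \<theta> (Inl t)"
| "psi x z y \<theta> (Inr (t, j)) = (y t - (\<Sum>k\<in>UNIV. \<theta> (Inr (t, k)) * x $ k)) * (z * x $ j)"

definition partial_deriv :: "(('b \<Rightarrow> real) \<Rightarrow> 'b \<Rightarrow> real) \<Rightarrow> ('b \<Rightarrow> real) \<Rightarrow> 'b \<Rightarrow> 'b \<Rightarrow> real" where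
  "partial_deriv f \<theta> r k = deriv (\<lambda>h. f (\<theta>(k := h)) r) (\<theta> k)"

definition C1_on :: "'b set \<Rightarrow> ('b \<Rightarrow> real) set \<Rightarrow> (('b \<Rightarrow> real) \<Rightarrow> 'b \<Rightarrow> real) \<Rightarrow> bool" where
  "C1_on J N f \<longleftrightarrow> (\<forall>r\<in>J. \<forall>k\<in>J.
     (\<forall>\<theta>\<in>N. (\<lambda>h. f (\<theta>(k := h)) r) differentiable (at (\<theta> k))) \<and>
     continuous_on N (\<lambda>\<theta>. partial_deriv f \<theta> r k))"

definition nonsingular_on :: "'b set \<Rightarrow> ('b \<Rightarrow> 'b \<Rightarrow> real) \<Rightarrow> bool" where
  "nonsingular_on J A \<longleftrightarrow>
     (\<forall>v. (\<forall>r\<in>J. (\<Sum>k\<in>J. A r k * v k) = 0) \<longrightarrow> (\<forall>k\<in>J. v k = 0))"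

text \<open>
  Convergence in probability, in the Euclidean norm of the coordinates in \<open>J\<close>, of some sequence of
  random roots of the estimating equations.
\<close>

definition consistent_root ::
    "'a measure \<Rightarrow> 'b set \<Rightarrow> (nat \<Rightarrow> 'a \<Rightarrow> ('b \<Rightarrow> real) \<Rightarrow> 'b \<Rightarrow> real) \<Rightarrow> ('b \<Rightarrow> real) \<Rightarrow> bool" where
  "consistent_root M J \<Psi> \<theta>\<^sub>0 \<longleftrightarrow> (\<exists>\<theta>h :: nat \<Rightarrow> 'a \<Rightarrow> 'b \<Rightarrow> real.
     (\<forall>n. \<forall>k\<in>J. (\<lambda>\<omega>. \<theta>h n \<omega> k) \<in> borel_measurable M) \<and>
     (\<forall>n>0. AE \<omega> in M. \<forall>r\<in>J. (1 / real n) * (\<Sum>i<n. \<Psi> i \<omega> (\<theta>h n \<omega>) r) = 0) \<and>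
     (\<forall>e>0. (\<lambda>n. measure M {\<omega> \<in> space M. L2_set (\<lambda>k. \<theta>h n \<omega> k - \<theta>\<^sub>0 k) J > e}) \<longlonglongrightarrow> 0))"

text \<open>
  Conditions (i)--(iv). The parameter space is the whole Euclidean space, so each of its points is
  interior. The neighbourhood \<open>N\<close> is open in the product topology; coordinates outside the finite
  index set \<open>J\<close> do not enter the components of \<open>\<psi>\<close> in \<open>J\<close>.
\<close>

definition M_regular ::
    "'a measure \<Rightarrow> 'b set \<Rightarrow> (nat \<Rightarrow> 'a \<Rightarrow> ('b \<Rightarrow> real) \<Rightarrow> 'b \<Rightarrow> real) \<Rightarrow> bool" where
  "M_regular M J \<Psi> \<longleftrightarrow> (\<exists>\<theta>\<^sub>0 N. open N \<and> \<theta>\<^sub>0 \<in> N \<and>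
     (\<forall>i. \<forall>r\<in>J. integrable M (\<lambda>\<omega>. \<Psi> i \<omega> \<theta>\<^sub>0 r) \<and> (\<integral>\<omega>. \<Psi> i \<omega> \<theta>\<^sub>0 r \<partial>M) = 0) \<and>
     consistent_root M J \<Psi> \<theta>\<^sub>0 \<and>
     (\<forall>i. AE \<omega> in M. C1_on J N (\<Psi> i \<omega>)) \<and>
     (\<forall>i. integrable M (\<lambda>\<omega>. (L2_set (\<Psi> i \<omega> \<theta>\<^sub>0) J)\<^sup>2)) \<and>
     (\<forall>i. (\<integral>\<^sup>+\<omega>. (SUP \<theta>\<in>N. ennreal (L2_set (\<lambda>(r, k). partial_deriv (\<Psi> i \<omega>) \<theta> r k) (J \<times> J))) \<partial>M) < \<infinity>) \<and>
     (\<forall>i. nonsingular_on J (\<lambda>r k. \<integral>\<omega>. partial_deriv (\<Psi> i \<omega>) \<theta>\<^sub>0 r k \<partial>M)))"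

end

theory Submission
  imports Defs
begin

text \<open>
  Put \<open>a = \<Pi>\<^sup>-\<^sup>1 \<mu>\<^sub>x\<close>. Expanding the least squares estimator gives
  \<open>\<surd>n (\<mu>\<^sub>O\<^sub>R - \<mu>\<^sub>y) = n\<^sup>-\<^sup>1\<^sup>/\<^sup>2 \<Sum>\<^sub>i \<psi>\<^sub>i + \<Sum>\<^sub>j (c\<^sub>n\<^sub>j - a\<^sub>j) T\<^sub>n\<^sub>j\<close> with the influence functions
  \<open>\<psi>\<^sub>i = (x\<^sub>i - \<mu>\<^sub>x)\<^sup>T \<beta> + (a\<^sup>T x\<^sub>i) Z\<^sub>i \<epsilon>\<^sub>i\<close>, where \<open>c\<^sub>n \<rightarrow> a\<close> in probability by the weak law of large numbers
  and the \<open>T\<^sub>n\<^sub>j = n\<^sup>-\<^sup>1\<^sup>/\<^sup>2 \<Sum>\<^sub>i x\<^sub>i\<^sub>j Z\<^sub>i \<epsilon>\<^sub>i\<close> are bounded in mean square; so only the sum of the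
  \<open>\<psi>\<^sub>i\<close> matters. Missingness at random makes \<open>\<psi>\<^sub>i\<close> centred, with the asserted covariance.

  The central limit theorem in the Hilbert space follows from the one on the line: inner products with
  fixed vectors give the characteristic functional, Levy's theorem handles the coordinates one after the
  other, and the tails of an orthonormal expansion are uniformly small in mean square.

  The covariance of the limit has to be the prescribed function at every pair of points, not just
  almost everywhere. Sections of a jointly measurable process generate a countably generated
  sigma-algebra, so Parseval's identity writes the covariance of the process
  \<open>U = (x\<^sub>0 - \<mu>\<^sub>x)\<^sup>T \<beta> + \<surd>(\<mu>\<^sub>x\<^sup>T a) \<epsilon>\<^sub>0\<close> as \<open>\<Sum>\<^sub>k \<phi>\<^sub>k(s) \<phi>\<^sub>k(t)\<close>, and the limit is \<open>\<Sum>\<^sub>k \<xi>\<^sub>k \<phi>\<^sub>k\<close>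
  for independent standard normal \<open>\<xi>\<^sub>k\<close>. The process \<open>U\<close> replaces \<open>\<psi>\<^sub>0\<close> here because missingness at
  random is a statement about \<open>Y\<close> as an element of \<open>L2\<close> and does not control \<open>Z \<epsilon>(t)\<close> at a fixed \<open>t\<close>.
\<close>

section \<open>Orthonormal bases for countably generated sigma-algebras\<close>

text \<open>The expansion involves no linearization. Wherever the Gram matrix is invertible, the
  weights \<open>c n\<close> solve the normal equations \<open>A n *v c n = s n\<close>; applied to
  the systematic parts x_i^T \<beta> of the Y_i they therefore reproduce the sum of the x_i^T
  \<beta> exactly, and only residuals remain. Invertibility of \<Pi> is read off the Jacobian of the
  estimating functions at a single time point. The obstacle is that missingness at random conditions
  on the class of Y, whereas the model and the covariance of \<epsilon> are statements at fixed t.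
  Hence Z is first exchanged for the propensity, a function of x, while \<epsilon> still enters
  through norms and inner products in \<open>L2\<close>; then Fubini's theorem moves the expectation
  under the integral over t, where conditioning on x is possible. Variances of inner products depend
  on a process only through its covariance kernel. This lets processes on different spaces be
  compared, and it is what identifies the limit. Orthonormal systems may contain null vectors, so
  that dependent generators need no pruning; the same basis theorem then serves [0,1] and the sample
  space.\<close>

definition sqi :: "'a measure \<Rightarrow> ('a \<Rightarrow> real) \<Rightarrow> bool" where
  "sqi M f \<longleftrightarrow> f \<in> borel_measurable M \<and> integrable M (\<lambda>x. (f x)\<^sup>2)"

text \<open>A positive semidefinite form on functions rather than on classes, because values at
  individual points matter later. Null functions are therefore not identified with zero.\<close>

definition ip :: "'a measure \<Rightarrow> ('a \<Rightarrow> real) \<Rightarrow> ('a \<Rightarrow> real) \<Rightarrow> real" where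
  "ip M f g = (\<integral>x. f x * g x \<partial>M)"

lemma sqi_measurable [measurable_dest]: "sqi M f \<Longrightarrow> f \<in> borel_measurable M"
  by (simp add: sqi_def)

lemma abs_mult_le_squares: "\<bar>a * b\<bar> \<le> a\<^sup>2 + (b::real)\<^sup>2"
proof -
  have "2 * (\<bar>a\<bar> * \<bar>b\<bar>) \<le> a\<^sup>2 + b\<^sup>2"
    using sum_squares_bound[of "\<bar>a\<bar>" "\<bar>b\<bar>"] by simp
  moreover have "0 \<le> \<bar>a\<bar> * \<bar>b\<bar>" by simp
  ultimately show ?thesis unfolding abs_mult by linarith
qed

lemma sqi_mult:
  assumes "sqi M f" "sqi M g"
  shows "integrable M (\<lambda>t. f t * g t)"
proof (rule Bochner_Integration.integrable_bound)
  show "integrable M (\<lambda>t. (f t)\<^sup>2 + (g t)\<^sup>2)"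
    using assms by (auto simp: sqi_def)
  show "(\<lambda>t. f t * g t) \<in> borel_measurable M"
    using assms by (auto simp: sqi_def)
  show "AE t in M. norm (f t * g t) \<le> norm ((f t)\<^sup>2 + (g t)\<^sup>2)"
    using abs_mult_le_squares by simp
qed

lemma sqi_zero [simp]: "sqi M (\<lambda>_. 0)"
  by (simp add: sqi_def)

lemma sqi_add: "sqi M f \<Longrightarrow> sqi M g \<Longrightarrow> sqi M (\<lambda>t. f t + g t)"
  using sqi_mult[of M f g] by (auto simp: sqi_def power2_sum mult.assoc)

lemma sqi_scale: "sqi M f \<Longrightarrow> sqi M (\<lambda>t. c * f t)"
  by (auto simp: sqi_def power_mult_distrib)

lemma sqi_diff: "sqi M f \<Longrightarrow> sqi M g \<Longrightarrow> sqi M (\<lambda>t. f t - g t)"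
  using sqi_add[of M f "\<lambda>t. -1 * g t"] sqi_scale[of M g "-1"] by simp

lemma sqi_sum: "(\<And>i. i \<in> I \<Longrightarrow> sqi M (f i)) \<Longrightarrow> sqi M (\<lambda>t. \<Sum>i\<in>I. f i t)"
  by (induction I rule: infinite_finite_induct) (auto intro: sqi_add)

lemma ip_commute: "ip M f g = ip M g f"
  by (simp add: ip_def mult.commute)

lemma ip_diff: "sqi M f \<Longrightarrow> sqi M g \<Longrightarrow> sqi M h \<Longrightarrow> ip M (\<lambda>x. f x - g x) h = ip M f h - ip M g h"
  by (simp add: ip_def left_diff_distrib sqi_mult)

lemma ip_scale: "ip M (\<lambda>x. c * f x) h = c * ip M f h"
  by (simp add: ip_def mult.assoc)

lemma ip_sum:
  "(\<And>i. i \<in> I \<Longrightarrow> sqi M (f i)) \<Longrightarrow> sqi M h \<Longrightarrow>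
    ip M (\<lambda>x. \<Sum>i\<in>I. f i x) h = (\<Sum>i\<in>I. ip M (f i) h)"
  by (simp add: ip_def sum_distrib_right sqi_mult)

lemma ip_nonneg: "0 \<le> ip M f f"
  by (auto simp: ip_def)

text \<open>A null function is orthogonal to everything. This is what permits null vectors in an
  orthonormal system: their Fourier coefficients vanish.\<close>

lemma ip_self_zero:
  assumes "sqi M f" "sqi M g" "ip M g g = 0"
  shows "ip M f g = 0"
proof -
  have "AE x in M. g x * g x = 0"
    using assms sqi_mult[of M g g] by (simp add: ip_def integral_nonneg_eq_0_iff_AE)
  then have "AE x in M. f x * g x = 0" by auto
  then show ?thesis
    unfolding ip_def by (simp add: integral_eq_zero_AE)
qed

lemma ip_diff_diff:
  assumes "sqi M f" "sqi M g"
  shows "ip M (\<lambda>x. f x - g x) (\<lambda>x. f x - g x) = ip M f f - 2 * ip M f g + ip M g g"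
proof -
  have "ip M (\<lambda>x. f x - g x) (\<lambda>x. f x - g x) =
      ip M f (\<lambda>x. f x - g x) - ip M g (\<lambda>x. f x - g x)"
    by (intro ip_diff assms sqi_diff)
  also have "ip M f (\<lambda>x. f x - g x) = ip M f f - ip M g f"
    using ip_diff[OF assms assms(1)] by (simp add: ip_commute)
  also have "ip M g (\<lambda>x. f x - g x) = ip M f g - ip M g g"
    using ip_diff[OF assms assms(2)] by (simp add: ip_commute)
  finally show ?thesis by (simp add: ip_commute[of M g f])
qed

section \<open>Mean-square closure of the span of a sequence\<close>

definition lincomb :: "(nat \<Rightarrow> 'a \<Rightarrow> real) \<Rightarrow> ('a \<Rightarrow> real) \<Rightarrow> bool" where
  "lincomb u g \<longleftrightarrow> (\<exists>n c. g = (\<lambda>x. \<Sum>k<(n::nat). c k * u k x))"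

lemma lincomb_add:
  assumes "lincomb u f" "lincomb u g"
  shows "lincomb u (\<lambda>x. f x + g x)"
proof -
  obtain n c m d where f: "f = (\<lambda>x. \<Sum>k<n. c k * u k x)" and g: "g = (\<lambda>x. \<Sum>k<m. d k * u k x)"
    using assms unfolding lincomb_def by blast
  define N where "N = max n m"
  have ext: "(\<Sum>k<N. (if k < r then b k else 0) * u k x) = (\<Sum>k<r. b k * u k x)"
    if "r \<le> N" for r b x
  proof -
    have "(\<Sum>k<N. (if k < r then b k else 0) * u k x) = (\<Sum>k<r. (if k < r then b k else 0) * u k x)"
      using that by (intro sum.mono_neutral_right) auto
    then show ?thesis by simp
  qed
  have "f x + g x = (\<Sum>k<N. ((if k < n then c k else 0) + (if k < m then d k else 0)) * u k x)" for x
    unfolding distrib_right sum.distrib by (subst (1 2) ext) (auto simp: N_def f g)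
  then show ?thesis unfolding lincomb_def by fastforce
qed

lemma lincomb_scale: "lincomb u f \<Longrightarrow> lincomb u (\<lambda>x. a * f x)"
proof -
  assume "lincomb u f"
  then obtain n c where "f = (\<lambda>x. \<Sum>k<n. c k * u k x)" unfolding lincomb_def by blast
  then have "(\<lambda>x. a * f x) = (\<lambda>x. \<Sum>k<n. (a * c k) * u k x)"
    by (simp add: sum_distrib_left mult.assoc)
  then show ?thesis unfolding lincomb_def by (intro exI)
qed

lemma lincomb_zero: "lincomb u (\<lambda>x. 0)"
  unfolding lincomb_def by (intro exI[of _ 0] exI) simp

lemma lincomb_self: "lincomb u (u k)"
proof -
  have "u k = (\<lambda>x. \<Sum>j<Suc k. (if j = k then 1 else 0) * u j x)"
    by (auto simp: if_distrib[of "\<lambda>z. z * _"] cong: if_cong)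
  then show ?thesis
    unfolding lincomb_def by (intro exI[of _ "Suc k"] exI[of _ "\<lambda>j. if j = k then 1 else 0"])
qed

lemma sqi_lincomb: "(\<And>k. sqi M (u k)) \<Longrightarrow> lincomb u g \<Longrightarrow> sqi M g"
  unfolding lincomb_def by (auto intro!: sqi_sum sqi_scale)

text \<open>Membership in the closure of the span of \<open>u\<close>, with squared distances so
  that no roots occur.\<close>

definition approximable :: "'a measure \<Rightarrow> (nat \<Rightarrow> 'a \<Rightarrow> real) \<Rightarrow> ('a \<Rightarrow> real) \<Rightarrow> bool" where
  "approximable M u f \<longleftrightarrow> sqi M f \<and>
     (\<forall>e>0. \<exists>g. lincomb u g \<and> ip M (\<lambda>x. f x - g x) (\<lambda>x. f x - g x) < e)"

text \<open>Squared replacement for the triangle inequality, from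
  \<open>(f x - g x)\<^sup>2 \<ge> 0\<close>. Its factors 2 explain the thresholds
  \<open>e / 4\<close> below.\<close>

lemma ip_triangle:
  assumes "sqi M f" "sqi M g"
  shows "ip M (\<lambda>x. f x + g x) (\<lambda>x. f x + g x) \<le> 2 * ip M f f + 2 * ip M g g"
proof -
  have "ip M (\<lambda>x. f x + g x) (\<lambda>x. f x + g x) \<le> (\<integral>x. 2 * (f x * f x) + 2 * (g x * g x) \<partial>M)"
    unfolding ip_def
  proof (rule integral_mono)
    show "integrable M (\<lambda>x. (f x + g x) * (f x + g x))"
      by (intro sqi_mult sqi_add assms)
    show "integrable M (\<lambda>x. 2 * (f x * f x) + 2 * (g x * g x))"
      by (intro Bochner_Integration.integrable_add integrable_mult_right sqi_mult assms)
    show "(f x + g x) * (f x + g x) \<le> 2 * (f x * f x) + 2 * (g x * g x)" for x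
      using zero_le_square[of "f x - g x"] by (simp add: algebra_simps)
  qed
  also have "\<dots> = 2 * ip M f f + 2 * ip M g g"
    using assms by (simp add: ip_def sqi_mult)
  finally show ?thesis .
qed

lemma approximable_lim:
  assumes u: "\<And>k. sqi M (u k)" and f: "sqi M f"
    and ap: "\<And>e. e > 0 \<Longrightarrow> \<exists>h. approximable M u h \<and> ip M (\<lambda>x. f x - h x) (\<lambda>x. f x - h x) < e"
  shows "approximable M u f"
  unfolding approximable_def
proof (intro conjI allI impI f)
  fix e :: real assume e: "e > 0"
  obtain h where h: "approximable M u h" "ip M (\<lambda>x. f x - h x) (\<lambda>x. f x - h x) < e / 4"
    using ap[of "e / 4"] e by auto
  obtain g where g: "lincomb u g" "ip M (\<lambda>x. h x - g x) (\<lambda>x. h x - g x) < e / 4"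
    using h(1) e unfolding approximable_def by (meson divide_pos_pos zero_less_numeral)
  have sq: "sqi M h" "sqi M g"
    using h(1) sqi_lincomb[where u = u, OF u g(1)] by (auto simp: approximable_def)
  have "ip M (\<lambda>x. f x - g x) (\<lambda>x. f x - g x) \<le>
      2 * ip M (\<lambda>x. f x - h x) (\<lambda>x. f x - h x) + 2 * ip M (\<lambda>x. h x - g x) (\<lambda>x. h x - g x)"
    using ip_triangle[of M "\<lambda>x. f x - h x" "\<lambda>x. h x - g x"] sq f by (simp add: sqi_diff)
  also have "\<dots> < e" using h(2) g(2) by simp
  finally show "\<exists>g. lincomb u g \<and> ip M (\<lambda>x. f x - g x) (\<lambda>x. f x - g x) < e"
    using g(1) by blast
qed

lemma approximable_lincomb:
  assumes "\<And>k. sqi M (u k)" "lincomb u g"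
  shows "approximable M u g"
  unfolding approximable_def using assms sqi_lincomb[OF assms]
  by (auto simp: ip_def intro!: exI[of _ g])

lemma approximable_add:
  assumes u: "\<And>k. sqi M (u k)" and "approximable M u f" "approximable M u g"
  shows "approximable M u (\<lambda>x. f x + g x)"
  unfolding approximable_def
proof (intro conjI allI impI)
  have fg: "sqi M f" "sqi M g"
    using assms by (auto simp: approximable_def)
  then show "sqi M (\<lambda>x. f x + g x)" by (rule sqi_add)
  fix e :: real assume e: "e > 0"
  obtain f' where f': "lincomb u f'" "ip M (\<lambda>x. f x - f' x) (\<lambda>x. f x - f' x) < e / 4"
    using assms e unfolding approximable_def by (meson divide_pos_pos zero_less_numeral)
  obtain g' where g': "lincomb u g'" "ip M (\<lambda>x. g x - g' x) (\<lambda>x. g x - g' x) < e / 4"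
    using assms e unfolding approximable_def by (meson divide_pos_pos zero_less_numeral)
  have sq: "sqi M f'" "sqi M g'"
    using f' g' sqi_lincomb[OF u] by auto
  have "ip M (\<lambda>x. f x + g x - (f' x + g' x)) (\<lambda>x. f x + g x - (f' x + g' x)) \<le>
     2 * ip M (\<lambda>x. f x - f' x) (\<lambda>x. f x - f' x) + 2 * ip M (\<lambda>x. g x - g' x) (\<lambda>x. g x - g' x)"
    using ip_triangle[of M "\<lambda>x. f x - f' x" "\<lambda>x. g x - g' x"] sq fg
    by (simp add: sqi_diff algebra_simps)
  also have "\<dots> < e" using f' g' by simp
  finally show "\<exists>h. lincomb u h \<and> ip M (\<lambda>x. f x + g x - h x) (\<lambda>x. f x + g x - h x) < e"
    using lincomb_add[OF f'(1) g'(1)] by blast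
qed

lemma approximable_scale:
  assumes u: "\<And>k. sqi M (u k)" and "approximable M u f"
  shows "approximable M u (\<lambda>x. a * f x)"
  unfolding approximable_def
proof (intro conjI allI impI)
  have f: "sqi M f"
    using assms by (auto simp: approximable_def)
  then show "sqi M (\<lambda>x. a * f x)" by (rule sqi_scale)
  fix e :: real assume e: "e > 0"
  \<comment> \<open>The summand 1 keeps the denominator positive for \<open>a = 0\<close>.\<close>
  have "e / (a\<^sup>2 + 1) > 0" using e by (simp add: add_nonneg_pos)
  then obtain f' where f': "lincomb u f'" "ip M (\<lambda>x. f x - f' x) (\<lambda>x. f x - f' x) < e / (a\<^sup>2 + 1)"
    using assms e unfolding approximable_def by meson
  have "ip M (\<lambda>x. a * f x - a * f' x) (\<lambda>x. a * f x - a * f' x) = a\<^sup>2 * ip M (\<lambda>x. f x - f' x) (\<lambda>x. f x - f' x)"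
    unfolding right_diff_distrib[symmetric] ip_scale
    by (subst ip_commute) (simp add: ip_scale power2_eq_square mult.assoc)
  also have "\<dots> \<le> (a\<^sup>2 + 1) * ip M (\<lambda>x. f x - f' x) (\<lambda>x. f x - f' x)"
    by (intro mult_right_mono ip_nonneg) auto
  also have "\<dots> < e"
    using f'(2) by (simp add: pos_less_divide_eq add_nonneg_pos mult.commute)
  finally show "\<exists>h. lincomb u h \<and> ip M (\<lambda>x. a * f x - h x) (\<lambda>x. a * f x - h x) < e"
    using lincomb_scale[OF f'(1)] by blast
qed

lemma approximable_sum:
  assumes u: "\<And>k. sqi M (u k)" and "\<And>i. i \<in> I \<Longrightarrow> approximable M u (f i)"
  shows "approximable M u (\<lambda>x. \<Sum>i\<in>I. f i x)"
  using assms(2)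
  by (induction I rule: infinite_finite_induct)
    (auto intro: approximable_add[OF u] approximable_lincomb[OF u lincomb_zero])

lemma sqi_bounded:
  assumes "finite_measure M" "f \<in> borel_measurable M" "\<And>x. \<bar>f x\<bar> \<le> B"
  shows "sqi M f"
proof -
  interpret finite_measure M by fact
  have "(f x)\<^sup>2 \<le> B\<^sup>2" for x
    using power_mono[OF assms(3)[of x], of 2] by simp
  then show ?thesis
    using assms(2) unfolding sqi_def by (auto intro!: integrable_const_bound[of _ "B\<^sup>2"])
qed

lemma sqi_indicator: "finite_measure M \<Longrightarrow> A \<in> sets M \<Longrightarrow> sqi M (indicator A)"
  by (rule sqi_bounded[where B = 1]) (auto split: split_indicator)

text \<open>The squared distance from \<open>s i\<close> to \<open>f\<close> is dominated by
  \<open>(\<bar>f\<bar> + g)\<^sup>2\<close>, so dominated convergence turns pointwise into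
  mean-square approximation. This serves countable disjoint unions as well as limits of simple
  functions.\<close>

lemma approximable_dominated:
  assumes u: "\<And>k. sqi M (u k)"
    and s: "\<And>i. approximable M u (s i)"
    and f: "sqi M f" and lim: "\<And>x. x \<in> space M \<Longrightarrow> (\<lambda>i. s i x) \<longlonglongrightarrow> f x"
    and g: "sqi M g" and bd: "\<And>i x. x \<in> space M \<Longrightarrow> \<bar>s i x\<bar> \<le> g x"
  shows "approximable M u f"
proof (rule approximable_lim[OF u f])
  fix e :: real assume e: "e > 0"
  have sm: "sqi M (s i)" for i using s by (simp add: approximable_def)
  have "(\<lambda>i. \<integral>x. (f x - s i x) * (f x - s i x) \<partial>M) \<longlonglongrightarrow> (\<integral>x. 0 \<partial>M)"
  proof (rule integral_dominated_convergence[where w = "\<lambda>x. (\<bar>f x\<bar> + g x) * (\<bar>f x\<bar> + g x)"])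
    show "integrable M (\<lambda>x. (\<bar>f x\<bar> + g x) * (\<bar>f x\<bar> + g x))"
      using f g by (intro sqi_mult sqi_add) (auto simp: sqi_def)
    show "(\<lambda>x. (f x - s i x) * (f x - s i x)) \<in> borel_measurable M" for i
      using sm[of i] f by measurable
    show "AE x in M. (\<lambda>i. (f x - s i x) * (f x - s i x)) \<longlonglongrightarrow> 0"
    proof (intro AE_I2)
      fix x assume "x \<in> space M"
      then have "(\<lambda>i. (f x - s i x) * (f x - s i x)) \<longlonglongrightarrow> (f x - f x) * (f x - f x)"
        by (intro tendsto_intros lim)
      then show "(\<lambda>i. (f x - s i x) * (f x - s i x)) \<longlonglongrightarrow> 0" by simp
    qed
    show "AE x in M. norm ((f x - s i x) * (f x - s i x)) \<le> (\<bar>f x\<bar> + g x) * (\<bar>f x\<bar> + g x)" for i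
    proof (intro AE_I2)
      fix x assume "x \<in> space M"
      then have "\<bar>f x - s i x\<bar> \<le> \<bar>f x\<bar> + g x" using bd[of x i] by linarith
      then show "norm ((f x - s i x) * (f x - s i x)) \<le> (\<bar>f x\<bar> + g x) * (\<bar>f x\<bar> + g x)"
        unfolding real_norm_def abs_mult by (intro mult_mono) auto
    qed
  qed simp
  then have "(\<lambda>i. ip M (\<lambda>x. f x - s i x) (\<lambda>x. f x - s i x)) \<longlonglongrightarrow> 0"
    by (simp add: ip_def)
  then have "eventually (\<lambda>i. ip M (\<lambda>x. f x - s i x) (\<lambda>x. f x - s i x) < e) sequentially"
    using e by (rule order_tendstoD)
  then show "\<exists>h. approximable M u h \<and> ip M (\<lambda>x. f x - h x) (\<lambda>x. f x - h x) < e"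
    using s by (auto simp: eventually_sequentially)
qed

text \<open>Dynkin's argument: the sets whose indicator lies in the closed span include the
  Int-stable generator and are closed under complements and countable disjoint unions. Complements
  use \<open>top\<close>, which puts the indicator of the whole space into the span.\<close>

lemma approximable_indicator:
  assumes fin: "finite_measure M" and sub: "range A \<subseteq> sets M" and Int: "Int_stable (range A)"
    and top: "space M \<in> range A" and B: "B \<in> sigma_sets (space M) (range A)"
  shows "approximable M (\<lambda>k. indicator (A k)) (indicator B)"
proof -
  interpret finite_measure M by fact
  let ?u = "\<lambda>k. indicator (A k) :: _ \<Rightarrow> real"
  have u: "sqi M (?u k)" for k using sub fin by (auto intro: sqi_indicator)
  have "range A \<subseteq> Pow (space M)" using sub sets.sets_into_space by blast
  have sig: "sigma_sets (space M) (range A) \<subseteq> sets M"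
    using sub by (rule sets.sigma_sets_subset)
  from Int \<open>range A \<subseteq> Pow (space M)\<close> B show ?thesis
  proof (induction B rule: sigma_sets_induct_disjoint)
    case (basic B)
    then show ?case using approximable_lincomb[OF u lincomb_self] by auto
  next
    case empty
    show ?case using approximable_lincomb[OF u lincomb_zero] by (simp add: fun_eq_iff)
  next
    case (compl B)
    obtain j where "A j = space M" using top by auto
    then have 1: "approximable M ?u (indicator (space M))"
      using approximable_lincomb[OF u lincomb_self[of ?u j]] by simp
    have "B \<subseteq> space M" using compl(1) \<open>range A \<subseteq> Pow (space M)\<close> sigma_sets_into_sp by blast
    then have "indicator (space M - B) = (\<lambda>x. indicator (space M) x + -1 * indicator B x :: real)"
      by (auto simp: fun_eq_iff split: split_indicator)
    then show ?case
      using approximable_add[OF u 1 approximable_scale[OF u compl(2), of "-1"]] by simp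
  next
    case (union B)
    have B: "B i \<in> sets M" for i using union(2) sig by blast
    define s where "s n x = (\<Sum>i<n. indicator (B i) x :: real)" for n x
    \<comment> \<open>By disjointness the partial sums are indicators again, hence bounded by
      1.\<close>
    have s: "s n x = indicator (\<Union>i<n. B i) x" for n x
      unfolding s_def by (subst indicator_UN_disjoint[symmetric])
        (use union(1) in \<open>auto simp: disjoint_family_on_def\<close>)
    show ?case
    proof (rule approximable_dominated[OF u, where s = s and g = "\<lambda>_. 1"])
      show "approximable M ?u (s i)" for i
        unfolding s_def by (intro approximable_sum[OF u] union(3))
      show "sqi M (indicator (\<Union>i. B i))"
        using B by (intro sqi_indicator fin) auto
      show "sqi M (\<lambda>_. 1)" by (simp add: sqi_def)
      show "(\<lambda>i. s i x) \<longlonglongrightarrow> indicator (\<Union>i. B i) x" for x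
        unfolding s by (rule LIMSEQ_indicator_UN)
      show "\<bar>s i x\<bar> \<le> 1" for i x by (simp add: s)
    qed
  qed
qed

lemma approximable_measurable:
  assumes fin: "finite_measure M" and sub: "range A \<subseteq> sets M" and Int: "Int_stable (range A)"
    and top: "space M \<in> range A"
    and f: "f \<in> borel_measurable (sigma (space M) (range A))" "sqi M f"
  shows "approximable M (\<lambda>k. indicator (A k)) f"
proof -
  let ?u = "\<lambda>k. indicator (A k) :: _ \<Rightarrow> real" and ?F = "sigma (space M) (range A)"
  have u: "sqi M (?u k)" for k using sub fin by (auto intro: sqi_indicator)
  have AP: "range A \<subseteq> Pow (space M)" using sub sets.sets_into_space by blast
  have setsF: "sets ?F = sigma_sets (space M) (range A)" and spF: "space ?F = space M"
    using AP by auto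
  obtain s where s: "\<And>i. simple_function ?F (s i)"
      "\<And>x. x \<in> space ?F \<Longrightarrow> (\<lambda>i. s i x) \<longlonglongrightarrow> f x"
      "\<And>i x. x \<in> space ?F \<Longrightarrow> dist (s i x) 0 \<le> 2 * dist (f x) 0"
    using borel_measurable_implies_sequence_metric[OF f(1), of 0] by blast
  \<comment> \<open>The simple function as an explicit finite combination of indicators; it agrees
    with \<open>s i\<close> on the space, and the closure lemmas apply to it.\<close>
  define s' where "s' i x = (\<Sum>y\<in>s i ` space M. y * indicator (s i -` {y} \<inter> space M) x)" for i x
  have s': "s' i x = s i x" if "x \<in> space M" for i x
  proof -
    have fin: "finite (s i ` space M)" using simple_functionD(1)[OF s(1)[of i]] spF by simp
    have "s' i x = (\<Sum>y\<in>s i ` space M. if y = s i x then s i x else 0)"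
      unfolding s'_def using that by (intro sum.cong) (auto split: split_indicator)
    also have "\<dots> = s i x" using fin that by simp
    finally show ?thesis .
  qed
  show ?thesis
  proof (rule approximable_dominated[OF u _ f(2), where s = s' and g = "\<lambda>x. 2 * \<bar>f x\<bar>"])
    show "approximable M ?u (s' i)" for i
      unfolding s'_def
    proof (intro approximable_sum[OF u] approximable_scale[OF u]
        approximable_indicator[OF fin sub Int top])
      fix y
      have "s i -` {y} \<inter> space ?F \<in> sets ?F" by (rule simple_functionD(2)[OF s(1)])
      then show "s i -` {y} \<inter> space M \<in> sigma_sets (space M) (range A)"
        by (simp add: setsF spF)
    qed
    show "(\<lambda>i. s' i x) \<longlonglongrightarrow> f x" if "x \<in> space M" for x
      using s(2)[of x] that s'[OF that] spF by simp
    show "sqi M (\<lambda>x. 2 * \<bar>f x\<bar>)"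
      using f(2) by (intro sqi_scale) (auto simp: sqi_def)
    show "\<bar>s' i x\<bar> \<le> 2 * \<bar>f x\<bar>" if "x \<in> space M" for i x
      using s(3)[of x i] that s'[OF that] spF by simp
  qed
qed

text \<open>A vector in the span of its predecessors is sent to the zero function, since \<open>v / 0 = 0\<close>.\<close>

function gram_schmidt :: "'a measure \<Rightarrow> (nat \<Rightarrow> 'a \<Rightarrow> real) \<Rightarrow> nat \<Rightarrow> 'a \<Rightarrow> real" where
  "gram_schmidt M u k =
     (let v = (\<lambda>x. u k x - (\<Sum>j<k. ip M (u k) (gram_schmidt M u j) * gram_schmidt M u j x))
      in (\<lambda>x. v x / sqrt (ip M v v)))"
  by auto
termination by (relation "Wellfounded.measure (\<lambda>(M, u, k). k)") auto

declare gram_schmidt.simps [simp del]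

text \<open>Strong induction. In the inner product of the \<open>k\<close>-th residual with
  \<open>g i\<close> only the summand \<open>j = i\<close> survives. It equals
  \<open>ip M (u k) (g i)\<close> for a unit vector \<open>g i\<close> and also for a null one,
  where both are 0.\<close>

lemma gram_schmidt_orthonormal:
  assumes u: "\<And>k. sqi M (u k)"
  defines "g \<equiv> gram_schmidt M u"
  shows "sqi M (g k) \<and> ip M (g k) (g k) \<in> {0, 1} \<and> (\<forall>j<k. ip M (g k) (g j) = 0)"
proof (induction k rule: less_induct)
  case (less k)
  define v where "v = (\<lambda>x. u k x - (\<Sum>j<k. ip M (u k) (g j) * g j x))"
  define c where "c = 1 / sqrt (ip M v v)"
  have gk: "g k = (\<lambda>x. c * v x)"
    unfolding g_def gram_schmidt.simps[of M u k] Let_def v_def c_def by simp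
  have v: "sqi M v"
    unfolding v_def using less by (intro sqi_diff sqi_sum sqi_scale u) auto
  have "ip M (g k) (g k) = c\<^sup>2 * ip M v v"
    unfolding gk ip_scale by (subst ip_commute) (simp add: ip_scale power2_eq_square)
  also have "\<dots> \<in> {0, 1}"
    using ip_nonneg[of M v] by (simp add: c_def power_divide)
  finally have 1: "ip M (g k) (g k) \<in> {0, 1}" .
  have "ip M (g k) (g i) = 0" if i: "i < k" for i
  proof -
    have gi: "sqi M (g i)" using less i by auto
    have orth: "ip M (g j) (g i) = 0" if "j < k" "j \<noteq> i" for j
      using less[OF that(1)] less[OF i] that
      by (cases "i < j") (auto simp: ip_commute[of M "g j" "g i"])
    have "ip M v (g i) = ip M (u k) (g i) - (\<Sum>j<k. ip M (u k) (g j) * ip M (g j) (g i))"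
      unfolding v_def using less gi u
      by (subst ip_diff, (auto intro!: sqi_sum sqi_scale)[3], subst ip_sum)
        (auto intro!: sqi_scale simp: ip_scale)
    also have "(\<Sum>j<k. ip M (u k) (g j) * ip M (g j) (g i)) =
        (\<Sum>j<k. if j = i then ip M (u k) (g i) * ip M (g i) (g i) else 0)"
      using orth by (intro sum.cong) auto
    also have "\<dots> = ip M (u k) (g i) * ip M (g i) (g i)"
      using i by simp
    also have "\<dots> = ip M (u k) (g i)"
      using less[OF i] ip_self_zero[OF u gi] by auto
    finally show ?thesis by (simp add: gk ip_scale)
  qed
  moreover have "sqi M (g k)" unfolding gk by (rule sqi_scale[OF v])
  ultimately show ?case using 1 by blast
qed

text \<open>Up to a null function, \<open>u k\<close> is its projection \<open>w\<close> plus
  \<open>sqrt (ip M v v)\<close> times the \<open>k\<close>-th output vector. If the residual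
  \<open>v\<close> is null, that coefficient is 0 and the error is \<open>v\<close> itself.\<close>

lemma gram_schmidt_approximable:
  assumes u: "\<And>k. sqi M (u k)"
  shows "approximable M (gram_schmidt M u) (u k)"
proof -
  let ?g = "gram_schmidt M u"
  have g: "sqi M (?g k)" for k using gram_schmidt_orthonormal[where u = u, OF u, of k] by (rule conjunct1)
  define w where "w = (\<lambda>x. \<Sum>j<k. ip M (u k) (?g j) * ?g j x)"
  define v where "v = (\<lambda>x. u k x - w x)"
  have gk: "?g k = (\<lambda>x. v x / sqrt (ip M v v))"
    unfolding gram_schmidt.simps[of M u k] Let_def v_def w_def by simp
  have w: "lincomb ?g w"
    unfolding lincomb_def w_def by (rule exI[of _ k], rule exI) (rule refl)
  have sv: "sqi M v"
    unfolding v_def using sqi_lincomb[where u = "?g", OF g w] by (intro sqi_diff u)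
  define h where "h = (\<lambda>x. w x + sqrt (ip M v v) * ?g k x)"
  have h: "lincomb ?g h"
    unfolding h_def by (intro lincomb_add w lincomb_scale lincomb_self)
  have "ip M (\<lambda>x. u k x - h x) (\<lambda>x. u k x - h x) = 0"
  proof (cases "ip M v v = 0")
    case True
    then have "(\<lambda>x. u k x - h x) = v" by (auto simp: h_def v_def)
    then show ?thesis using True by simp
  next
    case False
    then have "sqrt (ip M v v) \<noteq> 0" by simp
    then have "(\<lambda>x. u k x - h x) = (\<lambda>x. 0)" by (auto simp: h_def gk) (simp add: v_def)
    then show ?thesis by (simp add: ip_def)
  qed
  then show ?thesis
    unfolding approximable_def using h u by auto
qed

lemma approximable_gram_schmidt:
  assumes u: "\<And>k. sqi M (u k)" and f: "approximable M u f"
  shows "approximable M (gram_schmidt M u) f"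
proof (rule approximable_lim)
  show g: "sqi M (gram_schmidt M u k)" for k using gram_schmidt_orthonormal[where u = u, OF u, of k] by (rule conjunct1)
  show "sqi M f" using f by (simp add: approximable_def)
  fix e :: real assume "e > 0"
  then obtain h where h: "lincomb u h" "ip M (\<lambda>x. f x - h x) (\<lambda>x. f x - h x) < e"
    using f unfolding approximable_def by blast
  have "approximable M (gram_schmidt M u) h"
    using h(1) unfolding lincomb_def
    by (auto intro!: approximable_sum approximable_scale g gram_schmidt_approximable u)
  then show "\<exists>h. approximable M (gram_schmidt M u) h \<and> ip M (\<lambda>x. f x - h x) (\<lambda>x. f x - h x) < e"
    using h(2) by blast
qed

text \<open>Stated for arbitrary coefficients: the Fourier coefficients give Bessel's inequality,
  the coefficients of an approximating combination give the opposite bound.\<close>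

lemma ip_orthonormal_expansion:
  fixes g :: "nat \<Rightarrow> 'a \<Rightarrow> real"
  assumes g: "\<And>k. sqi M (g k)" and orth: "\<And>j k. j \<noteq> k \<Longrightarrow> ip M (g j) (g k) = 0"
    and f: "sqi M f"
  shows "ip M (\<lambda>x. f x - (\<Sum>k<n. c k * g k x)) (\<lambda>x. f x - (\<Sum>k<n. c k * g k x)) =
     ip M f f - 2 * (\<Sum>k<n. c k * ip M f (g k)) + (\<Sum>k<n. (c k)\<^sup>2 * ip M (g k) (g k))"
proof -
  let ?h = "\<lambda>x. \<Sum>k<n. c k * g k x"
  have h: "sqi M ?h" by (intro sqi_sum sqi_scale g)
  have expand: "ip M ?h q = (\<Sum>k<n. c k * ip M (g k) q)" if "sqi M q" for q
    using that g by (simp add: ip_sum sqi_scale ip_scale)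
  have "ip M (g k) ?h = c k * ip M (g k) (g k)" if "k < n" for k
  proof -
    have "ip M (g k) ?h = (\<Sum>j<n. c j * ip M (g j) (g k))"
      using expand[OF g] by (simp add: ip_commute)
    also have "\<dots> = (\<Sum>j<n. if j = k then c k * ip M (g k) (g k) else 0)"
      using orth by (intro sum.cong) auto
    finally show ?thesis using that by simp
  qed
  then have "ip M ?h ?h = (\<Sum>k<n. (c k)\<^sup>2 * ip M (g k) (g k))"
    unfolding expand[OF h] by (simp add: power2_eq_square mult.assoc)
  moreover have "ip M f ?h = (\<Sum>k<n. c k * ip M f (g k))"
    using expand[OF f] by (simp add: ip_commute)
  ultimately show ?thesis by (simp add: ip_diff_diff[OF f h])
qed

text \<open>The partial sums increase and, by Bessel's inequality, stay below
  \<open>ip M f f\<close>. A combination of the first \<open>N\<close> vectors misses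
  \<open>f\<close> by at least \<open>ip M f f\<close> minus the \<open>N\<close>-th partial sum, so
  a good approximation forces that partial sum to be large.\<close>

lemma parseval_approximable:
  fixes g :: "nat \<Rightarrow> 'a \<Rightarrow> real"
  assumes g: "\<And>k. sqi M (g k)" and orth: "\<And>j k. j \<noteq> k \<Longrightarrow> ip M (g j) (g k) = 0"
    and norm: "\<And>k. ip M (g k) (g k) \<in> {0, 1}" and ap: "approximable M g f"
  shows "(\<lambda>k. (ip M f (g k))\<^sup>2) sums ip M f f"
proof -
  have f: "sqi M f" using ap by (simp add: approximable_def)
  have zero: "ip M f (g k) = 0" if "ip M (g k) (g k) = 0" for k
    using ip_self_zero[OF f g that] .
  have expand: "ip M (\<lambda>x. f x - (\<Sum>k<n. c k * g k x)) (\<lambda>x. f x - (\<Sum>k<n. c k * g k x)) =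
     ip M f f - 2 * (\<Sum>k<n. c k * ip M f (g k)) + (\<Sum>k<n. (c k)\<^sup>2 * ip M (g k) (g k))"
    for n :: nat and c :: "nat \<Rightarrow> real"
    by (rule ip_orthonormal_expansion) (use g orth f in auto)
  have bessel: "(\<Sum>k<n. (ip M f (g k))\<^sup>2) \<le> ip M f f" for n
  proof -
    have "(ip M f (g k))\<^sup>2 * ip M (g k) (g k) = (ip M f (g k))\<^sup>2" for k
      using norm[of k] zero[of k] by auto
    then have "(\<Sum>k<n. (ip M f (g k))\<^sup>2 * ip M (g k) (g k)) = (\<Sum>k<n. (ip M f (g k))\<^sup>2)"
      by (simp only:)
    then have "0 \<le> ip M f f - 2 * (\<Sum>k<n. (ip M f (g k))\<^sup>2) + (\<Sum>k<n. (ip M f (g k))\<^sup>2)"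
      using expand[of "\<lambda>k. ip M f (g k)" n]
        ip_nonneg[of M "\<lambda>x. f x - (\<Sum>k<n. ip M f (g k) * g k x)"]
      by (simp only: power2_eq_square)
    then show ?thesis by simp
  qed
  have "\<exists>N. \<forall>n\<ge>N. norm ((\<Sum>k<n. (ip M f (g k))\<^sup>2) - ip M f f) < e" if e: "e > 0" for e
  proof -
    obtain N c where N: "ip M (\<lambda>x. f x - (\<Sum>k<N. c k * g k x)) (\<lambda>x. f x - (\<Sum>k<N. c k * g k x)) < e"
      using ap e unfolding approximable_def lincomb_def by blast
    \<comment> \<open>Completing the square term by term: for a unit vector the two sides differ by
      \<open>(c k - ip M f (g k))\<^sup>2\<close>, for a null vector both are 0.\<close>
    have "- (ip M f (g k))\<^sup>2 \<le> - (2 * (c k * ip M f (g k))) + (c k)\<^sup>2 * ip M (g k) (g k)" for k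
      using norm[of k] zero[of k] zero_le_power2[of "c k - ip M f (g k)"]
      by (auto simp: power2_diff)
    then have "- (\<Sum>k<N. (ip M f (g k))\<^sup>2) \<le> - (2 * (\<Sum>k<N. c k * ip M f (g k))) + (\<Sum>k<N. (c k)\<^sup>2 * ip M (g k) (g k))"
      unfolding sum_distrib_left sum_negf[symmetric] sum.distrib[symmetric] by (rule sum_mono)
    then have "ip M f f - (\<Sum>k<N. (ip M f (g k))\<^sup>2) < e"
      using N expand[of c N] by simp
    moreover have "(\<Sum>k<N. (ip M f (g k))\<^sup>2) \<le> (\<Sum>k<n. (ip M f (g k))\<^sup>2)" if "n \<ge> N" for n
      using that by (intro sum_mono2) auto
    ultimately have "norm ((\<Sum>k<n. (ip M f (g k))\<^sup>2) - ip M f f) < e" if "n \<ge> N" for n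
      using bessel[of n] that by fastforce
    then show ?thesis by blast
  qed
  then show ?thesis unfolding sums_def by (rule LIMSEQ_I)
qed

text \<open>Polarization through \<open>f - h\<close>, which is measurable with respect to the same
  sub-sigma-algebra as \<open>f\<close> and \<open>h\<close>; hence three Parseval identities as
  premises.\<close>

lemma parseval_polarized:
  fixes g :: "nat \<Rightarrow> 'a \<Rightarrow> real"
  assumes g: "\<And>k. sqi M (g k)" and F: "sqi M f" "sqi M h"
    and "(\<lambda>k. (ip M f (g k))\<^sup>2) sums ip M f f" "(\<lambda>k. (ip M h (g k))\<^sup>2) sums ip M h h"
    and "(\<lambda>k. (ip M (\<lambda>x. f x - h x) (g k))\<^sup>2) sums ip M (\<lambda>x. f x - h x) (\<lambda>x. f x - h x)"
  shows "(\<lambda>k. ip M f (g k) * ip M h (g k)) sums ip M f h"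
proof -
  have "(\<lambda>k. ((ip M f (g k))\<^sup>2 + (ip M h (g k))\<^sup>2 - (ip M (\<lambda>x. f x - h x) (g k))\<^sup>2) / 2) sums
     ((ip M f f + ip M h h - ip M (\<lambda>x. f x - h x) (\<lambda>x. f x - h x)) / 2)"
    by (intro sums_divide sums_diff sums_add assms)
  then show ?thesis
    by (simp add: ip_diff_diff[OF F] ip_diff[OF F g] power2_diff)
qed

text \<open>Parseval's identity is claimed for functions measurable with respect to the generated
  sigma-algebra, however large \<open>M\<close> is. The theorem thus applies to a sample space whose
  square-integrable random variables need not form a separable space.\<close>

theorem orthonormal_basis_countably_generated:
  fixes A :: "nat \<Rightarrow> 'a set"
  assumes fin: "finite_measure M" and sub: "range A \<subseteq> sets M"
  obtains g where "\<And>k. sqi M (g k)" "\<And>j k. j \<noteq> k \<Longrightarrow> ip M (g j) (g k) = 0"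
    "\<And>k. ip M (g k) (g k) \<in> {0, 1}"
    "\<And>f h. sqi M f \<Longrightarrow> sqi M h \<Longrightarrow> f \<in> borel_measurable (sigma (space M) (range A)) \<Longrightarrow>
       h \<in> borel_measurable (sigma (space M) (range A)) \<Longrightarrow>
       (\<lambda>k. ip M f (g k) * ip M h (g k)) sums ip M f h"
proof -
  \<comment> \<open>Finite intersections of generators form a countable Int-stable family. The empty
    index set contributes the whole space.\<close>
  define I where "I F = space M \<inter> (\<Inter>k\<in>F. A k)" for F :: "nat set"
  define \<G> where "\<G> = I ` {F. finite F}"
  have cG: "countable \<G>" unfolding \<G>_def by (intro countable_image countable_Collect_finite)
  have neG: "\<G> \<noteq> {}" unfolding \<G>_def by auto
  define B where "B = from_nat_into \<G>"
  have B: "range B = \<G>" unfolding B_def using neG cG by (rule range_from_nat_into)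
  have AP: "range A \<subseteq> Pow (space M)" using sub sets.sets_into_space by blast
  have IM: "I F \<in> sets M" if "finite F" for F
    using that
  proof induction
    case (insert k F)
    have "I (insert k F) = A k \<inter> I F" by (auto simp: I_def)
    then show ?case using insert sub by auto
  qed (simp add: I_def)
  then have GM: "\<G> \<subseteq> sets M" unfolding \<G>_def by auto
  have Int: "Int_stable (range B)"
  proof (rule Int_stableI)
    fix a b assume "a \<in> range B" "b \<in> range B"
    then obtain F G where "finite F" "finite G" "a = I F" "b = I G"
      unfolding B \<G>_def by auto
    then show "a \<inter> b \<in> range B"
      unfolding B \<G>_def by (intro image_eqI[of _ _ "F \<union> G"]) (auto simp: I_def)
  qed
  have top: "space M \<in> range B"
    unfolding B \<G>_def I_def by (intro image_eqI[of _ _ "{}"]) auto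
  have "A k \<in> \<G>" for k
    unfolding \<G>_def I_def using AP by (intro image_eqI[of _ _ "{k}"]) auto
  then have AB: "range A \<subseteq> range B" using B by auto
  have BP: "range B \<subseteq> Pow (space M)" using GM sets.sets_into_space unfolding B by blast
  have meas: "f \<in> borel_measurable (sigma (space M) (range B))"
    if "f \<in> borel_measurable (sigma (space M) (range A))" for f :: "'a \<Rightarrow> real"
    using that sigma_sets_mono'[OF AB] AP BP unfolding measurable_def by (auto simp: subset_iff)
  define u where "u k = (indicator (B k) :: 'a \<Rightarrow> real)" for k
  have u: "sqi M (u k)" for k
    using GM B unfolding u_def by (intro sqi_indicator fin) auto
  define g where "g = gram_schmidt M u"
  have on: "sqi M (g k) \<and> ip M (g k) (g k) \<in> {0, 1} \<and> (\<forall>j<k. ip M (g k) (g j) = 0)" for k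
    unfolding g_def by (rule gram_schmidt_orthonormal[where u = u, OF u])
  have g: "sqi M (g k)" and norm: "ip M (g k) (g k) \<in> {0, 1}" for k
    using on by auto
  have orth: "ip M (g j) (g k) = 0" if "j \<noteq> k" for j k
    using on[of j] on[of k] that by (cases j k rule: linorder_cases) (auto simp: ip_commute[of M "g j" "g k"])
  have pars: "(\<lambda>k. (ip M f (g k))\<^sup>2) sums ip M f f"
    if "sqi M f" "f \<in> borel_measurable (sigma (space M) (range A))" for f
  proof (rule parseval_approximable[where g = g, OF g orth norm])
    have "approximable M u f"
      unfolding u_def using GM B
      by (intro approximable_measurable fin Int top meas that) auto
    then show "approximable M g f" unfolding g_def by (rule approximable_gram_schmidt[OF u])
  qed
  have "(\<lambda>k. ip M f (g k) * ip M h (g k)) sums ip M f h"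
    if "sqi M f" "sqi M h" "f \<in> borel_measurable (sigma (space M) (range A))"
      "h \<in> borel_measurable (sigma (space M) (range A))" for f h
    using that by (intro parseval_polarized g pars sqi_diff borel_measurable_diff) auto
  with g orth norm show ?thesis using that by blast
qed

section \<open>Orthonormal expansions\<close>

definition parseval_seq :: "(nat \<Rightarrow> 'h::real_inner) \<Rightarrow> bool" where
  "parseval_seq e \<longleftrightarrow> (\<forall>j k. j \<noteq> k \<longrightarrow> inner (e j) (e k) = 0) \<and> (\<forall>k. norm (e k) \<in> {0, 1}) \<and>
     (\<forall>h. (\<lambda>k. (inner h (e k))\<^sup>2) sums (norm h)\<^sup>2)"

definition proj :: "(nat \<Rightarrow> 'h::real_inner) \<Rightarrow> nat \<Rightarrow> 'h \<Rightarrow> 'h" where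
  "proj e n h = (\<Sum>k<n. inner h (e k) *\<^sub>R e k)"

lemma inner_proj:
  assumes e: "parseval_seq e"
  shows "inner (proj e n h) (e j) = (if j < n then inner h (e j) else 0)"
proof -
  \<comment> \<open>Valid for unit vectors, and for zero vectors because both sides vanish.\<close>
  have "inner h (e j) * inner (e j) (e j) = inner h (e j)"
    using e unfolding parseval_seq_def
    by (cases "norm (e j) = 0") (auto simp: power2_norm_eq_inner[symmetric])
  then have "inner (proj e n h) (e j) = (\<Sum>k<n. if k = j then inner h (e j) else 0)"
    unfolding proj_def inner_sum_left using e unfolding parseval_seq_def
    by (intro sum.cong) auto
  then show ?thesis by simp
qed

lemma inner_proj_left: "inner (proj e n h) g = (\<Sum>k<n. inner h (e k) * inner (e k) g)"
  by (simp add: proj_def inner_sum_left)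

lemma norm_proj:
  assumes e: "parseval_seq e"
  shows "(norm (proj e n h))\<^sup>2 = (\<Sum>k<n. (inner h (e k))\<^sup>2)"
proof -
  have "(norm (proj e n h))\<^sup>2 = (\<Sum>k<n. inner h (e k) * inner (e k) (proj e n h))"
    by (simp add: power2_norm_eq_inner inner_proj_left)
  also have "\<dots> = (\<Sum>k<n. (inner h (e k))\<^sup>2)"
    using inner_proj[OF e] by (intro sum.cong) (auto simp: inner_commute[of "e _"] power2_eq_square)
  finally show ?thesis .
qed

lemma norm_diff_proj:
  assumes e: "parseval_seq e"
  shows "(norm (h - proj e n h))\<^sup>2 = (norm h)\<^sup>2 - (\<Sum>k<n. (inner h (e k))\<^sup>2)"
proof -
  have "inner (proj e n h) h = (\<Sum>k<n. (inner h (e k))\<^sup>2)"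
    by (simp add: inner_proj_left inner_commute[of "e _"] power2_eq_square)
  then show ?thesis
    using norm_proj[OF e, of n h]
    by (simp add: power2_norm_eq_inner inner_diff_left inner_diff_right inner_commute[of h "proj e n h"])
qed

lemma proj_tendsto:
  assumes e: "parseval_seq e"
  shows "(\<lambda>n. proj e n h) \<longlonglongrightarrow> h"
proof -
  have "(\<lambda>n. (norm h)\<^sup>2 - (\<Sum>k<n. (inner h (e k))\<^sup>2)) \<longlonglongrightarrow> (norm h)\<^sup>2 - (norm h)\<^sup>2"
    using e unfolding parseval_seq_def sums_def by (intro tendsto_intros) auto
  then have "(\<lambda>n. (norm (h - proj e n h))\<^sup>2) \<longlonglongrightarrow> 0"
    by (simp add: norm_diff_proj[OF e])
  then have "(\<lambda>n. sqrt ((norm (h - proj e n h))\<^sup>2)) \<longlonglongrightarrow> sqrt 0"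
    by (intro tendsto_intros)
  then have "(\<lambda>n. norm (h - proj e n h)) \<longlonglongrightarrow> 0" by simp
  then show ?thesis
    by (subst LIM_zero_iff[symmetric], subst tendsto_norm_zero_iff[symmetric])
      (simp add: norm_minus_commute)
qed

text \<open>Finite combinations with rational coefficients are dense: truncate the expansion, then
  round its coefficients.\<close>

lemma parseval_seq_countable_dense:
  fixes e :: "nat \<Rightarrow> 'h::real_inner"
  assumes e: "parseval_seq e"
  shows "\<exists>D::'h set. countable D \<and> (\<forall>x. \<forall>r>0. \<exists>d\<in>D. dist x d < r)"
proof (intro exI conjI allI impI)
  let ?D = "range (\<lambda>q :: rat list. \<Sum>k<length q. real_of_rat (q ! k) *\<^sub>R e k)"
  show "countable ?D" by simp
  fix x :: 'h and r :: real assume r: "r > 0"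
  have "eventually (\<lambda>n. dist (proj e n x) x < r / 2) sequentially"
    using proj_tendsto[OF e, of x] r by (intro tendstoD) auto
  then obtain n where n: "dist (proj e n x) x < r / 2"
    by (auto simp: eventually_sequentially)
  \<comment> \<open>Rounding \<open>n\<close> coefficients by less than \<open>\<delta>\<close>
    costs at most \<open>n * \<delta> \<le> r / 2\<close>; the summand 1 covers
    \<open>n = 0\<close>.\<close>
  define \<delta> where "\<delta> = r / (2 * (real n + 1))"
  have \<delta>: "\<delta> > 0" using r by (simp add: \<delta>_def)
  have "\<exists>q. \<bar>inner x (e k) - real_of_rat q\<bar> < \<delta>" for k
  proof -
    obtain q where "inner x (e k) < real_of_rat q" "real_of_rat q < inner x (e k) + \<delta>"
      using of_rat_dense[of "inner x (e k)" "inner x (e k) + \<delta>"] \<delta> by auto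
    then show ?thesis by (intro exI[of _ q]) auto
  qed
  then obtain q where q: "\<And>k. \<bar>inner x (e k) - real_of_rat (q k)\<bar> < \<delta>" by metis
  define d where "d = (\<Sum>k<n. real_of_rat (q k) *\<^sub>R e k)"
  have "d \<in> ?D"
    unfolding d_def by (intro image_eqI[of _ _ "map q [0..<n]"]) auto
  moreover have "dist x d < r"
  proof -
    have "norm (proj e n x - d) = norm (\<Sum>k<n. (inner x (e k) - real_of_rat (q k)) *\<^sub>R e k)"
      by (simp add: proj_def d_def sum_subtractf scaleR_left_diff_distrib)
    also have "\<dots> \<le> (\<Sum>k<n. \<delta>)"
    proof (rule sum_norm_le)
      fix k
      have "norm (e k) \<le> 1" using e unfolding parseval_seq_def
        by (auto dest!: spec[of _ k])
      then have "\<bar>inner x (e k) - real_of_rat (q k)\<bar> * norm (e k) \<le> \<delta> * 1"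
        using q[of k] \<delta> by (intro mult_mono) auto
      then show "norm ((inner x (e k) - real_of_rat (q k)) *\<^sub>R e k) \<le> \<delta>" by simp
    qed
    also have "\<dots> = real n * \<delta>" by simp
    also have "\<dots> \<le> r / 2" using r by (simp add: \<delta>_def field_simps)
    finally have "dist (proj e n x) d \<le> r / 2" by (simp add: dist_norm)
    then show ?thesis
      using n dist_triangle[of x d "proj e n x"] by (simp add: dist_commute)
  qed
  ultimately show "\<exists>d\<in>?D. dist x d < r" by blast
qed

lemma countable_subbase_of_dense:
  fixes D :: "'m::metric_space set"
  assumes "countable D" and dense: "\<And>x r. r > 0 \<Longrightarrow> \<exists>d\<in>D. dist x d < r"
  shows "\<exists>B::'m set set. countable B \<and> open = generate_topology B"
proof -
  define B where "B = (\<lambda>(d, r). ball d (real_of_rat r)) ` (D \<times> UNIV)"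
  have "countable B" using assms(1) unfolding B_def by auto
  moreover have "topological_basis B"
  proof (rule topological_basisI)
    show "open b" if "b \<in> B" for b using that by (auto simp: B_def)
    fix U and x :: 'm assume U: "open U" "x \<in> U"
    then obtain r where r: "r > 0" "ball x r \<subseteq> U" by (meson open_contains_ball)
    obtain d where d: "d \<in> D" "dist x d < r / 2" using dense[of "r / 2" x] r by auto
    obtain q where q: "dist x d < real_of_rat q" "real_of_rat q < r / 2"
      using of_rat_dense d(2) by blast
    have "x \<in> ball d (real_of_rat q)" using q by (simp add: dist_commute)
    moreover have "ball d (real_of_rat q) \<subseteq> ball x r"
    proof
      fix y assume "y \<in> ball d (real_of_rat q)"
      then show "y \<in> ball x r" using d q dist_triangle[of x y d] by simp
    qed
    ultimately show "\<exists>B'\<in>B. x \<in> B' \<and> B' \<subseteq> U"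
      using d r unfolding B_def by (intro bexI[of _ "ball d (real_of_rat q)"]) auto
  qed
  ultimately show ?thesis using topological_basis_imp_subbasis by blast
qed

section \<open>The Hilbert space \<open>L2\<close>\<close>

lemma sq_int_iff_sqi: "sq_int f \<longleftrightarrow> sqi I01 f"
  by (simp add: sq_int_def sqi_def)

lemma L2_rel_refl: "L2_rel f f \<longleftrightarrow> sq_int f"
  by (simp add: L2_rel_def)

lemma inner_to_L2:
  "sq_int f \<Longrightarrow> sq_int g \<Longrightarrow> inner (to_L2 f) (to_L2 g) = (\<integral>t. f t * g t \<partial>I01)"
  unfolding to_L2_def by (simp add: inner_L2.abs_eq L2_rel_refl)

lemma to_L2_add: "sq_int f \<Longrightarrow> sq_int g \<Longrightarrow> to_L2 (\<lambda>t. f t + g t) = to_L2 f + to_L2 g"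
  unfolding to_L2_def by (simp add: plus_L2.abs_eq L2_rel_refl)

lemma to_L2_diff: "sq_int f \<Longrightarrow> sq_int g \<Longrightarrow> to_L2 (\<lambda>t. f t - g t) = to_L2 f - to_L2 g"
  unfolding to_L2_def by (simp add: minus_L2.abs_eq L2_rel_refl)

lemma to_L2_scale: "sq_int f \<Longrightarrow> to_L2 (\<lambda>t. c * f t) = c *\<^sub>R to_L2 f"
  unfolding to_L2_def by (simp add: scaleR_L2.abs_eq L2_rel_refl)

lemma to_L2_zero: "to_L2 (\<lambda>t. 0) = 0"
  unfolding to_L2_def by (simp add: zero_L2_def)

lemma sq_int_sum: "(\<And>i. i \<in> I \<Longrightarrow> sq_int (f i)) \<Longrightarrow> sq_int (\<lambda>t. \<Sum>i\<in>I. f i t)"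
  unfolding sq_int_iff_sqi by (rule sqi_sum)

lemma to_L2_sum:
  "(\<And>i. i \<in> I \<Longrightarrow> sq_int (f i)) \<Longrightarrow> to_L2 (\<lambda>t. \<Sum>i\<in>I. f i t) = (\<Sum>i\<in>I. to_L2 (f i))"
  by (induction I rule: infinite_finite_induct) (auto simp: to_L2_zero to_L2_add sq_int_sum)

lemma sq_int_cong: "(\<And>t. t \<in> {0..1} \<Longrightarrow> f t = g t) \<Longrightarrow> sq_int f \<longleftrightarrow> sq_int g"
  unfolding sq_int_def
  by (intro arg_cong2[where f = "(\<and>)"] measurable_cong Bochner_Integration.integrable_cong) auto

lemma to_L2_cong:
  assumes "\<And>t. t \<in> {0..1} \<Longrightarrow> f t = g t" and "sq_int f"
  shows "to_L2 f = to_L2 g"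
  unfolding to_L2_def
proof (rule Quotient3_rel_abs[OF Quotient3_L2])
  have "AE t in I01. f t = g t" using assms(1) by (intro AE_I2) simp
  then show "L2_rel f g"
    using assms sq_int_cong[of f g] by (simp add: L2_rel_def)
qed

lemma to_L2_cases:
  obtains f where "sq_int f" "h = to_L2 f"
proof -
  obtain f where "L2_rel f f" "abs_L2 f = h"
    using Quotient3_abs_rep[OF Quotient3_L2] Quotient3_rep_reflp[OF Quotient3_L2] by metis
  then show ?thesis using that by (auto simp: to_L2_def L2_rel_refl)
qed

lemma norm_to_L2: "sq_int f \<Longrightarrow> (norm (to_L2 f))\<^sup>2 = (\<integral>t. (f t)\<^sup>2 \<partial>I01)"
  unfolding power2_norm_eq_inner by (simp add: inner_to_L2 power2_eq_square)

lemma space_I01 [simp]: "space I01 = {0..1}"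
  by (simp add: space_restrict_space)

lemma prob_space_I01: "prob_space I01"
  by (rule prob_spaceI) (simp add: emeasure_restrict_space)

text \<open>The traces on [0,1] of a countable base of the line generate: the identity is measurable
  from their sigma-algebra into \<open>I01\<close>, and every Borel function factors through
  it.\<close>

lemma I01_countably_generated:
  obtains A :: "nat \<Rightarrow> real set" where "range A \<subseteq> sets I01"
    "\<And>f :: real \<Rightarrow> real. f \<in> borel_measurable I01 \<Longrightarrow> f \<in> borel_measurable (sigma (space I01) (range A))"
proof -
  obtain B :: "real set set" where B: "countable B" "open = generate_topology B"
    using ex_countable_basis topological_basis_imp_subbasis by blast
  have borel: "borel = sigma UNIV B" using second_countable_borel_measurable[OF B(2)] .
  have Bopen: "open b" if "b \<in> B" for b
    unfolding B(2) using that by (rule generate_topology.Basis)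
  \<comment> \<open>The empty set makes the family nonempty, as its enumeration by
    \<open>from_nat_into\<close> requires.\<close>
  define \<A> where "\<A> = insert {} ((\<lambda>b. b \<inter> {0..1}) ` B)"
  define A where "A = from_nat_into \<A>"
  have A: "range A = \<A>" unfolding A_def using B(1) by (intro range_from_nat_into) (auto simp: \<A>_def)
  have \<A>s: "\<A> \<subseteq> sets I01"
    unfolding \<A>_def by (auto simp: sets_restrict_space Bopen intro!: image_eqI[of _ _ "_ :: real set"])
  have "(\<lambda>t. t) \<in> measurable (sigma {0..1} \<A>) borel"
    unfolding borel
  proof (rule measurable_measure_of)
    show "(\<lambda>t. t) \<in> space (sigma {0..1} \<A>) \<rightarrow> UNIV" by simp
    fix b assume b: "b \<in> B"
    have "\<A> \<subseteq> Pow {0..1}" by (auto simp: \<A>_def)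
    moreover have "b \<inter> {0..1} \<in> \<A>" using b by (auto simp: \<A>_def)
    ultimately show "(\<lambda>t. t) -` b \<inter> space (sigma {0..1} \<A>) \<in> sets (sigma {0..1} \<A>)"
      by (simp add: sets_measure_of space_measure_of_conv sigma_sets.Basic)
  qed auto
  then have id: "(\<lambda>t. t) \<in> measurable (sigma {0..1} \<A>) I01"
    by (intro measurable_restrict_space2) (auto simp: space_measure_of_conv)
  have "f \<in> borel_measurable (sigma {0..1} \<A>)" if "f \<in> borel_measurable I01" for f :: "real \<Rightarrow> real"
    using measurable_compose[OF id that] by simp
  then show ?thesis
    using that[of A] \<A>s unfolding A space_I01 by blast
qed

lemma ex_parseval_seq_L2: "\<exists>e :: nat \<Rightarrow> L2. parseval_seq e"
proof -
  interpret prob_space I01 by (rule prob_space_I01)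
  obtain A :: "nat \<Rightarrow> real set" where A: "range A \<subseteq> sets I01"
    "\<And>f :: real \<Rightarrow> real. f \<in> borel_measurable I01 \<Longrightarrow> f \<in> borel_measurable (sigma (space I01) (range A))"
    by (rule I01_countably_generated) (rule that)
  obtain g where g: "\<And>k. sqi I01 (g k)" "\<And>j k. j \<noteq> k \<Longrightarrow> ip I01 (g j) (g k) = 0"
    "\<And>k. ip I01 (g k) (g k) \<in> {0, 1}"
    "\<And>f h. sqi I01 f \<Longrightarrow> sqi I01 h \<Longrightarrow> f \<in> borel_measurable (sigma (space I01) (range A)) \<Longrightarrow>
       h \<in> borel_measurable (sigma (space I01) (range A)) \<Longrightarrow>
       (\<lambda>k. ip I01 f (g k) * ip I01 h (g k)) sums ip I01 f h"
    by (rule orthonormal_basis_countably_generated[OF finite_measure_axioms A(1)]) (rule that)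
  have inner: "inner (to_L2 f) (to_L2 h) = ip I01 f h" if "sqi I01 f" "sqi I01 h" for f h
    using that by (simp add: inner_to_L2 sq_int_iff_sqi ip_def)
  have "parseval_seq (\<lambda>k. to_L2 (g k))"
    unfolding parseval_seq_def
  proof (intro conjI allI impI)
    show "inner (to_L2 (g j)) (to_L2 (g k)) = 0" if "j \<noteq> k" for j k
      using g that by (simp add: inner)
    show "norm (to_L2 (g k)) \<in> {0, 1}" for k
      using g(1)[of k] g(3)[of k] by (auto simp: norm_eq_sqrt_inner inner)
    fix h :: L2
    obtain f where f: "sq_int f" "h = to_L2 f" by (rule to_L2_cases)
    then have sqf: "sqi I01 f" by (simp add: sq_int_iff_sqi)
    have mf: "f \<in> borel_measurable (sigma (space I01) (range A))"
      by (rule A(2)[OF sqi_measurable[OF sqf]])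
    have "(\<lambda>k. ip I01 f (g k) * ip I01 f (g k)) sums ip I01 f f"
      by (rule g(4)[OF sqf sqf mf mf])
    then show "(\<lambda>k. (inner h (to_L2 (g k)))\<^sup>2) sums (norm h)\<^sup>2"
      unfolding f(2) power2_norm_eq_inner inner[OF sqf sqf] inner[OF sqf g(1)]
      by (simp only: power2_eq_square)
  qed
  then show ?thesis by blast
qed

text \<open>A countable base makes sums and inner products of Borel measurable
  \<open>L2\<close>-valued maps measurable; the random elements below are built from such
  operations.\<close>

instance L2 :: second_countable_topology
proof
  obtain e :: "nat \<Rightarrow> L2" where "parseval_seq e" using ex_parseval_seq_L2 by blast
  from parseval_seq_countable_dense[OF this] obtain D :: "L2 set"
    where "countable D" "\<And>x r. r > 0 \<Longrightarrow> \<exists>d\<in>D. dist x d < r" by blast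
  then show "\<exists>B :: L2 set set. countable B \<and> open = generate_topology B"
    by (rule countable_subbase_of_dense)
qed

text \<open>Scalar measurability suffices, since the map is the pointwise limit of its finite
  orthogonal projections.\<close>

lemma borel_measurable_inner_basis:
  fixes X :: "'a \<Rightarrow> 'h::{real_inner, second_countable_topology}"
  assumes e: "parseval_seq e" and X: "\<And>k. (\<lambda>\<omega>. inner (X \<omega>) (e k)) \<in> borel_measurable M"
  shows "X \<in> borel_measurable M"
proof (rule borel_measurable_LIMSEQ_metric)
  show "(\<lambda>\<omega>. proj e n (X \<omega>)) \<in> borel_measurable M" for n
    unfolding proj_def using X by measurable
  show "(\<lambda>n. proj e n (X \<omega>)) \<longlonglongrightarrow> X \<omega>" for \<omega>
    by (rule proj_tendsto[OF e])
qed

text \<open>The basis coefficients are integrals over t of a jointly measurable function, hence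
  measurable in \<omega>.\<close>

lemma L2_process_measurable:
  assumes X: "L2_process M X"
  shows "(\<lambda>\<omega>. to_L2 (X \<omega>)) \<in> borel_measurable M"
proof -
  interpret I: prob_space I01 by (rule prob_space_I01)
  obtain e :: "nat \<Rightarrow> L2" where e: "parseval_seq e" using ex_parseval_seq_L2 by blast
  show ?thesis
  proof (rule borel_measurable_inner_basis[OF e])
    fix k
    obtain f where f: "sq_int f" "e k = to_L2 f" by (rule to_L2_cases)
    have [measurable]: "case_prod X \<in> borel_measurable (M \<Otimes>\<^sub>M I01)" "f \<in> borel_measurable I01"
      using X f(1) by (auto simp: L2_process_def sq_int_def)
    have "(\<lambda>\<omega>. \<integral>t. X \<omega> t * f t \<partial>I01) \<in> borel_measurable M" by measurable
    moreover have "inner (to_L2 (X \<omega>)) (e k) = (\<integral>t. X \<omega> t * f t \<partial>I01)" if "\<omega> \<in> space M" for \<omega>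
      using X that f by (simp add: inner_to_L2 L2_process_def)
    ultimately show "(\<lambda>\<omega>. inner (to_L2 (X \<omega>)) (e k)) \<in> borel_measurable M"
      by (subst measurable_cong) auto
  qed
qed

section \<open>Weak convergence in a separable Hilbert space\<close>

lemma abs_integral_le:
  fixes f g :: "'a \<Rightarrow> real"
  assumes "integrable M f" "integrable M g" "\<And>x. x \<in> space M \<Longrightarrow> \<bar>f x\<bar> \<le> g x"
  shows "\<bar>\<integral>x. f x \<partial>M\<bar> \<le> (\<integral>x. g x \<partial>M)"
  by (rule order_trans[OF integral_abs_bound integral_mono]) (use assms in auto)

text \<open>The law of \<open>R\<close> under the probability measure with density
  \<open>V / p\<close>. It turns integrals with a nonnegative weight into integrals against a
  distribution on the line.\<close>

lemma (in prob_space) reweighted_distribution: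
  fixes V R :: "'a \<Rightarrow> real"
  assumes [measurable]: "V \<in> borel_measurable M" "R \<in> borel_measurable M"
    and V: "\<And>\<omega>. \<omega> \<in> space M \<Longrightarrow> 0 \<le> V \<omega>" "integrable M V"
    and p: "(\<integral>\<omega>. V \<omega> \<partial>M) = p" "p > 0"
  defines "D \<equiv> distr (density M (\<lambda>\<omega>. ennreal (V \<omega> / p))) borel R"
  shows "real_distribution D"
    and "f \<in> borel_measurable borel \<Longrightarrow>
      (\<integral>x. f x \<partial>D) = (\<integral>\<omega>. V \<omega> * (f (R \<omega>) :: real) \<partial>M) / p"
proof -
  have nn: "(\<integral>\<^sup>+\<omega>. ennreal (V \<omega> / p) \<partial>M) = 1"
    using V p by (subst nn_integral_eq_integral) (auto intro!: AE_I2)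
  have 1: "prob_space (density M (\<lambda>\<omega>. ennreal (V \<omega> / p)))"
    by (rule prob_spaceI) (simp add: emeasure_density nn cong: nn_integral_cong)
  then interpret D: prob_space "density M (\<lambda>\<omega>. ennreal (V \<omega> / p))" .
  show "real_distribution D"
    unfolding D_def by (intro real_distribution_distr D.real_distribution_distr) simp
  assume [measurable]: "f \<in> borel_measurable borel"
  have "(\<integral>x. f x \<partial>D) = (\<integral>\<omega>. (V \<omega> / p) * f (R \<omega>) \<partial>M)"
    unfolding D_def using V p by (subst integral_distr; simp?) (subst integral_density; simp?)
  also have "\<dots> = (\<integral>\<omega>. V \<omega> * f (R \<omega>) \<partial>M) / p" by simp
  finally show "(\<integral>x. f x \<partial>D) = (\<integral>\<omega>. V \<omega> * f (R \<omega>) \<partial>M) / p" .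
qed

lemma (in real_distribution) char_Re_Im:
  "Re (char M t) = (\<integral>x. cos (t * x) \<partial>M)" "Im (char M t) = (\<integral>x. sin (t * x) \<partial>M)"
proof -
  have "integrable M (\<lambda>x. iexp (t * x))"
    by (rule integrable_iexp) auto
  note * = integral_Re[OF this] integral_Im[OF this]
  show "Re (char M t) = (\<integral>x. cos (t * x) \<partial>M)" "Im (char M t) = (\<integral>x. sin (t * x) \<partial>M)"
    unfolding char_def *[symmetric] by (simp_all add: Re_exp Im_exp)
qed

text \<open>
  Levy's continuity theorem for the finite measures with density \<open>V n\<close>: they may be normalized
  unless their mass tends to \<open>0\<close>, when there is nothing to prove.
\<close>

lemma weighted_levy:
  fixes R V :: "nat \<Rightarrow> 'a \<Rightarrow> real" and r v :: "'b \<Rightarrow> real" and f :: "real \<Rightarrow> real"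
  assumes M: "prob_space M" and N: "prob_space N"
    and meas: "\<And>n. R n \<in> borel_measurable M" "\<And>n. V n \<in> borel_measurable M"
      "r \<in> borel_measurable N" "v \<in> borel_measurable N"
    and V: "\<And>n \<omega>. \<omega> \<in> space M \<Longrightarrow> 0 \<le> V n \<omega>" "\<And>n \<omega>. \<omega> \<in> space M \<Longrightarrow> V n \<omega> \<le> B"
    and v: "\<And>\<omega>. \<omega> \<in> space N \<Longrightarrow> 0 \<le> v \<omega>" "\<And>\<omega>. \<omega> \<in> space N \<Longrightarrow> v \<omega> \<le> B"
    and conv: "\<And>u \<theta>. (\<lambda>n. \<integral>\<omega>. V n \<omega> * cos (u * R n \<omega> + \<theta>) \<partial>M) \<longlonglongrightarrow> (\<integral>\<omega>. v \<omega> * cos (u * r \<omega> + \<theta>) \<partial>N)"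
    and f: "continuous_on UNIV f" "\<And>x. \<bar>f x\<bar> \<le> C"
  shows "(\<lambda>n. \<integral>\<omega>. V n \<omega> * f (R n \<omega>) \<partial>M) \<longlonglongrightarrow> (\<integral>\<omega>. v \<omega> * f (r \<omega>) \<partial>N)"
proof -
  interpret M: prob_space M by fact
  interpret N: prob_space N by fact
  note [measurable] = meas
  have fm [measurable]: "f \<in> borel_measurable borel"
    using f(1) by (rule borel_measurable_continuous_onI)
  have intV: "integrable M (V n)" for n
    using V by (intro M.integrable_const_bound[of _ B]) auto
  have intv: "integrable N v"
    using v by (intro N.integrable_const_bound[of _ B]) auto
  define p where "p n = (\<integral>\<omega>. V n \<omega> \<partial>M)" for n
  define q where "q = (\<integral>\<omega>. v \<omega> \<partial>N)"
  have p0: "p n \<ge> 0" for n unfolding p_def using V by (intro integral_nonneg_AE) auto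
  have q0: "q \<ge> 0" unfolding q_def using v by (intro integral_nonneg_AE) auto
  \<comment> \<open>The total masses converge by the hypothesis at frequency and phase 0.\<close>
  have pq: "p \<longlonglongrightarrow> q" using conv[of 0 0] by (simp add: p_def[abs_def] q_def)
  have C0: "C \<ge> 0" using f(2)[of 0] by linarith
  have B0: "B \<ge> 0" using v N.not_empty by (meson all_not_in_conv order_trans)
  have bdV: "\<bar>\<integral>\<omega>. V n \<omega> * f (R n \<omega>) \<partial>M\<bar> \<le> C * p n" for n
  proof -
    have "integrable M (\<lambda>\<omega>. V n \<omega> * f (R n \<omega>))"
      using V f(2) B0 C0 by (intro M.integrable_const_bound[of _ "B * C"] AE_I2)
        (auto simp: abs_mult intro!: mult_mono)
    then have "\<bar>\<integral>\<omega>. V n \<omega> * f (R n \<omega>) \<partial>M\<bar> \<le> (\<integral>\<omega>. C * V n \<omega> \<partial>M)"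
      using V f(2) intV by (intro abs_integral_le)
        (auto simp: abs_mult mult.commute[of C] intro!: mult_mono)
    then show ?thesis by (simp add: p_def)
  qed
  have bdv: "\<bar>\<integral>\<omega>. v \<omega> * f (r \<omega>) \<partial>N\<bar> \<le> C * q"
  proof -
    have "integrable N (\<lambda>\<omega>. v \<omega> * f (r \<omega>))"
      using v f(2) B0 C0 by (intro N.integrable_const_bound[of _ "B * C"] AE_I2)
        (auto simp: abs_mult intro!: mult_mono)
    then have "\<bar>\<integral>\<omega>. v \<omega> * f (r \<omega>) \<partial>N\<bar> \<le> (\<integral>\<omega>. C * v \<omega> \<partial>N)"
      using v f(2) intv by (intro abs_integral_le)
        (auto simp: abs_mult mult.commute[of C] intro!: mult_mono)
    then show ?thesis by (simp add: q_def)
  qed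
  show ?thesis
  proof (cases "q = 0")
    case True
    then have "(\<lambda>n. C * p n) \<longlonglongrightarrow> 0" using tendsto_mult_left[OF pq, of C] by simp
    then have "(\<lambda>n. \<integral>\<omega>. V n \<omega> * f (R n \<omega>) \<partial>M) \<longlonglongrightarrow> 0"
      by (rule Lim_null_comparison[rotated]) (simp add: bdV)
    then show ?thesis using bdv True by simp
  next
    case False
    then have q: "q > 0" using q0 by simp
    define D' where "D' = distr (density N (\<lambda>\<omega>. ennreal (v \<omega> / q))) borel r"
    \<comment> \<open>The default \<open>D'\<close> makes \<open>D n\<close> a distribution for
      every \<open>n\<close>; eventually \<open>p n\<close> is positive and the default is not
      taken.\<close>
    define D where "D n = (if p n > 0 then distr (density M (\<lambda>\<omega>. ennreal (V n \<omega> / p n))) borel (R n) else D')" for n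
    have D': "real_distribution D'"
      "\<And>g. g \<in> borel_measurable borel \<Longrightarrow> (\<integral>x. g x \<partial>D') = (\<integral>\<omega>. v \<omega> * (g (r \<omega>) :: real) \<partial>N) / q"
      unfolding D'_def using v intv q
      by (intro N.reweighted_distribution; auto simp: q_def)+
    have Dp: "real_distribution (D n)"
      "\<And>g. g \<in> borel_measurable borel \<Longrightarrow> (\<integral>x. g x \<partial>D n) = (\<integral>\<omega>. V n \<omega> * (g (R n \<omega>) :: real) \<partial>M) / p n"
      if "p n > 0" for n
      unfolding D_def using V intV that
      by (simp_all, (intro M.reweighted_distribution; auto simp: p_def)+)
    have D: "real_distribution (D n)" for n
      using Dp[of n] D' by (cases "p n > 0") (auto simp: D_def)
    have ev: "eventually (\<lambda>n. p n > 0) sequentially"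
      using pq q by (rule order_tendstoD)
    have cs: "(\<lambda>n. \<integral>x. cos (t * x + \<theta>) \<partial>D n) \<longlonglongrightarrow> (\<integral>x. cos (t * x + \<theta>) \<partial>D')" for t \<theta>
    proof -
      have "(\<lambda>n. (\<integral>\<omega>. V n \<omega> * cos (t * R n \<omega> + \<theta>) \<partial>M) / p n) \<longlonglongrightarrow>
          (\<integral>\<omega>. v \<omega> * cos (t * r \<omega> + \<theta>) \<partial>N) / q"
        using q by (intro tendsto_divide conv pq) auto
      then have "(\<lambda>n. (\<integral>\<omega>. V n \<omega> * cos (t * R n \<omega> + \<theta>) \<partial>M) / p n) \<longlonglongrightarrow> (\<integral>x. cos (t * x + \<theta>) \<partial>D')"
        by (subst D'(2)) auto
      then show ?thesis
        by (rule Lim_transform_eventually) (use ev in eventually_elim, subst Dp(2), auto)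
    qed
    \<comment> \<open>The arbitrary phase in the hypothesis on cosines covers the sines as well:
      shift by a quarter period.\<close>
    have "sin x = cos (x - pi / 2)" for x :: real by (simp add: cos_diff)
    then have sn: "(\<lambda>n. \<integral>x. sin (t * x) \<partial>D n) \<longlonglongrightarrow> (\<integral>x. sin (t * x) \<partial>D')" for t
      using cs[of t "- (pi / 2)"] by simp
    have "(\<lambda>n. char (D n) t) \<longlonglongrightarrow> char D' t" for t
      unfolding tendsto_complex_iff real_distribution.char_Re_Im[OF D] real_distribution.char_Re_Im[OF D'(1)]
      using cs[of t 0] sn[of t] by simp
    then have wc: "weak_conv_m D D'"
      by (intro levy_continuity D D'(1))
    have "(\<lambda>n. \<integral>x. f x \<partial>D n) \<longlonglongrightarrow> (\<integral>x. f x \<partial>D')"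
      using f by (intro weak_conv_imp_integral_bdd_continuous_conv[OF D D'(1) wc, of f C])
        (auto simp: continuous_on_eq_continuous_at)
    then have "(\<lambda>n. p n * (\<integral>x. f x \<partial>D n)) \<longlonglongrightarrow> q * (\<integral>x. f x \<partial>D')"
      by (intro tendsto_mult pq)
    moreover have "q * (\<integral>x. f x \<partial>D') = (\<integral>\<omega>. v \<omega> * f (r \<omega>) \<partial>N)"
      using q by (subst D'(2)) auto
    ultimately have "(\<lambda>n. p n * (\<integral>x. f x \<partial>D n)) \<longlonglongrightarrow> (\<integral>\<omega>. v \<omega> * f (r \<omega>) \<partial>N)"
      by simp
    then show ?thesis
      by (rule Lim_transform_eventually) (use ev in eventually_elim, subst Dp(2), auto)
  qed
qed

text \<open>Bounded Lipschitz functions suffice to test convergence in distribution.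
  \<open>C\<close> may have any sign, hence the \<open>\<bar>C\<bar>\<close> in later
  estimates.\<close>

definition lip_bdd :: "('h::metric_space \<Rightarrow> real) \<Rightarrow> real \<Rightarrow> real \<Rightarrow> bool" where
  "lip_bdd F C B \<longleftrightarrow> (\<forall>x y. \<bar>F x - F y\<bar> \<le> C * dist x y) \<and> (\<forall>x. \<bar>F x\<bar> \<le> B)"

lemma lip_bdd_nonneg:
  assumes "lip_bdd F C B"
  shows "0 \<le> B"
  using assms unfolding lip_bdd_def by (meson abs_ge_zero order_trans)

lemma lip_bdd_continuous:
  assumes "lip_bdd F C B"
  shows "continuous_on UNIV F"
proof -
  have "lipschitz_on (\<bar>C\<bar>) UNIV F"
  proof (rule lipschitz_onI)
    fix x y
    have "\<bar>F x - F y\<bar> \<le> C * dist x y" using assms by (simp add: lip_bdd_def)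
    also have "\<dots> \<le> \<bar>C\<bar> * dist x y" by (intro mult_right_mono) auto
    finally show "dist (F x) (F y) \<le> \<bar>C\<bar> * dist x y" by (simp add: dist_real_def)
  qed simp
  then show ?thesis by (rule lipschitz_on_continuous_on)
qed

lemma lip_bdd_measurable: "lip_bdd F C B \<Longrightarrow> F \<in> borel_measurable borel"
  by (intro borel_measurable_continuous_onI lip_bdd_continuous)

lemma lip_bdd_const: "lip_bdd (\<lambda>_. c) 0 \<bar>c\<bar>"
  by (simp add: lip_bdd_def)

lemma measurable_proj [measurable]:
  fixes e :: "nat \<Rightarrow> 'h::{real_inner, second_countable_topology}"
  shows "proj e n \<in> borel_measurable borel"
  unfolding proj_def[abs_def] by (intro borel_measurable_continuous_onI continuous_intros)

text \<open>A continuous ramp that rises from 0 to 1 on the unit interval; differences of its shifts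
  by 1 are the hat functions of a partition of unity.\<close>

definition clamp01 :: "real \<Rightarrow> real" where
  "clamp01 y = max 0 (min 1 y)"

lemma continuous_clamp01 [continuous_intros]:
  "continuous_on S g \<Longrightarrow> continuous_on S (\<lambda>x. clamp01 (g x))"
  unfolding clamp01_def by (intro continuous_intros)

lemma clamp01_bounds: "0 \<le> clamp01 y" "clamp01 y \<le> 1"
  by (auto simp: clamp01_def)

text \<open>
  Induction on \<open>j\<close>: the dependence of \<open>F\<close> on one further coordinate is discretized by a partition
  of unity, and the resulting products are treated by the weighted continuity theorem.
\<close>

context
  fixes M :: "'a measure" and N :: "'b measure"
    and X :: "nat \<Rightarrow> 'a \<Rightarrow> 'h::{real_inner, second_countable_topology}" and L :: "'b \<Rightarrow> 'h"
    and e :: "nat \<Rightarrow> 'h"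
  assumes M: "prob_space M" and N: "prob_space N" and e: "parseval_seq e"
    and X [measurable]: "\<And>n. X n \<in> borel_measurable M" and L [measurable]: "L \<in> borel_measurable N"
    and char: "\<And>h \<theta>. (\<lambda>n. \<integral>\<omega>. cos (inner (X n \<omega>) h + \<theta>) \<partial>M) \<longlonglongrightarrow> (\<integral>w. cos (inner (L w) h + \<theta>) \<partial>N)"
begin

definition test_conv :: "('h \<Rightarrow> real) \<Rightarrow> bool" where
  "test_conv F \<longleftrightarrow> (\<lambda>n. \<integral>\<omega>. F (X n \<omega>) \<partial>M) \<longlonglongrightarrow> (\<integral>w. F (L w) \<partial>N)"

lemma bounded_integrable:
  fixes F :: "'h \<Rightarrow> real"
  assumes [measurable]: "F \<in> borel_measurable borel" and "\<And>x. \<bar>F x\<bar> \<le> B"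
  shows "integrable M (\<lambda>\<omega>. F (X n \<omega>))" "integrable N (\<lambda>w. F (L w))"
proof -
  interpret M: prob_space M by (rule M)
  interpret N: prob_space N by (rule N)
  show "integrable M (\<lambda>\<omega>. F (X n \<omega>))"
    using assms(2) by (intro M.integrable_const_bound[of _ B]) auto
  show "integrable N (\<lambda>w. F (L w))"
    using assms(2) by (intro N.integrable_const_bound[of _ B]) auto
qed

lemma test_conv_add:
  assumes "F \<in> borel_measurable borel" "\<And>x. \<bar>F x\<bar> \<le> B" "test_conv F"
    and "G \<in> borel_measurable borel" "\<And>x. \<bar>G x\<bar> \<le> C" "test_conv G"
  shows "test_conv (\<lambda>x. F x + G x)"
  using tendsto_add[OF assms(3)[unfolded test_conv_def] assms(6)[unfolded test_conv_def]]
    bounded_integrable[OF assms(1,2)] bounded_integrable[OF assms(4,5)]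
  unfolding test_conv_def by simp

lemma test_conv_scale: "test_conv F \<Longrightarrow> test_conv (\<lambda>x. c * F x)"
  unfolding test_conv_def by (auto intro: tendsto_mult_left)

lemma test_conv_sum:
  assumes "finite I" "\<And>i. i \<in> I \<Longrightarrow> F i \<in> borel_measurable borel" "\<And>i x. i \<in> I \<Longrightarrow> \<bar>F i x\<bar> \<le> B"
    "\<And>i. i \<in> I \<Longrightarrow> test_conv (F i)"
  shows "test_conv (\<lambda>x. \<Sum>i\<in>I. F i x)"
  using assms(4) bounded_integrable[OF assms(2,3)]
  unfolding test_conv_def by (simp add: tendsto_sum)

lemma test_conv_levy:
  fixes f :: "real \<Rightarrow> real"
  assumes V: "V \<in> borel_measurable borel" "\<And>x. 0 \<le> V x" "\<And>x. V x \<le> B"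
    and cos: "\<And>u \<theta>. test_conv (\<lambda>x. V x * cos (inner x (u *\<^sub>R h) + \<theta>))"
    and f: "continuous_on UNIV f" "\<And>x. \<bar>f x\<bar> \<le> C"
  shows "test_conv (\<lambda>x. V x * f (inner x h))"
  unfolding test_conv_def
proof (rule weighted_levy[OF M N, where B = B and C = C and V = "\<lambda>n \<omega>. V (X n \<omega>)" and
      v = "\<lambda>w. V (L w)" and R = "\<lambda>n \<omega>. inner (X n \<omega>) h" and r = "\<lambda>w. inner (L w) h"])
  note [measurable] = V(1)
  show "(\<lambda>\<omega>. inner (X n \<omega>) h) \<in> borel_measurable M" "(\<lambda>\<omega>. V (X n \<omega>)) \<in> borel_measurable M" for n
    by measurable
  show "(\<lambda>\<omega>. inner (L \<omega>) h) \<in> borel_measurable N" "(\<lambda>\<omega>. V (L \<omega>)) \<in> borel_measurable N"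
    by measurable
  show "(\<lambda>n. \<integral>\<omega>. V (X n \<omega>) * cos (u * inner (X n \<omega>) h + \<theta>) \<partial>M) \<longlonglongrightarrow>
      (\<integral>\<omega>. V (L \<omega>) * cos (u * inner (L \<omega>) h + \<theta>) \<partial>N)" for u \<theta>
    using cos[of u \<theta>] by (simp add: test_conv_def)
qed (use V f in auto)

text \<open>The cosine of a functional of all coordinates is what makes the statement inductive.
  With \<open>h = 0\<close> and \<open>\<theta> = 0\<close> it reduces to convergence for functions
  of the first \<open>j\<close> coordinates.\<close>

definition proj_conv :: "nat \<Rightarrow> bool" where
  "proj_conv j \<longleftrightarrow> (\<forall>F C B h \<theta>. lip_bdd F C B \<longrightarrow>
     test_conv (\<lambda>x. F (proj e j x) * cos (inner x h + \<theta>)))"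

text \<open>Since \<open>proj e 0 x = 0\<close>, the function contributes a constant factor, and the
  assumption on the characteristic functional remains.\<close>

lemma proj_conv_0: "proj_conv 0"
  unfolding proj_conv_def using char
  by (auto simp: proj_def test_conv_def intro!: tendsto_mult_left)

text \<open>The weighted continuity theorem asks for nonnegative weights, which \<open>F\<close>
  times a cosine is not. It is applied to the weights \<open>F\<close> and
  \<open>F * (1 + cos)\<close>, and the results are subtracted.\<close>

lemma proj_conv_nonneg_coordinate:
  assumes IH: "proj_conv j" and F: "lip_bdd F C B" and nn: "\<And>x. 0 \<le> F x"
    and f: "continuous_on UNIV f" "\<And>x. \<bar>f x\<bar> \<le> K"
  shows "test_conv (\<lambda>x. F (proj e j x) * cos (inner x h + \<theta>) * f (inner x (e j)))"
proof -
  have [measurable]: "F \<in> borel_measurable borel" using F by (rule lip_bdd_measurable)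
  have fm [measurable]: "f \<in> borel_measurable borel" using f(1) by (rule borel_measurable_continuous_onI)
  have FB: "F x \<le> B" "\<bar>F x\<bar> \<le> B" for x using F by (auto simp: lip_bdd_def abs_le_iff)
  have K: "K \<ge> 0" using f(2)[of 0] by linarith
  have B: "B \<ge> 0" using lip_bdd_nonneg[OF F] .
  have bd: "\<bar>F x * cos a\<bar> \<le> B" for x a
    using mult_mono[OF FB(2)[of x] abs_cos_le_one[of a]] B by (simp add: abs_mult)
  have IH': "test_conv (\<lambda>x. F (proj e j x) * cos (inner x h' + \<theta>'))" for h' \<theta>'
    using IH F unfolding proj_conv_def by blast
  let ?V1 = "\<lambda>x. F (proj e j x)" and ?V2 = "\<lambda>x. F (proj e j x) * (1 + cos (inner x h + \<theta>))"
  have 1: "test_conv (\<lambda>x. ?V1 x * f (inner x (e j)))"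
  proof (rule test_conv_levy[where V = ?V1 and B = B and h = "e j" and f = f and C = K])
    show "?V1 \<in> borel_measurable borel" by measurable
    show "0 \<le> ?V1 x" "?V1 x \<le> B" for x using nn FB by auto
    show "test_conv (\<lambda>x. ?V1 x * cos (inner x (u *\<^sub>R e j) + \<theta>'))" for u \<theta>'
      by (rule IH')
  qed (rule f)+
  have 2: "test_conv (\<lambda>x. ?V2 x * f (inner x (e j)))"
  proof (rule test_conv_levy[where V = ?V2 and B = "2 * B" and h = "e j" and f = f and C = K])
    show "?V2 \<in> borel_measurable borel" by measurable
    have c: "0 \<le> 1 + cos a" "1 + cos a \<le> 2" for a :: real
      using cos_ge_minus_one[of a] cos_le_one[of a] by linarith+
    show "0 \<le> ?V2 x" for x using nn c by simp
    show "?V2 x \<le> 2 * B" for x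
      using mult_mono[OF FB(1)[of "proj e j x"] c(2)[of "inner x h + \<theta>"]] B c by (simp add: mult.commute)
    fix u \<theta>'
    \<comment> \<open>The product of two cosines is half the sum of cosines in the directions
      \<open>h + u *\<^sub>R e j\<close> and \<open>h - u *\<^sub>R e j\<close>, so the induction
      hypothesis covers every term.\<close>
    have eq: "?V2 x * cos (inner x (u *\<^sub>R e j) + \<theta>') =
        F (proj e j x) * cos (inner x (u *\<^sub>R e j) + \<theta>') +
        (1 / 2) * (F (proj e j x) * cos (inner x (h + u *\<^sub>R e j) + (\<theta> + \<theta>')) +
         F (proj e j x) * cos (inner x (h - u *\<^sub>R e j) + (\<theta> - \<theta>')))" for x
    proof -
      have "cos a * cos b = (1 / 2) * (cos (a + b) + cos (a - b))" for a b :: real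
        by (simp add: cos_add cos_diff)
      from this[of "inner x h + \<theta>" "inner x (u *\<^sub>R e j) + \<theta>'"] show ?thesis
        by (simp add: algebra_simps inner_add_right inner_diff_right)
    qed
    let ?T = "\<lambda>h' \<theta>' x. F (proj e j x) * cos (inner x h' + \<theta>')"
    have T: "?T h' \<theta>' \<in> borel_measurable borel" "\<bar>?T h' \<theta>' x\<bar> \<le> B" for h' \<theta>' x
      by (measurable, rule bd)
    have half: "\<bar>(1 / 2) * (a + b)\<bar> \<le> 2 * B" if "\<bar>a\<bar> \<le> B" "\<bar>b\<bar> \<le> B" for a b :: real
      using that by (simp add: abs_le_iff)
    have W: "test_conv (\<lambda>x. ?T (h + u *\<^sub>R e j) (\<theta> + \<theta>') x + ?T (h - u *\<^sub>R e j) (\<theta> - \<theta>') x)"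
      by (rule test_conv_add[OF T IH' T IH'])
    have "\<bar>(1 / 2) * (?T (h + u *\<^sub>R e j) (\<theta> + \<theta>') x + ?T (h - u *\<^sub>R e j) (\<theta> - \<theta>') x)\<bar> \<le> 2 * B" for x
      by (rule half[OF T(2) T(2)])
    then show "test_conv (\<lambda>x. ?V2 x * cos (inner x (u *\<^sub>R e j) + \<theta>'))"
      unfolding eq by (intro test_conv_add[OF T IH' _ _ test_conv_scale[OF W]]) measurable
  qed (rule f)+
  have "test_conv (\<lambda>x. ?V2 x * f (inner x (e j)) + -1 * (?V1 x * f (inner x (e j))))"
  proof (intro test_conv_add[where B = "2 * B * K" and C = "B * K"] test_conv_scale 1 2)
    fix x
    show "\<bar>-1 * (?V1 x * f (inner x (e j)))\<bar> \<le> B * K"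
      using mult_mono[OF FB(2)[of "proj e j x"] f(2)[of "inner x (e j)"]] B by (simp add: abs_mult)
    have "\<bar>1 + cos (inner x h + \<theta>)\<bar> \<le> 2" using abs_cos_le_one[of "inner x h + \<theta>"] by linarith
    then have "\<bar>?V2 x\<bar> \<le> B * 2"
      unfolding abs_mult using FB(2) B by (intro mult_mono) auto
    then have "\<bar>?V2 x * f (inner x (e j))\<bar> \<le> (B * 2) * K"
      unfolding abs_mult[of "?V2 x"] using f(2) B by (intro mult_mono) auto
    then show "\<bar>?V2 x * f (inner x (e j))\<bar> \<le> 2 * B * K" by (simp only: mult_ac)
  qed measurable
  moreover have "?V2 x * f (inner x (e j)) + -1 * (?V1 x * f (inner x (e j))) =
     F (proj e j x) * cos (inner x h + \<theta>) * f (inner x (e j))" for x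
    by (simp add: algebra_simps)
  ultimately show ?thesis by simp
qed

text \<open>A function of arbitrary sign is the nonnegative \<open>F + B\<close> minus the constant
  \<open>B\<close>.\<close>

lemma proj_conv_coordinate:
  assumes IH: "proj_conv j" and F: "lip_bdd F C B"
    and f: "continuous_on UNIV f" "\<And>x. \<bar>f x\<bar> \<le> K"
  shows "test_conv (\<lambda>x. F (proj e j x) * cos (inner x h + \<theta>) * f (inner x (e j)))"
proof -
  have [measurable]: "F \<in> borel_measurable borel" using F by (rule lip_bdd_measurable)
  have fm [measurable]: "f \<in> borel_measurable borel" using f(1) by (rule borel_measurable_continuous_onI)
  have FB: "\<bar>F x\<bar> \<le> B" for x using F by (auto simp: lip_bdd_def)
  have B: "B \<ge> 0" using lip_bdd_nonneg[OF F] .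
  let ?G = "\<lambda>x. F x + B"
  have G: "lip_bdd ?G C (2 * B)"
    unfolding lip_bdd_def
  proof (intro conjI allI)
    show "\<bar>?G x - ?G y\<bar> \<le> C * dist x y" for x y using F by (simp add: lip_bdd_def)
    show "\<bar>?G x\<bar> \<le> 2 * B" for x using FB[of x] by linarith
  qed
  have G0: "0 \<le> ?G x" for x using FB[of x] by linarith
  have K: "K \<ge> 0" using f(2)[of 0] by linarith
  have bd: "\<bar>a * cos b * f c\<bar> \<le> D * K" if "\<bar>a\<bar> \<le> D" for a b c D
    using mult_mono[OF mult_mono[OF that abs_cos_le_one[of b]] f(2)[of c]] that by (simp add: abs_mult)
  have "test_conv (\<lambda>x. ?G (proj e j x) * cos (inner x h + \<theta>) * f (inner x (e j)) +
      (-1) * (B * cos (inner x h + \<theta>) * f (inner x (e j))))"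
  proof (intro test_conv_add[where B = "2 * B * K" and C = "B * K"] test_conv_scale)
    show "test_conv (\<lambda>x. ?G (proj e j x) * cos (inner x h + \<theta>) * f (inner x (e j)))"
      by (rule proj_conv_nonneg_coordinate[OF IH G G0 f])
    show "test_conv (\<lambda>x. B * cos (inner x h + \<theta>) * f (inner x (e j)))"
      using proj_conv_nonneg_coordinate[OF IH lip_bdd_const[of B] B f] by simp
    show "\<bar>?G (proj e j x) * cos (inner x h + \<theta>) * f (inner x (e j))\<bar> \<le> 2 * B * K" for x
      using G by (intro bd) (simp add: lip_bdd_def)
    show "\<bar>(-1) * (B * cos (inner x h + \<theta>) * f (inner x (e j)))\<bar> \<le> B * K" for x
      using bd[of B B] B by simp
  qed measurable
  then show ?thesis by (simp add: algebra_simps)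
qed

lemma proj_conv_Suc:
  assumes IH: "proj_conv j"
  shows "proj_conv (Suc j)"
  unfolding proj_conv_def
proof (intro allI impI)
  interpret M: prob_space M by (rule M)
  interpret N: prob_space N by (rule N)
  fix F :: "'h \<Rightarrow> real" and C B :: real and h \<theta> assume F: "lip_bdd F C B"
  have [measurable]: "F \<in> borel_measurable borel" using F by (rule lip_bdd_measurable)
  have FB: "\<bar>F x\<bar> \<le> B" for x using F by (auto simp: lip_bdd_def)
  have FC: "\<bar>F x - F y\<bar> \<le> \<bar>C\<bar> * dist x y" for x y
    using F mult_right_mono[OF abs_ge_self[of C] zero_le_dist[of x y]]
    by (auto simp: lip_bdd_def intro: order_trans)
  have B: "B \<ge> 0" using lip_bdd_nonneg[OF F] .
  have ej: "norm (e j) \<le> 1" using e unfolding parseval_seq_def by (auto dest!: spec[of _ j])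
  let ?H = "\<lambda>x. F (proj e (Suc j) x) * cos (inner x h + \<theta>)"
  \<comment> \<open>For positive \<open>\<delta>\<close> this function vanishes when
    \<open>\<bar>s\<bar> \<le> K * \<delta>\<close> and is 1 when
    \<open>\<bar>s\<bar> \<ge> (K + 1) * \<delta>\<close>: it measures the mass that escapes the
    grid.\<close>
  define \<kappa> where "\<kappa> K \<delta> s = 1 - (clamp01 (s / \<delta> + real K + 1) - clamp01 (s / \<delta> - real K))" for K :: nat and \<delta> s
  have \<kappa>_cont: "continuous_on UNIV (\<kappa> K \<delta>)" for K \<delta>
    unfolding \<kappa>_def[abs_def] divide_inverse by (intro continuous_intros)
  have \<kappa>_bd: "\<bar>\<kappa> K \<delta> s\<bar> \<le> 2" for K \<delta> s
    using clamp01_bounds[of "s / \<delta> + real K + 1"] clamp01_bounds[of "s / \<delta> - real K"]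
    unfolding \<kappa>_def by linarith
  have [measurable]: "\<kappa> K \<delta> \<in> borel_measurable borel" for K \<delta>
    using \<kappa>_cont by (rule borel_measurable_continuous_onI)
  have \<kappa>_conv: "test_conv (\<lambda>x. \<kappa> K \<delta> (inner x (e j)))" for K \<delta>
    using proj_conv_coordinate[OF IH lip_bdd_const[of 1] \<kappa>_cont \<kappa>_bd, of 0 0] by simp
  have approx: "\<exists>A. A \<in> borel_measurable borel \<and> (\<exists>D. \<forall>x. \<bar>A x\<bar> \<le> D) \<and> test_conv A \<and>
      (\<forall>x. \<bar>?H x - A x\<bar> \<le> \<bar>C\<bar> * \<delta> + B * \<kappa> K \<delta> (inner x (e j)))" if \<delta>: "\<delta> > 0" for \<delta> and K :: nat
  proof -
    \<comment> \<open>The hat function supported within distance \<open>\<delta>\<close> of the grid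
      point \<open>(i - K) * \<delta>\<close>; the sum over \<open>i < 2 * K + 1\<close> telescopes
      to \<open>1 - \<kappa> K \<delta> s\<close>.\<close>
    define T where "T i s = clamp01 (s / \<delta> + real K + 1 - real i) - clamp01 (s / \<delta> + real K + 1 - real (Suc i))" for i :: nat and s
    have T_sum: "(\<Sum>i<2*K+1. T i s) = 1 - \<kappa> K \<delta> s" for s
      unfolding T_def by (subst sum_lessThan_telescope') (simp add: \<kappa>_def algebra_simps)
    have T0: "0 \<le> T i s" for i s unfolding T_def by (auto simp: clamp01_def)
    have T1: "\<bar>T i s\<bar> \<le> 1" for i s unfolding T_def by (auto simp: clamp01_def)
    have T_supp: "\<bar>s - (real i - real K) * \<delta>\<bar> \<le> \<delta>" if "T i s \<noteq> 0" for i s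
    proof -
      have "\<bar>s / \<delta> - (real i - real K)\<bar> \<le> 1"
        using that unfolding T_def clamp01_def by (auto simp: min_def max_def split: if_splits)
      then have "\<bar>s / \<delta> - (real i - real K)\<bar> * \<delta> \<le> 1 * \<delta>" using \<delta> by (intro mult_right_mono) auto
      also have "\<bar>s / \<delta> - (real i - real K)\<bar> * \<delta> = \<bar>(s / \<delta> - (real i - real K)) * \<delta>\<bar>"
        using \<delta> by (simp add: abs_mult)
      also have "(s / \<delta> - (real i - real K)) * \<delta> = s - (real i - real K) * \<delta>"
        using \<delta> by (simp add: field_simps)
      finally show ?thesis by simp
    qed
    have T_cont: "continuous_on UNIV (T i)" for i
      unfolding T_def[abs_def] divide_inverse by (intro continuous_intros)
    have [measurable]: "T i \<in> borel_measurable borel" for i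
      using T_cont by (rule borel_measurable_continuous_onI)
    \<comment> \<open>The additional coordinate is frozen at a grid point, which leaves a Lipschitz
      function of the first \<open>j\<close> coordinates.\<close>
    define G where "G i y = F (y + ((real i - real K) * \<delta>) *\<^sub>R e j)" for i :: nat and y
    have G: "lip_bdd (G i) C B" for i
      using F unfolding lip_bdd_def G_def by (metis dist_add_cancel2)
    have [measurable]: "G i \<in> borel_measurable borel" for i using G by (rule lip_bdd_measurable)
    define A where "A x = (\<Sum>i<2*K+1. G i (proj e j x) * cos (inner x h + \<theta>) * T i (inner x (e j)))" for x
    have bdA: "\<bar>G i y * cos b * T i c\<bar> \<le> B" for i y b c
      using mult_mono[OF mult_mono[OF _ abs_cos_le_one[of b]] T1[of i c], of "\<bar>G i y\<bar>" B] G[of i] B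
      by (simp add: abs_mult lip_bdd_def)
    have "test_conv A"
      unfolding A_def
      by (rule test_conv_sum[where B = B]) (auto intro!: bdA proj_conv_coordinate[OF IH G T_cont T1])
    moreover have "A \<in> borel_measurable borel" unfolding A_def[abs_def] by measurable
    moreover have "\<bar>A x\<bar> \<le> (\<Sum>i<2*K+1. B)" for x
      unfolding A_def by (rule order_trans[OF sum_abs]) (rule sum_mono, rule bdA)
    moreover have "\<bar>?H x - A x\<bar> \<le> \<bar>C\<bar> * \<delta> + B * \<kappa> K \<delta> (inner x (e j))" for x
    proof -
      let ?s = "inner x (e j)"
      have P: "proj e (Suc j) x = proj e j x + ?s *\<^sub>R e j" by (simp add: proj_def)
      have k0: "\<kappa> K \<delta> ?s \<ge> 0"
        using clamp01_bounds[of "?s / \<delta> + real K + 1"] clamp01_bounds[of "?s / \<delta> - real K"]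
        unfolding \<kappa>_def by linarith
      let ?c = "cos (inner x h + \<theta>)"
      have "?H x - A x = ?c * (F (proj e (Suc j) x) * (\<kappa> K \<delta> ?s + (\<Sum>i<2*K+1. T i ?s)) - (\<Sum>i<2*K+1. G i (proj e j x) * T i ?s))"
        unfolding A_def T_sum by (simp add: algebra_simps sum_distrib_left)
      also have "\<dots> = ?c * (F (proj e (Suc j) x) * \<kappa> K \<delta> ?s + (\<Sum>i<2*K+1. (F (proj e (Suc j) x) - G i (proj e j x)) * T i ?s))"
        by (simp only: distrib_left sum_distrib_left left_diff_distrib sum_subtractf) (simp add: algebra_simps)
      finally have "\<bar>?H x - A x\<bar> \<le> 1 * \<bar>F (proj e (Suc j) x) * \<kappa> K \<delta> ?s + (\<Sum>i<2*K+1. (F (proj e (Suc j) x) - G i (proj e j x)) * T i ?s)\<bar>"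
        by (simp only: abs_mult) (intro mult_right_mono, auto)
      also have "\<dots> \<le> \<bar>F (proj e (Suc j) x) * \<kappa> K \<delta> ?s\<bar> + (\<Sum>i<2*K+1. \<bar>(F (proj e (Suc j) x) - G i (proj e j x)) * T i ?s\<bar>)"
        unfolding mult_1 by (rule order_trans[OF abs_triangle_ineq add_left_mono[OF sum_abs]])
      also have "\<dots> \<le> B * \<kappa> K \<delta> ?s + (\<Sum>i<2*K+1. (\<bar>C\<bar> * \<delta>) * T i ?s)"
      proof (intro add_mono sum_mono)
        show "\<bar>F (proj e (Suc j) x) * \<kappa> K \<delta> ?s\<bar> \<le> B * \<kappa> K \<delta> ?s"
          using FB k0 by (simp add: abs_mult mult_right_mono)
        fix i
        show "\<bar>(F (proj e (Suc j) x) - G i (proj e j x)) * T i ?s\<bar> \<le> (\<bar>C\<bar> * \<delta>) * T i ?s"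
        proof (cases "T i ?s = 0")
          case False
          have "dist (proj e (Suc j) x) (proj e j x + ((real i - real K) * \<delta>) *\<^sub>R e j) =
              norm ((?s - (real i - real K) * \<delta>) *\<^sub>R e j)"
            unfolding P by (simp add: dist_norm scaleR_left_diff_distrib)
          also have "\<dots> \<le> \<delta> * 1"
            unfolding norm_scaleR using T_supp[OF False] ej \<delta> by (intro mult_mono) auto
          finally have "\<bar>C\<bar> * dist (proj e (Suc j) x) (proj e j x + ((real i - real K) * \<delta>) *\<^sub>R e j) \<le> \<bar>C\<bar> * \<delta>"
            by (intro mult_left_mono) auto
          then have "\<bar>F (proj e (Suc j) x) - G i (proj e j x)\<bar> \<le> \<bar>C\<bar> * \<delta>"
            unfolding G_def by (rule order_trans[OF FC])
          then show ?thesis using T0 by (simp add: abs_mult mult_right_mono)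
        qed simp
      qed
      also have "(\<Sum>i<2*K+1. (\<bar>C\<bar> * \<delta>) * T i ?s) = \<bar>C\<bar> * \<delta> * (1 - \<kappa> K \<delta> ?s)"
        by (simp only: sum_distrib_left[symmetric] T_sum)
      also have "B * \<kappa> K \<delta> ?s + \<bar>C\<bar> * \<delta> * (1 - \<kappa> K \<delta> ?s) \<le> \<bar>C\<bar> * \<delta> + B * \<kappa> K \<delta> ?s"
        using mult_nonneg_nonneg[of "\<bar>C\<bar> * \<delta>" "\<kappa> K \<delta> ?s"] \<delta> k0 by (simp add: algebra_simps)
      finally show ?thesis .
    qed
    ultimately show ?thesis by blast
  qed
  have HB: "\<bar>?H x\<bar> \<le> B" for x
    using mult_mono[OF FB[of "proj e (Suc j) x"] abs_cos_le_one[of "inner x h + \<theta>"]] B by (simp add: abs_mult)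
  have [measurable]: "?H \<in> borel_measurable borel" by measurable
  note intH = bounded_integrable[OF this HB]
  show "test_conv ?H"
    unfolding test_conv_def
  proof (rule LIMSEQ_I)
    fix \<eta> :: real assume \<eta>: "\<eta> > 0"
    \<comment> \<open>The error budget has five terms of size \<open>\<eta> / 8\<close>: grid
      spacing and escaping mass for each of the two laws, and the convergence of the grid
      approximation.\<close>
    define \<delta> where "\<delta> = \<eta> / (8 * (\<bar>C\<bar> + 1))"
    have \<delta>: "\<delta> > 0" using \<eta> by (simp add: \<delta>_def)
    have C\<delta>: "\<bar>C\<bar> * \<delta> \<le> \<eta> / 8" using \<eta> by (simp add: \<delta>_def field_simps)
    have "(\<lambda>K. \<integral>w. \<kappa> K \<delta> (inner (L w) (e j)) \<partial>N) \<longlonglongrightarrow> (\<integral>w. 0 \<partial>N)"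
    proof (rule integral_dominated_convergence[where w = "\<lambda>_. 2"])
      show "AE w in N. (\<lambda>K. \<kappa> K \<delta> (inner (L w) (e j))) \<longlonglongrightarrow> 0"
      proof (intro AE_I2)
        fix w
        let ?s = "inner (L w) (e j)"
        obtain K0 :: nat where K0: "\<bar>?s / \<delta>\<bar> \<le> real K0" using real_arch_simple by blast
        have "\<kappa> K \<delta> ?s = 0" if "K \<ge> K0" for K
        proof -
          have "\<bar>?s / \<delta>\<bar> \<le> real K" using K0 that by linarith
          then have "1 \<le> ?s / \<delta> + real K + 1" "?s / \<delta> - real K \<le> 0"
            unfolding abs_le_iff by linarith+
          then show ?thesis unfolding \<kappa>_def clamp01_def by simp
        qed
        then show "(\<lambda>K. \<kappa> K \<delta> ?s) \<longlonglongrightarrow> 0"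
          by (intro tendsto_eventually) (auto simp: eventually_sequentially)
      qed
    qed (use \<kappa>_bd in auto)
    then have "eventually (\<lambda>K. (\<integral>w. \<kappa> K \<delta> (inner (L w) (e j)) \<partial>N) < \<eta> / (8 * (B + 1))) sequentially"
      using \<eta> B by (intro order_tendstoD(2)) auto
    then obtain K where K: "(\<integral>w. \<kappa> K \<delta> (inner (L w) (e j)) \<partial>N) < \<eta> / (8 * (B + 1))"
      by (auto simp: eventually_sequentially)
    obtain A D where A: "A \<in> borel_measurable borel" "\<And>x. \<bar>A x\<bar> \<le> D" "test_conv A"
      "\<And>x. \<bar>?H x - A x\<bar> \<le> \<bar>C\<bar> * \<delta> + B * \<kappa> K \<delta> (inner x (e j))"
      using approx[OF \<delta>, of K] by blast
    note [measurable] = A(1) and intA = bounded_integrable[OF A(1,2)]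
    define k where "k = (\<lambda>x. \<kappa> K \<delta> (inner x (e j)))"
    have km [measurable]: "k \<in> borel_measurable borel" unfolding k_def by measurable
    have kb: "\<bar>k x\<bar> \<le> 2" for x using \<kappa>_bd by (simp add: k_def)
    note intk = bounded_integrable[OF km kb]
    have diffM: "\<bar>(\<integral>\<omega>. ?H (X n \<omega>) \<partial>M) - (\<integral>\<omega>. A (X n \<omega>) \<partial>M)\<bar> \<le> \<bar>C\<bar> * \<delta> + B * (\<integral>\<omega>. k (X n \<omega>) \<partial>M)" for n
    proof -
      have "\<bar>\<integral>\<omega>. ?H (X n \<omega>) - A (X n \<omega>) \<partial>M\<bar> \<le> (\<integral>\<omega>. \<bar>C\<bar> * \<delta> + B * k (X n \<omega>) \<partial>M)"
        using intH intA intk A(4)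
        by (intro abs_integral_le) (auto simp: k_def)
      then show ?thesis using intH intA intk by (simp add: M.prob_space)
    qed
    have diffN: "\<bar>(\<integral>w. ?H (L w) \<partial>N) - (\<integral>w. A (L w) \<partial>N)\<bar> \<le> \<bar>C\<bar> * \<delta> + B * (\<integral>w. k (L w) \<partial>N)"
    proof -
      have "\<bar>\<integral>w. ?H (L w) - A (L w) \<partial>N\<bar> \<le> (\<integral>w. \<bar>C\<bar> * \<delta> + B * k (L w) \<partial>N)"
        using intH intA intk A(4)
        by (intro abs_integral_le) (auto simp: k_def)
      then show ?thesis using intH intA intk by (simp add: N.prob_space)
    qed
    have K': "(\<integral>w. k (L w) \<partial>N) < \<eta> / (8 * (B + 1))" using K by (simp add: k_def)
    have Bk: "B * z \<le> \<eta> / 8" if "z < \<eta> / (8 * (B + 1))" for z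
    proof -
      have "B * z \<le> B * (\<eta> / (8 * (B + 1)))" using that B by (intro mult_left_mono) auto
      also have "\<dots> \<le> \<eta> / 8" using B \<eta> by (simp add: field_simps)
      finally show ?thesis .
    qed
    \<comment> \<open>\<open>\<kappa>\<close> is itself a function of one coordinate to which the
      induction hypothesis applies. Hence the mass that \<open>X n\<close> puts off the grid is
      eventually under the threshold that \<open>K\<close> guarantees for the limit; this replaces a
      tightness argument.\<close>
    have "eventually (\<lambda>n. (\<integral>\<omega>. k (X n \<omega>) \<partial>M) < \<eta> / (8 * (B + 1))) sequentially"
      using \<kappa>_conv[of K \<delta>] K' unfolding test_conv_def k_def by (rule order_tendstoD(2))
    moreover have "eventually (\<lambda>n. dist (\<integral>\<omega>. A (X n \<omega>) \<partial>M) (\<integral>w. A (L w) \<partial>N) < \<eta> / 8) sequentially"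
      using A(3) \<eta> unfolding test_conv_def by (intro tendstoD) auto
    ultimately have "eventually (\<lambda>n. norm ((\<integral>\<omega>. ?H (X n \<omega>) \<partial>M) - (\<integral>w. ?H (L w) \<partial>N)) < \<eta>) sequentially"
    proof eventually_elim
      case (elim n)
      show ?case
        using diffM[of n] diffN Bk[OF elim(1)] Bk[OF K'] C\<delta> elim(2) \<eta>
        unfolding dist_real_def real_norm_def by linarith
    qed
    then show "\<exists>no. \<forall>n\<ge>no. norm ((\<integral>\<omega>. ?H (X n \<omega>) \<partial>M) - (\<integral>w. ?H (L w) \<partial>N)) < \<eta>"
      by (simp add: eventually_sequentially)
  qed
qed

lemma proj_conv: "proj_conv j"
  by (induction j) (auto intro: proj_conv_0 proj_conv_Suc)

text \<open>Projections approximate \<open>X n\<close> uniformly in \<open>n\<close> by the tail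
  hypothesis, and they approximate \<open>L\<close> by dominated convergence; between the projected
  laws \<open>proj_conv\<close> applies.\<close>

lemma lipschitz_conv:
  assumes tail: "\<And>\<eta>. \<eta> > 0 \<Longrightarrow> \<exists>j0. \<forall>j\<ge>j0. \<forall>n. integrable M (\<lambda>\<omega>. (norm (X n \<omega> - proj e j (X n \<omega>)))\<^sup>2) \<and>
      (\<integral>\<omega>. (norm (X n \<omega> - proj e j (X n \<omega>)))\<^sup>2 \<partial>M) \<le> \<eta>"
    and F: "lip_bdd F C B"
  shows "test_conv F"
  unfolding test_conv_def
proof (rule LIMSEQ_I)
  interpret M: prob_space M by (rule M)
  interpret N: prob_space N by (rule N)
  have [measurable]: "F \<in> borel_measurable borel" using F by (rule lip_bdd_measurable)
  have FB: "\<bar>F x\<bar> \<le> B" for x using F by (auto simp: lip_bdd_def)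
  have FC: "\<bar>F x - F y\<bar> \<le> \<bar>C\<bar> * dist x y" for x y
    using F mult_right_mono[OF abs_ge_self[of C] zero_le_dist[of x y]]
    by (auto simp: lip_bdd_def intro: order_trans)
  fix \<eta> :: real assume \<eta>: "\<eta> > 0"
  define a where "a = \<eta> / (8 * (\<bar>C\<bar> + 1))"
  have a: "a > 0" using \<eta> by (simp add: a_def)
  have Ca: "\<bar>C\<bar> * a \<le> \<eta> / 8" using \<eta> by (simp add: a_def field_simps)
  obtain j0 where j0: "\<And>j n. j \<ge> j0 \<Longrightarrow> integrable M (\<lambda>\<omega>. (norm (X n \<omega> - proj e j (X n \<omega>)))\<^sup>2)"
      "\<And>j n. j \<ge> j0 \<Longrightarrow> (\<integral>\<omega>. (norm (X n \<omega> - proj e j (X n \<omega>)))\<^sup>2 \<partial>M) \<le> a\<^sup>2"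
    using tail[of "a\<^sup>2"] a by (auto simp: zero_less_power)
  have "(\<lambda>j. \<integral>w. F (proj e j (L w)) \<partial>N) \<longlonglongrightarrow> (\<integral>w. F (L w) \<partial>N)"
  proof (rule integral_dominated_convergence[where w = "\<lambda>_. B"])
    show "AE w in N. (\<lambda>j. F (proj e j (L w))) \<longlonglongrightarrow> F (L w)"
      using lip_bdd_continuous[OF F] proj_tendsto[OF e]
      by (auto intro!: AE_I2 continuous_on_tendsto_compose[of UNIV F])
  qed (use FB in auto)
  then have "eventually (\<lambda>j. dist (\<integral>w. F (proj e j (L w)) \<partial>N) (\<integral>w. F (L w) \<partial>N) < \<eta> / 8) sequentially"
    using \<eta> by (intro tendstoD) auto
  then obtain j where j: "j \<ge> j0" "dist (\<integral>w. F (proj e j (L w)) \<partial>N) (\<integral>w. F (L w) \<partial>N) < \<eta> / 8"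
    using eventually_happens'[OF sequentially_bot eventually_conj[OF _ eventually_ge_at_top[of j0]]] by blast
  have FPm: "(\<lambda>x. F (proj e j x)) \<in> borel_measurable borel" by measurable
  note int = bounded_integrable[OF FPm FB] bounded_integrable[OF \<open>F \<in> _\<close> FB]
  have bd: "\<bar>(\<integral>\<omega>. F (X n \<omega>) \<partial>M) - (\<integral>\<omega>. F (proj e j (X n \<omega>)) \<partial>M)\<bar> \<le> 2 * (\<eta> / 8)" for n
  proof -
    let ?d = "\<lambda>\<omega>. norm (X n \<omega> - proj e j (X n \<omega>))"
    \<comment> \<open>Splitting at the threshold \<open>a\<close> brings in the second moment
      directly; with a mean squared tail of at most \<open>a\<^sup>2\<close>, the mean error is at
      most \<open>2 * (\<bar>C\<bar> * a)\<close>.\<close>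
    have "t \<le> a + t\<^sup>2 / a" if "t \<ge> 0" for t
    proof (cases "t \<le> a")
      case True then show ?thesis using a by (simp add: add_increasing2)
    next
      case False
      then have "t * a \<le> t\<^sup>2" using that by (simp add: power2_eq_square mult_left_mono)
      then have "t \<le> t\<^sup>2 / a" using a by (simp add: pos_le_divide_eq)
      then show ?thesis using a by simp
    qed
    then have pt: "\<bar>F (X n \<omega>) - F (proj e j (X n \<omega>))\<bar> \<le> \<bar>C\<bar> * (a + (?d \<omega>)\<^sup>2 / a)" for \<omega>
      by (intro order_trans[OF FC] mult_left_mono) (auto simp: dist_norm)
    have "\<bar>\<integral>\<omega>. F (X n \<omega>) - F (proj e j (X n \<omega>)) \<partial>M\<bar> \<le> (\<integral>\<omega>. \<bar>C\<bar> * (a + (?d \<omega>)\<^sup>2 / a) \<partial>M)"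
      using int j0(1)[OF j(1)] pt
      by (intro abs_integral_le) auto
    also have "\<dots> = \<bar>C\<bar> * (a + (\<integral>\<omega>. (?d \<omega>)\<^sup>2 \<partial>M) / a)"
      using j0(1)[OF j(1)] by (simp add: M.prob_space)
    also have "\<dots> \<le> \<bar>C\<bar> * (a + a\<^sup>2 / a)"
      using j0(2)[OF j(1)] a by (intro mult_left_mono add_mono divide_right_mono) auto
    also have "\<dots> = 2 * (\<bar>C\<bar> * a)" using a by (simp add: power2_eq_square)
    also have "\<dots> \<le> 2 * (\<eta> / 8)" using Ca by simp
    finally show ?thesis using int by simp
  qed
  have "test_conv (\<lambda>x. F (proj e j x))"
    using proj_conv[of j] F unfolding proj_conv_def by (auto dest!: spec[of _ F] spec[of _ 0])
  then have "eventually (\<lambda>n. dist (\<integral>\<omega>. F (proj e j (X n \<omega>)) \<partial>M) (\<integral>w. F (proj e j (L w)) \<partial>N) < \<eta> / 8) sequentially"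
    using \<eta> unfolding test_conv_def by (intro tendstoD) auto
  then have "eventually (\<lambda>n. norm ((\<integral>\<omega>. F (X n \<omega>) \<partial>M) - (\<integral>w. F (L w) \<partial>N)) < \<eta>) sequentially"
  proof eventually_elim
    case (elim n)
    then show ?case using bd[of n] j(2) \<eta> unfolding dist_real_def real_norm_def by linarith
  qed
  then show "\<exists>no. \<forall>n\<ge>no. norm ((\<integral>\<omega>. F (X n \<omega>) \<partial>M) - (\<integral>w. F (L w) \<partial>N)) < \<eta>"
    by (simp add: eventually_sequentially)
qed

end

text \<open>A bounded continuous \<open>f\<close> is the pointwise limit from below of the bounded
  Lipschitz functions \<open>F m\<close>, the infimal convolutions of \<open>f\<close> with
  \<open>m\<close> times the distance. This bounds the lower limit of the integrals from below; the
  same for \<open>- f\<close> bounds the upper limit from above.\<close>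

lemma conv_in_distr_of_lipschitz:
  fixes X :: "nat \<Rightarrow> 'a \<Rightarrow> 'c::metric_space" and L :: "'b \<Rightarrow> 'c"
  assumes M: "prob_space M" and N: "prob_space N"
    and X [measurable]: "\<And>n. X n \<in> borel_measurable M" and L [measurable]: "L \<in> borel_measurable N"
    and lip: "\<And>F C B. lip_bdd F C B \<Longrightarrow> (\<lambda>n. \<integral>\<omega>. F (X n \<omega>) \<partial>M) \<longlonglongrightarrow> (\<integral>w. F (L w) \<partial>N)"
  shows "conv_in_distr M X N L"
proof -
  interpret M: prob_space M by fact
  interpret N: prob_space N by fact
  have lower: "eventually (\<lambda>n. (\<integral>\<omega>. f (X n \<omega>) \<partial>M) > (\<integral>w. f (L w) \<partial>N) - \<eta>) sequentially"
    if f: "continuous_on UNIV f" and fB: "\<And>x. \<bar>f x\<bar> \<le> B" and \<eta>: "\<eta> > 0"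
    for f :: "'c \<Rightarrow> real" and B \<eta>
  proof -
    have [measurable]: "f \<in> borel_measurable borel" using f by (rule borel_measurable_continuous_onI)
    define F where "F m x = (INF y. f y + real m * dist x y)" for m :: nat and x
    have lb: "- B \<le> f y + real m * dist x y" for m x y
      using fB[of y] mult_nonneg_nonneg[of "real m" "dist x y"]
      unfolding abs_le_iff by (smt (verit) of_nat_0_le_iff zero_le_dist)
    have bdd: "bdd_below (range (\<lambda>y. f y + real m * dist x y))" for m x
      using lb by (intro bdd_belowI[of _ "- B"]) auto
    have F_le: "F m x \<le> f y + real m * dist x y" for m x y
      unfolding F_def by (rule cINF_lower[OF bdd]) simp
    have F_ge: "c \<le> F m x" if "\<And>y. c \<le> f y + real m * dist x y" for c m x
      unfolding F_def by (rule cINF_greatest) (use that in auto)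
    have F_f: "F m x \<le> f x" for m x using F_le[of m x x] by simp
    have F_bd: "\<bar>F m x\<bar> \<le> B" for m x
      using F_f[of m x] fB[of x] F_ge[OF lb, of m x] by (simp add: abs_le_iff)
    have half: "F m x - real m * dist x z \<le> F m z" for m x z
    proof (rule F_ge)
      fix y
      have "F m x \<le> f y + real m * dist x y" by (rule F_le)
      also have "\<dots> \<le> f y + real m * (dist x z + dist z y)"
        by (intro add_left_mono mult_left_mono dist_triangle) simp
      finally show "F m x - real m * dist x z \<le> f y + real m * dist z y"
        by (simp add: algebra_simps)
    qed
    have F_lip: "lip_bdd (F m) (real m) B" for m
      unfolding lip_bdd_def
    proof (intro conjI allI)
      show "\<bar>F m x - F m z\<bar> \<le> real m * dist x z" for x z
        using half[of m x z] half[of m z x] by (simp add: abs_le_iff dist_commute)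
    qed (rule F_bd)
    have [measurable]: "F m \<in> borel_measurable borel" for m
      using F_lip by (rule lip_bdd_measurable)
    have F_lim: "(\<lambda>m. F m x) \<longlonglongrightarrow> f x" for x
    proof (rule LIMSEQ_I)
      fix r :: real assume r: "r > 0"
      have "isCont f x" using f by (simp add: continuous_on_eq_continuous_at)
      then obtain d where d: "d > 0" "\<And>y. dist y x < d \<Longrightarrow> dist (f y) (f x) < r / 2"
        using r unfolding continuous_at_eps_delta by (metis half_gt_zero)
      \<comment> \<open>For \<open>m \<ge> m0\<close>, points at distance at least \<open>d\<close>
        from \<open>x\<close> pay a penalty of at least \<open>2 * B\<close>, the largest possible
        oscillation of \<open>f\<close>.\<close>
      obtain m0 :: nat where m0: "2 * B / d \<le> real m0" using real_arch_simple by blast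
      have "f x - r / 2 \<le> F m x" if m: "m \<ge> m0" for m
      proof (rule F_ge)
        fix y
        show "f x - r / 2 \<le> f y + real m * dist x y"
        proof (cases "dist y x < d")
          case True
          have "\<bar>f y - f x\<bar> < r / 2" using d(2)[OF True] by (simp add: dist_real_def)
          moreover have "0 \<le> real m * dist x y" by simp
          ultimately show ?thesis by linarith
        next
          case False
          have "2 * B \<le> real m0 * d" using m0 d(1) by (simp add: field_simps)
          also have "\<dots> \<le> real m * dist x y"
            using False m d(1) by (intro mult_mono) (auto simp: dist_commute)
          finally show ?thesis using fB[of x] fB[of y] r unfolding abs_le_iff by linarith
        qed
      qed
      then have "norm (F m x - f x) < r" if "m \<ge> m0" for m
        using that F_f[of m x] r unfolding real_norm_def by fastforce
      then show "\<exists>no. \<forall>m\<ge>no. norm (F m x - f x) < r" by blast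
    qed
    have "(\<lambda>m. \<integral>w. F m (L w) \<partial>N) \<longlonglongrightarrow> (\<integral>w. f (L w) \<partial>N)"
      by (rule integral_dominated_convergence[where w = "\<lambda>_. B"]) (use F_lim F_bd in auto)
    then have "eventually (\<lambda>m. (\<integral>w. F m (L w) \<partial>N) > (\<integral>w. f (L w) \<partial>N) - \<eta>) sequentially"
      using \<eta> by (intro order_tendstoD(1)) auto
    then obtain m where m: "(\<integral>w. F m (L w) \<partial>N) > (\<integral>w. f (L w) \<partial>N) - \<eta>"
      by (auto simp: eventually_sequentially)
    have "eventually (\<lambda>n. (\<integral>\<omega>. F m (X n \<omega>) \<partial>M) > (\<integral>w. f (L w) \<partial>N) - \<eta>) sequentially"
      using lip[OF F_lip] m by (rule order_tendstoD(1))
    then show ?thesis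
    proof eventually_elim
      case (elim n)
      have "(\<integral>\<omega>. F m (X n \<omega>) \<partial>M) \<le> (\<integral>\<omega>. f (X n \<omega>) \<partial>M)"
        using F_f F_bd fB by (intro integral_mono M.integrable_const_bound[where B = B]) auto
      then show ?case using elim by linarith
    qed
  qed
  show ?thesis
    unfolding conv_in_distr_def
  proof (intro conjI allI impI X L)
    fix f :: "'c \<Rightarrow> real" assume f: "continuous_on UNIV f \<and> bounded (range f)"
    then obtain B where B: "\<And>x. \<bar>f x\<bar> \<le> B" by (auto simp: bounded_iff)
    have f': "continuous_on UNIV (\<lambda>x. - f x)" using f by (intro continuous_intros) auto
    show "(\<lambda>n. \<integral>\<omega>. f (X n \<omega>) \<partial>M) \<longlonglongrightarrow> (\<integral>w. f (L w) \<partial>N)"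
    proof (rule LIMSEQ_I)
      fix r :: real assume r: "r > 0"
      have "eventually (\<lambda>n. (\<integral>\<omega>. f (X n \<omega>) \<partial>M) > (\<integral>w. f (L w) \<partial>N) - r) sequentially"
        using lower[of f B r] f B r by auto
      moreover have "eventually (\<lambda>n. (\<integral>\<omega>. - f (X n \<omega>) \<partial>M) > (\<integral>w. - f (L w) \<partial>N) - r) sequentially"
        using lower[OF f', of B r] B r by auto
      ultimately have "eventually (\<lambda>n. norm ((\<integral>\<omega>. f (X n \<omega>) \<partial>M) - (\<integral>w. f (L w) \<partial>N)) < r) sequentially"
        by eventually_elim (simp add: abs_less_iff)
      then show "\<exists>no. \<forall>n\<ge>no. norm ((\<integral>\<omega>. f (X n \<omega>) \<partial>M) - (\<integral>w. f (L w) \<partial>N)) < r"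
        by (simp add: eventually_sequentially)
    qed
  qed
qed

text \<open>On the event of closeness the Lipschitz bound applies; on its complement the crude bound
  \<open>2 * B\<close> is multiplied by a vanishing probability.\<close>

lemma slutsky_lipschitz:
  fixes X S :: "nat \<Rightarrow> 'a \<Rightarrow> 'h::{metric_space, second_countable_topology}"
  assumes M: "prob_space M"
    and X [measurable]: "\<And>n. X n \<in> borel_measurable M" and S [measurable]: "\<And>n. S n \<in> borel_measurable M"
    and close: "\<And>\<eta>. \<eta> > 0 \<Longrightarrow> (\<lambda>n. measure M {\<omega> \<in> space M. dist (X n \<omega>) (S n \<omega>) > \<eta>}) \<longlonglongrightarrow> 0"
    and F: "lip_bdd F C B" and conv: "(\<lambda>n. \<integral>\<omega>. F (S n \<omega>) \<partial>M) \<longlonglongrightarrow> l"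
  shows "(\<lambda>n. \<integral>\<omega>. F (X n \<omega>) \<partial>M) \<longlonglongrightarrow> l"
proof -
  interpret M: prob_space M by fact
  have [measurable]: "F \<in> borel_measurable borel" using F by (rule lip_bdd_measurable)
  have FB: "\<bar>F x\<bar> \<le> B" for x using F by (auto simp: lip_bdd_def)
  have B: "B \<ge> 0" using lip_bdd_nonneg[OF F] .
  have FC: "\<bar>F x - F y\<bar> \<le> \<bar>C\<bar> * dist x y" for x y
    using F mult_right_mono[OF abs_ge_self[of C] zero_le_dist[of x y]]
    by (auto simp: lip_bdd_def intro: order_trans)
  have int: "integrable M (\<lambda>\<omega>. F (X n \<omega>))" "integrable M (\<lambda>\<omega>. F (S n \<omega>))" for n
    using FB by (auto intro!: M.integrable_const_bound[where B = B])
  have "(\<lambda>n. (\<integral>\<omega>. F (X n \<omega>) \<partial>M) - (\<integral>\<omega>. F (S n \<omega>) \<partial>M)) \<longlonglongrightarrow> 0"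
  proof (rule LIMSEQ_I)
    fix r :: real assume r: "r > 0"
    define \<eta> where "\<eta> = r / (2 * (\<bar>C\<bar> + 1))"
    have \<eta>: "\<eta> > 0" using r by (simp add: \<eta>_def)
    have C\<eta>: "\<bar>C\<bar> * \<eta> \<le> r / 2" using r by (simp add: \<eta>_def field_simps)
    let ?A = "\<lambda>n. {\<omega> \<in> space M. dist (X n \<omega>) (S n \<omega>) > \<eta>}"
    have A [measurable]: "?A n \<in> sets M" for n by measurable
    have bd: "\<bar>(\<integral>\<omega>. F (X n \<omega>) \<partial>M) - (\<integral>\<omega>. F (S n \<omega>) \<partial>M)\<bar> \<le> \<bar>C\<bar> * \<eta> + 2 * B * measure M (?A n)" for n
    proof -
      have "\<bar>\<integral>\<omega>. F (X n \<omega>) - F (S n \<omega>) \<partial>M\<bar> \<le> (\<integral>\<omega>. \<bar>C\<bar> * \<eta> + 2 * B * indicator (?A n) \<omega> \<partial>M)"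
      proof (rule abs_integral_le)
        show "integrable M (\<lambda>\<omega>. F (X n \<omega>) - F (S n \<omega>))" using int by simp
        show "integrable M (\<lambda>\<omega>. \<bar>C\<bar> * \<eta> + 2 * B * indicator (?A n) \<omega>)"
          by (intro Bochner_Integration.integrable_add integrable_mult_right integrable_real_indicator) (auto simp: M.emeasure_eq_measure)
        fix \<omega> assume w: "\<omega> \<in> space M"
        show "\<bar>F (X n \<omega>) - F (S n \<omega>)\<bar> \<le> \<bar>C\<bar> * \<eta> + 2 * B * indicator (?A n) \<omega>"
        proof (cases "\<omega> \<in> ?A n")
          case True
          have "0 \<le> \<bar>C\<bar> * \<eta>" using \<eta> by simp
          then show ?thesis using True FB[of "X n \<omega>"] FB[of "S n \<omega>"] unfolding abs_le_iff by simp
        next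
          case False
          have "\<bar>C\<bar> * dist (X n \<omega>) (S n \<omega>) \<le> \<bar>C\<bar> * \<eta>"
            using False w by (intro mult_left_mono) auto
          then show ?thesis using False FC[of "X n \<omega>" "S n \<omega>"] by simp
        qed
      qed
      also have "\<dots> = \<bar>C\<bar> * \<eta> + 2 * B * measure M (?A n)"
        by (subst Bochner_Integration.integral_add) (auto simp: M.prob_space M.emeasure_eq_measure)
      finally show ?thesis using int by simp
    qed
    have "(\<lambda>n. 2 * B * measure M (?A n)) \<longlonglongrightarrow> 2 * B * 0"
      by (intro tendsto_mult tendsto_const close \<eta>)
    then have "eventually (\<lambda>n. 2 * B * measure M (?A n) < r / 2) sequentially"
      using r by (intro order_tendstoD(2)) auto
    then have "eventually (\<lambda>n. norm ((\<integral>\<omega>. F (X n \<omega>) \<partial>M) - (\<integral>\<omega>. F (S n \<omega>) \<partial>M) - 0) < r) sequentially"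
    proof eventually_elim
      case (elim n)
      show ?case using bd[of n] elim C\<eta> by simp
    qed
    then show "\<exists>no. \<forall>n\<ge>no. norm ((\<integral>\<omega>. F (X n \<omega>) \<partial>M) - (\<integral>\<omega>. F (S n \<omega>) \<partial>M) - 0) < r"
      by (simp add: eventually_sequentially)
  qed
  from tendsto_add[OF this conv] show ?thesis by simp
qed

section \<open>Limit theorems for independent real random variables\<close>

lemma (in prob_space) integrable_of_sqi: "sqi M R \<Longrightarrow> integrable M R"
  using sqi_mult[of M R "\<lambda>_. 1"] by (simp add: sqi_def)

lemma (in prob_space) second_moment_sum:
  fixes R :: "nat \<Rightarrow> 'a \<Rightarrow> real"
  assumes indep: "indep_vars (\<lambda>_. borel) R UNIV"
    and sq: "\<And>i. integrable M (\<lambda>\<omega>. (R i \<omega>)\<^sup>2)" and zero: "\<And>i. expectation (R i) = 0"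
    and "finite I"
  shows "integrable M (\<lambda>\<omega>. (\<Sum>i\<in>I. R i \<omega>)\<^sup>2) \<and>
    expectation (\<lambda>\<omega>. (\<Sum>i\<in>I. R i \<omega>)\<^sup>2) = (\<Sum>i\<in>I. expectation (\<lambda>\<omega>. (R i \<omega>)\<^sup>2))"
  using \<open>finite I\<close>
proof (induction I rule: finite_induct)
  case (insert i I)
  have rv: "R i \<in> borel_measurable M" for i using indep unfolding indep_vars_def2 by simp
  have Ri: "sqi M (R i)" for i using rv sq by (simp add: sqi_def)
  then have S: "sqi M (\<lambda>\<omega>. \<Sum>i\<in>I. R i \<omega>)" "sqi M (R i)" for i by (auto intro: sqi_sum)
  have int: "integrable M (\<lambda>\<omega>. \<Sum>i\<in>I. R i \<omega>)" "integrable M (R i)" for i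
    using integrable_of_sqi[OF S(1)] integrable_of_sqi[OF S(2)] by auto
  have "indep_var borel (R i) borel (\<lambda>\<omega>. \<Sum>i\<in>I. R i \<omega>)"
    using insert(1,2) indep_vars_subset[OF indep] by (intro indep_vars_sum) auto
  from indep_var_lebesgue_integral[OF this] int
  have cross: "expectation (\<lambda>\<omega>. R i \<omega> * (\<Sum>i\<in>I. R i \<omega>)) = 0" by (simp add: zero)
  have eq: "(\<Sum>i\<in>insert i I. R i \<omega>)\<^sup>2 = (R i \<omega>)\<^sup>2 + (\<Sum>i\<in>I. R i \<omega>)\<^sup>2 + 2 * (R i \<omega> * (\<Sum>i\<in>I. R i \<omega>))" for \<omega>
    using insert(1,2) by (simp add: power2_sum)
  have "integrable M (\<lambda>\<omega>. R i \<omega> * (\<Sum>i\<in>I. R i \<omega>))"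
    by (rule sqi_mult[OF S(2,1)])
  then show ?case
    unfolding eq using insert sq cross by simp
qed simp

text \<open>Truncation, as only a first moment is available: the truncated variables obey a variance
  bound, and the remainders are small in mean uniformly in \<open>n\<close>. Convergence in mean is
  convenient because the errors of several matrix entries can be added.\<close>

lemma (in prob_space) weak_law_L1:
  fixes R :: "nat \<Rightarrow> 'a \<Rightarrow> real"
  assumes indep: "indep_vars (\<lambda>_. borel) R UNIV"
    and distr: "\<And>i. distr M borel (R i) = distr M borel (R 0)"
    and int: "integrable M (R 0)"
  shows "(\<lambda>n. expectation (\<lambda>\<omega>. \<bar>(1 / real n) * (\<Sum>i<n. R i \<omega>) - expectation (R 0)\<bar>)) \<longlonglongrightarrow> 0"
proof (rule LIMSEQ_I)
  fix r :: real assume r: "r > 0"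
  have rv [measurable]: "R i \<in> borel_measurable M" for i using indep unfolding indep_vars_def2 by simp
  have transfer: "expectation (\<lambda>\<omega>. g (R i \<omega>)) = expectation (\<lambda>\<omega>. g (R 0 \<omega>))"
    "integrable M (\<lambda>\<omega>. g (R i \<omega>)) = integrable M (\<lambda>\<omega>. g (R 0 \<omega>))"
    if [measurable]: "g \<in> borel_measurable borel" for g :: "real \<Rightarrow> real" and i
  proof -
    have "(\<integral>x. g x \<partial>distr M borel (R i)) = (\<integral>x. g x \<partial>distr M borel (R 0))"
      "integrable (distr M borel (R i)) g = integrable (distr M borel (R 0)) g"
      by (simp_all only: distr[of i])
    then show "expectation (\<lambda>\<omega>. g (R i \<omega>)) = expectation (\<lambda>\<omega>. g (R 0 \<omega>))"
      "integrable M (\<lambda>\<omega>. g (R i \<omega>)) = integrable M (\<lambda>\<omega>. g (R 0 \<omega>))"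
      by (simp_all add: integral_distr integrable_distr_eq)
  qed
  define T where "T c x = max (- c) (min c x)" for c x :: real
  have [measurable]: "T c \<in> borel_measurable borel" for c unfolding T_def[abs_def] by measurable
  have T_bd: "\<bar>T (real c) x\<bar> \<le> real c" for c x unfolding T_def by auto
  have T_le: "\<bar>x - T (real c) x\<bar> \<le> \<bar>x\<bar>" for c x unfolding T_def by auto
  have "(\<lambda>c. expectation (\<lambda>\<omega>. \<bar>R 0 \<omega> - T (real c) (R 0 \<omega>)\<bar>)) \<longlonglongrightarrow> expectation (\<lambda>_. 0)"
  proof (rule integral_dominated_convergence[where w = "\<lambda>\<omega>. \<bar>R 0 \<omega>\<bar>"])
    show "AE \<omega> in M. (\<lambda>c. \<bar>R 0 \<omega> - T (real c) (R 0 \<omega>)\<bar>) \<longlonglongrightarrow> 0"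
    proof (intro AE_I2 tendsto_eventually)
      fix \<omega>
      obtain c0 :: nat where "\<bar>R 0 \<omega>\<bar> \<le> real c0" using real_arch_simple by blast
      then have "\<bar>R 0 \<omega> - T (real c) (R 0 \<omega>)\<bar> = 0" if "c \<ge> c0" for c
        using that by (auto simp: T_def)
      then show "eventually (\<lambda>c. \<bar>R 0 \<omega> - T (real c) (R 0 \<omega>)\<bar> = 0) sequentially"
        unfolding eventually_sequentially by blast
    qed
  qed (use int T_le in auto)
  then have "eventually (\<lambda>c. expectation (\<lambda>\<omega>. \<bar>R 0 \<omega> - T (real c) (R 0 \<omega>)\<bar>) < r / 8) sequentially"
    using r by (intro order_tendstoD(2)) auto
  then obtain c :: nat where c: "expectation (\<lambda>\<omega>. \<bar>R 0 \<omega> - T (real c) (R 0 \<omega>)\<bar>) < r / 8"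
    by (auto simp: eventually_sequentially)
  define m where "m = expectation (\<lambda>\<omega>. T (real c) (R 0 \<omega>))"
  define U where "U i \<omega> = T (real c) (R i \<omega>) - m" for i \<omega>
  define V where "V i \<omega> = R i \<omega> - T (real c) (R i \<omega>)" for i \<omega>
  have [measurable]: "U i \<in> borel_measurable M" "V i \<in> borel_measurable M" for i
    unfolding U_def[abs_def] V_def[abs_def] by measurable
  have intT: "integrable M (\<lambda>\<omega>. T (real c) (R i \<omega>))" for i
    using T_bd by (intro integrable_const_bound[where B = "real c"]) auto
  have m_bd: "\<bar>m\<bar> \<le> real c"
    unfolding m_def using abs_integral_le[OF intT integrable_const[of "real c"], of 0] T_bd
    by (simp add: prob_space)
  have U_bd: "\<bar>U i \<omega>\<bar> \<le> 2 * real c" for i \<omega>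
    using T_bd[of c "R i \<omega>"] m_bd unfolding U_def by linarith
  have U_sq: "(U i \<omega>)\<^sup>2 \<le> (2 * real c)\<^sup>2" for i \<omega>
    using power_mono[OF U_bd[of i \<omega>], of 2] by simp
  have intU2: "integrable M (\<lambda>\<omega>. (U i \<omega>)\<^sup>2)" for i
    using U_sq by (intro integrable_const_bound[where B = "(2 * real c)\<^sup>2"]) auto
  have intU: "integrable M (U i)" for i using intU2 by (intro integrable_of_sqi) (simp add: sqi_def)
  have U0: "expectation (U i) = 0" for i
    using transfer(1)[of "T (real c)" i] intT by (simp add: U_def[abs_def] prob_space m_def)
  have indepU: "indep_vars (\<lambda>_. borel) U UNIV"
    unfolding U_def[abs_def] by (rule indep_vars_compose2[OF indep]) measurable
  have intR: "integrable M (R i)" for i using transfer(2)[of "\<lambda>x. x" i] int by simp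
  have intV: "integrable M (V i)" for i unfolding V_def[abs_def] using intR intT by simp
  have EV: "expectation (\<lambda>\<omega>. \<bar>V i \<omega>\<bar>) < r / 8" for i
    using transfer(1)[of "\<lambda>x. \<bar>x - T (real c) x\<bar>" i] c by (simp add: V_def)
  have split: "expectation (R 0) = m + expectation (V 0)"
    using intR intT by (simp add: m_def V_def[abs_def])
  \<comment> \<open>The threshold for \<open>n\<close> makes the second moment
    \<open>4 * c\<^sup>2 / n\<close> of the averaged truncated variables at most
    \<open>r\<^sup>2 / 64\<close>. The contributions then add up to
    \<open>9 * r / 16\<close>.\<close>
  have "expectation (\<lambda>\<omega>. \<bar>(1 / real n) * (\<Sum>i<n. R i \<omega>) - expectation (R 0)\<bar>) < r"
    if n: "real n > 256 * (real c)\<^sup>2 / r\<^sup>2" "n > 0" for n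
  proof -
    let ?S = "\<lambda>\<omega>. (1 / real n) * (\<Sum>i<n. U i \<omega>)"
    have intS2: "integrable M (\<lambda>\<omega>. (?S \<omega>)\<^sup>2)"
      using second_moment_sum[OF indepU intU2 U0, of "{..<n}"] by (simp add: power_divide)
    have "expectation (\<lambda>\<omega>. (?S \<omega>)\<^sup>2) = (1 / real n)\<^sup>2 * (\<Sum>i<n. expectation (\<lambda>\<omega>. (U i \<omega>)\<^sup>2))"
      using second_moment_sum[OF indepU intU2 U0, of "{..<n}"] by (simp add: power_divide)
    also have "\<dots> \<le> (1 / real n)\<^sup>2 * (\<Sum>i<n. (2 * real c)\<^sup>2)"
    proof (intro mult_left_mono sum_mono)
      fix i
      have "expectation (\<lambda>\<omega>. (U i \<omega>)\<^sup>2) \<le> expectation (\<lambda>\<omega>. (2 * real c)\<^sup>2)"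
        using U_sq intU2 by (intro integral_mono) auto
      then show "expectation (\<lambda>\<omega>. (U i \<omega>)\<^sup>2) \<le> (2 * real c)\<^sup>2" by (simp add: prob_space)
    qed simp
    also have "\<dots> = 4 * (real c)\<^sup>2 / real n" using n by (simp add: power2_eq_square)
    also have "\<dots> \<le> r\<^sup>2 / 64"
      using n r by (simp add: field_simps)
    finally have ES2: "expectation (\<lambda>\<omega>. (?S \<omega>)\<^sup>2) \<le> r\<^sup>2 / 64" .
    have young: "\<bar>t\<bar> \<le> r / 4 + t\<^sup>2 * (4 / r)" for t
    proof (cases "\<bar>t\<bar> \<le> r / 4")
      case True then show ?thesis using r by (simp add: add_increasing2)
    next
      case False
      then have "\<bar>t\<bar> * (r / 4) \<le> \<bar>t\<bar> * \<bar>t\<bar>" by (intro mult_left_mono) auto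
      then have "\<bar>t\<bar> * (r / 4) * (4 / r) \<le> t\<^sup>2 * (4 / r)"
        using r by (intro mult_right_mono) (auto simp: power2_eq_square)
      then show ?thesis using r by simp
    qed
    have "(1 / real n) * (\<Sum>i<n. R i \<omega>) - expectation (R 0) =
        ?S \<omega> + (1 / real n) * (\<Sum>i<n. V i \<omega>) - expectation (V 0)" for \<omega>
    proof -
      have "(\<Sum>i<n. R i \<omega>) = (\<Sum>i<n. U i \<omega>) + (\<Sum>i<n. V i \<omega>) + real n * m"
        by (simp add: U_def V_def sum.distrib[symmetric] flip: sum_subtractf) (simp add: sum_subtractf)
      then show ?thesis using n split by (simp add: field_simps)
    qed
    then have pt: "\<bar>(1 / real n) * (\<Sum>i<n. R i \<omega>) - expectation (R 0)\<bar> \<le>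
        r / 4 + (?S \<omega>)\<^sup>2 * (4 / r) + (1 / real n) * (\<Sum>i<n. \<bar>V i \<omega>\<bar>) + \<bar>expectation (V 0)\<bar>" for \<omega>
    proof -
      assume eq: "\<And>\<omega>. (1 / real n) * (\<Sum>i<n. R i \<omega>) - expectation (R 0) =
        ?S \<omega> + (1 / real n) * (\<Sum>i<n. V i \<omega>) - expectation (V 0)"
      have "\<bar>(1 / real n) * (\<Sum>i<n. V i \<omega>)\<bar> \<le> (1 / real n) * (\<Sum>i<n. \<bar>V i \<omega>\<bar>)"
        unfolding abs_mult by (intro mult_mono sum_abs) auto
      then show ?thesis unfolding eq using young[of "?S \<omega>"] by linarith
    qed
    have "expectation (\<lambda>\<omega>. \<bar>(1 / real n) * (\<Sum>i<n. R i \<omega>) - expectation (R 0)\<bar>) \<le>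
      expectation (\<lambda>\<omega>. r / 4 + (?S \<omega>)\<^sup>2 * (4 / r) + (1 / real n) * (\<Sum>i<n. \<bar>V i \<omega>\<bar>) + \<bar>expectation (V 0)\<bar>)"
    proof (rule integral_mono)
      show "integrable M (\<lambda>\<omega>. \<bar>(1 / real n) * (\<Sum>i<n. R i \<omega>) - expectation (R 0)\<bar>)"
        using intR by auto
      show "integrable M (\<lambda>\<omega>. r / 4 + (?S \<omega>)\<^sup>2 * (4 / r) + (1 / real n) * (\<Sum>i<n. \<bar>V i \<omega>\<bar>) + \<bar>expectation (V 0)\<bar>)"
        using intS2 intV by (intro Bochner_Integration.integrable_add integrable_mult_left integrable_mult_right Bochner_Integration.integrable_sum) auto
    qed (rule pt)
    also have "\<dots> = r / 4 + expectation (\<lambda>\<omega>. (?S \<omega>)\<^sup>2) * (4 / r) + (1 / real n) * (\<Sum>i<n. expectation (\<lambda>\<omega>. \<bar>V i \<omega>\<bar>)) + \<bar>expectation (V 0)\<bar>"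
    proof -
      have 1: "integrable M (\<lambda>\<omega>. (?S \<omega>)\<^sup>2 * (4 / r))" using intS2 by (rule integrable_mult_left)
      have 2: "integrable M (\<lambda>\<omega>. (1 / real n) * (\<Sum>i<n. \<bar>V i \<omega>\<bar>))" using intV by (intro integrable_mult_right Bochner_Integration.integrable_sum) auto
      have 3: "expectation (\<lambda>\<omega>. (1 / real n) * (\<Sum>i<n. \<bar>V i \<omega>\<bar>)) = (1 / real n) * (\<Sum>i<n. expectation (\<lambda>\<omega>. \<bar>V i \<omega>\<bar>))"
        using intV by (subst integral_mult_right_zero, subst Bochner_Integration.integral_sum) auto
      have 4: "expectation (\<lambda>\<omega>. (?S \<omega>)\<^sup>2 * (4 / r)) = expectation (\<lambda>\<omega>. (?S \<omega>)\<^sup>2) * (4 / r)"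
        by (rule integral_mult_left_zero)
      show ?thesis
        using 1 2 by (simp only: Bochner_Integration.integral_add Bochner_Integration.integrable_add integrable_const 3 4 lebesgue_integral_const prob_space) simp
    qed
    also have "\<dots> \<le> r / 4 + (r\<^sup>2 / 64) * (4 / r) + (1 / real n) * (\<Sum>i<n. r / 8) + r / 8"
    proof (intro add_mono mult_left_mono mult_right_mono sum_mono ES2 order.refl)
      show "expectation (\<lambda>\<omega>. \<bar>V i \<omega>\<bar>) \<le> r / 8" for i using EV[of i] by simp
      have "\<bar>expectation (V 0)\<bar> \<le> expectation (\<lambda>\<omega>. \<bar>V 0 \<omega>\<bar>)" by (rule integral_abs_bound)
      then show "\<bar>expectation (V 0)\<bar> \<le> r / 8" using EV[of 0] by linarith
    qed (use r in auto)
    also have "\<dots> < r" using r n by (simp add: power2_eq_square)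
    finally show ?thesis .
  qed
  moreover obtain n0 :: nat where "256 * (real c)\<^sup>2 / r\<^sup>2 < real n0" using reals_Archimedean2 by blast
  ultimately have "\<forall>n\<ge>Suc n0. expectation (\<lambda>\<omega>. \<bar>(1 / real n) * (\<Sum>i<n. R i \<omega>) - expectation (R 0)\<bar>) < r"
    by fastforce
  moreover have "expectation (\<lambda>\<omega>. \<bar>(1 / real n) * (\<Sum>i<n. R i \<omega>) - expectation (R 0)\<bar>) \<ge> 0" for n
    by (rule integral_nonneg_AE) simp
  ultimately show "\<exists>no. \<forall>n\<ge>no. norm (expectation (\<lambda>\<omega>. \<bar>(1 / real n) * (\<Sum>i<n. R i \<omega>) - expectation (R 0)\<bar>) - 0) < r"
    by (intro exI[of _ "Suc n0"]) simp
qed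

text \<open>A real value of the characteristic function makes the sine integral vanish; the addition
  theorem then leaves the cosine of the phase.\<close>

lemma cos_shift_of_char:
  assumes D: "real_distribution D" and c: "char D t = complex_of_real z"
  shows "(\<integral>x. cos (t * x + \<theta>) \<partial>D) = z * cos \<theta>"
proof -
  interpret real_distribution D by fact
  have int: "integrable D (\<lambda>x. cos (t * x))" "integrable D (\<lambda>x. sin (t * x))"
    by (auto intro!: integrable_const_bound[where B = 1])
  have "(\<integral>x. cos (t * x + \<theta>) \<partial>D) = (\<integral>x. cos (t * x) * cos \<theta> - sin (t * x) * sin \<theta> \<partial>D)"
    by (simp add: cos_add)
  also have "\<dots> = (\<integral>x. cos (t * x) \<partial>D) * cos \<theta> - (\<integral>x. sin (t * x) \<partial>D) * sin \<theta>"
    using int by simp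
  also have "\<dots> = z * cos \<theta>"
    using char_Re_Im[of t] c by simp
  finally show ?thesis .
qed

text \<open>The central limit theorem in the form consumed by the weak convergence lemmas, cosines
  with arbitrary phase. Variance 0 is separate because the normalized theorem asks for
  \<open>\<sigma> > 0\<close>; in that case the sums vanish almost surely.\<close>

lemma (in prob_space) clt_cos:
  fixes R :: "nat \<Rightarrow> 'a \<Rightarrow> real"
  assumes indep: "indep_vars (\<lambda>_. borel) R UNIV"
    and distr: "\<And>i. distr M borel (R i) = \<nu>"
    and sq: "\<And>i. integrable M (\<lambda>\<omega>. (R i \<omega>)\<^sup>2)" and zero: "\<And>i. expectation (R i) = 0"
    and var: "\<And>i. expectation (\<lambda>\<omega>. (R i \<omega>)\<^sup>2) = q"
  shows "(\<lambda>n. expectation (\<lambda>\<omega>. cos ((1 / sqrt (real n)) * (\<Sum>i<n. R i \<omega>) + \<theta>))) \<longlonglongrightarrow> exp (- q / 2) * cos \<theta>"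
proof -
  have rv [measurable]: "R i \<in> borel_measurable M" for i using indep unfolding indep_vars_def2 by simp
  have q0: "q \<ge> 0" using var[of 0] by (metis integral_nonneg_AE AE_I2 zero_le_power2)
  show ?thesis
  proof (cases "q = 0")
    case True
    have "AE \<omega> in M. (R i \<omega>)\<^sup>2 = 0" for i
      using integral_nonneg_eq_0_iff_AE[OF sq[of i]] var[of i] True by simp
    then have "AE \<omega> in M. \<forall>i. R i \<omega> = 0" by (simp add: AE_all_countable)
    then have "expectation (\<lambda>\<omega>. cos ((1 / sqrt (real n)) * (\<Sum>i<n. R i \<omega>) + \<theta>)) = expectation (\<lambda>\<omega>. cos \<theta>)" for n
      by (intro integral_cong_AE) auto
    then show ?thesis using True by (simp add: prob_space)
  next
    case False
    define \<sigma> where "\<sigma> = sqrt q"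
    have \<sigma>: "\<sigma> > 0" "\<sigma>\<^sup>2 = q" using False q0 by (auto simp: \<sigma>_def)
    have wc: "weak_conv_m (\<lambda>n. distr M borel (\<lambda>\<omega>. (\<Sum>i<n. R i \<omega>) / sqrt (real n * \<sigma>\<^sup>2))) std_normal_distribution"
      by (rule central_limit_theorem_zero_mean[OF indep zero \<sigma>(1) sq _ distr])
        (simp add: zero var \<sigma>)
    have "(\<lambda>n. \<integral>x. cos (\<sigma> * x + \<theta>) \<partial>distr M borel (\<lambda>\<omega>. (\<Sum>i<n. R i \<omega>) / sqrt (real n * \<sigma>\<^sup>2))) \<longlonglongrightarrow>
        (\<integral>x. cos (\<sigma> * x + \<theta>) \<partial>std_normal_distribution)"
      by (rule weak_conv_imp_integral_bdd_continuous_conv[OF _ real_dist_normal_dist wc, where B = 1])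
        (auto intro!: real_distribution_distr)
    moreover have "(\<integral>x. cos (\<sigma> * x + \<theta>) \<partial>std_normal_distribution) = exp (- q / 2) * cos \<theta>"
      by (rule cos_shift_of_char[OF real_dist_normal_dist]) (simp add: char_std_normal_distribution \<sigma>)
    moreover have "\<sigma> * ((\<Sum>i<n. R i \<omega>) / sqrt (real n * \<sigma>\<^sup>2)) = (1 / sqrt (real n)) * (\<Sum>i<n. R i \<omega>)" for n \<omega>
      using \<sigma>(1) by (simp add: real_sqrt_mult)
    ultimately show ?thesis by (simp add: integral_distr)
  qed
qed

section \<open>Gaussian processes as limits of linear functionals of white noise\<close>

lemma ip_cauchy_schwarz:
  assumes "sqi M f" "sqi M g"
  shows "(ip M f g)\<^sup>2 \<le> ip M f f * ip M g g"
proof (cases "ip M g g = 0")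
  case True
  then show ?thesis using ip_self_zero[OF assms] by simp
next
  case False
  then have g: "ip M g g > 0" using ip_nonneg[of M g] by simp
  define s where "s = ip M f g / ip M g g"
  have sg: "sqi M (\<lambda>x. s * g x)" by (rule sqi_scale[OF assms(2)])
  have "0 \<le> ip M (\<lambda>x. f x - s * g x) (\<lambda>x. f x - s * g x)" by (rule ip_nonneg)
  also have "\<dots> = ip M f f - 2 * (s * ip M f g) + s * (s * ip M g g)"
    unfolding ip_diff_diff[OF assms(1) sg] ip_scale ip_commute[of M f "\<lambda>x. s * g x"]
      ip_commute[of M g "\<lambda>x. s * g x"] by (simp add: ip_commute[of M g f])
  also have "\<dots> = ip M f f - (ip M f g)\<^sup>2 / ip M g g"
    using g by (simp add: s_def power2_eq_square)
  finally show ?thesis using g by (simp add: pos_divide_le_eq)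
qed

lemma ip_tendsto:
  assumes f: "sqi M f" and g: "\<And>n. sqi M (g n)" and h: "sqi M h"
    and lim: "(\<lambda>n. ip M (\<lambda>x. f x - g n x) (\<lambda>x. f x - g n x)) \<longlonglongrightarrow> 0"
  shows "(\<lambda>n. ip M (g n) h) \<longlonglongrightarrow> ip M f h"
proof -
  let ?d = "\<lambda>n. ip M (\<lambda>x. f x - g n x) (\<lambda>x. f x - g n x)"
  have "(\<lambda>n. sqrt (?d n * ip M h h)) \<longlonglongrightarrow> sqrt (0 * ip M h h)"
    by (intro tendsto_intros lim)
  then have lim0: "(\<lambda>n. sqrt (?d n * ip M h h)) \<longlonglongrightarrow> 0" by simp
  have "\<bar>ip M f h - ip M (g n) h\<bar> \<le> sqrt (?d n * ip M h h)" for n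
    using ip_cauchy_schwarz[OF sqi_diff[OF f g] h, of n] ip_diff[OF f g h, of n]
    by (intro real_le_rsqrt) simp
  then have "(\<lambda>n. ip M f h - ip M (g n) h) \<longlonglongrightarrow> 0"
    by (intro Lim_null_comparison[OF _ lim0]) simp
  from tendsto_diff[OF tendsto_const[of "ip M f h"] this] show ?thesis by simp
qed

lemma ip_self_tendsto:
  assumes f: "sqi M f" and g: "\<And>n. sqi M (g n)"
    and lim: "(\<lambda>n. ip M (\<lambda>x. f x - g n x) (\<lambda>x. f x - g n x)) \<longlonglongrightarrow> 0"
  shows "(\<lambda>n. ip M (g n) (g n)) \<longlonglongrightarrow> ip M f f"
proof -
  let ?d = "\<lambda>n. ip M (\<lambda>x. f x - g n x) (\<lambda>x. f x - g n x)"
  have "(\<lambda>n. ?d n - ip M f f + 2 * ip M (g n) f) \<longlonglongrightarrow> 0 - ip M f f + 2 * ip M f f"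
    by (intro tendsto_intros lim ip_tendsto[OF f g f lim])
  moreover have "?d n - ip M f f + 2 * ip M (g n) f = ip M (g n) (g n)" for n
    by (simp add: ip_diff_diff[OF f g] ip_commute[of M "g n" f])
  ultimately show ?thesis by simp
qed

text \<open>One fixed space carries every limit: the law of a sequence of independent standard
  normal coordinates.\<close>

definition white_noise :: "(nat \<Rightarrow> real) measure" where
  "white_noise = (\<Pi>\<^sub>M i\<in>UNIV. std_normal_distribution)"

lemma prob_space_std_normal: "prob_space std_normal_distribution"
  by (rule prob_space_normal_density) simp

lemma prob_space_white_noise: "prob_space white_noise"
  unfolding white_noise_def by (intro prob_space_PiM prob_space_std_normal)

interpretation WN: prob_space white_noise by (rule prob_space_white_noise)

lemma coordinate_measurable [measurable]: "(\<lambda>w. w k) \<in> borel_measurable white_noise"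
proof -
  have "(\<lambda>w. w k) \<in> measurable white_noise std_normal_distribution"
    unfolding white_noise_def by (rule measurable_component_singleton) simp
  then show ?thesis by (simp add: measurable_def)
qed

lemma distr_coordinate: "distr white_noise borel (\<lambda>w. w k) = std_normal_distribution"
proof -
  have "distr white_noise borel (\<lambda>w. w k) = distr white_noise std_normal_distribution (\<lambda>w. w k)"
    by (intro distr_cong) auto
  also have "\<dots> = std_normal_distribution"
    unfolding white_noise_def by (rule distr_PiM_component) (auto intro: prob_space_std_normal)
  finally show ?thesis .
qed

lemma indep_coordinates: "WN.indep_vars (\<lambda>_. borel) (\<lambda>k w. w k) UNIV"
proof -
  have "distr white_noise (\<Pi>\<^sub>M i\<in>UNIV. borel) (\<lambda>w. \<lambda>i\<in>UNIV. w i) = distr white_noise white_noise (\<lambda>w. w)"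
  proof (rule distr_cong)
    show "sets (\<Pi>\<^sub>M i\<in>UNIV. borel :: real measure) = sets white_noise"
      unfolding white_noise_def by (intro sets_PiM_cong) auto
  qed auto
  also have "\<dots> = (\<Pi>\<^sub>M i\<in>UNIV. distr white_noise borel (\<lambda>w. w i))"
    by (simp add: distr_id distr_coordinate) (simp add: white_noise_def)
  finally show ?thesis
    by (subst WN.indep_vars_iff_distr_eq_PiM) auto
qed

lemma coordinate_moments:
  "sqi white_noise (\<lambda>w. w k)" "WN.expectation (\<lambda>w. w k) = 0" "WN.expectation (\<lambda>w. (w k)\<^sup>2) = 1"
proof -
  have i: "integrable (distr white_noise borel (\<lambda>w. w k)) (\<lambda>x. x\<^sup>2)"
    unfolding distr_coordinate by (rule integrable_std_normal_distribution_moment)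
  then show "sqi white_noise (\<lambda>w. w k)"
    by (simp add: sqi_def integrable_distr_eq)
  have "WN.expectation (\<lambda>w. w k) = (\<integral>x. x \<partial>distr white_noise borel (\<lambda>w. w k))"
    by (simp add: integral_distr)
  also have "\<dots> = 0"
    unfolding distr_coordinate using integral_std_normal_distribution_moment_odd[of 1] by simp
  finally show "WN.expectation (\<lambda>w. w k) = 0" .
  have "WN.expectation (\<lambda>w. (w k)\<^sup>2) = (\<integral>x. x\<^sup>2 \<partial>distr white_noise borel (\<lambda>w. w k))"
    by (simp add: integral_distr)
  also have "\<dots> = 1"
    unfolding distr_coordinate using std_normal_distribution_even_moments(1)[of 1] by simp
  finally show "WN.expectation (\<lambda>w. (w k)\<^sup>2) = 1" .
qed

section \<open>Finite Gaussian sums and their mean-square limits\<close>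

definition lin :: "(nat \<Rightarrow> real) \<Rightarrow> nat \<Rightarrow> (nat \<Rightarrow> real) \<Rightarrow> real" where
  "lin c n w = (\<Sum>k<n. c k * w k)"

lemma indep_scaled: "WN.indep_vars (\<lambda>_. borel) (\<lambda>k w. c k * w k) UNIV"
  by (rule WN.indep_vars_compose2[OF indep_coordinates]) auto

lemma sqi_lin: "sqi white_noise (lin c n)"
  unfolding lin_def[abs_def] by (intro sqi_sum sqi_scale coordinate_moments)

lemma lin_measurable [measurable]: "lin c n \<in> borel_measurable white_noise"
  using sqi_lin by (rule sqi_measurable)

lemma ip_lin: "ip white_noise (lin c n) (lin c n) = (\<Sum>k<n. (c k)\<^sup>2)"
proof -
  have "integrable white_noise (\<lambda>w. (c k * w k)\<^sup>2)" for k
    using sqi_scale[OF coordinate_moments(1), of "c k" k] by (simp add: sqi_def)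
  from WN.second_moment_sum[OF indep_scaled this, of "{..<n}"]
  have "WN.expectation (\<lambda>w. (lin c n w)\<^sup>2) = (\<Sum>k<n. WN.expectation (\<lambda>w. (c k * w k)\<^sup>2))"
    by (simp add: coordinate_moments lin_def)
  also have "\<dots> = (\<Sum>k<n. (c k)\<^sup>2)"
    by (simp add: power_mult_distrib coordinate_moments)
  finally show ?thesis by (simp add: ip_def power2_eq_square)
qed

lemma lin_mean: "WN.expectation (lin c n) = 0"
  unfolding lin_def[abs_def] using WN.integrable_of_sqi[OF coordinate_moments(1)]
  by (simp add: coordinate_moments)

lemma ip_lin_diff:
  assumes "n \<le> m"
  shows "ip white_noise (\<lambda>w. lin c m w - lin c n w) (\<lambda>w. lin c m w - lin c n w) = (\<Sum>k<m. (c k)\<^sup>2) - (\<Sum>k<n. (c k)\<^sup>2)"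
proof -
  have split: "(\<Sum>k<m. f k) - (\<Sum>k<n. f k) = (\<Sum>k<m. (if k < n then 0 else f k))" for f :: "nat \<Rightarrow> real"
  proof -
    have "(\<Sum>k<n. f k) = (\<Sum>k<m. if k < n then f k else 0)"
      using assms by (intro sum.mono_neutral_cong_left) auto
    then show ?thesis by (simp add: sum_subtractf[symmetric] cong: if_cong) (intro sum.cong, auto)
  qed
  have "(\<lambda>w. lin c m w - lin c n w) = lin (\<lambda>k. if k < n then 0 else c k) m"
    unfolding lin_def split by (intro ext sum.cong) auto
  then show ?thesis
    by (simp add: ip_lin split) (intro sum.cong, auto)
qed

text \<open>By independence the characteristic function is a product of normal ones. It is evaluated
  at frequency 1, as scaling can be absorbed into \<open>c\<close>.\<close>

lemma cos_lin: "WN.expectation (\<lambda>w. cos (lin c n w + \<theta>)) = exp (- (\<Sum>k<n. (c k)\<^sup>2) / 2) * cos \<theta>"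
proof -
  let ?D = "distr white_noise borel (lin c n)"
  have char1: "char (distr white_noise borel (\<lambda>w. c k * w k)) 1 = complex_of_real (exp (- (c k)\<^sup>2 / 2))" for k
  proof -
    have "char (distr white_noise borel (\<lambda>w. c k * w k)) 1 = char (distr white_noise borel (\<lambda>w. w k)) (c k)"
      by (simp add: char_def integral_distr)
    then show ?thesis by (simp add: distr_coordinate char_std_normal_distribution)
  qed
  have "char ?D 1 = (\<Prod>k<n. char (distr white_noise borel (\<lambda>w. c k * w k)) 1)"
    unfolding lin_def[abs_def]
    by (rule WN.char_distr_sum) (rule WN.indep_vars_subset[OF indep_scaled], simp)
  also have "\<dots> = complex_of_real (\<Prod>k<n. exp (- (c k)\<^sup>2 / 2))"
    unfolding char1 by simp
  also have "(\<Prod>k<n. exp (- (c k)\<^sup>2 / 2)) = exp (- (\<Sum>k<n. (c k)\<^sup>2) / 2)"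
    by (simp add: exp_sum[symmetric] sum_negf sum_divide_distrib)
  finally have "(\<integral>x. cos (1 * x + \<theta>) \<partial>?D) = exp (- (\<Sum>k<n. (c k)\<^sup>2) / 2) * cos \<theta>"
    by (intro cos_shift_of_char WN.real_distribution_distr) simp_all
  then show ?thesis by (simp add: integral_distr)
qed

text \<open>\<open>W\<close> is the mean-square sum of the terms \<open>c k * w k\<close>: an
  element of the Gaussian Hilbert space with coordinates \<open>c\<close>. Since \<open>W\<close> is
  a function rather than a class, the relation can be asserted at each fixed time point of a
  process.\<close>

definition gauss_lim :: "(nat \<Rightarrow> real) \<Rightarrow> ((nat \<Rightarrow> real) \<Rightarrow> real) \<Rightarrow> bool" where
  "gauss_lim c W \<longleftrightarrow> sqi white_noise W \<and>
     (\<lambda>n. ip white_noise (\<lambda>w. W w - lin c n w) (\<lambda>w. W w - lin c n w)) \<longlonglongrightarrow> 0"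

lemma gauss_lim_zero: "gauss_lim (\<lambda>_. 0) (\<lambda>_. 0)"
  by (simp add: gauss_lim_def lin_def ip_def)

lemma gauss_lim_scale:
  assumes "gauss_lim c W"
  shows "gauss_lim (\<lambda>k. a * c k) (\<lambda>w. a * W w)"
proof -
  have "ip white_noise (\<lambda>w. a * W w - lin (\<lambda>k. a * c k) n w) (\<lambda>w. a * W w - lin (\<lambda>k. a * c k) n w) =
      a\<^sup>2 * ip white_noise (\<lambda>w. W w - lin c n w) (\<lambda>w. W w - lin c n w)" for n
  proof -
    have "(\<lambda>w. a * W w - lin (\<lambda>k. a * c k) n w) = (\<lambda>w. a * (W w - lin c n w))"
      by (simp add: lin_def sum_distrib_left algebra_simps)
    then show ?thesis
      by (simp only: ip_scale ip_commute[of white_noise _ "\<lambda>w. a * (W w - lin c n w)"])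
        (simp add: power2_eq_square)
  qed
  then show ?thesis
    using assms tendsto_mult_left[of _ 0 sequentially "a\<^sup>2"] unfolding gauss_lim_def by (simp add: sqi_scale)
qed

lemma gauss_lim_add:
  assumes c: "gauss_lim c W" and d: "gauss_lim d V"
  shows "gauss_lim (\<lambda>k. c k + d k) (\<lambda>w. W w + V w)"
  unfolding gauss_lim_def
proof
  have s: "sqi white_noise W" "sqi white_noise V" using c d by (auto simp: gauss_lim_def)
  then show "sqi white_noise (\<lambda>w. W w + V w)" by (rule sqi_add)
  let ?a = "\<lambda>n w. W w - lin c n w" and ?b = "\<lambda>n w. V w - lin d n w"
  let ?ab = "\<lambda>n w. W w + V w - lin (\<lambda>k. c k + d k) n w"
  have eq: "?ab n = (\<lambda>w. ?a n w + ?b n w)" for n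
    by (simp add: lin_def sum.distrib algebra_simps)
  have "(\<lambda>n. 2 * ip white_noise (?a n) (?a n) + 2 * ip white_noise (?b n) (?b n)) \<longlonglongrightarrow> 2 * 0 + 2 * 0"
    using c d unfolding gauss_lim_def by (intro tendsto_intros) auto
  then have lim0: "(\<lambda>n. 2 * ip white_noise (?a n) (?a n) + 2 * ip white_noise (?b n) (?b n)) \<longlonglongrightarrow> 0" by simp
  have "norm (ip white_noise (?ab n) (?ab n)) \<le> 2 * ip white_noise (?a n) (?a n) + 2 * ip white_noise (?b n) (?b n)" for n
    unfolding eq using ip_triangle[of white_noise "?a n" "?b n"] s sqi_lin
      ip_nonneg[of white_noise "\<lambda>w. ?a n w + ?b n w"]
    by (simp add: sqi_diff)
  then show "(\<lambda>n. ip white_noise (?ab n) (?ab n)) \<longlonglongrightarrow> 0"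
    by (intro Lim_null_comparison[OF _ lim0]) simp
qed

lemma gauss_lim_sum:
  assumes "\<And>s. s \<in> S \<Longrightarrow> gauss_lim (c s) (W s)"
  shows "gauss_lim (\<lambda>k. \<Sum>s\<in>S. a s * c s k) (\<lambda>w. \<Sum>s\<in>S. a s * W s w)"
  using assms
proof (induction S rule: infinite_finite_induct)
  case (insert s S)
  then show ?case using gauss_lim_add[OF gauss_lim_scale[of "c s" "W s" "a s"]] by simp
qed (simp_all add: gauss_lim_zero)

lemma gauss_lim_norm:
  assumes "gauss_lim c W"
  shows "(\<lambda>k. (c k)\<^sup>2) sums ip white_noise W W"
  using ip_self_tendsto[of white_noise W "lin c"] assms sqi_lin
  unfolding sums_def gauss_lim_def ip_lin by blast

lemma gauss_lim_cov:
  assumes c: "gauss_lim c W" and d: "gauss_lim d V"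
  shows "(\<lambda>k. c k * d k) sums ip white_noise W V"
proof -
  have s: "sqi white_noise W" "sqi white_noise V" using c d by (auto simp: gauss_lim_def)
  have m: "gauss_lim (\<lambda>k. c k + (-1) * d k) (\<lambda>w. W w + (-1) * V w)"
    by (intro gauss_lim_add gauss_lim_scale c d)
  have "(\<lambda>k. ((c k)\<^sup>2 + (d k)\<^sup>2 - (c k + (-1) * d k)\<^sup>2) / 2) sums
    ((ip white_noise W W + ip white_noise V V - ip white_noise (\<lambda>w. W w + (-1) * V w) (\<lambda>w. W w + (-1) * V w)) / 2)"
    by (intro sums_divide sums_diff sums_add gauss_lim_norm c d m)
  then show ?thesis
    by (simp add: ip_diff_diff[OF s] power2_diff)
qed

lemma gauss_lim_mean:
  assumes "gauss_lim c W"
  shows "WN.expectation W = 0"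
proof -
  have one: "sqi white_noise (\<lambda>_. 1)" by (simp add: sqi_def)
  have "(\<lambda>n. ip white_noise (lin c n) (\<lambda>_. 1)) \<longlonglongrightarrow> ip white_noise W (\<lambda>_. 1)"
    using assms unfolding gauss_lim_def by (intro ip_tendsto sqi_lin one) auto
  then have "(\<lambda>n. 0) \<longlonglongrightarrow> WN.expectation W"
    by (simp add: ip_def lin_mean)
  then show ?thesis using LIMSEQ_unique tendsto_const by blast
qed

text \<open>Passage to the limit in \<open>cos_lin\<close>: the cosine has Lipschitz constant 1, and
  the mean of the absolute difference is at most its root mean square.\<close>

lemma gauss_lim_cos:
  assumes W: "gauss_lim c W"
  shows "WN.expectation (\<lambda>w. cos (W w + \<theta>)) = exp (- ip white_noise W W / 2) * cos \<theta>"
proof (rule LIMSEQ_unique)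
  have s: "sqi white_noise W" using W by (simp add: gauss_lim_def)
  note [measurable] = sqi_measurable[OF s]
  let ?d = "\<lambda>n w. W w - lin c n w"
  have "(\<lambda>n. sqrt (ip white_noise (?d n) (?d n))) \<longlonglongrightarrow> sqrt 0"
    using W unfolding gauss_lim_def by (intro tendsto_intros) auto
  then have d0: "(\<lambda>n. sqrt (ip white_noise (?d n) (?d n))) \<longlonglongrightarrow> 0" by simp
  have "norm (WN.expectation (\<lambda>w. cos (lin c n w + \<theta>)) - WN.expectation (\<lambda>w. cos (W w + \<theta>))) \<le> sqrt (ip white_noise (?d n) (?d n))" for n
  proof -
    have sd: "sqi white_noise (?d n)" by (intro sqi_diff s sqi_lin)
    then have sa: "sqi white_noise (\<lambda>w. \<bar>?d n w\<bar>)" unfolding sqi_def by auto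
    have int: "integrable white_noise (\<lambda>w. cos (f w + \<theta>))" if [measurable]: "f \<in> borel_measurable white_noise" for f
      by (rule WN.integrable_const_bound[where B = 1]) auto
    have "WN.expectation (\<lambda>w. cos (lin c n w + \<theta>)) - WN.expectation (\<lambda>w. cos (W w + \<theta>)) =
        WN.expectation (\<lambda>w. cos (lin c n w + \<theta>) - cos (W w + \<theta>))"
      by (intro Bochner_Integration.integral_diff[symmetric] int) measurable
    also have "\<bar>\<dots>\<bar> \<le> WN.expectation (\<lambda>w. \<bar>?d n w\<bar>)"
    proof (rule abs_integral_le)
      show "integrable white_noise (\<lambda>w. cos (lin c n w + \<theta>) - cos (W w + \<theta>))"
        by (intro Bochner_Integration.integrable_diff int) measurable
      show "integrable white_noise (\<lambda>w. \<bar>?d n w\<bar>)" by (rule WN.integrable_of_sqi[OF sa])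
      fix w
      have "\<bar>cos a - cos b\<bar> \<le> \<bar>b - a\<bar>" for a b :: real
      proof -
        have "\<bar>cos a - cos b\<bar> = 2 * \<bar>sin ((a + b) / 2)\<bar> * \<bar>sin ((b - a) / 2)\<bar>"
          by (simp add: cos_diff_cos abs_mult)
        also have "\<dots> \<le> 2 * 1 * \<bar>(b - a) / 2\<bar>"
          by (rule mult_mono) (simp_all only: abs_sin_x_le_abs_x, simp_all)
        finally show ?thesis by simp
      qed
      from this[of "lin c n w + \<theta>" "W w + \<theta>"]
      show "\<bar>cos (lin c n w + \<theta>) - cos (W w + \<theta>)\<bar> \<le> \<bar>?d n w\<bar>" by simp
    qed
    also have "\<dots> \<le> sqrt (ip white_noise (?d n) (?d n))"
    proof (rule real_le_rsqrt)
      have "(ip white_noise (\<lambda>w. \<bar>?d n w\<bar>) (\<lambda>_. 1))\<^sup>2 \<le>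
          ip white_noise (\<lambda>w. \<bar>?d n w\<bar>) (\<lambda>w. \<bar>?d n w\<bar>) * ip white_noise (\<lambda>_. 1) (\<lambda>_. 1)"
        by (rule ip_cauchy_schwarz[OF sa]) (simp add: sqi_def)
      then show "(WN.expectation (\<lambda>w. \<bar>?d n w\<bar>))\<^sup>2 \<le> ip white_noise (?d n) (?d n)"
        by (simp add: ip_def WN.prob_space)
    qed
    finally show ?thesis by simp
  qed
  then have "(\<lambda>n. WN.expectation (\<lambda>w. cos (lin c n w + \<theta>)) - WN.expectation (\<lambda>w. cos (W w + \<theta>))) \<longlonglongrightarrow> 0"
    by (intro Lim_null_comparison[OF _ d0]) simp
  then show "(\<lambda>n. WN.expectation (\<lambda>w. cos (lin c n w + \<theta>))) \<longlonglongrightarrow> WN.expectation (\<lambda>w. cos (W w + \<theta>))"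
    by (rule LIM_zero_cancel)
  show "(\<lambda>n. WN.expectation (\<lambda>w. cos (lin c n w + \<theta>))) \<longlonglongrightarrow> exp (- ip white_noise W W / 2) * cos \<theta>"
    unfolding cos_lin using gauss_lim_norm[OF W] unfolding sums_def
    by (intro tendsto_intros) auto
qed

lemma char_normal_density:
  assumes "s > 0"
  shows "char (density lborel (normal_density 0 s)) t = complex_of_real (exp (- (s * t)\<^sup>2 / 2))"
proof -
  let ?N = "density lborel (normal_density 0 s)"
  interpret P: prob_space ?N by (rule prob_space_normal_density[OF assms])
  have "distributed ?N lborel (\<lambda>x. x) (normal_density 0 s)"
    by (auto simp: distributed_def distr_id2)
  then have "distributed ?N lborel (\<lambda>x. (x - 0) / s) std_normal_density"
    using P.normal_standard_normal_convert[OF assms, of "\<lambda>x. x" 0] by simp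
  then have d: "distr ?N lborel (\<lambda>x. x / s) = std_normal_distribution"
    by (simp add: distributed_def)
  have "char std_normal_distribution (s * t) = char ?N t"
    unfolding d[symmetric] char_def using assms by (subst integral_distr) auto
  then show ?thesis by (simp add: char_std_normal_distribution)
qed

text \<open>The characteristic function identifies the law; variance 0 leads to the point mass that
  \<open>normal_rv\<close> admits.\<close>

lemma gauss_lim_normal:
  assumes W: "gauss_lim c W"
  shows "normal_rv white_noise W"
proof -
  have s: "sqi white_noise W" using W by (simp add: gauss_lim_def)
  note [measurable] = sqi_measurable[OF s]
  define v where "v = sqrt (ip white_noise W W)"
  have v2: "v\<^sup>2 = ip white_noise W W" and v0: "v \<ge> 0" using ip_nonneg[of white_noise W] by (auto simp: v_def)
  define D where "D = (if v = 0 then return borel 0 else density lborel (normal_density 0 v))"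
  have D: "real_distribution D"
  proof (cases "v = 0")
    case True
    then show ?thesis unfolding D_def real_distribution_def real_distribution_axioms_def
      by (auto intro: prob_space_return)
  next
    case False
    then show ?thesis unfolding D_def real_distribution_def real_distribution_axioms_def
      using v0 by (auto intro: prob_space_normal_density)
  qed
  have Wd: "real_distribution (distr white_noise borel W)"
    by (rule WN.real_distribution_distr) simp
  have "char (distr white_noise borel W) t = complex_of_real (exp (- (v * t)\<^sup>2 / 2))" for t
  proof (rule complex_eqI)
    have cosW: "WN.expectation (\<lambda>w. cos (t * W w + \<theta>)) = exp (- (v * t)\<^sup>2 / 2) * cos \<theta>" for \<theta>
    proof -
      have "ip white_noise (\<lambda>w. t * W w) (\<lambda>w. t * W w) = (v * t)\<^sup>2"
        unfolding ip_scale by (subst ip_commute) (simp add: ip_scale v2[symmetric] power2_eq_square)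
      then show ?thesis using gauss_lim_cos[OF gauss_lim_scale[OF W], of t \<theta>] by simp
    qed
    show "Re (char (distr white_noise borel W) t) = Re (complex_of_real (exp (- (v * t)\<^sup>2 / 2)))"
      using cosW[of 0] by (simp add: real_distribution.char_Re_Im[OF Wd] integral_distr)
    have "sin x = cos (x - pi / 2)" for x :: real by (simp add: cos_diff)
    then show "Im (char (distr white_noise borel W) t) = Im (complex_of_real (exp (- (v * t)\<^sup>2 / 2)))"
      using cosW[of "- (pi / 2)"] by (simp add: real_distribution.char_Re_Im[OF Wd] integral_distr)
  qed
  moreover have "char D t = complex_of_real (exp (- (v * t)\<^sup>2 / 2))" for t
    using v0 unfolding D_def
    by (cases "v = 0") (auto simp: char_normal_density, simp add: char_def integral_return)
  ultimately have "distr white_noise borel W = D"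
    by (intro Levy_uniqueness Wd D) auto
  then show ?thesis
    unfolding normal_rv_def D_def using v0 by (intro conjI exI[of _ 0] exI[of _ v]) auto
qed

section \<open>A jointly measurable Gaussian process with square-integrable paths\<close>

lemma ip_ennreal:
  assumes "sqi M f"
  shows "(\<integral>\<^sup>+x. ennreal ((f x)\<^sup>2) \<partial>M) = ennreal (ip M f f)"
  using assms unfolding ip_def sqi_def power2_eq_square by (subst nn_integral_eq_integral) auto

lemma sqi_of_nn_integral:
  assumes "f \<in> borel_measurable M" "(\<integral>\<^sup>+x. ennreal ((f x)\<^sup>2) \<partial>M) \<le> ennreal b" "b \<ge> 0"
  shows "sqi M f" "ip M f f \<le> b"
proof -
  have "(\<integral>\<^sup>+x. ennreal ((f x)\<^sup>2) \<partial>M) < \<infinity>"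
    using assms(2) by (rule order_le_less_trans) simp
  then show s: "sqi M f"
    unfolding sqi_def using assms(1) by (intro conjI integrableI_bounded) auto
  show "ip M f f \<le> b"
    using assms(2,3) unfolding ip_ennreal[OF s] by simp
qed

lemma L2_process_section: "L2_process M X \<Longrightarrow> t \<in> {0..1} \<Longrightarrow> (\<lambda>\<omega>. X \<omega> t) \<in> borel_measurable M"
  unfolding L2_process_def
  using measurable_compose[OF measurable_Pair2'[of t I01 M], of "case_prod X" borel] by simp

interpretation I01: prob_space I01 by (rule prob_space_I01)

lemma pair_sigma_finite_I01:
  assumes "prob_space M"
  shows "pair_sigma_finite M I01"
proof -
  interpret prob_space M by fact
  show ?thesis by standard
qed

text \<open>
  The partial sums are evaluated along an index sequence \<open>nj\<close> that depends measurably on \<open>t\<close>, chosen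
  so that the tails of the variances decay geometrically; this gives almost sure convergence.
\<close>

theorem gaussian_process_of_series:
  fixes \<phi> :: "nat \<Rightarrow> real \<Rightarrow> real"
  assumes \<phi>_meas [measurable]: "\<And>k. \<phi> k \<in> borel_measurable I01"
    and q: "\<And>t. t \<in> {0..1} \<Longrightarrow> (\<lambda>k. (\<phi> k t)\<^sup>2) sums q t" and intq: "integrable I01 q"
  obtains G where "L2_process white_noise G"
    "\<And>t. t \<in> {0..1} \<Longrightarrow> gauss_lim (\<lambda>k. \<phi> k t) (\<lambda>w. G w t)"
    "\<And>f. sq_int f \<Longrightarrow> gauss_lim (\<lambda>k. \<integral>t. \<phi> k t * f t \<partial>I01) (\<lambda>w. inner (to_L2 (G w)) (to_L2 f))"
proof -
  interpret P: pair_sigma_finite white_noise I01 by (rule pair_sigma_finite_I01[OF prob_space_white_noise])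
  have [measurable]: "q \<in> borel_measurable I01" using intq by auto
  define tail where "tail n t = q t - (\<Sum>k<n. (\<phi> k t)\<^sup>2)" for n t
  have [measurable]: "tail n \<in> borel_measurable I01" for n unfolding tail_def[abs_def] by measurable
  have tail0: "tail n t \<ge> 0" if "t \<in> {0..1}" for n t
    using sum_le_suminf[OF sums_summable[OF q[OF that]], of "{..<n}"] sums_unique[OF q[OF that]]
    unfolding tail_def by simp
  have tail_q: "tail n t \<le> q t" for n t unfolding tail_def by (simp add: sum_nonneg)
  have tail_lim: "(\<lambda>n. tail n t) \<longlonglongrightarrow> 0" if "t \<in> {0..1}" for t
  proof -
    have "(\<lambda>n. q t - (\<Sum>k<n. (\<phi> k t)\<^sup>2)) \<longlonglongrightarrow> q t - q t"
      using q[OF that] unfolding sums_def by (intro tendsto_intros)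
    then show ?thesis by (simp add: tail_def[abs_def])
  qed
  \<comment> \<open>The rate 1/4 for the variances becomes \<open>(1/2)^j\<close> for the mean
    absolute increments, which is summable.\<close>
  define nj where "nj j t = (LEAST n. tail n t \<le> (1/4)^j)" for j t
  have [measurable]: "nj j \<in> measurable I01 (count_space UNIV)" for j
    unfolding nj_def[abs_def] by measurable
  have nj: "tail (nj j t) t \<le> (1/4)^j" if t: "t \<in> {0..1}" for j t
  proof -
    have "eventually (\<lambda>n. tail n t < (1/4)^j) sequentially"
      using tail_lim[OF t] by (rule order_tendstoD(2)) simp
    then obtain n where "tail n t \<le> (1/4)^j"
      using eventually_happens'[OF sequentially_bot] less_imp_le by blast
    then show ?thesis unfolding nj_def by (rule LeastI)
  qed
  have nj_mono: "nj j t \<le> nj (Suc j) t" if t: "t \<in> {0..1}" for j t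
    unfolding nj_def[of j]
  proof (rule Least_le)
    have "(1/4)^(Suc j) \<le> (1/4 :: real)^j" by (rule power_decreasing) auto
    then show "tail (nj (Suc j) t) t \<le> (1/4)^j" using nj[OF t, of "Suc j"] by linarith
  qed
  define S where "S n w t = lin (\<lambda>k. \<phi> k t) n w" for n w t
  have S_meas [measurable]: "(\<lambda>p. S n (fst p) (snd p)) \<in> borel_measurable (white_noise \<Otimes>\<^sub>M I01)" for n
    unfolding S_def lin_def by measurable
  \<comment> \<open>\<open>nj j\<close> takes countably many values, each on a measurable set of t,
    so joint measurability survives the substitution of the index.\<close>
  have Sj_meas [measurable]: "(\<lambda>p. S (nj j (snd p)) (fst p) (snd p)) \<in> borel_measurable (white_noise \<Otimes>\<^sub>M I01)" for j
    by (rule measurable_compose_countable[OF S_meas]) measurable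
  \<comment> \<open>Where the sequence diverges, \<open>lim\<close> has an unspecified value;
    \<open>G0\<close> is jointly measurable nevertheless.\<close>
  define G0 where "G0 w t = lim (\<lambda>j. S (nj j t) w t)" for w t
  have G0_meas [measurable]: "(\<lambda>p. G0 (fst p) (snd p)) \<in> borel_measurable (white_noise \<Otimes>\<^sub>M I01)"
    unfolding G0_def by measurable
  have G0_sec: "(\<lambda>w. G0 w t) \<in> borel_measurable white_noise" if "t \<in> {0..1}" for t
    using measurable_compose[OF measurable_Pair2'[of t I01 white_noise] G0_meas] that by simp
  have S_diff: "ip white_noise (\<lambda>w. S m w t - S n w t) (\<lambda>w. S m w t - S n w t) \<le> tail m t + tail n t"
    if t: "t \<in> {0..1}" for m n t
  proof -
    have *: "ip white_noise (\<lambda>w. S m w t - S n w t) (\<lambda>w. S m w t - S n w t) \<le> tail n t" if "n \<le> m" for n m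
      unfolding S_def ip_lin_diff[OF that] using tail0[OF t, of m] by (simp add: tail_def)
    show ?thesis
    proof (cases "n \<le> m")
      case True then show ?thesis using *[OF True] tail0[OF t, of m] by simp
    next
      case False
      have "ip white_noise (\<lambda>w. S m w t - S n w t) (\<lambda>w. S m w t - S n w t) =
          ip white_noise (\<lambda>w. S n w t - S m w t) (\<lambda>w. S n w t - S m w t)"
        by (simp add: ip_def algebra_simps)
      then show ?thesis using *[of m n] False tail0[OF t, of n] by simp
    qed
  qed
  have S_sqi: "sqi white_noise (\<lambda>w. S n w t)" for n t
    unfolding S_def using sqi_lin by simp
  have S_sec [measurable]: "(\<lambda>w. S n w t) \<in> borel_measurable white_noise" for n t
    by (rule sqi_measurable[OF S_sqi])
  have conv: "AE w in white_noise. (\<lambda>j. S (nj j t) w t) \<longlonglongrightarrow> G0 w t" if t: "t \<in> {0..1}" for t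
  proof -
    define D where "D j w = S (nj (Suc j) t) w t - S (nj j t) w t" for j w
    have sD: "sqi white_noise (D j)" for j unfolding D_def[abs_def] by (intro sqi_diff S_sqi)
    have sD': "sqi white_noise (\<lambda>w. \<bar>D j w\<bar>)" for j using sD[of j] unfolding sqi_def by auto
    note [measurable] = sqi_measurable[OF sD]
    have E: "WN.expectation (\<lambda>w. \<bar>D j w\<bar>) \<le> (1/2)^j" for j
    proof (rule power2_le_imp_le)
      have "(ip white_noise (\<lambda>w. \<bar>D j w\<bar>) (\<lambda>_. 1))\<^sup>2 \<le> ip white_noise (\<lambda>w. \<bar>D j w\<bar>) (\<lambda>w. \<bar>D j w\<bar>) * ip white_noise (\<lambda>_. 1) (\<lambda>_. 1)"
        by (rule ip_cauchy_schwarz[OF sD']) (simp add: sqi_def)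
      then have "(WN.expectation (\<lambda>w. \<bar>D j w\<bar>))\<^sup>2 \<le> ip white_noise (D j) (D j)"
        by (simp add: ip_def WN.prob_space)
      also have "\<dots> \<le> tail (nj j t) t"
        unfolding D_def S_def ip_lin_diff[OF nj_mono[OF t]] using tail0[OF t, of "nj (Suc j) t"]
        by (simp add: tail_def)
      also have "\<dots> \<le> (1/4)^j" by (rule nj[OF t])
      also have "(1/4 :: real)^j = ((1/2)^j)\<^sup>2"
        by (simp add: power2_eq_square power_mult_distrib[symmetric])
      finally show "(WN.expectation (\<lambda>w. \<bar>D j w\<bar>))\<^sup>2 \<le> ((1/2)^j)\<^sup>2" .
    qed simp
    have "(\<integral>\<^sup>+w. (\<Sum>j. ennreal \<bar>D j w\<bar>) \<partial>white_noise) = (\<Sum>j. \<integral>\<^sup>+w. ennreal \<bar>D j w\<bar> \<partial>white_noise)"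
      by (rule nn_integral_suminf) measurable
    also have "\<dots> \<le> (\<Sum>j. ennreal ((1/2)^j))"
    proof (rule suminf_le)
      fix j
      have "(\<integral>\<^sup>+w. ennreal \<bar>D j w\<bar> \<partial>white_noise) = ennreal (WN.expectation (\<lambda>w. \<bar>D j w\<bar>))"
        by (rule nn_integral_eq_integral[OF WN.integrable_of_sqi[OF sD']]) simp
      then show "(\<integral>\<^sup>+w. ennreal \<bar>D j w\<bar> \<partial>white_noise) \<le> ennreal ((1/2)^j)"
        using E[of j] by (simp add: ennreal_leI)
    qed auto
    also have "\<dots> = ennreal (\<Sum>j. (1/2)^j)"
      by (rule suminf_ennreal2) (auto intro: summable_geometric)
    also have "\<dots> < \<infinity>" by simp
    finally have "AE w in white_noise. (\<Sum>j. ennreal \<bar>D j w\<bar>) \<noteq> \<infinity>"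
      by (intro nn_integral_PInf_AE) auto
    then show ?thesis
    proof eventually_elim
      case (elim w)
      then have "summable (\<lambda>j. \<bar>D j w\<bar>)"
        by (intro summable_suminf_not_top) auto
      then have "summable (\<lambda>j. D j w)" by (rule summable_rabs_cancel)
      then have "convergent (\<lambda>n. \<Sum>j<n. D j w)" by (simp add: summable_iff_convergent)
      then have "convergent (\<lambda>n. S (nj 0 t) w t + (\<Sum>j<n. D j w))"
        by (intro convergent_add convergent_const)
      moreover have "S (nj 0 t) w t + (\<Sum>j<n. D j w) = S (nj n t) w t" for n
        unfolding D_def by (subst sum_lessThan_telescope) simp
      ultimately have "convergent (\<lambda>n. S (nj n t) w t)" by simp
      then show ?case unfolding G0_def by (simp add: convergent_LIMSEQ_iff)
    qed
  qed
  \<comment> \<open>Fatou's lemma along the indices \<open>nj\<close> bounds the distance to every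
    partial sum \<open>S K\<close>, so at each fixed t the full series converges to
    \<open>G0\<close> in mean square.\<close>
  have fatou: "(\<integral>\<^sup>+w. ennreal ((G0 w t - S K w t)\<^sup>2) \<partial>white_noise) \<le> ennreal (tail K t)" if t: "t \<in> {0..1}" for K t
  proof -
    have "(\<integral>\<^sup>+w. ennreal ((G0 w t - S K w t)\<^sup>2) \<partial>white_noise) =
      (\<integral>\<^sup>+w. liminf (\<lambda>j. ennreal ((S (nj j t) w t - S K w t)\<^sup>2)) \<partial>white_noise)"
    proof (rule nn_integral_cong_AE)
      show "AE w in white_noise. ennreal ((G0 w t - S K w t)\<^sup>2) = liminf (\<lambda>j. ennreal ((S (nj j t) w t - S K w t)\<^sup>2))"
        using conv[OF t]
      proof eventually_elim
        case (elim w)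
        then have "(\<lambda>j. ennreal ((S (nj j t) w t - S K w t)\<^sup>2)) \<longlonglongrightarrow> ennreal ((G0 w t - S K w t)\<^sup>2)"
          by (intro tendsto_intros)
        then show ?case using lim_imp_Liminf[OF sequentially_bot] by metis
      qed
    qed
    also have "\<dots> \<le> liminf (\<lambda>j. \<integral>\<^sup>+w. ennreal ((S (nj j t) w t - S K w t)\<^sup>2) \<partial>white_noise)"
      by (rule nn_integral_liminf) measurable
    also have "\<dots> \<le> liminf (\<lambda>j. ennreal ((1/4)^j + tail K t))"
    proof (rule Liminf_mono, rule always_eventually, rule allI)
      fix j
      have "(\<integral>\<^sup>+w. ennreal ((S (nj j t) w t - S K w t)\<^sup>2) \<partial>white_noise) =
          ennreal (ip white_noise (\<lambda>w. S (nj j t) w t - S K w t) (\<lambda>w. S (nj j t) w t - S K w t))"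
        by (intro ip_ennreal sqi_diff S_sqi)
      also have "\<dots> \<le> ennreal ((1/4)^j + tail K t)"
        using S_diff[OF t, of "nj j t" K] nj[OF t, of j] by (intro ennreal_leI) linarith
      finally show "(\<integral>\<^sup>+w. ennreal ((S (nj j t) w t - S K w t)\<^sup>2) \<partial>white_noise) \<le> ennreal ((1/4)^j + tail K t)" .
    qed
    also have "\<dots> = ennreal (0 + tail K t)"
      by (intro lim_imp_Liminf tendsto_ennrealI tendsto_add tendsto_const LIMSEQ_realpow_zero) auto
    finally show ?thesis by simp
  qed
  have G0_sqi: "sqi white_noise (\<lambda>w. G0 w t - S K w t)"
      "ip white_noise (\<lambda>w. G0 w t - S K w t) (\<lambda>w. G0 w t - S K w t) \<le> tail K t" if t: "t \<in> {0..1}" for K t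
    using sqi_of_nn_integral[OF _ fatou[OF t] tail0[OF t]] G0_sec[OF t] by auto
  have G0_lim: "gauss_lim (\<lambda>k. \<phi> k t) (\<lambda>w. G0 w t)" if t: "t \<in> {0..1}" for t
    unfolding gauss_lim_def
  proof
    show "sqi white_noise (\<lambda>w. G0 w t)" using G0_sqi(1)[OF t, of 0] by (simp add: S_def lin_def)
    show "(\<lambda>n. ip white_noise (\<lambda>w. G0 w t - lin (\<lambda>k. \<phi> k t) n w) (\<lambda>w. G0 w t - lin (\<lambda>k. \<phi> k t) n w)) \<longlonglongrightarrow> 0"
      by (rule Lim_null_comparison[OF _ tail_lim[OF t]])
        (use G0_sqi(2)[OF t, unfolded S_def] in \<open>simp add: abs_of_nonneg[OF ip_nonneg]\<close>)
  qed
  \<comment> \<open>\<open>L2_process\<close> asks that every path be square-integrable, not merely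
    almost every one; the exceptional paths are replaced by zero.\<close>
  define good where "good w \<longleftrightarrow> (\<integral>\<^sup>+t. ennreal ((G0 w t)\<^sup>2) \<partial>I01) < \<infinity>" for w
  have [measurable]: "Measurable.pred white_noise good"
    unfolding good_def by measurable
  have Fub: "(\<integral>\<^sup>+w. (\<integral>\<^sup>+t. ennreal ((G0 w t - S K w t)\<^sup>2) \<partial>I01) \<partial>white_noise) \<le> (\<integral>\<^sup>+t. ennreal (tail K t) \<partial>I01)" for K
  proof -
    have "(\<integral>\<^sup>+w. (\<integral>\<^sup>+t. ennreal ((G0 w t - S K w t)\<^sup>2) \<partial>I01) \<partial>white_noise) =
       (\<integral>\<^sup>+t. (\<integral>\<^sup>+w. ennreal ((G0 w t - S K w t)\<^sup>2) \<partial>white_noise) \<partial>I01)"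
      by (rule P.Fubini'[symmetric]) measurable
    also have "\<dots> \<le> (\<integral>\<^sup>+t. ennreal (tail K t) \<partial>I01)"
      by (rule nn_integral_mono) (use fatou in simp)
    finally show ?thesis .
  qed
  have fin_q: "(\<integral>\<^sup>+t. ennreal (tail K t) \<partial>I01) < \<infinity>" for K
  proof -
    have "(\<integral>\<^sup>+t. ennreal (tail K t) \<partial>I01) \<le> (\<integral>\<^sup>+t. ennreal (norm (q t)) \<partial>I01)"
      by (intro nn_integral_mono ennreal_leI) (use tail_q in \<open>simp add: abs_le_iff order_trans[OF _ abs_ge_self]\<close>)
    also have "\<dots> < \<infinity>" using intq by (simp add: integrable_iff_bounded)
    finally show ?thesis .
  qed
  have AE_good: "AE w in white_noise. good w"
  proof -
    have m: "(\<lambda>w. \<integral>\<^sup>+t. ennreal ((G0 w t)\<^sup>2) \<partial>I01) \<in> borel_measurable white_noise"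
      by measurable
    have "(\<integral>\<^sup>+w. (\<integral>\<^sup>+t. ennreal ((G0 w t)\<^sup>2) \<partial>I01) \<partial>white_noise) < \<infinity>"
      using order_le_less_trans[OF Fub[of 0] fin_q] by (simp add: S_def lin_def)
    then have "AE w in white_noise. (\<integral>\<^sup>+t. ennreal ((G0 w t)\<^sup>2) \<partial>I01) \<noteq> \<infinity>"
      by (intro nn_integral_PInf_AE[OF m]) simp
    then show ?thesis by eventually_elim (simp add: good_def less_top)
  qed
  define G where "G w t = (if good w then G0 w t else 0)" for w t
  have G_meas: "case_prod G \<in> borel_measurable (white_noise \<Otimes>\<^sub>M I01)"
  proof -
    have "(\<lambda>p. if good (fst p) then G0 (fst p) (snd p) else 0) \<in> borel_measurable (white_noise \<Otimes>\<^sub>M I01)"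
      by measurable
    then show ?thesis by (simp add: G_def split_beta')
  qed
  have G_sq: "sq_int (G w)" if w: "w \<in> space white_noise" for w
  proof (cases "good w")
    case True
    have "G0 w \<in> borel_measurable I01"
      using measurable_compose[OF measurable_Pair1'[OF w] G0_meas] by simp
    then have "sq_int (G0 w)"
      unfolding sq_int_def using True by (auto simp: good_def intro!: integrableI_bounded)
    then show ?thesis using True by (simp add: G_def[abs_def])
  next
    case False then show ?thesis by (simp add: G_def[abs_def] sq_int_zero)
  qed
  have G_proc: "L2_process white_noise G" unfolding L2_process_def using G_meas G_sq by auto
  have gl_cong: "gauss_lim c W'" if "gauss_lim c W" "AE w in white_noise. W w = W' w" "W' \<in> borel_measurable white_noise" for c W W'
  proof -
    have [measurable]: "W \<in> borel_measurable white_noise" "W' \<in> borel_measurable white_noise"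
      using that unfolding gauss_lim_def by (auto dest: sqi_measurable)
    have "integrable white_noise (\<lambda>w. (W' w)\<^sup>2) = integrable white_noise (\<lambda>w. (W w)\<^sup>2)"
      using that(2) by (intro integrable_cong_AE) auto
    then have "sqi white_noise W'" using that unfolding gauss_lim_def sqi_def by auto
    moreover have "ip white_noise (\<lambda>w. W' w - lin c n w) (\<lambda>w. W' w - lin c n w) =
        ip white_noise (\<lambda>w. W w - lin c n w) (\<lambda>w. W w - lin c n w)" for n
      unfolding ip_def using that(2) by (intro integral_cong_AE) auto
    ultimately show ?thesis using that(1) unfolding gauss_lim_def by simp
  qed
  have G_lim: "gauss_lim (\<lambda>k. \<phi> k t) (\<lambda>w. G w t)" if t: "t \<in> {0..1}" for t
  proof (rule gl_cong[OF G0_lim[OF t]])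
    show "AE w in white_noise. G0 w t = G w t" using AE_good by eventually_elim (simp add: G_def)
    show "(\<lambda>w. G w t) \<in> borel_measurable white_noise" unfolding G_def using G0_sec[OF t] by measurable
  qed
  have \<phi>_sq: "sq_int (\<phi> k)" for k
    unfolding sq_int_def
  proof
    show "integrable I01 (\<lambda>t. (\<phi> k t)\<^sup>2)"
    proof (rule Bochner_Integration.integrable_bound[OF intq])
      show "AE t in I01. norm ((\<phi> k t)\<^sup>2) \<le> norm (q t)"
      proof (intro AE_I2)
        fix t assume "t \<in> space I01"
        then have t: "t \<in> {0..1}" by simp
        have "(\<phi> k t)\<^sup>2 \<le> (\<Sum>i<Suc k. (\<phi> i t)\<^sup>2)" by (simp add: sum_nonneg)
        then show "norm ((\<phi> k t)\<^sup>2) \<le> norm (q t)" using tail0[OF t, of "Suc k"] by (simp add: tail_def)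
      qed
    qed measurable
  qed measurable
  \<comment> \<open>Integration over t commutes with the mean-square limit: by the Cauchy-Schwarz
    inequality and Fubini's theorem the squared error is at most \<open>ip I01 f f\<close> times the
    integral of \<open>tail K\<close>, which tends to 0.\<close>
  have G_pair: "gauss_lim (\<lambda>k. \<integral>t. \<phi> k t * f t \<partial>I01) (\<lambda>w. inner (to_L2 (G w)) (to_L2 f))" if f: "sq_int f" for f
  proof -
    let ?c = "\<lambda>k. \<integral>t. \<phi> k t * f t \<partial>I01"
    have SK: "sqi I01 (S K w)" for K w
    proof -
      have "sqi I01 (\<lambda>t. \<Sum>k<K. w k * \<phi> k t)"
        by (intro sqi_sum sqi_scale \<phi>_sq[unfolded sq_int_iff_sqi])
      then show ?thesis by (simp add: S_def[abs_def] lin_def mult.commute)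
    qed
    have lin_eq: "lin ?c K w = (\<integral>t. S K w t * f t \<partial>I01)" for K w
    proof -
      have "integrable I01 (\<lambda>t. w k * (\<phi> k t * f t))" for k
        by (intro integrable_mult_right sq_int_mult \<phi>_sq f)
      then have "(\<integral>t. (\<Sum>k<K. w k * (\<phi> k t * f t)) \<partial>I01) = (\<Sum>k<K. \<integral>t. w k * (\<phi> k t * f t) \<partial>I01)"
        by (rule Bochner_Integration.integral_sum)
      moreover have "S K w t * f t = (\<Sum>k<K. w k * (\<phi> k t * f t))" for t
        unfolding S_def lin_def sum_distrib_right by (simp add: mult_ac)
      ultimately show ?thesis
        by (simp add: lin_def mult.commute[of _ "w _"])
    qed
    have Wm [measurable]: "(\<lambda>w. inner (to_L2 (G w)) (to_L2 f)) \<in> borel_measurable white_noise"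
      using L2_process_measurable[OF G_proc] by measurable
    have F0: "0 \<le> ip I01 f f" by (rule ip_nonneg)
    have bd: "(\<integral>\<^sup>+w. ennreal ((inner (to_L2 (G w)) (to_L2 f) - lin ?c K w)\<^sup>2) \<partial>white_noise) \<le>
        ennreal (ip I01 f f * (\<integral>t. tail K t \<partial>I01))" for K
    proof -
      have "AE w in white_noise. ennreal ((inner (to_L2 (G w)) (to_L2 f) - lin ?c K w)\<^sup>2) \<le>
          ennreal (ip I01 f f) * (\<integral>\<^sup>+t. ennreal ((G0 w t - S K w t)\<^sup>2) \<partial>I01)"
        using AE_good AE_space
      proof eventually_elim
        case (elim w)
        have Gw: "sqi I01 (G w)" using G_sq[OF elim(2)] by (simp add: sq_int_iff_sqi)
        have fs: "sqi I01 f" using f by (simp add: sq_int_iff_sqi)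
        have d: "sqi I01 (\<lambda>t. G w t - S K w t)" by (intro sqi_diff Gw SK)
        have "inner (to_L2 (G w)) (to_L2 f) - lin ?c K w = ip I01 (\<lambda>t. G w t - S K w t) f"
          using inner_to_L2[OF G_sq[OF elim(2)] f] ip_diff[OF Gw SK fs] unfolding lin_eq by (simp add: ip_def)
        then have "(inner (to_L2 (G w)) (to_L2 f) - lin ?c K w)\<^sup>2 \<le>
            ip I01 (\<lambda>t. G w t - S K w t) (\<lambda>t. G w t - S K w t) * ip I01 f f"
          using ip_cauchy_schwarz[OF d fs] by simp
        then have "ennreal ((inner (to_L2 (G w)) (to_L2 f) - lin ?c K w)\<^sup>2) \<le>
            ennreal (ip I01 f f * ip I01 (\<lambda>t. G w t - S K w t) (\<lambda>t. G w t - S K w t))"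
          by (intro ennreal_leI) (simp add: mult.commute)
        also have "\<dots> = ennreal (ip I01 f f) * (\<integral>\<^sup>+t. ennreal ((G w t - S K w t)\<^sup>2) \<partial>I01)"
          by (subst ip_ennreal[OF d]) (rule ennreal_mult[OF F0 ip_nonneg])
        finally show ?case using elim(1) by (simp add: G_def)
      qed
      then have "(\<integral>\<^sup>+w. ennreal ((inner (to_L2 (G w)) (to_L2 f) - lin ?c K w)\<^sup>2) \<partial>white_noise) \<le>
          (\<integral>\<^sup>+w. ennreal (ip I01 f f) * (\<integral>\<^sup>+t. ennreal ((G0 w t - S K w t)\<^sup>2) \<partial>I01) \<partial>white_noise)"
        by (rule nn_integral_mono_AE)
      also have "\<dots> = ennreal (ip I01 f f) * (\<integral>\<^sup>+w. (\<integral>\<^sup>+t. ennreal ((G0 w t - S K w t)\<^sup>2) \<partial>I01) \<partial>white_noise)"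
        by (rule nn_integral_cmult) measurable
      also have "\<dots> \<le> ennreal (ip I01 f f) * (\<integral>\<^sup>+t. ennreal (tail K t) \<partial>I01)"
        by (intro mult_left_mono Fub) simp
      also have "(\<integral>\<^sup>+t. ennreal (tail K t) \<partial>I01) = ennreal (\<integral>t. tail K t \<partial>I01)"
      proof (rule nn_integral_eq_integral)
        show "integrable I01 (tail K)"
          unfolding tail_def[abs_def] using intq \<phi>_sq by (auto simp: sq_int_def)
        show "AE t in I01. 0 \<le> tail K t" using tail0 by (intro AE_I2) simp
      qed
      also have "ennreal (ip I01 f f) * ennreal (\<integral>t. tail K t \<partial>I01) = ennreal (ip I01 f f * (\<integral>t. tail K t \<partial>I01))"
        using F0 tail0 by (intro ennreal_mult[symmetric]) (auto intro!: integral_nonneg_AE)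
      finally show ?thesis .
    qed
    have b0: "0 \<le> ip I01 f f * (\<integral>t. tail K t \<partial>I01)" for K
      using F0 tail0 by (intro mult_nonneg_nonneg) (auto intro!: integral_nonneg_AE)
    have sq: "sqi white_noise (\<lambda>w. inner (to_L2 (G w)) (to_L2 f) - lin ?c K w)"
      "ip white_noise (\<lambda>w. inner (to_L2 (G w)) (to_L2 f) - lin ?c K w) (\<lambda>w. inner (to_L2 (G w)) (to_L2 f) - lin ?c K w)
        \<le> ip I01 f f * (\<integral>t. tail K t \<partial>I01)" for K
      by (rule sqi_of_nn_integral[OF _ bd b0], measurable)+
    have "(\<lambda>K. \<integral>t. tail K t \<partial>I01) \<longlonglongrightarrow> (\<integral>t. 0 \<partial>I01)"
    proof (rule integral_dominated_convergence[OF _ _ intq])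
      show "AE t in I01. (\<lambda>K. tail K t) \<longlonglongrightarrow> 0" using tail_lim by (intro AE_I2) simp
      show "AE t in I01. norm (tail K t) \<le> q t" for K using tail0 tail_q by (intro AE_I2) simp
    qed auto
    from tendsto_mult_left[OF this, of "ip I01 f f"]
    have lim0: "(\<lambda>K. ip I01 f f * (\<integral>t. tail K t \<partial>I01)) \<longlonglongrightarrow> 0" by simp
    show ?thesis
      unfolding gauss_lim_def
    proof
      show "sqi white_noise (\<lambda>w. inner (to_L2 (G w)) (to_L2 f))" using sq(1)[of 0] by (simp add: lin_def)
      show "(\<lambda>n. ip white_noise (\<lambda>w. inner (to_L2 (G w)) (to_L2 f) - lin ?c n w)
          (\<lambda>w. inner (to_L2 (G w)) (to_L2 f) - lin ?c n w)) \<longlonglongrightarrow> 0"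
        by (rule Lim_null_comparison[OF _ lim0]) (use sq(2) in \<open>simp add: abs_of_nonneg[OF ip_nonneg]\<close>)
    qed
  qed
  show ?thesis by (rule that[OF G_proc G_lim G_pair])
qed

section \<open>Covariances prescribed at every pair of time points\<close>

lemma sigma_sets_countable_subset:
  assumes "B \<in> sigma_sets \<Omega> G"
  shows "\<exists>C. C \<subseteq> G \<and> countable C \<and> B \<in> sigma_sets \<Omega> C"
  using assms
proof induction
  case (Basic a)
  then show ?case by (intro exI[of _ "{a}"]) (auto intro: sigma_sets.Basic)
next
  case Empty
  then show ?case by (intro exI[of _ "{}"]) (auto intro: sigma_sets.Empty)
next
  case (Compl a)
  then show ?case by (auto intro: sigma_sets.Compl)
next
  case (Union a)
  then obtain C where C: "\<And>i::nat. C i \<subseteq> G" "\<And>i. countable (C i)" "\<And>i. a i \<in> sigma_sets \<Omega> (C i)" by metis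
  have "a i \<in> sigma_sets \<Omega> (\<Union>i. C i)" for i
    using C(3)[of i] sigma_sets_mono'[of "C i" "\<Union>i. C i" \<Omega>] by blast
  then show ?case using C(1,2) by (intro exI[of _ "\<Union>i. C i"]) (auto intro: sigma_sets.Union)
qed

text \<open>The preimages of a countable base lie in the sigma-algebra generated by countably many
  measurable rectangles. The first sides of these rectangles make every section measurable, and they
  form one family for all t.\<close>

lemma jointly_measurable_sections_countably_generated:
  fixes U :: "'a \<Rightarrow> 't \<Rightarrow> real"
  assumes U: "case_prod U \<in> borel_measurable (M \<Otimes>\<^sub>M T)"
  obtains A :: "nat \<Rightarrow> 'a set" where "range A \<subseteq> sets M"
    "\<And>t. t \<in> space T \<Longrightarrow> (\<lambda>\<omega>. U \<omega> t) \<in> borel_measurable (sigma (space M) (range A))"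
proof -
  obtain B :: "real set set" where B: "countable B" "open = generate_topology B"
    using ex_countable_basis topological_basis_imp_subbasis by blast
  have borel: "borel = sigma UNIV B" using second_countable_borel_measurable[OF B(2)] .
  have Bopen: "open b" if "b \<in> B" for b
    unfolding B(2) using that by (rule generate_topology.Basis)
  let ?\<Omega> = "space M \<times> space T" and ?R = "{a \<times> b |a b. a \<in> sets M \<and> b \<in> sets T}"
  have "case_prod U -` b \<inter> ?\<Omega> \<in> sigma_sets ?\<Omega> ?R" if "b \<in> B" for b
    using measurable_sets[OF U, of b] Bopen[OF that] by (simp add: space_pair_measure sets_pair_measure)
  then have "\<forall>b\<in>B. \<exists>C. C \<subseteq> ?R \<and> countable C \<and> case_prod U -` b \<inter> ?\<Omega> \<in> sigma_sets ?\<Omega> C"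
    using sigma_sets_countable_subset by blast
  from bchoice[OF this] obtain C where C0: "\<forall>b\<in>B. C b \<subseteq> ?R \<and> countable (C b) \<and>
      case_prod U -` b \<inter> ?\<Omega> \<in> sigma_sets ?\<Omega> (C b)" ..
  then have C: "\<And>b. b \<in> B \<Longrightarrow> C b \<subseteq> ?R" "\<And>b. b \<in> B \<Longrightarrow> countable (C b)"
    "\<And>b. b \<in> B \<Longrightarrow> case_prod U -` b \<inter> ?\<Omega> \<in> sigma_sets ?\<Omega> (C b)" by blast+
  define D where "D = (\<Union>b\<in>B. C b)"
  have D: "countable D" "D \<subseteq> ?R" unfolding D_def using C(1,2) B(1) by (auto intro!: countable_UN)
  have "\<exists>q. c = fst q \<times> snd q \<and> fst q \<in> sets M" if "c \<in> D" for c
  proof -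
    from subsetD[OF D(2) that] obtain a b where "c = a \<times> b" "a \<in> sets M"
      unfolding mem_Collect_eq by (elim exE conjE)
    then show ?thesis by (intro exI[of _ "(a, b)"]) simp
  qed
  then have "\<forall>c\<in>D. \<exists>q. c = fst q \<times> snd q \<and> fst q \<in> sets M" ..
  from bchoice[OF this] obtain q where q: "\<forall>c\<in>D. c = fst (q c) \<times> snd (q c) \<and> fst (q c) \<in> sets M" ..
  define p where "p c = fst (q c)" for c
  define r where "r c = snd (q c)" for c
  have "c = p c \<times> r c" if "c \<in> D" for c
    using bspec[OF q that] unfolding p_def r_def by (rule conjunct1)
  moreover have "p c \<in> sets M" if "c \<in> D" for c
    using bspec[OF q that] unfolding p_def by (rule conjunct2)
  note pr = calculation this
  define \<A> where "\<A> = insert {} (p ` D)"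
  define A where "A = from_nat_into \<A>"
  have A: "range A = \<A>" unfolding A_def using D(1) by (intro range_from_nat_into) (auto simp: \<A>_def)
  have \<A>s: "\<A> \<subseteq> sets M" using pr(2) by (auto simp: \<A>_def)
  then have \<A>P: "\<A> \<subseteq> Pow (space M)" using sets.sets_into_space by blast
  have DP: "D \<subseteq> Pow ?\<Omega>"
  proof
    fix c assume "c \<in> D"
    from subsetD[OF D(2) this] obtain a b where "c = a \<times> b" "a \<in> sets M" "b \<in> sets T"
      unfolding mem_Collect_eq by (elim exE conjE)
    then show "c \<in> Pow ?\<Omega>"
      using Sigma_mono[OF sets.sets_into_space[of a M] sets.sets_into_space[of b T]] by simp
  qed
  have "(\<lambda>\<omega>. U \<omega> t) \<in> borel_measurable (sigma (space M) (range A))" if t: "t \<in> space T" for t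
  proof -
    have pair: "(\<lambda>\<omega>. (\<omega>, t)) \<in> measurable (sigma (space M) \<A>) (sigma ?\<Omega> D)"
    proof (rule measurable_measure_of[OF DP])
      show "(\<lambda>\<omega>. (\<omega>, t)) \<in> space (sigma (space M) \<A>) \<rightarrow> ?\<Omega>"
        using t \<A>P by (auto simp: space_measure_of_conv)
      fix c assume c: "c \<in> D"
      \<comment> \<open>The section of a rectangle at t is its first side or empty, which is why the
        empty set was added to the family.\<close>
      have "(\<lambda>\<omega>. (\<omega>, t)) -` c \<inter> space M = (if t \<in> r c then p c else {})"
        using pr(1)[OF c] sets.sets_into_space[OF pr(2)[OF c]] by auto
      moreover have "(if t \<in> r c then p c else {}) \<in> \<A>" using c by (auto simp: \<A>_def)
      ultimately show "(\<lambda>\<omega>. (\<omega>, t)) -` c \<inter> space (sigma (space M) \<A>) \<in> sets (sigma (space M) \<A>)"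
        using \<A>P by (simp add: space_measure_of_conv sets_measure_of sigma_sets.Basic)
    qed
    have U': "case_prod U \<in> measurable (sigma ?\<Omega> D) borel"
      unfolding borel
    proof (rule measurable_measure_of)
      fix b assume b: "b \<in> B"
      have "sigma_sets ?\<Omega> (C b) \<subseteq> sigma_sets ?\<Omega> D"
        using b by (intro sigma_sets_mono') (auto simp: D_def)
      then show "case_prod U -` b \<inter> space (sigma ?\<Omega> D) \<in> sets (sigma ?\<Omega> D)"
        using C(3)[OF b] DP by (auto simp: space_measure_of_conv sets_measure_of)
    qed auto
    show ?thesis using measurable_compose[OF pair U'] by (simp add: A)
  qed
  then show ?thesis using \<A>s A by (intro that[of A]) auto
qed

text \<open>The coefficients in the third conclusion stay existential: it records that inner
  products with the process are Gaussian, and their variance is recovered from the covariance kernel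
  afterwards.\<close>

theorem gaussian_process_with_covariance:
  fixes U :: "'a \<Rightarrow> real \<Rightarrow> real"
  assumes M: "prob_space M" and U: "L2_process M U"
    and sq: "\<And>t. t \<in> {0..1} \<Longrightarrow> integrable M (\<lambda>\<omega>. (U \<omega> t)\<^sup>2)"
    and int: "integrable I01 (\<lambda>t. \<integral>\<omega>. (U \<omega> t)\<^sup>2 \<partial>M)"
  obtains G where "L2_process white_noise G"
    "gaussian_process_0 white_noise G (\<lambda>s t. \<integral>\<omega>. U \<omega> s * U \<omega> t \<partial>M)"
    "\<And>f. sq_int f \<Longrightarrow> \<exists>c. gauss_lim c (\<lambda>w. inner (to_L2 (G w)) (to_L2 f))"
    "\<And>t. t \<in> {0..1} \<Longrightarrow> sqi white_noise (\<lambda>w. G w t)"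
proof -
  interpret prob_space M by fact
  have Um: "case_prod U \<in> borel_measurable (M \<Otimes>\<^sub>M I01)" using U by (simp add: L2_process_def)
  obtain A :: "nat \<Rightarrow> 'a set" where A: "range A \<subseteq> sets M"
    "\<And>t. t \<in> space I01 \<Longrightarrow> (\<lambda>\<omega>. U \<omega> t) \<in> borel_measurable (sigma (space M) (range A))"
    by (rule jointly_measurable_sections_countably_generated[OF Um]) (rule that)
  obtain g where g: "\<And>k. sqi M (g k)" "\<And>j k. j \<noteq> k \<Longrightarrow> ip M (g j) (g k) = 0"
    "\<And>k. ip M (g k) (g k) \<in> {0, 1}"
    "\<And>f h. sqi M f \<Longrightarrow> sqi M h \<Longrightarrow> f \<in> borel_measurable (sigma (space M) (range A)) \<Longrightarrow>
       h \<in> borel_measurable (sigma (space M) (range A)) \<Longrightarrow>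
       (\<lambda>k. ip M f (g k) * ip M h (g k)) sums ip M f h"
    by (rule orthonormal_basis_countably_generated[OF finite_measure_axioms A(1)]) (rule that)
  define \<phi> where "\<phi> k t = (\<integral>\<omega>. U \<omega> t * g k \<omega> \<partial>M)" for k t
  have Ut: "sqi M (\<lambda>\<omega>. U \<omega> t)" if "t \<in> {0..1}" for t
    using L2_process_section[OF U that] sq[OF that] by (simp add: sqi_def)
  have \<phi>_ip: "\<phi> k t = ip M (\<lambda>\<omega>. U \<omega> t) (g k)" for k t by (simp add: \<phi>_def ip_def)
  have sums: "(\<lambda>k. \<phi> k s * \<phi> k t) sums (\<integral>\<omega>. U \<omega> s * U \<omega> t \<partial>M)" if "s \<in> {0..1}" "t \<in> {0..1}" for s t
    unfolding \<phi>_ip using g(4)[OF Ut[OF that(1)] Ut[OF that(2)]] A(2) that by (simp add: ip_def)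
  have \<phi>_meas: "\<phi> k \<in> borel_measurable I01" for k
  proof -
    have [measurable]: "g k \<in> borel_measurable M" by (rule sqi_measurable[OF g(1)])
    have [measurable]: "(\<lambda>p. U (snd p) (fst p)) \<in> borel_measurable (I01 \<Otimes>\<^sub>M M)"
      using measurable_compose[OF measurable_pair_swap' Um] by (simp add: split_beta')
    show ?thesis unfolding \<phi>_def[abs_def] by measurable
  qed
  obtain G where G: "L2_process white_noise G"
    "\<And>t. t \<in> {0..1} \<Longrightarrow> gauss_lim (\<lambda>k. \<phi> k t) (\<lambda>w. G w t)"
    "\<And>f. sq_int f \<Longrightarrow> gauss_lim (\<lambda>k. \<integral>t. \<phi> k t * f t \<partial>I01) (\<lambda>w. inner (to_L2 (G w)) (to_L2 f))"
  proof (rule gaussian_process_of_series[OF \<phi>_meas _ int])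
    show "(\<lambda>k. (\<phi> k t)\<^sup>2) sums (\<integral>\<omega>. (U \<omega> t)\<^sup>2 \<partial>M)" if "t \<in> {0..1}" for t
      using sums[OF that that] by (simp add: power2_eq_square)
  qed (rule that)
  have "gaussian_process_0 white_noise G (\<lambda>s t. \<integral>\<omega>. U \<omega> s * U \<omega> t \<partial>M)"
    unfolding gaussian_process_0_def
  proof (intro conjI allI ballI impI)
    fix S :: "real set" and a assume "finite S \<and> S \<subseteq> {0..1}"
    then have "gauss_lim (\<lambda>k. \<Sum>s\<in>S. a s * \<phi> k s) (\<lambda>w. \<Sum>s\<in>S. a s * G w s)"
      by (intro gauss_lim_sum G(2)) auto
    then show "normal_rv white_noise (\<lambda>w. \<Sum>t\<in>S. a t * G w t)" by (rule gauss_lim_normal)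
  next
    fix t :: real assume "t \<in> {0..1}"
    then show "(\<integral>w. G w t \<partial>white_noise) = 0" by (rule gauss_lim_mean[OF G(2)])
  next
    fix s t :: real assume st: "s \<in> {0..1}" "t \<in> {0..1}"
    from gauss_lim_cov[OF G(2)[OF st(1)] G(2)[OF st(2)]] sums[OF st]
    show "(\<integral>w. G w s * G w t \<partial>white_noise) = (\<integral>\<omega>. U \<omega> s * U \<omega> t \<partial>M)"
      by (simp add: ip_def sums_unique2)
  qed
  moreover have "sqi white_noise (\<lambda>w. G w t)" if "t \<in> {0..1}" for t
    using G(2)[OF that] by (simp add: gauss_lim_def)
  ultimately show ?thesis using that G(1,3) by blast
qed

section \<open>Interchanging expectations with inner products in \<open>L2\<close>\<close>

text \<open>Fubini's theorem; the Cauchy-Schwarz inequality in t reduces its integrability condition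
  to a finite mean of \<open>\<bar>Y\<bar>\<close> times the norm. The scalar weight makes room for
  functions of the covariates and for a second inner product.\<close>

lemma integral_inner_process:
  assumes M: "prob_space M" and V: "L2_process M V" and f: "sq_int f"
    and Y [measurable]: "Y \<in> borel_measurable M"
    and int: "integrable M (\<lambda>\<omega>. Y \<omega> * norm (to_L2 (V \<omega>)))"
  shows "integrable M (\<lambda>\<omega>. Y \<omega> * inner (to_L2 (V \<omega>)) (to_L2 f))"
    and "(\<integral>\<omega>. Y \<omega> * inner (to_L2 (V \<omega>)) (to_L2 f) \<partial>M) = (\<integral>t. f t * (\<integral>\<omega>. Y \<omega> * V \<omega> t \<partial>M) \<partial>I01)"
proof -
  interpret prob_space M by fact
  interpret P: pair_sigma_finite M I01 by (rule pair_sigma_finite_I01[OF M])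
  have Vm [measurable]: "case_prod V \<in> borel_measurable (M \<Otimes>\<^sub>M I01)" and Vsq: "\<And>\<omega>. \<omega> \<in> space M \<Longrightarrow> sq_int (V \<omega>)"
    using V by (auto simp: L2_process_def)
  have [measurable]: "f \<in> borel_measurable I01" using f by (simp add: sq_int_def)
  have [measurable]: "(\<lambda>\<omega>. to_L2 (V \<omega>)) \<in> borel_measurable M" by (rule L2_process_measurable[OF V])
  have inner: "inner (to_L2 (V \<omega>)) (to_L2 f) = (\<integral>t. V \<omega> t * f t \<partial>I01)" if "\<omega> \<in> space M" for \<omega>
    by (rule inner_to_L2[OF Vsq[OF that] f])
  have norm_abs: "norm (to_L2 (\<lambda>t. \<bar>g t\<bar>)) = norm (to_L2 g)" if g: "sq_int g" for g
  proof (rule power2_eq_imp_eq)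
    have "sq_int (\<lambda>t. \<bar>g t\<bar>)" using g by (auto simp: sq_int_def)
    then show "(norm (to_L2 (\<lambda>t. \<bar>g t\<bar>)))\<^sup>2 = (norm (to_L2 g))\<^sup>2"
      unfolding norm_to_L2[OF g] by (subst norm_to_L2) simp_all
  qed simp_all
  have abs_bd: "(\<integral>t. \<bar>V \<omega> t * f t\<bar> \<partial>I01) \<le> norm (to_L2 (V \<omega>)) * norm (to_L2 f)" if w: "\<omega> \<in> space M" for \<omega>
  proof -
    have a: "sq_int (\<lambda>t. \<bar>V \<omega> t\<bar>)" "sq_int (\<lambda>t. \<bar>f t\<bar>)" using Vsq[OF w] f by (auto simp: sq_int_def)
    have "(\<integral>t. \<bar>V \<omega> t * f t\<bar> \<partial>I01) = inner (to_L2 (\<lambda>t. \<bar>V \<omega> t\<bar>)) (to_L2 (\<lambda>t. \<bar>f t\<bar>))"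
      by (simp add: inner_to_L2[OF a] abs_mult)
    also have "\<dots> \<le> norm (to_L2 (\<lambda>t. \<bar>V \<omega> t\<bar>)) * norm (to_L2 (\<lambda>t. \<bar>f t\<bar>))" by (rule norm_cauchy_schwarz)
    also have "norm (to_L2 (\<lambda>t. \<bar>V \<omega> t\<bar>)) = norm (to_L2 (V \<omega>))" by (rule norm_abs[OF Vsq[OF w]])
    also have "norm (to_L2 (\<lambda>t. \<bar>f t\<bar>)) = norm (to_L2 f)" by (rule norm_abs[OF f])
    finally show ?thesis .
  qed
  have int': "integrable M (\<lambda>\<omega>. \<bar>Y \<omega>\<bar> * norm (to_L2 (V \<omega>)) * norm (to_L2 f))"
    using integrable_abs[OF int] by (intro integrable_mult_left) (simp add: abs_mult)
  have joint: "integrable (M \<Otimes>\<^sub>M I01) (\<lambda>(\<omega>, t). Y \<omega> * (V \<omega> t * f t))"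
  proof (rule P.Fubini_integrable)
    show "(\<lambda>(\<omega>, t). Y \<omega> * (V \<omega> t * f t)) \<in> borel_measurable (M \<Otimes>\<^sub>M I01)"
      by measurable
    show "AE \<omega> in M. integrable I01 (\<lambda>t. case (\<omega>, t) of (\<omega>, t) \<Rightarrow> Y \<omega> * (V \<omega> t * f t))"
      using Vsq f by (intro AE_I2) (auto intro!: integrable_mult_right sq_int_mult)
    show "integrable M (\<lambda>\<omega>. \<integral>t. norm (case (\<omega>, t) of (\<omega>, t) \<Rightarrow> Y \<omega> * (V \<omega> t * f t)) \<partial>I01)"
    proof (rule Bochner_Integration.integrable_bound[OF int'])
      show "(\<lambda>\<omega>. \<integral>t. norm (case (\<omega>, t) of (\<omega>, t) \<Rightarrow> Y \<omega> * (V \<omega> t * f t)) \<partial>I01) \<in> borel_measurable M"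
        by measurable
      show "AE \<omega> in M. norm (\<integral>t. norm (case (\<omega>, t) of (\<omega>, t) \<Rightarrow> Y \<omega> * (V \<omega> t * f t)) \<partial>I01)
          \<le> norm (\<bar>Y \<omega>\<bar> * norm (to_L2 (V \<omega>)) * norm (to_L2 f))"
      proof (intro AE_I2)
        fix \<omega> assume w: "\<omega> \<in> space M"
        have "(\<integral>t. norm (case (\<omega>, t) of (\<omega>, t) \<Rightarrow> Y \<omega> * (V \<omega> t * f t)) \<partial>I01) = \<bar>Y \<omega>\<bar> * (\<integral>t. \<bar>V \<omega> t * f t\<bar> \<partial>I01)"
          by (simp add: abs_mult[of "Y \<omega>"])
        moreover have "0 \<le> (\<integral>t. \<bar>V \<omega> t * f t\<bar> \<partial>I01)" by (rule integral_nonneg_AE) simp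
        ultimately show "norm (\<integral>t. norm (case (\<omega>, t) of (\<omega>, t) \<Rightarrow> Y \<omega> * (V \<omega> t * f t)) \<partial>I01)
          \<le> norm (\<bar>Y \<omega>\<bar> * norm (to_L2 (V \<omega>)) * norm (to_L2 f))"
          using mult_left_mono[OF abs_bd[OF w], of "\<bar>Y \<omega>\<bar>"] by (simp add: mult.assoc)
      qed
    qed
  qed
  show "integrable M (\<lambda>\<omega>. Y \<omega> * inner (to_L2 (V \<omega>)) (to_L2 f))"
  proof (rule Bochner_Integration.integrable_bound[OF int'])
    show "AE \<omega> in M. norm (Y \<omega> * inner (to_L2 (V \<omega>)) (to_L2 f)) \<le> norm (\<bar>Y \<omega>\<bar> * norm (to_L2 (V \<omega>)) * norm (to_L2 f))"
      by (intro AE_I2) (simp add: abs_mult mult.assoc mult_left_mono Cauchy_Schwarz_ineq2)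
  qed measurable
  have "(\<integral>\<omega>. Y \<omega> * inner (to_L2 (V \<omega>)) (to_L2 f) \<partial>M) = (\<integral>\<omega>. (\<integral>t. Y \<omega> * (V \<omega> t * f t) \<partial>I01) \<partial>M)"
    by (intro Bochner_Integration.integral_cong refl) (simp add: inner)
  also have "\<dots> = (\<integral>t. (\<integral>\<omega>. Y \<omega> * (V \<omega> t * f t) \<partial>M) \<partial>I01)"
    using P.Fubini_integral[OF joint] by simp
  also have "\<dots> = (\<integral>t. (\<integral>\<omega>. f t * (Y \<omega> * V \<omega> t) \<partial>M) \<partial>I01)"
    by (simp add: mult_ac)
  also have "\<dots> = (\<integral>t. f t * (\<integral>\<omega>. Y \<omega> * V \<omega> t \<partial>M) \<partial>I01)" by simp
  finally show "(\<integral>\<omega>. Y \<omega> * inner (to_L2 (V \<omega>)) (to_L2 f) \<partial>M) = (\<integral>t. f t * (\<integral>\<omega>. Y \<omega> * V \<omega> t \<partial>M) \<partial>I01)" .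
qed

text \<open>Two applications of the preceding lemma, the first with the inner product itself as
  weight. The right-hand side involves the process only through its covariance kernel, so equal
  kernels give equal variances, even on different spaces.\<close>

lemma inner_square_expectation:
  assumes M: "prob_space M" and V: "L2_process M V" and f: "sq_int f"
    and sq: "integrable M (\<lambda>\<omega>. (norm (to_L2 (V \<omega>)))\<^sup>2)"
    and pt: "\<And>t. t \<in> {0..1} \<Longrightarrow> integrable M (\<lambda>\<omega>. (V \<omega> t)\<^sup>2)"
  shows "integrable M (\<lambda>\<omega>. (inner (to_L2 (V \<omega>)) (to_L2 f))\<^sup>2)"
    and "(\<integral>\<omega>. (inner (to_L2 (V \<omega>)) (to_L2 f))\<^sup>2 \<partial>M) =
      (\<integral>s. f s * (\<integral>t. f t * (\<integral>\<omega>. V \<omega> s * V \<omega> t \<partial>M) \<partial>I01) \<partial>I01)"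
proof -
  interpret prob_space M by fact
  have [measurable]: "(\<lambda>\<omega>. to_L2 (V \<omega>)) \<in> borel_measurable M" by (rule L2_process_measurable[OF V])
  let ?N = "\<lambda>\<omega>. norm (to_L2 (V \<omega>))" and ?I = "\<lambda>\<omega>. inner (to_L2 (V \<omega>)) (to_L2 f)"
  have Nsq: "sqi M ?N" using sq by (simp add: sqi_def)
  have bd: "\<bar>?I \<omega>\<bar> \<le> norm (to_L2 f) * ?N \<omega>" for \<omega>
    using Cauchy_Schwarz_ineq2[of "to_L2 (V \<omega>)" "to_L2 f"] by (simp add: mult.commute)
  have "integrable M (\<lambda>\<omega>. (norm (to_L2 f) * ?N \<omega>)\<^sup>2)"
    using sqi_scale[OF Nsq, of "norm (to_L2 f)"] by (simp add: sqi_def)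
  then show I2: "integrable M (\<lambda>\<omega>. (?I \<omega>)\<^sup>2)"
    by (rule Bochner_Integration.integrable_bound) (use bd in \<open>auto simp: power_mono abs_le_square_iff[symmetric]\<close>)
  have Isq: "sqi M ?I" using I2 by (simp add: sqi_def)
  have "(\<integral>\<omega>. (?I \<omega>)\<^sup>2 \<partial>M) = (\<integral>\<omega>. ?I \<omega> * ?I \<omega> \<partial>M)" by (simp add: power2_eq_square)
  also have "\<dots> = (\<integral>s. f s * (\<integral>\<omega>. ?I \<omega> * V \<omega> s \<partial>M) \<partial>I01)"
    by (rule integral_inner_process(2)[OF M V f]) (measurable, rule sqi_mult[OF Isq Nsq])
  also have "\<dots> = (\<integral>s. f s * (\<integral>t. f t * (\<integral>\<omega>. V \<omega> s * V \<omega> t \<partial>M) \<partial>I01) \<partial>I01)"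
  proof (intro Bochner_Integration.integral_cong refl arg_cong2[where f = "(*)"])
    fix s assume "s \<in> space I01"
    then have s: "s \<in> {0..1}" by simp
    have Vs: "sqi M (\<lambda>\<omega>. V \<omega> s)" using L2_process_section[OF V s] pt[OF s] by (simp add: sqi_def)
    have "(\<integral>\<omega>. ?I \<omega> * V \<omega> s \<partial>M) = (\<integral>\<omega>. V \<omega> s * ?I \<omega> \<partial>M)" by (simp add: mult.commute)
    also have "\<dots> = (\<integral>t. f t * (\<integral>\<omega>. V \<omega> s * V \<omega> t \<partial>M) \<partial>I01)"
      by (rule integral_inner_process(2)[OF M V f sqi_measurable[OF Vs] sqi_mult[OF Vs Nsq]])
    finally show "(\<integral>\<omega>. ?I \<omega> * V \<omega> s \<partial>M) = (\<integral>t. f t * (\<integral>\<omega>. V \<omega> s * V \<omega> t \<partial>M) \<partial>I01)" .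
  qed
  finally show "(\<integral>\<omega>. (?I \<omega>)\<^sup>2 \<partial>M) = (\<integral>s. f s * (\<integral>t. f t * (\<integral>\<omega>. V \<omega> s * V \<omega> t \<partial>M) \<partial>I01) \<partial>I01)" .
qed

section \<open>The central limit theorem in a separable Hilbert space\<close>

lemma parseval_seq_ennreal:
  fixes h :: "'h::real_inner"
  assumes "parseval_seq e"
  shows "(\<Sum>k. ennreal ((inner h (e k))\<^sup>2)) = ennreal ((norm h)\<^sup>2)"
  using assms unfolding parseval_seq_def by (intro sums_unique[symmetric] sums_ennreal[THEN iffD2]) auto

text \<open>Second moments are additive in every coordinate, and Parseval's identity sums the
  coordinates. The computation runs in \<open>ennreal\<close>, where sums and integrals interchange
  freely and integrability comes out as a result.\<close>

lemma (in prob_space) hilbert_second_moment_sum: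
  fixes u :: "nat \<Rightarrow> 'a \<Rightarrow> 'h::{real_inner, second_countable_topology}" and e :: "nat \<Rightarrow> 'h"
  assumes e: "parseval_seq e" and indep: "indep_vars (\<lambda>_. borel) u UNIV"
    and sq: "\<And>i. integrable M (\<lambda>\<omega>. (norm (u i \<omega>))\<^sup>2)"
    and zero: "\<And>i h. expectation (\<lambda>\<omega>. inner (u i \<omega>) h) = 0"
  shows "integrable M (\<lambda>\<omega>. (norm (\<Sum>i<n. u i \<omega>))\<^sup>2)"
    and "expectation (\<lambda>\<omega>. (norm (\<Sum>i<n. u i \<omega>))\<^sup>2) = (\<Sum>i<n. expectation (\<lambda>\<omega>. (norm (u i \<omega>))\<^sup>2))"
proof -
  have [measurable]: "u i \<in> borel_measurable M" for i using indep unfolding indep_vars_def2 by simp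
  have isq: "integrable M (\<lambda>\<omega>. (inner (u i \<omega>) (e k))\<^sup>2)" for i k
  proof (rule Bochner_Integration.integrable_bound[OF integrable_mult_left[OF sq[of i], of "(norm (e k))\<^sup>2"]])
    show "AE \<omega> in M. norm ((inner (u i \<omega>) (e k))\<^sup>2) \<le> norm ((norm (u i \<omega>))\<^sup>2 * (norm (e k))\<^sup>2)"
    proof (intro AE_I2)
      fix \<omega>
      have "\<bar>inner (u i \<omega>) (e k)\<bar>\<^sup>2 \<le> (norm (u i \<omega>) * norm (e k))\<^sup>2"
        by (intro power_mono Cauchy_Schwarz_ineq2) simp
      then show "norm ((inner (u i \<omega>) (e k))\<^sup>2) \<le> norm ((norm (u i \<omega>))\<^sup>2 * (norm (e k))\<^sup>2)"
        by (simp add: power_mult_distrib)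
    qed
  qed measurable
  have indk: "indep_vars (\<lambda>_. borel) (\<lambda>i \<omega>. inner (u i \<omega>) (e k)) UNIV" for k
    by (rule indep_vars_compose2[OF indep]) measurable
  have one: "(\<integral>\<^sup>+\<omega>. ennreal ((inner (\<Sum>i<n. u i \<omega>) (e k))\<^sup>2) \<partial>M) = (\<Sum>i<n. \<integral>\<^sup>+\<omega>. ennreal ((inner (u i \<omega>) (e k))\<^sup>2) \<partial>M)" for k
  proof -
    note s = second_moment_sum[OF indk isq zero, of "{..<n}" k]
    have "(\<integral>\<^sup>+\<omega>. ennreal ((inner (\<Sum>i<n. u i \<omega>) (e k))\<^sup>2) \<partial>M) =
        ennreal (expectation (\<lambda>\<omega>. (\<Sum>i<n. inner (u i \<omega>) (e k))\<^sup>2))"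
      using s by (simp add: inner_sum_left nn_integral_eq_integral)
    also have "\<dots> = ennreal (\<Sum>i<n. expectation (\<lambda>\<omega>. (inner (u i \<omega>) (e k))\<^sup>2))"
      using s by simp
    also have "\<dots> = (\<Sum>i<n. ennreal (expectation (\<lambda>\<omega>. (inner (u i \<omega>) (e k))\<^sup>2)))"
      by (intro sum_ennreal[symmetric]) simp
    also have "\<dots> = (\<Sum>i<n. \<integral>\<^sup>+\<omega>. ennreal ((inner (u i \<omega>) (e k))\<^sup>2) \<partial>M)"
      using isq by (simp add: nn_integral_eq_integral)
    finally show ?thesis .
  qed
  have "(\<integral>\<^sup>+\<omega>. ennreal ((norm (\<Sum>i<n. u i \<omega>))\<^sup>2) \<partial>M) = (\<Sum>k. \<integral>\<^sup>+\<omega>. ennreal ((inner (\<Sum>i<n. u i \<omega>) (e k))\<^sup>2) \<partial>M)"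
    unfolding parseval_seq_ennreal[OF e, symmetric] by (rule nn_integral_suminf) measurable
  also have "\<dots> = (\<Sum>i<n. \<Sum>k. \<integral>\<^sup>+\<omega>. ennreal ((inner (u i \<omega>) (e k))\<^sup>2) \<partial>M)"
    unfolding one by (rule suminf_sum) simp
  also have "\<dots> = (\<Sum>i<n. \<integral>\<^sup>+\<omega>. ennreal ((norm (u i \<omega>))\<^sup>2) \<partial>M)"
    unfolding parseval_seq_ennreal[OF e, symmetric] by (intro sum.cong refl nn_integral_suminf[symmetric]) measurable
  also have "\<dots> = (\<Sum>i<n. ennreal (expectation (\<lambda>\<omega>. (norm (u i \<omega>))\<^sup>2)))"
    using sq by (simp add: nn_integral_eq_integral)
  also have "\<dots> = ennreal (\<Sum>i<n. expectation (\<lambda>\<omega>. (norm (u i \<omega>))\<^sup>2))"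
    by (intro sum_ennreal) simp
  finally have nn: "(\<integral>\<^sup>+\<omega>. ennreal ((norm (\<Sum>i<n. u i \<omega>))\<^sup>2) \<partial>M) = ennreal (\<Sum>i<n. expectation (\<lambda>\<omega>. (norm (u i \<omega>))\<^sup>2))" .
  show int: "integrable M (\<lambda>\<omega>. (norm (\<Sum>i<n. u i \<omega>))\<^sup>2)"
    by (rule integrableI_bounded) (measurable, simp add: nn)
  show "expectation (\<lambda>\<omega>. (norm (\<Sum>i<n. u i \<omega>))\<^sup>2) = (\<Sum>i<n. expectation (\<lambda>\<omega>. (norm (u i \<omega>))\<^sup>2))"
    using nn unfolding nn_integral_eq_integral[OF int AE_I2[OF zero_le_power2]]
    by (subst (asm) ennreal_inj) (auto intro!: sum_nonneg)
qed

lemma proj_scaleR: "proj e j (c *\<^sub>R h) = c *\<^sub>R proj e j h"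
  by (simp add: proj_def scaleR_sum_right)

text \<open>Projections are self-adjoint; consequently the tails of centred summands are
  centred.\<close>

lemma inner_diff_proj:
  "inner (h - proj e j h) g = inner h (g - proj e j g)"
proof -
  have "inner (proj e j h) g = inner h (proj e j g)"
    by (simp add: inner_proj_left) (simp add: proj_def inner_sum_right inner_commute mult_ac)
  then show ?thesis by (simp add: inner_diff_left inner_diff_right)
qed

text \<open>\<open>clt_cos\<close> supplies the characteristic functional. The tail condition is
  uniform because, for every \<open>n > 0\<close>, the mean squared tail of the normalized sum
  equals that of the single summand \<open>u 0\<close>, which is small by dominated
  convergence.\<close>

lemma (in prob_space) hilbert_clt:
  fixes u :: "nat \<Rightarrow> 'a \<Rightarrow> 'h::{real_inner, second_countable_topology}" and L :: "'b \<Rightarrow> 'h"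
    and e :: "nat \<Rightarrow> 'h"
  assumes e: "parseval_seq e" and indep: "indep_vars (\<lambda>_. borel) u UNIV"
    and distr: "\<And>i. distr M borel (u i) = distr M borel (u 0)"
    and sq: "integrable M (\<lambda>\<omega>. (norm (u 0 \<omega>))\<^sup>2)"
    and zero: "\<And>h. expectation (\<lambda>\<omega>. inner (u 0 \<omega>) h) = 0"
    and N: "prob_space N" and L: "L \<in> borel_measurable N"
    and cosL: "\<And>h \<theta>. (\<integral>w. cos (inner (L w) h + \<theta>) \<partial>N) = exp (- expectation (\<lambda>\<omega>. (inner (u 0 \<omega>) h)\<^sup>2) / 2) * cos \<theta>"
    and F: "lip_bdd F C B"
  shows "(\<lambda>n. expectation (\<lambda>\<omega>. F ((1 / sqrt (real n)) *\<^sub>R (\<Sum>i<n. u i \<omega>)))) \<longlonglongrightarrow> (\<integral>w. F (L w) \<partial>N)"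
proof -
  have [measurable]: "u i \<in> borel_measurable M" for i using indep unfolding indep_vars_def2 by simp
  have transfer: "expectation (\<lambda>\<omega>. g (u i \<omega>)) = expectation (\<lambda>\<omega>. g (u 0 \<omega>))"
    "integrable M (\<lambda>\<omega>. g (u i \<omega>)) = integrable M (\<lambda>\<omega>. g (u 0 \<omega>))"
    if [measurable]: "g \<in> borel_measurable borel" for g :: "'h \<Rightarrow> real" and i
  proof -
    have "(\<integral>x. g x \<partial>distr M borel (u i)) = (\<integral>x. g x \<partial>distr M borel (u 0))"
      "integrable (distr M borel (u i)) g = integrable (distr M borel (u 0)) g"
      by (simp_all only: distr[of i])
    then show "expectation (\<lambda>\<omega>. g (u i \<omega>)) = expectation (\<lambda>\<omega>. g (u 0 \<omega>))"
      "integrable M (\<lambda>\<omega>. g (u i \<omega>)) = integrable M (\<lambda>\<omega>. g (u 0 \<omega>))"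
      by (simp_all add: integral_distr integrable_distr_eq)
  qed
  have sqi: "integrable M (\<lambda>\<omega>. (norm (u i \<omega>))\<^sup>2)" for i
    using transfer(2)[of "\<lambda>x. (norm x)\<^sup>2" i] sq by simp
  have zeroi: "expectation (\<lambda>\<omega>. inner (u i \<omega>) h) = 0" for i h
    using transfer(1)[of "\<lambda>x. inner x h" i] zero by simp
  let ?S = "\<lambda>n \<omega>. (1 / sqrt (real n)) *\<^sub>R (\<Sum>i<n. u i \<omega>)"
  have char: "(\<lambda>n. expectation (\<lambda>\<omega>. cos (inner (?S n \<omega>) h + \<theta>))) \<longlonglongrightarrow> (\<integral>w. cos (inner (L w) h + \<theta>) \<partial>N)" for h \<theta>
  proof -
    have ind: "indep_vars (\<lambda>_. borel) (\<lambda>i \<omega>. inner (u i \<omega>) h) UNIV"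
      by (rule indep_vars_compose2[OF indep]) measurable
    have d: "distr M borel (\<lambda>\<omega>. inner (u i \<omega>) h) = distr M borel (\<lambda>\<omega>. inner (u 0 \<omega>) h)" for i
    proof -
      have "distr (distr M borel (u i)) borel (\<lambda>x. inner x h) = distr (distr M borel (u 0)) borel (\<lambda>x. inner x h)"
        by (simp only: distr[of i])
      then show ?thesis by (simp add: distr_distr comp_def)
    qed
    have s: "integrable M (\<lambda>\<omega>. (inner (u i \<omega>) h)\<^sup>2)" for i
    proof (rule Bochner_Integration.integrable_bound[OF integrable_mult_left[OF sqi[of i], of "(norm h)\<^sup>2"]])
      show "AE \<omega> in M. norm ((inner (u i \<omega>) h)\<^sup>2) \<le> norm ((norm (u i \<omega>))\<^sup>2 * (norm h)\<^sup>2)"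
      proof (intro AE_I2)
        fix \<omega>
        have "\<bar>inner (u i \<omega>) h\<bar>\<^sup>2 \<le> (norm (u i \<omega>) * norm h)\<^sup>2"
          by (intro power_mono Cauchy_Schwarz_ineq2) simp
        then show "norm ((inner (u i \<omega>) h)\<^sup>2) \<le> norm ((norm (u i \<omega>))\<^sup>2 * (norm h)\<^sup>2)"
          by (simp add: power_mult_distrib)
      qed
    qed measurable
    have v: "expectation (\<lambda>\<omega>. (inner (u i \<omega>) h)\<^sup>2) = expectation (\<lambda>\<omega>. (inner (u 0 \<omega>) h)\<^sup>2)" for i
      using transfer(1)[of "\<lambda>x. (inner x h)\<^sup>2" i] by simp
    show ?thesis
      using clt_cos[OF ind d s zeroi v, of \<theta>] by (simp add: cosL inner_sum_left)
  qed
  have tail: "\<exists>j0. \<forall>j\<ge>j0. \<forall>n. integrable M (\<lambda>\<omega>. (norm (?S n \<omega> - proj e j (?S n \<omega>)))\<^sup>2) \<and>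
      expectation (\<lambda>\<omega>. (norm (?S n \<omega> - proj e j (?S n \<omega>)))\<^sup>2) \<le> \<eta>" if \<eta>: "\<eta> > 0" for \<eta>
  proof -
    have le: "norm (h - proj e j h) \<le> norm h" for h j
    proof (rule power2_le_imp_le)
      show "(norm (h - proj e j h))\<^sup>2 \<le> (norm h)\<^sup>2"
        unfolding norm_diff_proj[OF e] by (simp add: sum_nonneg)
    qed simp
    have lim0: "(\<lambda>j. norm (h - proj e j h)) \<longlonglongrightarrow> 0" for h
      using tendsto_norm[OF tendsto_diff[OF tendsto_const[of h] proj_tendsto[OF e, of h]]] by simp
    have "(\<lambda>j. expectation (\<lambda>\<omega>. (norm (u 0 \<omega> - proj e j (u 0 \<omega>)))\<^sup>2)) \<longlonglongrightarrow> expectation (\<lambda>\<omega>. 0)"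
    proof (rule integral_dominated_convergence[OF _ _ sq])
      show "AE \<omega> in M. (\<lambda>j. (norm (u 0 \<omega> - proj e j (u 0 \<omega>)))\<^sup>2) \<longlonglongrightarrow> 0"
        using tendsto_power[OF lim0, of _ 2] by simp
      show "AE \<omega> in M. norm ((norm (u 0 \<omega> - proj e j (u 0 \<omega>)))\<^sup>2) \<le> (norm (u 0 \<omega>))\<^sup>2" for j
        using le by (auto intro!: power_mono)
    qed measurable
    then have "eventually (\<lambda>j. expectation (\<lambda>\<omega>. (norm (u 0 \<omega> - proj e j (u 0 \<omega>)))\<^sup>2) < \<eta>) sequentially"
      using \<eta> by (intro order_tendstoD(2)) auto
    then obtain j0 where j0: "\<And>j. j \<ge> j0 \<Longrightarrow> expectation (\<lambda>\<omega>. (norm (u 0 \<omega> - proj e j (u 0 \<omega>)))\<^sup>2) < \<eta>"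
      unfolding eventually_sequentially by blast
    have "integrable M (\<lambda>\<omega>. (norm (?S n \<omega> - proj e j (?S n \<omega>)))\<^sup>2) \<and>
      expectation (\<lambda>\<omega>. (norm (?S n \<omega> - proj e j (?S n \<omega>)))\<^sup>2) \<le> \<eta>" if j: "j \<ge> j0" for j n
    proof -
      let ?v = "\<lambda>i \<omega>. u i \<omega> - proj e j (u i \<omega>)"
      have vm: "(\<lambda>x. x - proj e j x) \<in> borel_measurable borel" by measurable
      have vi: "indep_vars (\<lambda>_. borel) ?v UNIV"
        by (rule indep_vars_compose2[OF indep]) (rule vm)
      have vsq: "integrable M (\<lambda>\<omega>. (norm (?v i \<omega>))\<^sup>2)" for i
        by (rule Bochner_Integration.integrable_bound[OF sqi[of i]])
          (measurable, use le in \<open>auto intro!: power_mono\<close>)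
      have v0: "expectation (\<lambda>\<omega>. inner (?v i \<omega>) h) = 0" for i h
        unfolding inner_diff_proj by (rule zeroi)
      have Ev: "expectation (\<lambda>\<omega>. (norm (?v i \<omega>))\<^sup>2) = expectation (\<lambda>\<omega>. (norm (?v 0 \<omega>))\<^sup>2)" for i
        using transfer(1)[of "\<lambda>x. (norm (x - proj e j x))\<^sup>2" i] by simp
      note s = hilbert_second_moment_sum[OF e vi vsq v0, of n]
      have pl: "?S n \<omega> - proj e j (?S n \<omega>) = (1 / sqrt (real n)) *\<^sub>R (\<Sum>i<n. ?v i \<omega>)" for \<omega>
      proof -
        have "proj e j (?S n \<omega>) = (1 / sqrt (real n)) *\<^sub>R proj e j (\<Sum>i<n. u i \<omega>)"
          by (rule proj_scaleR)
        moreover have "proj e j (\<Sum>i<n. u i \<omega>) = (\<Sum>i<n. proj e j (u i \<omega>))"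
          unfolding proj_def inner_sum_left scaleR_sum_left by (rule sum.swap)
        ultimately show ?thesis by (simp add: sum_subtractf scaleR_right_diff_distrib)
      qed
      have nrm: "(norm (?S n \<omega> - proj e j (?S n \<omega>)))\<^sup>2 = (1 / real n) * (norm (\<Sum>i<n. ?v i \<omega>))\<^sup>2" for \<omega>
        unfolding pl by (simp add: power_mult_distrib power_divide)
      have SE: "(\<Sum>i<n. expectation (\<lambda>\<omega>. (norm (?v i \<omega>))\<^sup>2)) = (\<Sum>i<n. expectation (\<lambda>\<omega>. (norm (?v 0 \<omega>))\<^sup>2))"
        by (intro sum.cong refl Ev)
      have "expectation (\<lambda>\<omega>. (norm (?S n \<omega> - proj e j (?S n \<omega>)))\<^sup>2) = (1 / real n) * (real n * expectation (\<lambda>\<omega>. (norm (?v 0 \<omega>))\<^sup>2))"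
        unfolding nrm integral_mult_right_zero s(2) SE by simp
      \<comment> \<open>At \<open>n = 0\<close> the division by zero gives the value 0, which
        satisfies the bound as well.\<close>
      also have "\<dots> \<le> \<eta>" using j0[OF j] \<eta> by (cases "n = 0") auto
      finally show ?thesis unfolding nrm using s(1) by simp
    qed
    then show ?thesis by blast
  qed
  have Sm: "?S n \<in> borel_measurable M" for n by measurable
  show ?thesis
    using lipschitz_conv[OF prob_space_axioms N e Sm L char tail F]
    unfolding test_conv_def[OF prob_space_axioms N e Sm L char] .
qed

section \<open>Moments of the residuals under missingness at random\<close>

lemma subalgebra_gen_by:
  assumes "X \<in> measurable M K"
  shows "subalgebra M (gen_by M X K)"
proof -
  have "X \<in> space M \<rightarrow> space K" using measurable_space[OF assms] by auto
  then show ?thesis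
    using measurable_sets[OF assms] unfolding subalgebra_def gen_by_def
    by (auto simp: sets_vimage_algebra2)
qed

lemma measurable_gen_by:
  assumes "X \<in> measurable M K" "g \<in> measurable K L"
  shows "(\<lambda>\<omega>. g (X \<omega>)) \<in> measurable (gen_by M X K) L"
proof -
  have "X \<in> measurable (gen_by M X K) K"
    unfolding gen_by_def using measurable_space[OF assms(1)] by (intro measurable_vimage_algebra1) auto
  from measurable_compose[OF this assms(2)] show ?thesis .
qed

text \<open>The weight has values in \<open>ennreal\<close> and the product need not be integrable,
  for the lemma is used where that integrability is to be proved. Integrability of \<open>g\<close>
  makes \<open>nn_cond_exp\<close> finite almost everywhere, so its conversion to a real number
  loses nothing.\<close>

lemma (in sigma_finite_subalgebra) nn_integral_cond_exp:
  assumes g [measurable]: "g \<in> borel_measurable M" "\<And>x. 0 \<le> g x" "integrable M g"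
    and h: "AE x in M. real_cond_exp M F g x = h x"
    and w [measurable]: "w \<in> borel_measurable F"
  shows "(\<integral>\<^sup>+x. w x * ennreal (g x) \<partial>M) = (\<integral>\<^sup>+x. w x * ennreal (h x) \<partial>M)"
proof -
  have neg: "(\<lambda>x. ennreal (- g x)) = (\<lambda>x. 0)" using g(2) by (simp add: ennreal_neg)
  have "(\<integral>\<^sup>+x. 1 * nn_cond_exp M F (\<lambda>x. ennreal (g x)) x \<partial>M) = (\<integral>\<^sup>+x. 1 * ennreal (g x) \<partial>M)"
    by (rule nn_cond_exp_intg) measurable
  also have "\<dots> < \<infinity>" using g by (simp add: integrable_iff_bounded)
  finally have "AE x in M. nn_cond_exp M F (\<lambda>x. ennreal (g x)) x \<noteq> \<infinity>"
    by (intro nn_integral_PInf_AE) auto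
  moreover have "AE x in M. 0 = nn_cond_exp M F (\<lambda>x. 0) x"
    by (rule nn_cond_exp_F_meas) simp
  ultimately have "AE x in M. nn_cond_exp M F (\<lambda>x. ennreal (g x)) x = ennreal (h x)"
    using h
  proof eventually_elim
    case (elim x)
    then show ?case
      unfolding real_cond_exp_def neg by (metis diff_zero enn2real_0 ennreal_enn2real infinity_ennreal_def less_top)
  qed
  then have "(\<integral>\<^sup>+x. w x * ennreal (h x) \<partial>M) = (\<integral>\<^sup>+x. w x * nn_cond_exp M F (\<lambda>x. ennreal (g x)) x \<partial>M)"
    by (intro nn_integral_cong_AE) auto
  also have "\<dots> = (\<integral>\<^sup>+x. w x * ennreal (g x) \<partial>M)"
    by (rule nn_cond_exp_intg) measurable
  finally show ?thesis by simp
qed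

lemma nn_integral_norm_process:
  assumes M: "prob_space M" and V: "L2_process M V" and v: "v \<in> borel_measurable M"
  shows "(\<integral>\<^sup>+\<omega>. v \<omega> * ennreal ((norm (to_L2 (V \<omega>)))\<^sup>2) \<partial>M) = (\<integral>\<^sup>+t. (\<integral>\<^sup>+\<omega>. v \<omega> * ennreal ((V \<omega> t)\<^sup>2) \<partial>M) \<partial>I01)"
proof -
  interpret prob_space M by fact
  interpret P: pair_sigma_finite M I01 by (rule pair_sigma_finite_I01[OF M])
  note [measurable] = v
  have Vm [measurable]: "case_prod V \<in> borel_measurable (M \<Otimes>\<^sub>M I01)" and Vsq: "\<And>\<omega>. \<omega> \<in> space M \<Longrightarrow> sq_int (V \<omega>)"
    using V by (auto simp: L2_process_def)
  have "(\<integral>\<^sup>+\<omega>. v \<omega> * ennreal ((norm (to_L2 (V \<omega>)))\<^sup>2) \<partial>M) = (\<integral>\<^sup>+\<omega>. (\<integral>\<^sup>+t. v \<omega> * ennreal ((V \<omega> t)\<^sup>2) \<partial>I01) \<partial>M)"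
  proof (rule nn_integral_cong)
    fix \<omega> assume w: "\<omega> \<in> space M"
    have [measurable]: "V \<omega> \<in> borel_measurable I01" using Vsq[OF w] by (simp add: sq_int_def)
    have "ennreal ((norm (to_L2 (V \<omega>)))\<^sup>2) = (\<integral>\<^sup>+t. ennreal ((V \<omega> t)\<^sup>2) \<partial>I01)"
      using Vsq[OF w] unfolding norm_to_L2[OF Vsq[OF w]] sq_int_def
      by (subst nn_integral_eq_integral) auto
    then show "v \<omega> * ennreal ((norm (to_L2 (V \<omega>)))\<^sup>2) = (\<integral>\<^sup>+t. v \<omega> * ennreal ((V \<omega> t)\<^sup>2) \<partial>I01)"
      by (simp add: nn_integral_cmult)
  qed
  also have "\<dots> = (\<integral>\<^sup>+t. (\<integral>\<^sup>+\<omega>. v \<omega> * ennreal ((V \<omega> t)\<^sup>2) \<partial>M) \<partial>I01)"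
    by (rule P.Fubini'[symmetric]) measurable
  finally show ?thesis .
qed

text \<open>The limit and \<open>U\<close> share a covariance kernel, hence by
  \<open>inner_square_expectation\<close> the same variance in every direction \<open>h\<close>;
  this variance determines a centred Gaussian inner product.\<close>

lemma gaussian_process_functional:
  fixes U :: "'a \<Rightarrow> real \<Rightarrow> real"
  assumes M: "prob_space M" and U: "L2_process M U"
    and sq: "\<And>t. t \<in> {0..1} \<Longrightarrow> integrable M (\<lambda>\<omega>. (U \<omega> t)\<^sup>2)"
    and nsq: "integrable M (\<lambda>\<omega>. (norm (to_L2 (U \<omega>)))\<^sup>2)"
  obtains G where "L2_process white_noise G"
    "gaussian_process_0 white_noise G (\<lambda>s t. \<integral>\<omega>. U \<omega> s * U \<omega> t \<partial>M)"
    "\<And>h \<theta>. WN.expectation (\<lambda>w. cos (inner (to_L2 (G w)) h + \<theta>)) =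
       exp (- (\<integral>\<omega>. (inner (to_L2 (U \<omega>)) h)\<^sup>2 \<partial>M) / 2) * cos \<theta>"
proof -
  interpret prob_space M by fact
  have Um [measurable]: "case_prod U \<in> borel_measurable (M \<Otimes>\<^sub>M I01)" using U by (simp add: L2_process_def)
  have Um' [measurable]: "(\<lambda>p. U (snd p) (fst p)) \<in> borel_measurable (I01 \<Otimes>\<^sub>M M)"
    using measurable_compose[OF measurable_pair_swap' Um] by (simp add: split_beta')
  let ?q = "\<lambda>t. \<integral>\<omega>. (U \<omega> t)\<^sup>2 \<partial>M"
  have qm: "?q \<in> borel_measurable I01" by measurable
  have qn: "(\<integral>\<^sup>+t. ennreal (?q t) \<partial>I01) = (\<integral>\<^sup>+\<omega>. ennreal ((norm (to_L2 (U \<omega>)))\<^sup>2) \<partial>M)"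
  proof -
    have "(\<integral>\<^sup>+t. ennreal (?q t) \<partial>I01) = (\<integral>\<^sup>+t. (\<integral>\<^sup>+\<omega>. 1 * ennreal ((U \<omega> t)\<^sup>2) \<partial>M) \<partial>I01)"
      using sq by (intro nn_integral_cong) (simp add: nn_integral_eq_integral)
    then show ?thesis using nn_integral_norm_process[OF M U, of "\<lambda>_. 1"] by simp
  qed
  have fin: "(\<integral>\<^sup>+\<omega>. ennreal ((norm (to_L2 (U \<omega>)))\<^sup>2) \<partial>M) < \<infinity>"
    using nsq by (simp add: integrable_iff_bounded)
  have int: "integrable I01 ?q"
    using qm qn fin by (intro integrableI_bounded) (auto simp: integral_nonneg_AE)
  obtain G where G: "L2_process white_noise G"
    "gaussian_process_0 white_noise G (\<lambda>s t. \<integral>\<omega>. U \<omega> s * U \<omega> t \<partial>M)"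
    "\<And>f. sq_int f \<Longrightarrow> \<exists>c. gauss_lim c (\<lambda>w. inner (to_L2 (G w)) (to_L2 f))"
    "\<And>t. t \<in> {0..1} \<Longrightarrow> sqi white_noise (\<lambda>w. G w t)"
    by (rule gaussian_process_with_covariance[OF M U sq int]) (auto intro: that)
  have Gcov: "WN.expectation (\<lambda>w. G w s * G w t) = (\<integral>\<omega>. U \<omega> s * U \<omega> t \<partial>M)" if "s \<in> {0..1}" "t \<in> {0..1}" for s t
    using G(2) that unfolding gaussian_process_0_def by blast
  have Gsq: "integrable white_noise (\<lambda>w. (G w t)\<^sup>2)" if "t \<in> {0..1}" for t
    using G(4)[OF that] by (simp add: sqi_def)
  have Gn: "integrable white_noise (\<lambda>w. (norm (to_L2 (G w)))\<^sup>2)"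
  proof (rule integrableI_bounded)
    have [measurable]: "(\<lambda>w. to_L2 (G w)) \<in> borel_measurable white_noise" by (rule L2_process_measurable[OF G(1)])
    show "(\<lambda>w. (norm (to_L2 (G w)))\<^sup>2) \<in> borel_measurable white_noise" by measurable
    have "(\<integral>\<^sup>+w. ennreal ((norm (to_L2 (G w)))\<^sup>2) \<partial>white_noise) = (\<integral>\<^sup>+t. (\<integral>\<^sup>+w. ennreal ((G w t)\<^sup>2) \<partial>white_noise) \<partial>I01)"
      using nn_integral_norm_process[OF prob_space_white_noise G(1), of "\<lambda>_. 1"] by simp
    also have "\<dots> = (\<integral>\<^sup>+t. ennreal (?q t) \<partial>I01)"
    proof (rule nn_integral_cong)
      fix t assume "t \<in> space I01"
      then have t: "t \<in> {0..1}" by simp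
      show "(\<integral>\<^sup>+w. ennreal ((G w t)\<^sup>2) \<partial>white_noise) = ennreal (?q t)"
        using Gcov[OF t t] Gsq[OF t] by (simp add: nn_integral_eq_integral power2_eq_square)
    qed
    finally show "(\<integral>\<^sup>+w. ennreal (norm ((norm (to_L2 (G w)))\<^sup>2)) \<partial>white_noise) < \<infinity>"
      using qn fin by simp
  qed
  have "WN.expectation (\<lambda>w. cos (inner (to_L2 (G w)) h + \<theta>)) = exp (- (\<integral>\<omega>. (inner (to_L2 (U \<omega>)) h)\<^sup>2 \<partial>M) / 2) * cos \<theta>" for h \<theta>
  proof -
    obtain f where f: "sq_int f" "h = to_L2 f" by (rule to_L2_cases)
    obtain c where c: "gauss_lim c (\<lambda>w. inner (to_L2 (G w)) (to_L2 f))" using G(3)[OF f(1)] ..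
    have "ip white_noise (\<lambda>w. inner (to_L2 (G w)) (to_L2 f)) (\<lambda>w. inner (to_L2 (G w)) (to_L2 f)) =
        WN.expectation (\<lambda>w. (inner (to_L2 (G w)) (to_L2 f))\<^sup>2)"
      by (simp add: ip_def power2_eq_square)
    also have "\<dots> = (\<integral>s. f s * (\<integral>t. f t * WN.expectation (\<lambda>w. G w s * G w t) \<partial>I01) \<partial>I01)"
      by (rule inner_square_expectation(2)[OF prob_space_white_noise G(1) f(1) Gn Gsq])
    also have "\<dots> = (\<integral>s. f s * (\<integral>t. f t * (\<integral>\<omega>. U \<omega> s * U \<omega> t \<partial>M) \<partial>I01) \<partial>I01)"
      by (intro Bochner_Integration.integral_cong refl arg_cong2[where f = "(*)"]) (simp add: Gcov)
    also have "\<dots> = (\<integral>\<omega>. (inner (to_L2 (U \<omega>)) (to_L2 f))\<^sup>2 \<partial>M)"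
      by (rule inner_square_expectation(2)[OF M U f(1) nsq sq, symmetric])
    finally show ?thesis using gauss_lim_cos[OF c, of \<theta>] f(2) by simp
  qed
  then show ?thesis using that G(1,2) by blast
qed

lemma borel_measurable_vec_nth' [measurable]: "(\<lambda>v :: real ^ 'p. v $ j) \<in> borel_measurable borel"
  by (intro borel_measurable_continuous_onI continuous_intros)

lemma inner_vec_sum: "inner (u :: real ^ 'p) v = (\<Sum>j\<in>UNIV. u $ j * v $ j)"
  by (simp add: inner_vec_def)

text \<open>The model for a single observation, so that its moment identities can be instantiated at
  any index of the sample.\<close>

locale missing_at_random = prob_space M for M :: "'a measure" +
  fixes Y \<epsilon> :: "'a \<Rightarrow> real \<Rightarrow> real" and x :: "'a \<Rightarrow> real ^ 'p" and Z :: "'a \<Rightarrow> real"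
    and \<beta> :: "real \<Rightarrow> real ^ 'p" and \<mu> :: "real ^ 'p" and \<sigma> :: "real \<Rightarrow> real \<Rightarrow> real"
  assumes Y_process: "L2_process M Y" and eps_process: "L2_process M \<epsilon>"
    and x_meas [measurable]: "x \<in> borel_measurable M" and Z_meas [measurable]: "Z \<in> borel_measurable M"
    and Z_01: "\<And>\<omega>. \<omega> \<in> space M \<Longrightarrow> Z \<omega> \<in> {0, 1}"
    and Y_int: "\<And>t. t \<in> {0..1} \<Longrightarrow> integrable M (\<lambda>\<omega>. Y \<omega> t)"
    and x_sq: "integrable M (\<lambda>\<omega>. (norm (x \<omega>))\<^sup>2)" and x_mean: "expectation x = \<mu>"
    and MAR: "AE \<omega> in M.
           real_cond_exp M (gen_by M (\<lambda>\<omega>. (x \<omega>, to_L2 (Y \<omega>))) (borel \<Otimes>\<^sub>M borel))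
             (indicat_real {\<omega> \<in> space M. Z \<omega> = 1}) \<omega> =
           real_cond_exp M (gen_by M x borel) (indicat_real {\<omega> \<in> space M. Z \<omega> = 1}) \<omega>"
    and beta_L2: "\<And>j. sq_int (\<lambda>t. \<beta> t $ j)"
    and model: "\<And>\<omega> t. \<omega> \<in> space M \<Longrightarrow> t \<in> {0..1} \<Longrightarrow> Y \<omega> t = inner (x \<omega>) (\<beta> t) + \<epsilon> \<omega> t"
    and correct: "\<And>t. t \<in> {0..1} \<Longrightarrow>
           AE \<omega> in M. real_cond_exp M (gen_by M x borel) (\<lambda>\<omega>. Y \<omega> t) \<omega> = inner (x \<omega>) (\<beta> t)"
    and eps_sq: "integrable M (\<lambda>\<omega>. (norm (to_L2 (\<epsilon> \<omega>)))\<^sup>2)"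
    and eps_var: "\<And>t. t \<in> {0..1} \<Longrightarrow> integrable M (\<lambda>\<omega>. (\<epsilon> \<omega> t)\<^sup>2)"
    and eps_cov: "\<And>s t. s \<in> {0..1} \<Longrightarrow> t \<in> {0..1} \<Longrightarrow> expectation (\<lambda>\<omega>. \<epsilon> \<omega> s * \<epsilon> \<omega> t) = \<sigma> s t"
    and eps_cond_cov: "\<And>s t. s \<in> {0..1} \<Longrightarrow> t \<in> {0..1} \<Longrightarrow>
           AE \<omega> in M. real_cond_exp M (gen_by M x borel) (\<lambda>\<omega>. \<epsilon> \<omega> s * \<epsilon> \<omega> t) \<omega> = \<sigma> s t"
begin

section \<open>Conditioning on the covariates and on the class of the response\<close>

abbreviation "Fx \<equiv> gen_by M x borel"
abbreviation "Fxy \<equiv> gen_by M (\<lambda>\<omega>. (x \<omega>, to_L2 (Y \<omega>))) (borel \<Otimes>\<^sub>M borel)"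
abbreviation "eL \<omega> \<equiv> to_L2 (\<epsilon> \<omega>)"

definition bL :: "'p \<Rightarrow> L2" where
  "bL j = to_L2 (\<lambda>t. \<beta> t $ j)"

text \<open>The conditional probability of being observed. The absolute value makes it nonnegative
  at every point instead of almost everywhere, so that its root can be taken, and preserves
  measurability with respect to \<open>Fx\<close>.\<close>

definition propensity :: "'a \<Rightarrow> real" where
  "propensity \<omega> = \<bar>real_cond_exp M Fx (indicat_real {\<omega> \<in> space M. Z \<omega> = 1}) \<omega>\<bar>"

lemma YL_meas [measurable]: "(\<lambda>\<omega>. to_L2 (Y \<omega>)) \<in> borel_measurable M"
  by (rule L2_process_measurable[OF Y_process])

lemma eL_meas [measurable]: "eL \<in> borel_measurable M"
  by (rule L2_process_measurable[OF eps_process])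

lemma eps_sq_int: "\<omega> \<in> space M \<Longrightarrow> sq_int (\<epsilon> \<omega>)"
  using eps_process by (simp add: L2_process_def)

lemma eps_section [measurable]: "t \<in> {0..1} \<Longrightarrow> (\<lambda>\<omega>. \<epsilon> \<omega> t) \<in> borel_measurable M"
  by (rule L2_process_section[OF eps_process])

lemma pair_meas: "(\<lambda>\<omega>. (x \<omega>, to_L2 (Y \<omega>))) \<in> measurable M (borel \<Otimes>\<^sub>M borel)"
  by measurable

lemma sigma_finite_subalgebra_gen_by:
  assumes "X \<in> measurable M K"
  shows "sigma_finite_subalgebra M (gen_by M X K)"
  by (intro finite_measure_subalgebra_is_sigma_finite finite_measure_subalgebra.intro
      finite_measure_subalgebra_axioms.intro finite_measure_axioms subalgebra_gen_by assms)

lemmas Fx = sigma_finite_subalgebra_gen_by[OF x_meas]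
lemmas Fxy = sigma_finite_subalgebra_gen_by[OF pair_meas]

lemma meas_Fx: "w \<in> measurable borel L \<Longrightarrow> (\<lambda>\<omega>. w (x \<omega>)) \<in> measurable Fx L"
  by (rule measurable_gen_by[OF x_meas])

lemma meas_Fxy: "w \<in> measurable (borel \<Otimes>\<^sub>M borel) L \<Longrightarrow> (\<lambda>\<omega>. w (x \<omega>, to_L2 (Y \<omega>))) \<in> measurable Fxy L"
  by (rule measurable_gen_by[OF pair_meas])

lemma meas_Fx_M: "w \<in> measurable Fx L \<Longrightarrow> w \<in> measurable M L"
  by (rule measurable_from_subalg[OF subalgebra_gen_by[OF x_meas]])

lemma propensity_Fx [measurable]: "propensity \<in> borel_measurable Fx"
  unfolding propensity_def[abs_def] by measurable

lemma propensity_M [measurable]: "propensity \<in> borel_measurable M"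
  by (rule meas_Fx_M[OF propensity_Fx])

lemma propensity_nonneg: "0 \<le> propensity \<omega>"
  by (simp add: propensity_def)

lemma Z_nonneg: "\<omega> \<in> space M \<Longrightarrow> 0 \<le> Z \<omega>"
  using Z_01[of \<omega>] by auto

lemma indicator_Z: "\<omega> \<in> space M \<Longrightarrow> indicat_real {\<omega> \<in> space M. Z \<omega> = 1} \<omega> = Z \<omega>"
  using Z_01[of \<omega>] by auto

lemma indicator_meas [measurable]: "indicat_real {\<omega> \<in> space M. Z \<omega> = 1} \<in> borel_measurable M"
  by measurable

lemma AE_propensity:
  "AE \<omega> in M. real_cond_exp M Fxy (indicat_real {\<omega> \<in> space M. Z \<omega> = 1}) \<omega> = propensity \<omega>"
proof -
  interpret Fx: sigma_finite_subalgebra M Fx by (rule Fx)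
  have "AE \<omega> in M. 0 \<le> real_cond_exp M Fx (indicat_real {\<omega> \<in> space M. Z \<omega> = 1}) \<omega>"
    by (rule Fx.real_cond_exp_pos) auto
  with MAR show ?thesis by eventually_elim (simp add: propensity_def)
qed

text \<open>Missingness at random as an identity of integrals: the conditional expectation of the
  indicator given \<open>Fxy\<close> is already a function of x, and it may replace the indicator
  against any \<open>Fxy\<close>-measurable weight.\<close>

lemma nn_integral_Z:
  assumes w: "w \<in> borel_measurable Fxy"
  shows "(\<integral>\<^sup>+\<omega>. w \<omega> * ennreal (Z \<omega>) \<partial>M) = (\<integral>\<^sup>+\<omega>. w \<omega> * ennreal (propensity \<omega>) \<partial>M)"
proof -
  interpret Fxy: sigma_finite_subalgebra M Fxy by (rule Fxy)
  have "(\<integral>\<^sup>+\<omega>. w \<omega> * ennreal (Z \<omega>) \<partial>M) = (\<integral>\<^sup>+\<omega>. w \<omega> * ennreal (indicat_real {\<omega> \<in> space M. Z \<omega> = 1} \<omega>) \<partial>M)"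
    by (intro nn_integral_cong) (simp only: indicator_Z)
  also have "\<dots> = (\<integral>\<^sup>+\<omega>. w \<omega> * ennreal (propensity \<omega>) \<partial>M)"
    by (rule Fxy.nn_integral_cond_exp[OF indicator_meas _ _ AE_propensity w])
      (auto intro!: integrable_real_indicator simp: emeasure_eq_measure)
  finally show ?thesis .
qed

lemma integral_Z:
  assumes w: "w \<in> borel_measurable Fxy" and int: "integrable M (\<lambda>\<omega>. w \<omega> * Z \<omega>)"
  shows "integrable M (\<lambda>\<omega>. w \<omega> * propensity \<omega>)"
    and "expectation (\<lambda>\<omega>. w \<omega> * Z \<omega>) = expectation (\<lambda>\<omega>. w \<omega> * propensity \<omega>)"
proof -
  interpret Fxy: sigma_finite_subalgebra M Fxy by (rule Fxy)
  let ?I = "indicat_real {\<omega> \<in> space M. Z \<omega> = 1}"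
  have [measurable]: "w \<in> borel_measurable M" by (rule measurable_from_subalg[OF subalgebra_gen_by[OF pair_meas] w])
  have i: "integrable M (\<lambda>\<omega>. w \<omega> * ?I \<omega>)"
    using int by (subst Bochner_Integration.integrable_cong[OF refl, of _ _ "\<lambda>\<omega>. w \<omega> * Z \<omega>"]) (simp_all only: indicator_Z)
  note c = Fxy.real_cond_exp_intg[OF i w indicator_meas]
  have ae: "AE \<omega> in M. w \<omega> * real_cond_exp M Fxy ?I \<omega> = w \<omega> * propensity \<omega>"
    using AE_propensity by eventually_elim simp
  show "integrable M (\<lambda>\<omega>. w \<omega> * propensity \<omega>)"
    by (rule integrable_cong_AE_imp[OF c(1) _ ae]) measurable
  have "expectation (\<lambda>\<omega>. w \<omega> * Z \<omega>) = expectation (\<lambda>\<omega>. w \<omega> * ?I \<omega>)"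
    by (intro Bochner_Integration.integral_cong refl) (simp only: indicator_Z)
  also have "\<dots> = expectation (\<lambda>\<omega>. w \<omega> * propensity \<omega>)"
    unfolding c(2)[symmetric] by (intro integral_cong_AE ae) measurable
  finally show "expectation (\<lambda>\<omega>. w \<omega> * Z \<omega>) = expectation (\<lambda>\<omega>. w \<omega> * propensity \<omega>)" .
qed

lemma nn_integral_eps:
  assumes w: "w \<in> borel_measurable Fx" and t: "t \<in> {0..1}"
  shows "(\<integral>\<^sup>+\<omega>. w \<omega> * ennreal ((\<epsilon> \<omega> t)\<^sup>2) \<partial>M) = (\<integral>\<^sup>+\<omega>. w \<omega> * ennreal (\<sigma> t t) \<partial>M)"
proof -
  interpret Fx: sigma_finite_subalgebra M Fx by (rule Fx)
  show ?thesis
  proof (rule Fx.nn_integral_cond_exp[OF _ _ eps_var[OF t] _ w])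
    show "(\<lambda>\<omega>. (\<epsilon> \<omega> t)\<^sup>2) \<in> borel_measurable M" using t by measurable
    show "AE \<omega> in M. real_cond_exp M Fx (\<lambda>\<omega>. (\<epsilon> \<omega> t)\<^sup>2) \<omega> = \<sigma> t t"
      using eps_cond_cov[OF t t] by (simp add: power2_eq_square)
  qed simp
qed

lemma integral_eps_eps:
  assumes w: "w \<in> borel_measurable Fx" and s: "s \<in> {0..1}" and t: "t \<in> {0..1}"
    and int: "integrable M (\<lambda>\<omega>. w \<omega> * (\<epsilon> \<omega> s * \<epsilon> \<omega> t))"
  shows "expectation (\<lambda>\<omega>. w \<omega> * (\<epsilon> \<omega> s * \<epsilon> \<omega> t)) = expectation w * \<sigma> s t"
proof -
  interpret Fx: sigma_finite_subalgebra M Fx by (rule Fx)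
  have m [measurable]: "(\<lambda>\<omega>. \<epsilon> \<omega> s * \<epsilon> \<omega> t) \<in> borel_measurable M" using s t by measurable
  have [measurable]: "w \<in> borel_measurable M" by (rule meas_Fx_M[OF w])
  have "expectation (\<lambda>\<omega>. w \<omega> * (\<epsilon> \<omega> s * \<epsilon> \<omega> t)) = expectation (\<lambda>\<omega>. w \<omega> * real_cond_exp M Fx (\<lambda>\<omega>. \<epsilon> \<omega> s * \<epsilon> \<omega> t) \<omega>)"
    by (rule Fx.real_cond_exp_intg(2)[OF int w m, symmetric])
  also have "\<dots> = expectation (\<lambda>\<omega>. w \<omega> * \<sigma> s t)"
    using eps_cond_cov[OF s t] by (intro integral_cong_AE) auto
  finally show ?thesis by simp
qed

lemma x_component_sqi: "sqi M (\<lambda>\<omega>. x \<omega> $ j)"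
  unfolding sqi_def
proof
  show "integrable M (\<lambda>\<omega>. (x \<omega> $ j)\<^sup>2)"
  proof (rule Bochner_Integration.integrable_bound[OF x_sq])
    show "AE \<omega> in M. norm ((x \<omega> $ j)\<^sup>2) \<le> norm ((norm (x \<omega>))\<^sup>2)"
      using component_le_norm_cart[of _ j] by (auto simp: abs_le_square_iff[symmetric])
  qed measurable
qed measurable

lemma x_inner_sqi: "sqi M (\<lambda>\<omega>. inner (x \<omega>) a)"
  unfolding inner_vec_sum
  by (intro sqi_sum) (auto simp: mult.commute[of _ "a $ _"] intro!: sqi_scale x_component_sqi)

lemma AE_cond_eps_zero:
  assumes t: "t \<in> {0..1}"
  shows "AE \<omega> in M. real_cond_exp M Fx (\<lambda>\<omega>. \<epsilon> \<omega> t) \<omega> = 0"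
proof -
  interpret Fx: sigma_finite_subalgebra M Fx by (rule Fx)
  have xb: "integrable M (\<lambda>\<omega>. inner (x \<omega>) (\<beta> t))" by (rule integrable_of_sqi[OF x_inner_sqi])
  have Ym: "(\<lambda>\<omega>. Y \<omega> t) \<in> borel_measurable M" by (rule L2_process_section[OF Y_process t])
  have "AE \<omega> in M. real_cond_exp M Fx (\<lambda>\<omega>. \<epsilon> \<omega> t) \<omega> = real_cond_exp M Fx (\<lambda>\<omega>. Y \<omega> t - inner (x \<omega>) (\<beta> t)) \<omega>"
  proof (rule Fx.real_cond_exp_cong)
    show "AE \<omega> in M. \<epsilon> \<omega> t = Y \<omega> t - inner (x \<omega>) (\<beta> t)" using model[OF _ t] by (intro AE_I2) simp
    show "(\<lambda>\<omega>. \<epsilon> \<omega> t) \<in> borel_measurable M" using t by measurable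
    show "(\<lambda>\<omega>. Y \<omega> t - inner (x \<omega>) (\<beta> t)) \<in> borel_measurable M" using Ym by measurable
  qed
  moreover have "AE \<omega> in M. real_cond_exp M Fx (\<lambda>\<omega>. Y \<omega> t - inner (x \<omega>) (\<beta> t)) \<omega> =
      real_cond_exp M Fx (\<lambda>\<omega>. Y \<omega> t) \<omega> - real_cond_exp M Fx (\<lambda>\<omega>. inner (x \<omega>) (\<beta> t)) \<omega>"
    by (rule Fx.real_cond_exp_diff[OF Y_int[OF t] xb])
  moreover have "AE \<omega> in M. real_cond_exp M Fx (\<lambda>\<omega>. inner (x \<omega>) (\<beta> t)) \<omega> = inner (x \<omega>) (\<beta> t)"
    by (rule Fx.real_cond_exp_F_meas[OF xb]) (rule meas_Fx, measurable)
  ultimately show ?thesis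
    using correct[OF t] by eventually_elim simp
qed

text \<open>Integrability is not among the premises because the lemma is applied at every t under an
  integral; in the non-integrable case the integral is 0 by convention.\<close>

lemma integral_eps_zero:
  assumes w: "w \<in> borel_measurable Fx" and t: "t \<in> {0..1}"
  shows "expectation (\<lambda>\<omega>. w \<omega> * \<epsilon> \<omega> t) = 0"
proof (cases "integrable M (\<lambda>\<omega>. w \<omega> * \<epsilon> \<omega> t)")
  case True
  interpret Fx: sigma_finite_subalgebra M Fx by (rule Fx)
  have m [measurable]: "(\<lambda>\<omega>. \<epsilon> \<omega> t) \<in> borel_measurable M" using t by measurable
  have [measurable]: "w \<in> borel_measurable M" by (rule meas_Fx_M[OF w])
  have "expectation (\<lambda>\<omega>. w \<omega> * \<epsilon> \<omega> t) = expectation (\<lambda>\<omega>. w \<omega> * real_cond_exp M Fx (\<lambda>\<omega>. \<epsilon> \<omega> t) \<omega>)"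
    by (rule Fx.real_cond_exp_intg(2)[OF True w m, symmetric])
  also have "\<dots> = expectation (\<lambda>\<omega>. 0)"
    using AE_cond_eps_zero[OF t] by (intro integral_cong_AE) auto
  finally show ?thesis by simp
qed (simp add: not_integrable_integral_eq)

text \<open>As an element of \<open>L2\<close> the residual is a function of x and the class of Y.
  This makes it measurable with respect to \<open>Fxy\<close>, and later a function of the
  independent observations; its value at a fixed t need not have either property.\<close>

lemma eL_eq: "\<omega> \<in> space M \<Longrightarrow> eL \<omega> = to_L2 (Y \<omega>) - (\<Sum>j\<in>UNIV. x \<omega> $ j *\<^sub>R bL j)"
proof -
  assume w: "\<omega> \<in> space M"
  have Yw: "sq_int (Y \<omega>)" using Y_process w by (simp add: L2_process_def)
  have s: "sq_int (\<lambda>t. \<Sum>j\<in>UNIV. x \<omega> $ j * \<beta> t $ j)" by (intro sq_int_sum sq_int_scale beta_L2)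
  have "eL \<omega> = to_L2 (\<lambda>t. Y \<omega> t - (\<Sum>j\<in>UNIV. x \<omega> $ j * \<beta> t $ j))"
    by (rule to_L2_cong) (use model[OF w] eps_sq_int[OF w] in \<open>auto simp: inner_vec_sum\<close>)
  also have "\<dots> = to_L2 (Y \<omega>) - to_L2 (\<lambda>t. \<Sum>j\<in>UNIV. x \<omega> $ j * \<beta> t $ j)"
    by (rule to_L2_diff[OF Yw s])
  also have "to_L2 (\<lambda>t. \<Sum>j\<in>UNIV. x \<omega> $ j * \<beta> t $ j) = (\<Sum>j\<in>UNIV. to_L2 (\<lambda>t. x \<omega> $ j * \<beta> t $ j))"
    by (intro to_L2_sum sq_int_scale beta_L2)
  also have "\<dots> = (\<Sum>j\<in>UNIV. x \<omega> $ j *\<^sub>R bL j)"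
    by (intro sum.cong refl) (simp add: bL_def to_L2_scale beta_L2)
  finally show ?thesis .
qed

lemma eL_Fxy [measurable]: "eL \<in> borel_measurable Fxy"
proof -
  have "(\<lambda>p. snd p - (\<Sum>j\<in>UNIV. (fst p :: real ^ 'p) $ j *\<^sub>R bL j)) \<in> borel_measurable (borel \<Otimes>\<^sub>M borel)"
    by measurable
  from meas_Fxy[OF this]
  have "(\<lambda>\<omega>. to_L2 (Y \<omega>) - (\<Sum>j\<in>UNIV. x \<omega> $ j *\<^sub>R bL j)) \<in> borel_measurable Fxy" by simp
  then show ?thesis
    by (subst measurable_cong[where g = "\<lambda>\<omega>. to_L2 (Y \<omega>) - (\<Sum>j\<in>UNIV. x \<omega> $ j *\<^sub>R bL j)"])
      (auto simp: eL_eq gen_by_def)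
qed

lemma x_Fxy [measurable]: "x \<in> borel_measurable Fxy"
  using meas_Fxy[OF measurable_fst] by simp

lemma x_Fx [measurable]: "x \<in> borel_measurable Fx"
  using meas_Fx[of "\<lambda>v. v"] by simp

lemma eL_norm_sqi: "sqi M (\<lambda>\<omega>. norm (eL \<omega>))"
  using eps_sq by (simp add: sqi_def)

text \<open>The indicator is exchanged for the propensity while the residual enters by its norm. The
  weight now depends on x alone, so Tonelli's theorem and conditioning on x at each fixed t split
  off the factor \<open>\<sigma> t t\<close>; finally the propensity is exchanged back.\<close>

lemma nn_integral_Z_eL:
  assumes w [measurable]: "w \<in> borel_measurable borel"
  shows "(\<integral>\<^sup>+\<omega>. w (x \<omega>) * ennreal ((norm (eL \<omega>))\<^sup>2) * ennreal (Z \<omega>) \<partial>M) =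
    (\<integral>\<^sup>+\<omega>. ennreal ((norm (eL \<omega>))\<^sup>2) \<partial>M) * (\<integral>\<^sup>+\<omega>. w (x \<omega>) * ennreal (Z \<omega>) \<partial>M)"
proof -
  have var: "(\<integral>\<^sup>+\<omega>. ennreal ((norm (eL \<omega>))\<^sup>2) \<partial>M) = (\<integral>\<^sup>+t. ennreal (\<sigma> t t) \<partial>I01)"
  proof -
    have "(\<integral>\<^sup>+\<omega>. ennreal ((norm (eL \<omega>))\<^sup>2) \<partial>M) = (\<integral>\<^sup>+t. (\<integral>\<^sup>+\<omega>. 1 * ennreal ((\<epsilon> \<omega> t)\<^sup>2) \<partial>M) \<partial>I01)"
      using nn_integral_norm_process[OF prob_space_axioms eps_process, of "\<lambda>_. 1"] by simp
    also have "\<dots> = (\<integral>\<^sup>+t. ennreal (\<sigma> t t) \<partial>I01)"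
    proof (rule nn_integral_cong)
      fix t assume "t \<in> space I01"
      then have "t \<in> {0..1}" by simp
      from nn_integral_eps[of "\<lambda>_. 1", OF _ this]
      show "(\<integral>\<^sup>+\<omega>. 1 * ennreal ((\<epsilon> \<omega> t)\<^sup>2) \<partial>M) = ennreal (\<sigma> t t)" by (simp add: emeasure_space_1)
    qed
    finally show ?thesis .
  qed
  have wF: "(\<lambda>\<omega>. w (x \<omega>) * ennreal (propensity \<omega>)) \<in> borel_measurable Fx" by measurable
  have wM: "(\<lambda>\<omega>. w (x \<omega>) * ennreal (propensity \<omega>)) \<in> borel_measurable M" by measurable
  have wxy: "(\<lambda>\<omega>. w (x \<omega>)) \<in> borel_measurable Fxy" by measurable
  let ?k = "\<integral>\<^sup>+\<omega>. w (x \<omega>) * ennreal (propensity \<omega>) \<partial>M"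
  have "(\<integral>\<^sup>+\<omega>. w (x \<omega>) * ennreal ((norm (eL \<omega>))\<^sup>2) * ennreal (Z \<omega>) \<partial>M) =
      (\<integral>\<^sup>+\<omega>. w (x \<omega>) * ennreal ((norm (eL \<omega>))\<^sup>2) * ennreal (propensity \<omega>) \<partial>M)"
    by (rule nn_integral_Z) measurable
  also have "\<dots> = (\<integral>\<^sup>+\<omega>. w (x \<omega>) * ennreal (propensity \<omega>) * ennreal ((norm (eL \<omega>))\<^sup>2) \<partial>M)"
    by (simp only: mult_ac)
  also have "\<dots> = (\<integral>\<^sup>+t. (\<integral>\<^sup>+\<omega>. w (x \<omega>) * ennreal (propensity \<omega>) * ennreal ((\<epsilon> \<omega> t)\<^sup>2) \<partial>M) \<partial>I01)"
    by (rule nn_integral_norm_process[OF prob_space_axioms eps_process wM])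
  also have "\<dots> = (\<integral>\<^sup>+t. ?k * ennreal (\<sigma> t t) \<partial>I01)"
  proof (rule nn_integral_cong)
    fix t assume "t \<in> space I01"
    then have t: "t \<in> {0..1}" by simp
    show "(\<integral>\<^sup>+\<omega>. w (x \<omega>) * ennreal (propensity \<omega>) * ennreal ((\<epsilon> \<omega> t)\<^sup>2) \<partial>M) = ?k * ennreal (\<sigma> t t)"
      unfolding nn_integral_eps[OF wF t] by (rule nn_integral_multc[OF wM])
  qed
  also have "\<dots> = ?k * (\<integral>\<^sup>+t. ennreal (\<sigma> t t) \<partial>I01)"
  proof (rule nn_integral_cmult)
    have em: "(\<lambda>p. \<epsilon> (snd p) (fst p)) \<in> borel_measurable (I01 \<Otimes>\<^sub>M M)"
      using measurable_compose[OF measurable_pair_swap', of "case_prod \<epsilon>" M I01 borel] eps_process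
      by (simp add: split_beta' L2_process_def)
    then have "(\<lambda>t. expectation (\<lambda>\<omega>. \<epsilon> \<omega> t * \<epsilon> \<omega> t)) \<in> borel_measurable I01" by measurable
    \<comment> \<open>\<open>\<sigma>\<close> is given by its values only; its diagonal is
      measurable as the second moment of a jointly measurable process.\<close>
    then have "(\<lambda>t. \<sigma> t t) \<in> borel_measurable I01"
      by (subst measurable_cong[where g = "\<lambda>t. expectation (\<lambda>\<omega>. \<epsilon> \<omega> t * \<epsilon> \<omega> t)"]) (auto simp: eps_cov)
    then show "(\<lambda>t. ennreal (\<sigma> t t)) \<in> borel_measurable I01" by measurable
  qed
  also have "?k = (\<integral>\<^sup>+\<omega>. w (x \<omega>) * ennreal (Z \<omega>) \<partial>M)" by (rule nn_integral_Z[OF wxy, symmetric])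
  finally show ?thesis by (simp add: var mult.commute)
qed

text \<open>Separate second moments of \<open>w (x \<omega>)\<close> and of the residual suffice,
  because the conditional covariance is constant in x and the second moment of the product
  factorizes.\<close>

lemma Z_eL_sqi:
  assumes w [measurable]: "w \<in> borel_measurable borel" and sq: "sqi M (\<lambda>\<omega>. w (x \<omega>))"
  shows "sqi M (\<lambda>\<omega>. w (x \<omega>) * Z \<omega> * norm (eL \<omega>))"
  unfolding sqi_def
proof
  show "integrable M (\<lambda>\<omega>. (w (x \<omega>) * Z \<omega> * norm (eL \<omega>))\<^sup>2)"
  proof (rule integrableI_bounded)
    have "(\<integral>\<^sup>+\<omega>. ennreal (norm ((w (x \<omega>) * Z \<omega> * norm (eL \<omega>))\<^sup>2)) \<partial>M) =
        (\<integral>\<^sup>+\<omega>. ennreal ((w (x \<omega>))\<^sup>2) * ennreal ((norm (eL \<omega>))\<^sup>2) * ennreal (Z \<omega>) \<partial>M)"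
    proof (rule nn_integral_cong)
      fix \<omega> assume w: "\<omega> \<in> space M"
      have "(w (x \<omega>) * Z \<omega> * norm (eL \<omega>))\<^sup>2 = (w (x \<omega>))\<^sup>2 * (norm (eL \<omega>))\<^sup>2 * Z \<omega>"
        using Z_01[OF w] by (auto simp: power_mult_distrib)
      then show "ennreal (norm ((w (x \<omega>) * Z \<omega> * norm (eL \<omega>))\<^sup>2)) =
          ennreal ((w (x \<omega>))\<^sup>2) * ennreal ((norm (eL \<omega>))\<^sup>2) * ennreal (Z \<omega>)"
        using Z_nonneg[OF w] by (simp add: ennreal_mult[symmetric])
    qed
    also have "\<dots> = (\<integral>\<^sup>+\<omega>. ennreal ((norm (eL \<omega>))\<^sup>2) \<partial>M) * (\<integral>\<^sup>+\<omega>. ennreal ((w (x \<omega>))\<^sup>2) * ennreal (Z \<omega>) \<partial>M)"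
      by (rule nn_integral_Z_eL) measurable
    also have "\<dots> \<le> (\<integral>\<^sup>+\<omega>. ennreal ((norm (eL \<omega>))\<^sup>2) \<partial>M) * (\<integral>\<^sup>+\<omega>. ennreal ((w (x \<omega>))\<^sup>2) \<partial>M)"
    proof (intro mult_left_mono nn_integral_mono)
      fix \<omega> assume "\<omega> \<in> space M"
      then have "Z \<omega> \<le> 1" using Z_01[of \<omega>] by auto
      then have "ennreal (Z \<omega>) \<le> 1" by (simp add: ennreal_le_1)
      then show "ennreal ((w (x \<omega>))\<^sup>2) * ennreal (Z \<omega>) \<le> ennreal ((w (x \<omega>))\<^sup>2)"
        using mult_left_mono[of "ennreal (Z \<omega>)" 1 "ennreal ((w (x \<omega>))\<^sup>2)"] by simp
    qed simp
    also have "\<dots> < \<infinity>"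
      unfolding ip_ennreal[OF eL_norm_sqi] ip_ennreal[OF sq] by (simp add: ennreal_mult_less_top)
    finally show "(\<integral>\<^sup>+\<omega>. ennreal (norm ((w (x \<omega>) * Z \<omega> * norm (eL \<omega>))\<^sup>2)) \<partial>M) < \<infinity>" .
  qed measurable
qed measurable

text \<open>The same route as for second moments: indicator to propensity in \<open>L2\<close>, then
  Fubini's theorem, then conditional mean zero at each t. The premise provides the absolute moment
  for Fubini's theorem.\<close>

lemma expectation_Z_eL:
  assumes w [measurable]: "w \<in> borel_measurable borel"
    and int: "integrable M (\<lambda>\<omega>. w (x \<omega>) * Z \<omega> * norm (eL \<omega>))"
  shows "integrable M (\<lambda>\<omega>. w (x \<omega>) * Z \<omega> * inner (eL \<omega>) h)"
    and "expectation (\<lambda>\<omega>. w (x \<omega>) * Z \<omega> * inner (eL \<omega>) h) = 0"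
proof -
  obtain f where f: "sq_int f" "h = to_L2 f" by (rule to_L2_cases)
  show i: "integrable M (\<lambda>\<omega>. w (x \<omega>) * Z \<omega> * inner (eL \<omega>) h)"
  proof (rule Bochner_Integration.integrable_bound[OF integrable_mult_left[OF int, of "norm h"]])
    show "AE \<omega> in M. norm (w (x \<omega>) * Z \<omega> * inner (eL \<omega>) h) \<le> norm (w (x \<omega>) * Z \<omega> * norm (eL \<omega>) * norm h)"
      by (intro AE_I2) (auto simp: abs_mult mult.assoc intro!: mult_left_mono Cauchy_Schwarz_ineq2)
  qed measurable
  have wm: "(\<lambda>\<omega>. w (x \<omega>) * norm (eL \<omega>)) \<in> borel_measurable Fxy" "(\<lambda>\<omega>. w (x \<omega>) * inner (eL \<omega>) h) \<in> borel_measurable Fxy"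
    by measurable
  have i1: "integrable M (\<lambda>\<omega>. w (x \<omega>) * norm (eL \<omega>) * Z \<omega>)" using int by (simp add: mult_ac)
  have i2: "integrable M (\<lambda>\<omega>. w (x \<omega>) * inner (eL \<omega>) h * Z \<omega>)" using i by (simp add: mult_ac)
  have "expectation (\<lambda>\<omega>. w (x \<omega>) * Z \<omega> * inner (eL \<omega>) h) = expectation (\<lambda>\<omega>. w (x \<omega>) * inner (eL \<omega>) h * Z \<omega>)"
    by (simp add: mult_ac)
  also have "\<dots> = expectation (\<lambda>\<omega>. w (x \<omega>) * propensity \<omega> * inner (eL \<omega>) (to_L2 f))"
    unfolding integral_Z(2)[OF wm(2) i2] f(2)[symmetric] by (simp add: mult_ac)
  also have "\<dots> = (\<integral>t. f t * expectation (\<lambda>\<omega>. w (x \<omega>) * propensity \<omega> * \<epsilon> \<omega> t) \<partial>I01)"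
  proof (rule integral_inner_process(2)[OF prob_space_axioms eps_process f(1)])
    show "integrable M (\<lambda>\<omega>. w (x \<omega>) * propensity \<omega> * norm (eL \<omega>))"
      using integral_Z(1)[OF wm(1) i1] by (simp add: mult_ac)
  qed measurable
  also have "\<dots> = (\<integral>t. 0 \<partial>I01)"
  proof (rule Bochner_Integration.integral_cong[OF refl])
    fix t assume "t \<in> space I01"
    then have t: "t \<in> {0..1}" by simp
    have "(\<lambda>\<omega>. w (x \<omega>) * propensity \<omega>) \<in> borel_measurable Fx" by measurable
    from integral_eps_zero[OF this t]
    show "f t * expectation (\<lambda>\<omega>. w (x \<omega>) * propensity \<omega> * \<epsilon> \<omega> t) = 0" by simp
  qed
  finally show "expectation (\<lambda>\<omega>. w (x \<omega>) * Z \<omega> * inner (eL \<omega>) h) = 0" by simp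
qed

lemma expectation_eL:
  assumes w [measurable]: "w \<in> borel_measurable borel"
    and int: "integrable M (\<lambda>\<omega>. w (x \<omega>) * norm (eL \<omega>))"
  shows "integrable M (\<lambda>\<omega>. w (x \<omega>) * inner (eL \<omega>) h)"
    and "expectation (\<lambda>\<omega>. w (x \<omega>) * inner (eL \<omega>) h) = 0"
proof -
  obtain f where f: "sq_int f" "h = to_L2 f" by (rule to_L2_cases)
  have wM: "(\<lambda>\<omega>. w (x \<omega>)) \<in> borel_measurable M" by measurable
  have wF: "(\<lambda>\<omega>. w (x \<omega>)) \<in> borel_measurable Fx" by measurable
  note i = integral_inner_process[OF prob_space_axioms eps_process f(1) wM int]
  show "integrable M (\<lambda>\<omega>. w (x \<omega>) * inner (eL \<omega>) h)" using i(1) f(2) by simp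
  have "(\<integral>t. f t * expectation (\<lambda>\<omega>. w (x \<omega>) * \<epsilon> \<omega> t) \<partial>I01) = (\<integral>t. 0 \<partial>I01)"
    by (rule Bochner_Integration.integral_cong[OF refl]) (simp add: integral_eps_zero[OF wF])
  then show "expectation (\<lambda>\<omega>. w (x \<omega>) * inner (eL \<omega>) h) = 0" using i(2) f(2) by simp
qed

text \<open>As \<open>Z\<close> is its own square, it turns into the propensity, whose root is
  absorbed into the process: \<open>v\<close> times the residual has the covariance kernel of the
  residual times the mean of \<open>v\<^sup>2\<close>. Kernels determine the variances of inner
  products.\<close>

lemma expectation_Z_eL_square:
  assumes w [measurable]: "w \<in> borel_measurable borel" and sq: "sqi M (\<lambda>\<omega>. w (x \<omega>))"
  shows "expectation (\<lambda>\<omega>. (w (x \<omega>) * Z \<omega> * inner (eL \<omega>) h)\<^sup>2) =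
    expectation (\<lambda>\<omega>. (w (x \<omega>))\<^sup>2 * Z \<omega>) * expectation (\<lambda>\<omega>. (inner (eL \<omega>) h)\<^sup>2)"
proof -
  obtain f where f: "sq_int f" "h = to_L2 f" by (rule to_L2_cases)
  have sZ: "sqi M (\<lambda>\<omega>. w (x \<omega>) * Z \<omega> * norm (eL \<omega>))" by (rule Z_eL_sqi[OF w sq])
  have Zsq: "(a * Z \<omega> * b)\<^sup>2 = a\<^sup>2 * b\<^sup>2 * Z \<omega>" if "\<omega> \<in> space M" for a b \<omega>
    using Z_01[OF that] by (auto simp: power_mult_distrib)
  have m1: "(\<lambda>\<omega>. (w (x \<omega>))\<^sup>2 * (norm (eL \<omega>))\<^sup>2) \<in> borel_measurable Fxy" by measurable
  have m2: "(\<lambda>\<omega>. (w (x \<omega>))\<^sup>2 * (inner (eL \<omega>) h)\<^sup>2) \<in> borel_measurable Fxy" by measurable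
  have m3: "(\<lambda>\<omega>. (w (x \<omega>))\<^sup>2) \<in> borel_measurable Fxy" by measurable
  have i1: "integrable M (\<lambda>\<omega>. (w (x \<omega>))\<^sup>2 * (norm (eL \<omega>))\<^sup>2 * Z \<omega>)"
    using sZ unfolding sqi_def by (simp add: Zsq cong: Bochner_Integration.integrable_cong)
  have i2: "integrable M (\<lambda>\<omega>. (w (x \<omega>))\<^sup>2 * (inner (eL \<omega>) h)\<^sup>2 * Z \<omega>)"
  proof (rule Bochner_Integration.integrable_bound[OF integrable_mult_left[OF i1, of "(norm h)\<^sup>2"]])
    have "(inner (eL \<omega>) h)\<^sup>2 \<le> (norm (eL \<omega>))\<^sup>2 * (norm h)\<^sup>2" for \<omega>
      using power_mono[OF Cauchy_Schwarz_ineq2[of "eL \<omega>" h], of 2] by (simp add: power_mult_distrib)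
    then have "(w (x \<omega>))\<^sup>2 * (inner (eL \<omega>) h)\<^sup>2 * \<bar>Z \<omega>\<bar> \<le> (w (x \<omega>))\<^sup>2 * ((norm (eL \<omega>))\<^sup>2 * (norm h)\<^sup>2) * \<bar>Z \<omega>\<bar>" for \<omega>
      by (intro mult_right_mono mult_left_mono) auto
    then show "AE \<omega> in M. norm ((w (x \<omega>))\<^sup>2 * (inner (eL \<omega>) h)\<^sup>2 * Z \<omega>) \<le> norm ((w (x \<omega>))\<^sup>2 * (norm (eL \<omega>))\<^sup>2 * Z \<omega> * (norm h)\<^sup>2)"
      by (intro AE_I2) (simp add: abs_mult mult_ac)
  qed measurable
  have i3: "integrable M (\<lambda>\<omega>. (w (x \<omega>))\<^sup>2 * Z \<omega>)"
  proof (rule Bochner_Integration.integrable_bound)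
    show "integrable M (\<lambda>\<omega>. (w (x \<omega>))\<^sup>2)" using sq by (simp add: sqi_def)
    show "AE \<omega> in M. norm ((w (x \<omega>))\<^sup>2 * Z \<omega>) \<le> norm ((w (x \<omega>))\<^sup>2)"
      using Z_01 by (intro AE_I2) fastforce
  qed measurable
  define v where "v \<omega> = w (x \<omega>) * sqrt (propensity \<omega>)" for \<omega>
  have [measurable]: "v \<in> borel_measurable Fx" unfolding v_def[abs_def] by measurable
  have vM [measurable]: "v \<in> borel_measurable M" unfolding v_def[abs_def] by measurable
  have v2: "(v \<omega>)\<^sup>2 = (w (x \<omega>))\<^sup>2 * propensity \<omega>" for \<omega>
    by (simp add: v_def power_mult_distrib propensity_nonneg)
  let ?V = "\<lambda>\<omega> t. v \<omega> * \<epsilon> \<omega> t"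
  have em [measurable]: "case_prod \<epsilon> \<in> borel_measurable (M \<Otimes>\<^sub>M I01)"
    using eps_process by (simp add: L2_process_def)
  have V: "L2_process M ?V"
    unfolding L2_process_def
  proof (intro conjI ballI)
    show "(\<lambda>(\<omega>, t). v \<omega> * \<epsilon> \<omega> t) \<in> borel_measurable (M \<Otimes>\<^sub>M I01)" by measurable
  qed (intro sq_int_scale eps_sq_int)
  have VL: "to_L2 (?V \<omega>) = v \<omega> *\<^sub>R eL \<omega>" if "\<omega> \<in> space M" for \<omega>
    by (rule to_L2_scale[OF eps_sq_int[OF that]])
  have Vn: "integrable M (\<lambda>\<omega>. (norm (to_L2 (?V \<omega>)))\<^sup>2)"
  proof -
    have "integrable M (\<lambda>\<omega>. (w (x \<omega>))\<^sup>2 * (norm (eL \<omega>))\<^sup>2 * propensity \<omega>)" by (rule integral_Z(1)[OF m1 i1])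
    then show ?thesis
      by (rule Bochner_Integration.integrable_cong[THEN iffD1, rotated 2])
        (auto simp: VL power_mult_distrib v2 mult_ac)
  qed
  have Vt: "integrable M (\<lambda>\<omega>. (?V \<omega> t)\<^sup>2)" if t: "t \<in> {0..1}" for t
  proof (rule integrableI_bounded)
    have m: "(\<lambda>\<omega>. ennreal ((v \<omega>)\<^sup>2)) \<in> borel_measurable Fx" by measurable
    have "(\<integral>\<^sup>+\<omega>. ennreal (norm ((?V \<omega> t)\<^sup>2)) \<partial>M) = (\<integral>\<^sup>+\<omega>. ennreal ((v \<omega>)\<^sup>2) * ennreal ((\<epsilon> \<omega> t)\<^sup>2) \<partial>M)"
      by (simp add: power_mult_distrib ennreal_mult)
    also have "\<dots> = (\<integral>\<^sup>+\<omega>. ennreal ((v \<omega>)\<^sup>2) \<partial>M) * ennreal (\<sigma> t t)"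
      unfolding nn_integral_eps[OF m t] by (rule nn_integral_multc) measurable
    also have "(\<integral>\<^sup>+\<omega>. ennreal ((v \<omega>)\<^sup>2) \<partial>M) = ennreal (expectation (\<lambda>\<omega>. (v \<omega>)\<^sup>2))"
      using integral_Z(1)[OF m3 i3] by (intro nn_integral_eq_integral) (simp_all add: v2 propensity_nonneg)
    finally show "(\<integral>\<^sup>+\<omega>. ennreal (norm ((?V \<omega> t)\<^sup>2)) \<partial>M) < \<infinity>"
      by (simp add: ennreal_mult_less_top)
    show "(\<lambda>\<omega>. (?V \<omega> t)\<^sup>2) \<in> borel_measurable M" using t by measurable
  qed
  have Vsqi: "sqi M (\<lambda>\<omega>. ?V \<omega> t)" if t: "t \<in> {0..1}" for t
    using Vt[OF t] t by (simp add: sqi_def)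
  let ?\<kappa> = "expectation (\<lambda>\<omega>. (v \<omega>)\<^sup>2)"
  have kernel: "expectation (\<lambda>\<omega>. ?V \<omega> s * ?V \<omega> t) = ?\<kappa> * expectation (\<lambda>\<omega>. \<epsilon> \<omega> s * \<epsilon> \<omega> t)"
    if s: "s \<in> {0..1}" and t: "t \<in> {0..1}" for s t
  proof -
    have m: "(\<lambda>\<omega>. (v \<omega>)\<^sup>2) \<in> borel_measurable Fx" by measurable
    have eq: "?V \<omega> s * ?V \<omega> t = (v \<omega>)\<^sup>2 * (\<epsilon> \<omega> s * \<epsilon> \<omega> t)" for \<omega> by (simp add: power2_eq_square mult_ac)
    have "integrable M (\<lambda>\<omega>. (v \<omega>)\<^sup>2 * (\<epsilon> \<omega> s * \<epsilon> \<omega> t))"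
      unfolding eq[symmetric] by (rule sqi_mult[OF Vsqi[OF s] Vsqi[OF t]])
    from integral_eps_eps[OF m s t this] show ?thesis unfolding eq by (simp add: eps_cov[OF s t])
  qed
  have "expectation (\<lambda>\<omega>. (w (x \<omega>) * Z \<omega> * inner (eL \<omega>) h)\<^sup>2) = expectation (\<lambda>\<omega>. (w (x \<omega>))\<^sup>2 * (inner (eL \<omega>) h)\<^sup>2 * Z \<omega>)"
    by (intro Bochner_Integration.integral_cong refl) (simp add: Zsq)
  also have "\<dots> = expectation (\<lambda>\<omega>. (w (x \<omega>))\<^sup>2 * (inner (eL \<omega>) h)\<^sup>2 * propensity \<omega>)"
    by (rule integral_Z(2)[OF m2 i2])
  also have "\<dots> = expectation (\<lambda>\<omega>. (inner (to_L2 (?V \<omega>)) (to_L2 f))\<^sup>2)"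
    by (intro Bochner_Integration.integral_cong refl) (simp add: VL f(2) power_mult_distrib v2 mult_ac)
  also have "\<dots> = (\<integral>s. f s * (\<integral>t. f t * expectation (\<lambda>\<omega>. ?V \<omega> s * ?V \<omega> t) \<partial>I01) \<partial>I01)"
    by (rule inner_square_expectation(2)[OF prob_space_axioms V f(1) Vn Vt])
  also have "\<dots> = (\<integral>s. f s * (\<integral>t. f t * (?\<kappa> * expectation (\<lambda>\<omega>. \<epsilon> \<omega> s * \<epsilon> \<omega> t)) \<partial>I01) \<partial>I01)"
    by (intro Bochner_Integration.integral_cong refl arg_cong2[where f = "(*)"]) (simp add: kernel)
  also have "\<dots> = (\<integral>s. ?\<kappa> * (f s * (\<integral>t. f t * expectation (\<lambda>\<omega>. \<epsilon> \<omega> s * \<epsilon> \<omega> t) \<partial>I01)) \<partial>I01)"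
    by (simp only: mult.left_commute[of _ ?\<kappa>] integral_mult_right_zero)
  also have "\<dots> = ?\<kappa> * expectation (\<lambda>\<omega>. (inner (eL \<omega>) h)\<^sup>2)"
    unfolding integral_mult_right_zero f(2)
    by (subst inner_square_expectation(2)[OF prob_space_axioms eps_process f(1) eps_sq eps_var]) simp_all
  also have "?\<kappa> = expectation (\<lambda>\<omega>. (w (x \<omega>))\<^sup>2 * Z \<omega>)"
    unfolding v2 by (rule integral_Z(2)[OF m3 i3, symmetric])
  finally show ?thesis .
qed

end

section \<open>The influence function and the surrogate process\<close>

context missing_at_random
begin

definition influence :: "real ^ 'p \<Rightarrow> 'a \<Rightarrow> L2" where
  "influence a \<omega> = (\<Sum>j\<in>UNIV. (x \<omega> $ j - \<mu> $ j) *\<^sub>R bL j) + (inner (x \<omega>) a * Z \<omega>) *\<^sub>R eL \<omega>"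

definition surrogate :: "real \<Rightarrow> 'a \<Rightarrow> real \<Rightarrow> real" where
  "surrogate r \<omega> t = inner (x \<omega> - \<mu>) (\<beta> t) + r * \<epsilon> \<omega> t"

text \<open>Inner products of the \<open>bL j\<close> with \<open>h\<close>: they reduce the
  regression part of an inner product with \<open>h\<close> to a scalar linear function of
  x.\<close>

definition pairing :: "L2 \<Rightarrow> real ^ 'p" where
  "pairing h = (\<chi> j. inner (bL j) h)"

lemma centred_component_sqi: "sqi M (\<lambda>\<omega>. x \<omega> $ j - \<mu> $ j)"
  by (intro sqi_diff x_component_sqi) (simp add: sqi_def)

lemma centred_inner_sqi: "sqi M (\<lambda>\<omega>. inner (x \<omega> - \<mu>) a)"
proof -
  have "sqi M (\<lambda>\<omega>. \<Sum>j\<in>UNIV. a $ j * (x \<omega> $ j - \<mu> $ j))"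
    by (intro sqi_sum sqi_scale centred_component_sqi)
  then show ?thesis by (simp add: inner_vec_sum mult.commute)
qed

lemma expectation_x_component: "expectation (\<lambda>\<omega>. x \<omega> $ j) = \<mu> $ j"
proof -
  have "integrable M x"
  proof (rule Bochner_Integration.integrable_bound)
    show "integrable M (\<lambda>\<omega>. norm (x \<omega>))"
      using x_sq by (intro integrable_of_sqi) (simp add: sqi_def)
  qed auto
  then have "has_bochner_integral M x \<mu>" by (simp add: has_bochner_integral_iff x_mean)
  from has_bochner_integral_bounded_linear[OF bounded_linear_vec_nth this, of j]
  show ?thesis by (rule has_bochner_integral_integral_eq)
qed

lemma expectation_centred_inner: "expectation (\<lambda>\<omega>. inner (x \<omega> - \<mu>) a) = 0"
proof -
  have "integrable M (\<lambda>\<omega>. x \<omega> $ j)" for j by (rule integrable_of_sqi[OF x_component_sqi])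
  then show ?thesis
    by (simp add: inner_vec_sum expectation_x_component prob_space)
qed

lemma inner_influence:
  "inner (influence a \<omega>) h = inner (x \<omega> - \<mu>) (pairing h) + inner (x \<omega>) a * Z \<omega> * inner (eL \<omega>) h"
  by (simp add: influence_def pairing_def inner_add_left inner_sum_left inner_vec_sum)

lemma influence_measurable [measurable]: "influence a \<in> borel_measurable M"
  unfolding influence_def[abs_def] by measurable

lemma L2_norm_sqi_imp_integrable:
  fixes f :: "'a \<Rightarrow> L2"
  assumes "f \<in> borel_measurable M" "sqi M g" "\<And>\<omega>. \<omega> \<in> space M \<Longrightarrow> norm (f \<omega>) \<le> g \<omega>"
  shows "integrable M (\<lambda>\<omega>. (norm (f \<omega>))\<^sup>2)"
proof (rule Bochner_Integration.integrable_bound)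
  show "integrable M (\<lambda>\<omega>. (g \<omega>)\<^sup>2)" using assms(2) by (simp add: sqi_def)
  show "(\<lambda>\<omega>. (norm (f \<omega>))\<^sup>2) \<in> borel_measurable M" using assms(1) by measurable
  show "AE \<omega> in M. norm ((norm (f \<omega>))\<^sup>2) \<le> norm ((g \<omega>)\<^sup>2)"
    using power_mono[OF assms(3) norm_ge_zero, of _ 2] by (intro AE_I2) simp
qed

lemma abs_sqi: "sqi M f \<Longrightarrow> sqi M (\<lambda>\<omega>. \<bar>f \<omega>\<bar>)"
  unfolding sqi_def by auto

lemma inner_Z_eL_sqi: "sqi M (\<lambda>\<omega>. inner (x \<omega>) a * Z \<omega> * norm (eL \<omega>))"
  by (rule Z_eL_sqi[of "\<lambda>v. inner v a"]) (auto intro: x_inner_sqi)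

lemma influence_norm_sq: "integrable M (\<lambda>\<omega>. (norm (influence a \<omega>))\<^sup>2)"
proof (rule L2_norm_sqi_imp_integrable)
  let ?g = "\<lambda>\<omega>. (\<Sum>j\<in>UNIV. norm (bL j) * \<bar>x \<omega> $ j - \<mu> $ j\<bar>) + \<bar>inner (x \<omega>) a * Z \<omega> * norm (eL \<omega>)\<bar>"
  show "sqi M ?g"
    by (intro sqi_add sqi_sum sqi_scale abs_sqi centred_component_sqi inner_Z_eL_sqi)
  show "norm (influence a \<omega>) \<le> ?g \<omega>" if "\<omega> \<in> space M" for \<omega>
    unfolding influence_def
    by (intro order_trans[OF norm_triangle_ineq] add_mono order_trans[OF norm_sum] sum_mono)
      (auto simp: abs_mult mult.commute)
qed measurable

lemma expectation_influence: "expectation (\<lambda>\<omega>. inner (influence a \<omega>) h) = 0"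
proof -
  have i: "integrable M (\<lambda>\<omega>. inner (x \<omega>) a * Z \<omega> * norm (eL \<omega>))" by (rule integrable_of_sqi[OF inner_Z_eL_sqi])
  have m: "(\<lambda>v. inner v a) \<in> borel_measurable borel" by measurable
  note e = expectation_Z_eL[OF m i, of h]
  show ?thesis
    unfolding inner_influence using e integrable_of_sqi[OF centred_inner_sqi]
    by (simp add: expectation_centred_inner)
qed

lemma expectation_influence_square:
  "expectation (\<lambda>\<omega>. (inner (influence a \<omega>) h)\<^sup>2) = expectation (\<lambda>\<omega>. (inner (x \<omega> - \<mu>) (pairing h))\<^sup>2) +
     expectation (\<lambda>\<omega>. (inner (x \<omega>) a)\<^sup>2 * Z \<omega>) * expectation (\<lambda>\<omega>. (inner (eL \<omega>) h)\<^sup>2)"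
proof -
  let ?A = "\<lambda>\<omega>. inner (x \<omega> - \<mu>) (pairing h)" and ?B = "\<lambda>\<omega>. inner (x \<omega>) a * Z \<omega> * inner (eL \<omega>) h"
  have A: "sqi M ?A" by (rule centred_inner_sqi)
  have B: "sqi M ?B"
    unfolding sqi_def
  proof
    show "integrable M (\<lambda>\<omega>. (?B \<omega>)\<^sup>2)"
    proof (rule Bochner_Integration.integrable_bound)
      show "integrable M (\<lambda>\<omega>. (norm h * (inner (x \<omega>) a * Z \<omega> * norm (eL \<omega>)))\<^sup>2)"
        using sqi_scale[OF inner_Z_eL_sqi, of "norm h" a] by (simp add: sqi_def)
      show "AE \<omega> in M. norm ((?B \<omega>)\<^sup>2) \<le> norm ((norm h * (inner (x \<omega>) a * Z \<omega> * norm (eL \<omega>)))\<^sup>2)"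
      proof (intro AE_I2)
        fix \<omega>
        have "\<bar>?B \<omega>\<bar> \<le> \<bar>inner (x \<omega>) a * Z \<omega>\<bar> * (norm (eL \<omega>) * norm h)"
          unfolding abs_mult[of _ "inner (eL \<omega>) h"] by (intro mult_left_mono Cauchy_Schwarz_ineq2) simp
        also have "\<dots> = \<bar>norm h * (inner (x \<omega>) a * Z \<omega> * norm (eL \<omega>))\<bar>" by (simp add: abs_mult mult_ac)
        finally have "\<bar>?B \<omega>\<bar>\<^sup>2 \<le> \<bar>norm h * (inner (x \<omega>) a * Z \<omega> * norm (eL \<omega>))\<bar>\<^sup>2" by (intro power_mono) simp_all
        then show "norm ((?B \<omega>)\<^sup>2) \<le> norm ((norm h * (inner (x \<omega>) a * Z \<omega> * norm (eL \<omega>)))\<^sup>2)" by simp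
      qed
    qed measurable
  qed measurable
  have cross: "expectation (\<lambda>\<omega>. ?A \<omega> * ?B \<omega>) = 0"
  proof -
    \<comment> \<open>The mixed term is again a function of x times \<open>Z\<close> times an inner
      product with the residual. Its weight is quadratic in x, so integrability is taken from the
      product of two square-integrable factors.\<close>
    let ?w = "\<lambda>v. inner (v - \<mu>) (pairing h) * inner v a"
    have m: "?w \<in> borel_measurable borel" by measurable
    have "integrable M (\<lambda>\<omega>. ?A \<omega> * (inner (x \<omega>) a * Z \<omega> * norm (eL \<omega>)))" by (rule sqi_mult[OF A inner_Z_eL_sqi])
    then have i: "integrable M (\<lambda>\<omega>. ?w (x \<omega>) * Z \<omega> * norm (eL \<omega>))" by (simp add: mult.assoc)
    from expectation_Z_eL(2)[OF m i, of h] show ?thesis by (simp add: mult.assoc)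
  qed
  have "expectation (\<lambda>\<omega>. (inner (influence a \<omega>) h)\<^sup>2) = expectation (\<lambda>\<omega>. (?A \<omega>)\<^sup>2 + (?B \<omega>)\<^sup>2 + 2 * (?A \<omega> * ?B \<omega>))"
    unfolding inner_influence power2_sum by (simp add: mult.assoc)
  also have "\<dots> = expectation (\<lambda>\<omega>. (?A \<omega>)\<^sup>2) + expectation (\<lambda>\<omega>. (?B \<omega>)\<^sup>2)"
    using A B sqi_mult[OF A B] cross by (simp add: sqi_def)
  also have "expectation (\<lambda>\<omega>. (?B \<omega>)\<^sup>2) = expectation (\<lambda>\<omega>. (inner (x \<omega>) a)\<^sup>2 * Z \<omega>) * expectation (\<lambda>\<omega>. (inner (eL \<omega>) h)\<^sup>2)"
    by (rule expectation_Z_eL_square[of "\<lambda>v. inner v a"]) (auto intro: x_inner_sqi)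
  finally show ?thesis .
qed

lemma surrogate_process: "L2_process M (surrogate r)"
  unfolding L2_process_def
proof (intro conjI ballI)
  have em [measurable]: "case_prod \<epsilon> \<in> borel_measurable (M \<Otimes>\<^sub>M I01)"
    using eps_process by (simp add: L2_process_def)
  have [measurable]: "(\<lambda>t. \<beta> t $ j) \<in> borel_measurable I01" for j using beta_L2[of j] by (simp add: sq_int_def)
  show "case_prod (surrogate r) \<in> borel_measurable (M \<Otimes>\<^sub>M I01)"
    unfolding surrogate_def inner_vec_sum by measurable
  show "sq_int (surrogate r \<omega>)" if "\<omega> \<in> space M" for \<omega>
    unfolding surrogate_def[abs_def] inner_vec_sum
    by (intro sq_int_add sq_int_sum sq_int_scale beta_L2 eps_sq_int that)
qed

lemma surrogate_L2: "\<omega> \<in> space M \<Longrightarrow> to_L2 (surrogate r \<omega>) = (\<Sum>j\<in>UNIV. (x \<omega> $ j - \<mu> $ j) *\<^sub>R bL j) + r *\<^sub>R eL \<omega>"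
  unfolding surrogate_def[abs_def] inner_vec_sum bL_def
  by (subst to_L2_add)
    (simp_all add: sq_int_sum to_L2_sum sq_int_scale beta_L2 to_L2_scale eps_sq_int)

lemma eps_sqi: "t \<in> {0..1} \<Longrightarrow> sqi M (\<lambda>\<omega>. \<epsilon> \<omega> t)"
  using eps_var by (simp add: sqi_def)

lemma surrogate_pointwise: "t \<in> {0..1} \<Longrightarrow> sqi M (\<lambda>\<omega>. surrogate r \<omega> t)"
  unfolding surrogate_def by (intro sqi_add sqi_scale centred_inner_sqi eps_sqi)

lemma surrogate_norm_sq: "integrable M (\<lambda>\<omega>. (norm (to_L2 (surrogate r \<omega>)))\<^sup>2)"
proof (rule L2_norm_sqi_imp_integrable)
  let ?g = "\<lambda>\<omega>. (\<Sum>j\<in>UNIV. norm (bL j) * \<bar>x \<omega> $ j - \<mu> $ j\<bar>) + \<bar>r\<bar> * norm (eL \<omega>)"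
  show "(\<lambda>\<omega>. to_L2 (surrogate r \<omega>)) \<in> borel_measurable M" by (rule L2_process_measurable[OF surrogate_process])
  show "sqi M ?g"
    by (intro sqi_add sqi_sum sqi_scale abs_sqi centred_component_sqi eL_norm_sqi)
  show "norm (to_L2 (surrogate r \<omega>)) \<le> ?g \<omega>" if "\<omega> \<in> space M" for \<omega>
    unfolding surrogate_L2[OF that]
    by (intro order_trans[OF norm_triangle_ineq] add_mono order_trans[OF norm_sum] sum_mono)
      (auto simp: mult.commute)
qed

text \<open>Agrees with the variance for the influence function as soon as \<open>r\<^sup>2\<close>
  is the mean of \<open>(inner (x \<omega>) a)\<^sup>2 * Z \<omega>\<close>; this dictates the
  choice of \<open>r\<close> in the main proof.\<close>

lemma expectation_surrogate_square:
  "expectation (\<lambda>\<omega>. (inner (to_L2 (surrogate r \<omega>)) h)\<^sup>2) = expectation (\<lambda>\<omega>. (inner (x \<omega> - \<mu>) (pairing h))\<^sup>2) +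
     r\<^sup>2 * expectation (\<lambda>\<omega>. (inner (eL \<omega>) h)\<^sup>2)"
proof -
  let ?A = "\<lambda>\<omega>. inner (x \<omega> - \<mu>) (pairing h)" and ?B = "\<lambda>\<omega>. inner (eL \<omega>) h"
  have A: "sqi M ?A" by (rule centred_inner_sqi)
  obtain f where f: "sq_int f" "h = to_L2 f" by (rule to_L2_cases)
  have B: "sqi M ?B"
    using inner_square_expectation(1)[OF prob_space_axioms eps_process f(1) eps_sq eps_var] f(2)
    by (simp add: sqi_def)
  have cross: "expectation (\<lambda>\<omega>. ?A \<omega> * ?B \<omega>) = 0"
    by (rule expectation_eL(2)[of "\<lambda>v. inner (v - \<mu>) (pairing h)"]) (auto intro: sqi_mult[OF A eL_norm_sqi])
  have eq: "inner (to_L2 (surrogate r \<omega>)) h = ?A \<omega> + r * ?B \<omega>" if "\<omega> \<in> space M" for \<omega>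
    unfolding surrogate_L2[OF that] by (simp add: pairing_def inner_add_left inner_sum_left inner_vec_sum)
  have "expectation (\<lambda>\<omega>. (inner (to_L2 (surrogate r \<omega>)) h)\<^sup>2) =
      expectation (\<lambda>\<omega>. (?A \<omega>)\<^sup>2 + r\<^sup>2 * (?B \<omega>)\<^sup>2 + 2 * r * (?A \<omega> * ?B \<omega>))"
    by (intro Bochner_Integration.integral_cong refl) (simp add: eq power2_sum power_mult_distrib mult_ac)
  also have "\<dots> = expectation (\<lambda>\<omega>. (?A \<omega>)\<^sup>2) + r\<^sup>2 * expectation (\<lambda>\<omega>. (?B \<omega>)\<^sup>2)"
    using A B sqi_mult[OF A B] cross by (simp add: sqi_def)
  finally show ?thesis .
qed

lemma surrogate_covariance:
  assumes s: "s \<in> {0..1}" and t: "t \<in> {0..1}"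
  shows "expectation (\<lambda>\<omega>. surrogate r \<omega> s * surrogate r \<omega> t) =
    expectation (\<lambda>\<omega>. inner (x \<omega> - \<mu>) (\<beta> s) * inner (x \<omega> - \<mu>) (\<beta> t)) + r\<^sup>2 * \<sigma> s t"
proof -
  have cross: "expectation (\<lambda>\<omega>. inner (x \<omega> - \<mu>) v * \<epsilon> \<omega> t) = 0" if "t \<in> {0..1}" for v t
    by (rule integral_eps_zero[OF _ that]) measurable
  note i = sqi_mult[OF centred_inner_sqi centred_inner_sqi] sqi_mult[OF centred_inner_sqi eps_sqi[OF s]]
    sqi_mult[OF centred_inner_sqi eps_sqi[OF t]] sqi_mult[OF eps_sqi[OF s] eps_sqi[OF t]]
  have "surrogate r \<omega> s * surrogate r \<omega> t = inner (x \<omega> - \<mu>) (\<beta> s) * inner (x \<omega> - \<mu>) (\<beta> t) +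
      r * (inner (x \<omega> - \<mu>) (\<beta> s) * \<epsilon> \<omega> t) + r * (inner (x \<omega> - \<mu>) (\<beta> t) * \<epsilon> \<omega> s) + r\<^sup>2 * (\<epsilon> \<omega> s * \<epsilon> \<omega> t)" for \<omega>
    unfolding surrogate_def by (simp add: algebra_simps power2_eq_square)
  then show ?thesis
    using i by (simp add: cross[OF s] cross[OF t] eps_cov[OF s t])
qed

end

section \<open>Random matrices\<close>

text \<open>Expansion in the unit matrices yields integrability of the matrix itself; after that,
  taking an entry is a bounded linear map and commutes with the integral.\<close>

lemma integral_matrix_components:
  fixes A :: "'a \<Rightarrow> real ^ 'p ^ 'q"
  assumes "\<And>j k. integrable M (\<lambda>\<omega>. A \<omega> $ j $ k)"
  shows "(\<integral>\<omega>. A \<omega> \<partial>M) $ j $ k = (\<integral>\<omega>. A \<omega> $ j $ k \<partial>M)"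
proof -
  have "A \<omega> = (\<Sum>j\<in>UNIV. \<Sum>k\<in>UNIV. A \<omega> $ j $ k *\<^sub>R axis j (axis k 1))" for \<omega>
  proof -
    have "(\<Sum>k'\<in>UNIV. A \<omega> $ j' $ k' * axis j' (axis k' 1) $ j $ k) = (if j' = j then A \<omega> $ j $ k else 0)" for j j' k
      by (auto simp: axis_def if_distrib[of "\<lambda>v. v $ _"] if_distrib[of "\<lambda>z. _ * z"] cong: if_cong)
    then show ?thesis by (simp add: vec_eq_iff)
  qed
  moreover have "integrable M (\<lambda>\<omega>. \<Sum>j\<in>UNIV. \<Sum>k\<in>UNIV. A \<omega> $ j $ k *\<^sub>R (axis j (axis k 1) :: real ^ 'p ^ 'q))"
    by (intro Bochner_Integration.integrable_sum integrable_scaleR_left assms)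
  ultimately have "integrable M A" by simp
  then have "has_bochner_integral M A (\<integral>\<omega>. A \<omega> \<partial>M)" by (rule has_bochner_integral_integrable)
  from has_bochner_integral_bounded_linear[OF bounded_linear_vec_nth this]
  have "has_bochner_integral M (\<lambda>\<omega>. A \<omega> $ j) ((\<integral>\<omega>. A \<omega> \<partial>M) $ j)" .
  from has_bochner_integral_bounded_linear[OF bounded_linear_vec_nth this]
  have "has_bochner_integral M (\<lambda>\<omega>. A \<omega> $ j $ k) ((\<integral>\<omega>. A \<omega> \<partial>M) $ j $ k)" .
  then show ?thesis by (simp add: has_bochner_integral_iff)
qed

lemma inner_matrix_vector: "inner (u :: real ^ 'p) (S *v v) = (\<Sum>j\<in>UNIV. \<Sum>k\<in>UNIV. u $ j * v $ k * S $ j $ k)"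
  by (simp add: inner_vec_sum matrix_vector_mult_def sum_distrib_left mult_ac)

lemma matrix_inv_works:
  fixes A :: "real ^ 'p ^ 'p"
  assumes "invertible A"
  shows "A ** matrix_inv A = mat 1" "matrix_inv A ** A = mat 1"
proof -
  have "\<exists>B. A ** B = mat 1 \<and> B ** A = mat 1" using assms by (simp add: invertible_def)
  then have "A ** matrix_inv A = mat 1 \<and> matrix_inv A ** A = mat 1"
    unfolding matrix_inv_def by (rule someI_ex)
  then show "A ** matrix_inv A = mat 1" "matrix_inv A ** A = mat 1" by auto
qed

text \<open>For every singular matrix the predicate under the choice operator is constantly false,
  so the chosen matrix is always the same. Measurability of the inverse rests on this.\<close>

lemma matrix_inv_singular:
  fixes A :: "real ^ 'p ^ 'p"
  assumes "\<not> invertible A"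
  shows "matrix_inv A = matrix_inv 0"
proof -
  have z: "\<not> invertible (0 :: real ^ 'p ^ 'p)"
  proof
    assume "invertible (0 :: real ^ 'p ^ 'p)"
    then obtain B :: "real ^ 'p ^ 'p" where "0 ** B = mat 1" unfolding invertible_def by blast
    then have "(0 ** B) $ undefined $ undefined = (mat 1 :: real ^ 'p ^ 'p) $ undefined $ undefined" by simp
    then show False by (simp add: matrix_matrix_mult_def mat_def)
  qed
  have "(\<lambda>B. A ** B = mat 1 \<and> B ** A = mat 1) = (\<lambda>B. 0 ** B = (mat 1 :: real ^ 'p ^ 'p) \<and> B ** 0 = (mat 1 :: real ^ 'p ^ 'p))"
    using assms z unfolding invertible_def by blast
  then show ?thesis unfolding matrix_inv_def by simp
qed

text \<open>Cramer's rule as a total function: quotients of polynomials in the entries, from which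
  measurability and joint continuity can be read off.\<close>

definition cramer_solution :: "real ^ 'p ^ 'p \<Rightarrow> real ^ 'p \<Rightarrow> real ^ 'p" where
  "cramer_solution B v = (\<chi> k. det (\<chi> i j. if j = k then v $ i else B $ i $ j) / det B)"

lemma matrix_inv_mult_cramer:
  fixes A :: "real ^ 'p ^ 'p"
  assumes "invertible A"
  shows "matrix_inv A *v v = cramer_solution A v"
proof -
  have "A *v (matrix_inv A *v v) = v"
    using matrix_inv_works[OF assms] by (simp add: matrix_vector_mul_assoc)
  then show ?thesis
    unfolding cramer_solution_def using cramer[of A "matrix_inv A *v v" v] assms by (simp add: invertible_det_nz)
qed

lemma det_measurable:
  fixes A :: "'a \<Rightarrow> real ^ 'p ^ 'p"
  assumes "\<And>i j. (\<lambda>\<omega>. A \<omega> $ i $ j) \<in> borel_measurable M"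
  shows "(\<lambda>\<omega>. det (A \<omega>)) \<in> borel_measurable M"
  unfolding det_def using assms by measurable

text \<open>The columns of the inverse are the Cramer solutions for the unit vectors; on the
  measurable event of a vanishing determinant the inverse is constant.\<close>

lemma matrix_inv_measurable:
  fixes A :: "'a \<Rightarrow> real ^ 'p ^ 'p"
  assumes A [measurable]: "\<And>i j. (\<lambda>\<omega>. A \<omega> $ i $ j) \<in> borel_measurable M"
  shows "(\<lambda>\<omega>. matrix_inv (A \<omega>) $ i $ j) \<in> borel_measurable M"
proof -
  have [measurable]: "(\<lambda>\<omega>. det (A \<omega>)) \<in> borel_measurable M" by (rule det_measurable[OF A])
  have [measurable]: "(\<lambda>\<omega>. cramer_solution (A \<omega>) (axis j 1) $ i) \<in> borel_measurable M"
  proof -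
    have "(\<lambda>\<omega>. det (\<chi> a b. if b = i then axis j 1 $ a else A \<omega> $ a $ b)) \<in> borel_measurable M"
      by (rule det_measurable) (simp add: measurable_If)
    then show ?thesis unfolding cramer_solution_def by simp
  qed
  have "matrix_inv (A \<omega>) $ i $ j = (if det (A \<omega>) \<noteq> 0 then cramer_solution (A \<omega>) (axis j 1) $ i else matrix_inv 0 $ i $ j)" for \<omega>
  proof (cases "invertible (A \<omega>)")
    case True
    then show ?thesis
      using arg_cong[OF matrix_inv_mult_cramer[OF True, of "axis j 1"], of "\<lambda>v. v $ i"]
      by (simp add: invertible_det_nz matrix_vector_mult_basis column_def)
  next
    case False
    then show ?thesis using matrix_inv_singular[OF False] by (simp add: invertible_det_nz)
  qed
  then show ?thesis by simp
qed

lemma continuous_det: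
  fixes A :: "'a::t2_space \<Rightarrow> real ^ 'p ^ 'p"
  assumes "\<And>i j. continuous F (\<lambda>w. A w $ i $ j)"
  shows "continuous F (\<lambda>w. det (A w))"
  unfolding det_def by (intro continuous_sum continuous_mult continuous_const continuous_prod assms)

lemma isCont_cramer_solution:
  fixes B :: "real ^ 'p ^ 'p"
  assumes "det B \<noteq> 0"
  shows "isCont (\<lambda>w. cramer_solution (fst w) (snd w)) (B, v)"
proof -
  have c: "isCont (\<lambda>w :: (real ^ 'p ^ 'p) \<times> (real ^ 'p). fst w $ i $ j) (B, v)"
    "isCont (\<lambda>w :: (real ^ 'p ^ 'p) \<times> (real ^ 'p). snd w $ i) (B, v)" for i j
    by (intro continuous_intros)+
  have "isCont (\<lambda>w :: (real ^ 'p ^ 'p) \<times> (real ^ 'p). (\<chi> i j. if j = k then snd w $ i else fst w $ i $ j) $ i $ j) (B, v)" for i j k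
    using c by (cases "j = k") auto
  then have n: "isCont (\<lambda>w :: (real ^ 'p ^ 'p) \<times> (real ^ 'p). det (\<chi> i j. if j = k then snd w $ i else fst w $ i $ j)) (B, v)" for k
    by (rule continuous_det)
  have d: "isCont (\<lambda>w :: (real ^ 'p ^ 'p) \<times> (real ^ 'p). det (fst w)) (B, v)"
    by (rule continuous_det[OF c(1)])
  show ?thesis
    unfolding isCont_def
  proof (rule vec_tendstoI)
    fix k
    show "((\<lambda>w. cramer_solution (fst w) (snd w) $ k) \<longlongrightarrow> cramer_solution (fst (B, v)) (snd (B, v)) $ k) (at (B, v))"
      unfolding cramer_solution_def vec_lambda_beta
      by (rule tendsto_divide[OF n[unfolded isCont_def] d[unfolded isCont_def]]) (simp add: assms)
  qed
qed

section \<open>The Jacobian condition\<close>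

text \<open>For one time point the mean Jacobian is block triangular with rows
  \<open>(-1, E x)\<close> and \<open>(0, - P)\<close>. It does not depend on the parameter, because
  the estimating functions are affine.\<close>

lemma psi_jacobian_invertible:
  fixes x :: "nat \<Rightarrow> 'a \<Rightarrow> real ^ 'p" and P :: "real ^ 'p ^ 'p"
  assumes regular: "M_regular M (par_idx {0 :: real}) (\<lambda>i \<omega>. psi (x i \<omega>) (Z i \<omega>) (Y i \<omega>))"
    and M: "prob_space M"
    and xint: "\<And>j. integrable M (\<lambda>\<omega>. x 0 \<omega> $ j)"
    and P: "\<And>j k. P $ j $ k = (\<integral>\<omega>. Z 0 \<omega> * (x 0 \<omega> $ j * x 0 \<omega> $ k) \<partial>M)"
  shows "invertible P"
proof -
  interpret prob_space M by (rule M)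
  let ?J = "par_idx {0 :: real} :: (real + real \<times> 'p) set"
  obtain \<theta> where ns: "nonsingular_on ?J (\<lambda>r k. \<integral>\<omega>. partial_deriv (psi (x 0 \<omega>) (Z 0 \<omega>) (Y 0 \<omega>)) \<theta> r k \<partial>M)"
    using regular unfolding M_regular_def by blast
  let ?D = "\<lambda>\<omega>. partial_deriv (psi (x 0 \<omega>) (Z 0 \<omega>) (Y 0 \<omega>)) \<theta>"
  have J: "?J = insert (Inl 0) (range (\<lambda>j. Inr (0, j)))" unfolding par_idx_def by auto
  have sumJ: "(\<Sum>k\<in>?J. f k) = f (Inl 0) + (\<Sum>j\<in>UNIV. f (Inr (0, j)))" for f :: "real + real \<times> 'p \<Rightarrow> real"
    unfolding J by (subst sum.insert) (auto simp: sum.reindex inj_on_def)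
  have upd: "(\<Sum>k\<in>UNIV. (\<theta>(Inr (0, l) := h)) (Inr (0, k)) * v $ k) =
      h * v $ l + (\<Sum>k\<in>UNIV - {l}. \<theta> (Inr (0, k)) * v $ k)" for h l and v :: "real ^ 'p"
    by (subst sum.remove[of UNIV l]) auto
  have D11: "?D \<omega> (Inl 0) (Inl 0) = -1" for \<omega>
    unfolding partial_deriv_def by (rule DERIV_imp_deriv) (auto intro!: derivative_eq_intros)
  have D12: "?D \<omega> (Inl 0) (Inr (0, l)) = x 0 \<omega> $ l" for \<omega> l
    unfolding partial_deriv_def psi.simps upd
    by (rule DERIV_imp_deriv) (auto intro!: derivative_eq_intros)
  have D21: "?D \<omega> (Inr (0, j)) (Inl 0) = 0" for \<omega> j
    unfolding partial_deriv_def by (rule DERIV_imp_deriv) (auto intro!: derivative_eq_intros)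
  have D22: "?D \<omega> (Inr (0, j)) (Inr (0, l)) = - (Z 0 \<omega> * (x 0 \<omega> $ j * x 0 \<omega> $ l))" for \<omega> j l
    unfolding partial_deriv_def psi.simps upd
    by (rule DERIV_imp_deriv) (auto intro!: derivative_eq_intros)
  have ker: "v = 0" if v: "P *v v = 0" for v
  proof -
    \<comment> \<open>A kernel vector of \<open>P\<close> extends to one of the Jacobian: the
      component belonging to \<mu> is chosen to annihilate the first row.\<close>
    define u :: "real + real \<times> 'p \<Rightarrow> real"
      where "u k = (case k of Inl _ \<Rightarrow> (\<Sum>j\<in>UNIV. expectation (\<lambda>\<omega>. x 0 \<omega> $ j) * v $ j) | Inr p \<Rightarrow> v $ snd p)" for k
    have rows: "\<forall>r\<in>?J. (\<Sum>k\<in>?J. (\<integral>\<omega>. ?D \<omega> r k \<partial>M) * u k) = 0"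
    proof
      fix r assume "r \<in> ?J"
      then consider "r = Inl 0" | j where "r = Inr (0, j)" unfolding J by auto
      then show "(\<Sum>k\<in>?J. (\<integral>\<omega>. ?D \<omega> r k \<partial>M) * u k) = 0"
      proof cases
        case 1
        then show ?thesis unfolding sumJ by (simp add: D11 D12 u_def prob_space)
      next
        case 2
        have "(P *v v) $ j = 0" using v by simp
        then show ?thesis
          using 2 unfolding sumJ by (simp add: D21 D22 u_def P matrix_vector_mult_def sum_negf)
      qed
    qed
    have "u (Inr (0, j)) = 0" for j
      using ns rows unfolding nonsingular_on_def J by blast
    then show "v = 0" by (simp add: vec_eq_iff u_def)
  qed
  then show ?thesis
    using matrix_left_invertible_ker[of P] by (auto simp: invertible_left_inverse)
qed

section \<open>Asymptotic normality of the outcome regression estimator\<close>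

lemma (in prob_space) indep_identical_image:
  assumes indep: "indep_vars (\<lambda>_. K) W UNIV" and ident: "\<And>i j. distr M K (W i) = distr M K (W j)"
    and g: "g \<in> measurable K L"
  shows "indep_vars (\<lambda>_. L) (\<lambda>i \<omega>. g (W i \<omega>)) UNIV"
    and "distr M L (\<lambda>\<omega>. g (W i \<omega>)) = distr M L (\<lambda>\<omega>. g (W j \<omega>))"
proof -
  show "indep_vars (\<lambda>_. L) (\<lambda>i \<omega>. g (W i \<omega>)) UNIV"
    by (rule indep_vars_compose2[OF indep g])
  have W: "W i \<in> measurable M K" for i using indep unfolding indep_vars_def2 by simp
  have "distr M L (\<lambda>\<omega>. g (W i \<omega>)) = distr (distr M K (W i)) L g" for i
    using distr_distr[OF g W[of i]] by (simp add: comp_def)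
  then show "distr M L (\<lambda>\<omega>. g (W i \<omega>)) = distr M L (\<lambda>\<omega>. g (W j \<omega>))"
    using ident[of i j] by simp
qed

theorem theorem1:
  fixes M :: "'a measure"
    and Y \<epsilon> :: "nat \<Rightarrow> 'a \<Rightarrow> real \<Rightarrow> real"
    and x :: "nat \<Rightarrow> 'a \<Rightarrow> real ^ 'p"
    and Z :: "nat \<Rightarrow> 'a \<Rightarrow> real"
    and \<beta> :: "real \<Rightarrow> real ^ 'p"
    and \<mu>\<^sub>y :: "real \<Rightarrow> real"
    and \<mu>\<^sub>x :: "real ^ 'p"
    and \<Sigma>\<^sub>x P :: "real ^ 'p ^ 'p"
    and \<sigma>\<^sub>\<epsilon> :: "real \<Rightarrow> real \<Rightarrow> real"
  assumes prob: "prob_space M"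
    and Y_process: "\<And>i. L2_process M (Y i)"
    and indep: "prob_space.indep_vars M (\<lambda>_. borel \<Otimes>\<^sub>M borel \<Otimes>\<^sub>M borel)
           (\<lambda>i \<omega>. (to_L2 (Y i \<omega>), x i \<omega>, Z i \<omega>)) UNIV"
    and ident: "\<And>i j. distr M (borel \<Otimes>\<^sub>M borel \<Otimes>\<^sub>M borel) (\<lambda>\<omega>. (to_L2 (Y i \<omega>), x i \<omega>, Z i \<omega>)) =
               distr M (borel \<Otimes>\<^sub>M borel \<Otimes>\<^sub>M borel) (\<lambda>\<omega>. (to_L2 (Y j \<omega>), x j \<omega>, Z j \<omega>))"
    and Z_01: "\<And>i \<omega>. \<omega> \<in> space M \<Longrightarrow> Z i \<omega> \<in> {0, 1}"
    and Y_int: "\<And>i t. t \<in> {0..1} \<Longrightarrow> integrable M (\<lambda>\<omega>. Y i \<omega> t)"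
    and Y_mean: "\<And>i t. t \<in> {0..1} \<Longrightarrow> (\<integral>\<omega>. Y i \<omega> t \<partial>M) = \<mu>\<^sub>y t"
    and x_sq: "\<And>i. integrable M (\<lambda>\<omega>. (norm (x i \<omega>))\<^sup>2)"
    and x_mean: "\<And>i. (\<integral>\<omega>. x i \<omega> \<partial>M) = \<mu>\<^sub>x"
    and x_cov: "\<And>i. (\<integral>\<omega>. outer (x i \<omega> - \<mu>\<^sub>x) (x i \<omega> - \<mu>\<^sub>x) \<partial>M) = \<Sigma>\<^sub>x"
    and P_def: "\<And>i. (\<integral>\<omega>. Z i \<omega> *\<^sub>R outer (x i \<omega>) (x i \<omega>) \<partial>M) = P"
    and MAR: "\<And>i. AE \<omega> in M.
           real_cond_exp M (gen_by M (\<lambda>\<omega>. (x i \<omega>, to_L2 (Y i \<omega>))) (borel \<Otimes>\<^sub>M borel))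
             (indicat_real {\<omega> \<in> space M. Z i \<omega> = 1}) \<omega> =
           real_cond_exp M (gen_by M (x i) borel) (indicat_real {\<omega> \<in> space M. Z i \<omega> = 1}) \<omega>"
    and beta_L2: "\<And>j. sq_int (\<lambda>t. \<beta> t $ j)"
    and model: "\<And>i \<omega> t. \<omega> \<in> space M \<Longrightarrow> t \<in> {0..1} \<Longrightarrow> Y i \<omega> t = x i \<omega> \<bullet> \<beta> t + \<epsilon> i \<omega> t"
    and correct: "\<And>i t. t \<in> {0..1} \<Longrightarrow>
           AE \<omega> in M. real_cond_exp M (gen_by M (x i) borel) (\<lambda>\<omega>. Y i \<omega> t) \<omega> = x i \<omega> \<bullet> \<beta> t"
    and eps_process: "\<And>i. L2_process M (\<epsilon> i)"
    and eps_sq: "\<And>i. integrable M (\<lambda>\<omega>. (norm (to_L2 (\<epsilon> i \<omega>)))\<^sup>2)"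
    and eps_var: "\<And>i t. t \<in> {0..1} \<Longrightarrow> integrable M (\<lambda>\<omega>. (\<epsilon> i \<omega> t)\<^sup>2)"
    and eps_mean: "\<And>i t. t \<in> {0..1} \<Longrightarrow> (\<integral>\<omega>. \<epsilon> i \<omega> t \<partial>M) = 0"
    and eps_cov: "\<And>i s t. s \<in> {0..1} \<Longrightarrow> t \<in> {0..1} \<Longrightarrow> (\<integral>\<omega>. \<epsilon> i \<omega> s * \<epsilon> i \<omega> t \<partial>M) = \<sigma>\<^sub>\<epsilon> s t"
    and eps_cond_cov: "\<And>i s t. s \<in> {0..1} \<Longrightarrow> t \<in> {0..1} \<Longrightarrow>
           AE \<omega> in M. real_cond_exp M (gen_by M (x i) borel) (\<lambda>\<omega>. \<epsilon> i \<omega> s * \<epsilon> i \<omega> t) \<omega> = \<sigma>\<^sub>\<epsilon> s t"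
    and regular: "\<And>S. finite S \<Longrightarrow> S \<subseteq> {0..1} \<Longrightarrow>
           M_regular M (par_idx S) (\<lambda>i \<omega>. psi (x i \<omega>) (Z i \<omega>) (Y i \<omega>))"
  shows "\<exists>(N :: (nat \<Rightarrow> real) measure) G.
           prob_space N \<and> L2_process N G \<and>
           gaussian_process_0 N G
             (\<lambda>s t. \<beta> s \<bullet> (\<Sigma>\<^sub>x *v \<beta> t) + (\<mu>\<^sub>x \<bullet> (matrix_inv P *v \<mu>\<^sub>x)) * \<sigma>\<^sub>\<epsilon> s t) \<and>
           conv_in_distr M (\<lambda>n \<omega>. to_L2 (\<lambda>t. sqrt (real n) * (mu_OR x Z Y n \<omega> t - \<mu>\<^sub>y t)))
             N (\<lambda>w. to_L2 (G w))"
proof -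
  interpret prob_space M by (rule prob)
  let ?K = "borel \<Otimes>\<^sub>M borel \<Otimes>\<^sub>M borel :: (L2 \<times> (real ^ 'p) \<times> real) measure"

  \<comment> \<open>The sample as one independent, identically distributed sequence\<close>
  define W where "W i \<omega> = (to_L2 (Y i \<omega>), x i \<omega>, Z i \<omega>)" for i \<omega>
  have indepW: "indep_vars (\<lambda>_. ?K) W UNIV" using indep unfolding W_def[abs_def] .
  have identW: "distr M ?K (W i) = distr M ?K (W j)" for i j using ident[of i j] unfolding W_def[abs_def] .
  have W_meas [measurable]: "W i \<in> measurable M ?K" for i using indepW unfolding indep_vars_def2 by simp
  have x_meas [measurable]: "x i \<in> borel_measurable M" for i
  proof -
    have "(\<lambda>\<omega>. fst (snd (W i \<omega>))) \<in> borel_measurable M" by measurable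
    then show ?thesis by (simp add: W_def)
  qed
  have Z_meas [measurable]: "Z i \<in> borel_measurable M" for i
  proof -
    have "(\<lambda>\<omega>. snd (snd (W i \<omega>))) \<in> borel_measurable M" by measurable
    then show ?thesis by (simp add: W_def)
  qed
  have YL_meas [measurable]: "(\<lambda>\<omega>. to_L2 (Y i \<omega>)) \<in> borel_measurable M" for i
    by (rule L2_process_measurable[OF Y_process])
  have mar: "missing_at_random M (Y i) (\<epsilon> i) (x i) (Z i) \<beta> \<mu>\<^sub>x \<sigma>\<^sub>\<epsilon>" for i
    unfolding missing_at_random_def missing_at_random_axioms_def
    using prob Y_process[of i] eps_process[of i] x_meas[of i] Z_meas[of i] Z_01[of _ i] Y_int[of _ i] x_sq[of i]
      x_mean[of i] MAR[of i] beta_L2 model[of _ _ i] correct[of _ i] eps_sq[of i] eps_var[of _ i] eps_cov[of _ _ i]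
      eps_cond_cov[of _ _ i]
    by blast
  interpret O: missing_at_random M "Y 0" "\<epsilon> 0" "x 0" "Z 0" \<beta> \<mu>\<^sub>x \<sigma>\<^sub>\<epsilon> by (rule mar)
  define bL where "bL = missing_at_random.bL \<beta>"
  have eL_eq: "to_L2 (\<epsilon> i \<omega>) = to_L2 (Y i \<omega>) - (\<Sum>j\<in>UNIV. x i \<omega> $ j *\<^sub>R bL j)" if "\<omega> \<in> space M" for i \<omega>
    using missing_at_random.eL_eq[OF mar that] unfolding bL_def .

  \<comment> \<open>Invertibility of \<Pi> and the variance factor\<close>
  have zxx_int: "integrable M (\<lambda>\<omega>. Z i \<omega> * (x i \<omega> $ j * x i \<omega> $ k))" for i j k
  proof (rule Bochner_Integration.integrable_bound)
    show "integrable M (\<lambda>\<omega>. x i \<omega> $ j * x i \<omega> $ k)"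
      by (rule sqi_mult[OF missing_at_random.x_component_sqi[OF mar] missing_at_random.x_component_sqi[OF mar]])
    show "AE \<omega> in M. norm (Z i \<omega> * (x i \<omega> $ j * x i \<omega> $ k)) \<le> norm (x i \<omega> $ j * x i \<omega> $ k)"
      using Z_01[of _ i] by (intro AE_I2) fastforce
  qed measurable
  have P_comp: "P $ j $ k = expectation (\<lambda>\<omega>. Z 0 \<omega> * (x 0 \<omega> $ j * x 0 \<omega> $ k))" for j k
    unfolding P_def[of 0, symmetric]
    using integral_matrix_components[of M "\<lambda>\<omega>. Z 0 \<omega> *\<^sub>R outer (x 0 \<omega>) (x 0 \<omega>)" j k] zxx_int[of 0]
    by (simp add: outer_def)
  have invP: "invertible P"
  proof (rule psi_jacobian_invertible[OF regular prob])
    show "integrable M (\<lambda>\<omega>. x 0 \<omega> $ j)" for j by (rule integrable_of_sqi[OF O.x_component_sqi])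
  qed (simp_all add: P_comp)
  have detP: "det P \<noteq> 0" using invP by (simp add: invertible_det_nz)
  define a where "a = matrix_inv P *v \<mu>\<^sub>x"
  have Pa: "P *v a = \<mu>\<^sub>x"
    using matrix_inv_works[OF invP] by (simp add: a_def matrix_vector_mul_assoc)
  define \<kappa> where "\<kappa> = \<mu>\<^sub>x \<bullet> a"
  \<comment> \<open>Expanding the square gives the quadratic form
    \<open>a \<bullet> (P *v a)\<close>, and \<open>P *v a = \<mu>\<^sub>x\<close>. The
    probabilistic form also shows that \<open>\<kappa>\<close> is nonnegative, as
    \<open>sqrt \<kappa>\<close> below demands.\<close>
  have \<kappa>_eq: "expectation (\<lambda>\<omega>. (x 0 \<omega> \<bullet> a)\<^sup>2 * Z 0 \<omega>) = \<kappa>"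
  proof -
    have "(x 0 \<omega> \<bullet> a)\<^sup>2 * Z 0 \<omega> = (\<Sum>j\<in>UNIV. \<Sum>k\<in>UNIV. a $ j * a $ k * (Z 0 \<omega> * (x 0 \<omega> $ j * x 0 \<omega> $ k)))" for \<omega>
    proof -
      have "(x 0 \<omega> \<bullet> a)\<^sup>2 = (\<Sum>j\<in>UNIV. \<Sum>k\<in>UNIV. (x 0 \<omega> $ j * a $ j) * (x 0 \<omega> $ k * a $ k))"
        unfolding inner_vec_sum power2_eq_square sum_product ..
      then show ?thesis by (simp only: sum_distrib_right) (simp only: mult_ac)
    qed
    then have "expectation (\<lambda>\<omega>. (x 0 \<omega> \<bullet> a)\<^sup>2 * Z 0 \<omega>) = (\<Sum>j\<in>UNIV. \<Sum>k\<in>UNIV. a $ j * a $ k * P $ j $ k)"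
      using zxx_int[of 0] by (simp add: P_comp)
    also have "\<dots> = a \<bullet> (P *v a)" by (simp add: inner_matrix_vector)
    finally show ?thesis by (simp add: Pa \<kappa>_def inner_commute)
  qed
  have \<kappa>0: "\<kappa> \<ge> 0"
    unfolding \<kappa>_eq[symmetric] using O.Z_nonneg by (intro integral_nonneg_AE AE_I2) simp

  \<comment> \<open>The limiting Gaussian process\<close>
  obtain G where G: "L2_process white_noise G"
    "gaussian_process_0 white_noise G (\<lambda>s t. expectation (\<lambda>\<omega>. O.surrogate (sqrt \<kappa>) \<omega> s * O.surrogate (sqrt \<kappa>) \<omega> t))"
    "\<And>h \<theta>. WN.expectation (\<lambda>w. cos (inner (to_L2 (G w)) h + \<theta>)) =
       exp (- expectation (\<lambda>\<omega>. (inner (to_L2 (O.surrogate (sqrt \<kappa>) \<omega>)) h)\<^sup>2) / 2) * cos \<theta>"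
  proof (rule gaussian_process_functional[OF prob O.surrogate_process _ O.surrogate_norm_sq])
    show "integrable M (\<lambda>\<omega>. (O.surrogate (sqrt \<kappa>) \<omega> t)\<^sup>2)" if "t \<in> {0..1}" for t
      using O.surrogate_pointwise[OF that] by (simp add: sqi_def)
  qed (rule that)
  have kernel: "expectation (\<lambda>\<omega>. O.surrogate (sqrt \<kappa>) \<omega> s * O.surrogate (sqrt \<kappa>) \<omega> t) =
      \<beta> s \<bullet> (\<Sigma>\<^sub>x *v \<beta> t) + (\<mu>\<^sub>x \<bullet> (matrix_inv P *v \<mu>\<^sub>x)) * \<sigma>\<^sub>\<epsilon> s t" if "s \<in> {0..1}" "t \<in> {0..1}" for s t
  proof -
    let ?c = "\<lambda>\<omega> j. x 0 \<omega> $ j - \<mu>\<^sub>x $ j"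
    have int: "integrable M (\<lambda>\<omega>. ?c \<omega> j * ?c \<omega> k)" for j k
      by (rule sqi_mult[OF O.centred_component_sqi O.centred_component_sqi])
    have S: "\<Sigma>\<^sub>x $ j $ k = expectation (\<lambda>\<omega>. ?c \<omega> j * ?c \<omega> k)" for j k
      unfolding x_cov[of 0, symmetric]
      using integral_matrix_components[of M "\<lambda>\<omega>. outer (x 0 \<omega> - \<mu>\<^sub>x) (x 0 \<omega> - \<mu>\<^sub>x)" j k] int
      by (simp add: outer_def)
    have "(x 0 \<omega> - \<mu>\<^sub>x) \<bullet> \<beta> s * ((x 0 \<omega> - \<mu>\<^sub>x) \<bullet> \<beta> t) = (\<Sum>j\<in>UNIV. \<Sum>k\<in>UNIV. \<beta> s $ j * \<beta> t $ k * (?c \<omega> j * ?c \<omega> k))" for \<omega>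
      unfolding inner_vec_sum sum_product by (intro sum.cong refl) (simp add: mult_ac)
    then have "expectation (\<lambda>\<omega>. (x 0 \<omega> - \<mu>\<^sub>x) \<bullet> \<beta> s * ((x 0 \<omega> - \<mu>\<^sub>x) \<bullet> \<beta> t)) = \<beta> s \<bullet> (\<Sigma>\<^sub>x *v \<beta> t)"
      using int by (simp add: inner_matrix_vector S)
    then show ?thesis
      using O.surrogate_covariance[OF that, of "sqrt \<kappa>"] \<kappa>0 by (simp add: \<kappa>_def a_def)
  qed
  have gp: "gaussian_process_0 white_noise G
      (\<lambda>s t. \<beta> s \<bullet> (\<Sigma>\<^sub>x *v \<beta> t) + (\<mu>\<^sub>x \<bullet> (matrix_inv P *v \<mu>\<^sub>x)) * \<sigma>\<^sub>\<epsilon> s t)"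
    using G(2) unfolding gaussian_process_0_def by (simp add: kernel)

  \<comment> \<open>The central limit theorem for the influence functions\<close>
  define E where "E p = fst p - (\<Sum>j\<in>UNIV. fst (snd p) $ j *\<^sub>R bL j)" for p :: "L2 \<times> (real ^ 'p) \<times> real"
  define \<Psi> where "\<Psi> p = (\<Sum>j\<in>UNIV. (fst (snd p) $ j - \<mu>\<^sub>x $ j) *\<^sub>R bL j) + (fst (snd p) \<bullet> a * snd (snd p)) *\<^sub>R E p" for p
  define \<tau> where "\<tau> j p = (fst (snd p) $ j * snd (snd p)) *\<^sub>R E p" for j p
  have [measurable]: "E \<in> borel_measurable ?K" unfolding E_def[abs_def] by measurable
  have \<Psi>_meas [measurable]: "\<Psi> \<in> borel_measurable ?K" unfolding \<Psi>_def[abs_def] by measurable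
  have \<tau>_meas [measurable]: "\<tau> j \<in> borel_measurable ?K" for j unfolding \<tau>_def[abs_def] by measurable
  \<comment> \<open>Independence and identical distribution are assumptions on the
    \<open>W i\<close>; the residual classes inherit them as measurable images.\<close>
  have EW: "E (W i \<omega>) = to_L2 (\<epsilon> i \<omega>)" if "\<omega> \<in> space M" for i \<omega>
    using eL_eq[OF that] by (simp add: E_def W_def)
  have \<Psi>W0: "\<Psi> (W 0 \<omega>) = O.influence a \<omega>" if "\<omega> \<in> space M" for \<omega>
    unfolding \<Psi>_def O.influence_def EW[OF that] by (simp add: W_def bL_def)
  have \<tau>W: "\<tau> j (W i \<omega>) = (x i \<omega> $ j * Z i \<omega>) *\<^sub>R to_L2 (\<epsilon> i \<omega>)" if "\<omega> \<in> space M" for i j \<omega>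
    unfolding \<tau>_def EW[OF that] by (simp add: W_def)

  obtain e :: "nat \<Rightarrow> L2" where e: "parseval_seq e" using ex_parseval_seq_L2 by blast
  define S where "S n \<omega> = (1 / sqrt (real n)) *\<^sub>R (\<Sum>i<n. \<Psi> (W i \<omega>))" for n \<omega>
  have S_meas [measurable]: "S n \<in> borel_measurable M" for n unfolding S_def[abs_def] by measurable
  have S_conv: "(\<lambda>n. expectation (\<lambda>\<omega>. F (S n \<omega>))) \<longlonglongrightarrow> WN.expectation (\<lambda>w. F (to_L2 (G w)))"
    if F: "lip_bdd F C B" for F C B
    unfolding S_def
  proof (rule hilbert_clt[OF e indep_identical_image(1)[OF indepW identW \<Psi>_meas]
        indep_identical_image(2)[OF indepW identW \<Psi>_meas] _ _ prob_space_white_noise L2_process_measurable[OF G(1)] _ F])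
    show "integrable M (\<lambda>\<omega>. (norm (\<Psi> (W 0 \<omega>)))\<^sup>2)"
      using O.influence_norm_sq[of a]
      by (subst Bochner_Integration.integrable_cong[OF refl, of _ _ "\<lambda>\<omega>. (norm (O.influence a \<omega>))\<^sup>2"]) (simp_all add: \<Psi>W0)
    show "expectation (\<lambda>\<omega>. inner (\<Psi> (W 0 \<omega>)) h) = 0" for h
      using O.expectation_influence[of a h]
      by (subst Bochner_Integration.integral_cong[OF refl, of _ _ "\<lambda>\<omega>. inner (O.influence a \<omega>) h"]) (simp_all add: \<Psi>W0)
    \<comment> \<open>Equal variances in every direction identify the limit of the sums with
      \<open>G\<close>, although \<open>G\<close> was built from the surrogate.\<close>
    have "expectation (\<lambda>\<omega>. (inner (\<Psi> (W 0 \<omega>)) h)\<^sup>2) = expectation (\<lambda>\<omega>. (inner (O.influence a \<omega>) h)\<^sup>2)" for h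
      by (intro Bochner_Integration.integral_cong refl) (simp add: \<Psi>W0)
    then have "expectation (\<lambda>\<omega>. (inner (\<Psi> (W 0 \<omega>)) h)\<^sup>2) = expectation (\<lambda>\<omega>. (inner (to_L2 (O.surrogate (sqrt \<kappa>) \<omega>)) h)\<^sup>2)" for h
      using \<kappa>0 by (simp add: O.expectation_influence_square O.expectation_surrogate_square \<kappa>_eq)
    then show "WN.expectation (\<lambda>w. cos (inner (to_L2 (G w)) h + \<theta>)) =
        exp (- expectation (\<lambda>\<omega>. (inner (\<Psi> (W 0 \<omega>)) h)\<^sup>2) / 2) * cos \<theta>" for h \<theta>
      by (simp add: G(3))
  qed

  \<comment> \<open>The estimator as a measurable weighted sum of the responses\<close>
  define A where "A n \<omega> = (\<Sum>i<n. Z i \<omega> *\<^sub>R outer (x i \<omega>) (x i \<omega>))" for n \<omega>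
  define s where "s n \<omega> = (\<Sum>i<n. x i \<omega>)" for n \<omega>
  \<comment> \<open>The inverse Gram matrix is moved over to the covariate sum, which turns the
    estimator into a weighted sum of the Y_k. On the singular event this is still a measurable
    vector.\<close>
  define c where "c n \<omega> = s n \<omega> v* matrix_inv (A n \<omega>)" for n \<omega>
  define T where "T n j \<omega> = (1 / sqrt (real n)) *\<^sub>R (\<Sum>i<n. \<tau> j (W i \<omega>))" for n j \<omega>
  define X where "X n \<omega> = to_L2 (\<lambda>t. sqrt (real n) * (mu_OR x Z Y n \<omega> t - \<mu>\<^sub>y t))" for n \<omega>
  have A_comp: "A n \<omega> $ j $ k = (\<Sum>i<n. Z i \<omega> * (x i \<omega> $ j * x i \<omega> $ k))" for n \<omega> j k
    by (simp add: A_def outer_def)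
  have c_meas [measurable]: "(\<lambda>\<omega>. c n \<omega> $ j) \<in> borel_measurable M" for n j
  proof -
    have "(\<lambda>\<omega>. A n \<omega> $ j $ k) \<in> borel_measurable M" for j k unfolding A_comp by measurable
    then have [measurable]: "(\<lambda>\<omega>. matrix_inv (A n \<omega>) $ j $ k) \<in> borel_measurable M" for j k by (rule matrix_inv_measurable)
    have [measurable]: "(\<lambda>\<omega>. s n \<omega> $ j) \<in> borel_measurable M" for j unfolding s_def by measurable
    show ?thesis unfolding c_def vector_matrix_mult_def vec_lambda_beta by measurable
  qed
  have ZY: "mu_OR x Z Y n \<omega> t = (\<Sum>k<n. (1 / real n) * (c n \<omega> \<bullet> x k \<omega> * Z k \<omega>) * Y k \<omega> t)" for n \<omega> t
  proof -
    have "(\<Sum>i<n. x i \<omega> \<bullet> beta_hat x Z Y n \<omega> t) = s n \<omega> \<bullet> (matrix_inv (A n \<omega>) *v (\<Sum>i<n. (Z i \<omega> * Y i \<omega> t) *\<^sub>R x i \<omega>))"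
      by (simp add: beta_hat_def s_def A_def inner_sum_left)
    also have "\<dots> = c n \<omega> \<bullet> (\<Sum>i<n. (Z i \<omega> * Y i \<omega> t) *\<^sub>R x i \<omega>)"
      unfolding c_def dot_lmul_matrix ..
    also have "\<dots> = (\<Sum>k<n. (c n \<omega> \<bullet> x k \<omega> * Z k \<omega>) * Y k \<omega> t)"
      by (simp add: inner_sum_right mult_ac)
    finally show ?thesis by (simp add: mu_OR_def sum_distrib_left mult.assoc)
  qed
  have muy: "\<mu>\<^sub>y t = (\<Sum>j\<in>UNIV. \<mu>\<^sub>x $ j * \<beta> t $ j)" if t: "t \<in> {0..1}" for t
  proof -
    have "\<mu>\<^sub>y t = expectation (\<lambda>\<omega>. x 0 \<omega> \<bullet> \<beta> t + \<epsilon> 0 \<omega> t)"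
      unfolding Y_mean[OF t, of 0, symmetric]
      by (intro Bochner_Integration.integral_cong refl) (rule model[OF _ t])
    also have "\<dots> = expectation (\<lambda>\<omega>. x 0 \<omega> \<bullet> \<beta> t)"
      using integrable_of_sqi[OF O.x_inner_sqi] integrable_of_sqi[OF O.eps_sqi[OF t]] eps_mean[OF t, of 0] by simp
    also have "\<dots> = (\<Sum>j\<in>UNIV. \<mu>\<^sub>x $ j * \<beta> t $ j)"
      unfolding inner_vec_sum using integrable_of_sqi[OF O.x_component_sqi]
      by (simp add: O.expectation_x_component)
    finally show ?thesis .
  qed
  \<comment> \<open>The identity holds on the whole space, including the event of a singular Gram
    matrix, so that measurability of \<open>X n\<close> can be read off.\<close>
  have X_eq: "X n \<omega> = sqrt (real n) *\<^sub>R ((\<Sum>k<n. ((1 / real n) * (c n \<omega> \<bullet> x k \<omega> * Z k \<omega>)) *\<^sub>R to_L2 (Y k \<omega>)) - (\<Sum>j\<in>UNIV. \<mu>\<^sub>x $ j *\<^sub>R bL j))"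
    if w: "\<omega> \<in> space M" for n \<omega>
  proof -
    have Yw: "sq_int (Y k \<omega>)" for k using Y_process[of k] w by (simp add: L2_process_def)
    let ?m = "\<lambda>t. \<Sum>k<n. ((1 / real n) * (c n \<omega> \<bullet> x k \<omega> * Z k \<omega>)) * Y k \<omega> t"
    let ?b = "\<lambda>t. \<Sum>j\<in>UNIV. \<mu>\<^sub>x $ j * \<beta> t $ j"
    have m: "sq_int ?m" by (intro sq_int_sum sq_int_scale Yw)
    have b: "sq_int ?b" by (intro sq_int_sum sq_int_scale beta_L2)
    have "X n \<omega> = to_L2 (\<lambda>t. sqrt (real n) * (?m t - ?b t))"
      unfolding X_def
    proof (rule to_L2_cong[symmetric])
      show "sq_int (\<lambda>t. sqrt (real n) * (?m t - ?b t))" by (intro sq_int_scale sq_int_diff m b)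
    qed (simp add: ZY muy)
    also have "\<dots> = sqrt (real n) *\<^sub>R (to_L2 ?m - to_L2 ?b)"
      unfolding to_L2_scale[OF sq_int_diff[OF m b]] to_L2_diff[OF m b] ..
    also have "to_L2 ?m = (\<Sum>k<n. ((1 / real n) * (c n \<omega> \<bullet> x k \<omega> * Z k \<omega>)) *\<^sub>R to_L2 (Y k \<omega>))"
      by (simp only: to_L2_sum[OF sq_int_scale[OF Yw]] to_L2_scale[OF Yw])
    also have "to_L2 ?b = (\<Sum>j\<in>UNIV. \<mu>\<^sub>x $ j *\<^sub>R bL j)"
      unfolding bL_def O.bL_def
      by (simp only: to_L2_sum[OF sq_int_scale[OF beta_L2]] to_L2_scale[OF beta_L2])
    finally show ?thesis .
  qed
  have X_meas [measurable]: "X n \<in> borel_measurable M" for n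
  proof -
    have "(\<lambda>\<omega>. c n \<omega> \<bullet> x k \<omega>) \<in> borel_measurable M" for k unfolding inner_vec_sum by measurable
    then have "(\<lambda>\<omega>. sqrt (real n) *\<^sub>R ((\<Sum>k<n. ((1 / real n) * (c n \<omega> \<bullet> x k \<omega> * Z k \<omega>)) *\<^sub>R to_L2 (Y k \<omega>)) - (\<Sum>j\<in>UNIV. \<mu>\<^sub>x $ j *\<^sub>R bL j))) \<in> borel_measurable M"
      by measurable
    then show ?thesis by (subst measurable_cong[OF X_eq]) 
  qed

  \<comment> \<open>Exact decomposition for an invertible Gram matrix\<close>
  have Ac: "A n \<omega> *v c n \<omega> = s n \<omega>" if inv: "invertible (A n \<omega>)" for n \<omega>
  proof -
    have "transpose (A n \<omega>) = A n \<omega>"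
      by (simp add: vec_eq_iff transpose_def A_comp mult_ac)
    then have "A n \<omega> *v c n \<omega> = c n \<omega> v* A n \<omega>" using transpose_matrix_vector[of "A n \<omega>" "c n \<omega>"] by simp
    also have "\<dots> = s n \<omega>"
      unfolding c_def vector_matrix_mul_assoc matrix_inv_works(2)[OF inv] by simp
    finally show ?thesis .
  qed
  have diff: "X n \<omega> - S n \<omega> = (\<Sum>j\<in>UNIV. (c n \<omega> $ j - a $ j) *\<^sub>R T n j \<omega>)"
    if w: "\<omega> \<in> space M" and inv: "invertible (A n \<omega>)" and n: "n > 0" for n \<omega>
  proof -
    let ?r = "1 / sqrt (real n)"
    let ?y = "\<lambda>k. c n \<omega> \<bullet> x k \<omega> * Z k \<omega>" and ?e = "\<lambda>k. to_L2 (\<epsilon> k \<omega>)"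
    let ?b = "\<lambda>u. \<Sum>j\<in>UNIV. u $ j *\<^sub>R bL j"
    have rr: "sqrt (real n) * (1 / real n) = ?r" using sqrt_divide_self_eq[of "real n"] by (simp add: inverse_eq_divide)
    have rn: "sqrt (real n) = ?r * real n" using real_div_sqrt[of "real n"] by simp
    have b_add: "?b (u + v) = ?b u + ?b v" and b_scale: "?b (d *\<^sub>R u) = d *\<^sub>R ?b u"
      and b_diff: "?b (u - v) = ?b u - ?b v" for u v d
      by (simp_all add: scaleR_left_distrib sum.distrib scaleR_sum_right scaleR_left_diff_distrib sum_subtractf)
    have b_sum: "?b (\<Sum>k<n. f k) = (\<Sum>k<n. ?b (f k))" for f :: "nat \<Rightarrow> real ^ 'p"
      by (simp add: scaleR_sum_left) (rule sum.swap)
    \<comment> \<open>The normal equations: the weights reproduce the covariate sum. The regression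
      parts of the Y_k and of the \<open>\<Psi> (W k \<omega>)\<close> therefore cancel in the
      difference, centring included.\<close>
    have yx: "(\<Sum>k<n. ?y k *\<^sub>R x k \<omega>) = s n \<omega>"
    proof -
      have "(\<Sum>k<n. ?y k *\<^sub>R x k \<omega>) = A n \<omega> *v c n \<omega>"
        unfolding vec_eq_iff matrix_vector_mult_def vec_lambda_beta A_comp
      proof
        fix j
        have "(\<Sum>k<n. ?y k *\<^sub>R x k \<omega>) $ j = (\<Sum>k<n. \<Sum>i\<in>UNIV. Z k \<omega> * (x k \<omega> $ j * x k \<omega> $ i) * c n \<omega> $ i)"
          unfolding sum_component vector_scaleR_component inner_vec_sum real_scaleR_def
          by (simp only: sum_distrib_right) (simp only: mult_ac)
        also have "\<dots> = (\<Sum>i\<in>UNIV. (\<Sum>k<n. Z k \<omega> * (x k \<omega> $ j * x k \<omega> $ i)) * c n \<omega> $ i)"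
          unfolding sum_distrib_right by (rule sum.swap)
        finally show "(\<Sum>k<n. ?y k *\<^sub>R x k \<omega>) $ j = (\<Sum>i\<in>UNIV. (\<Sum>k<n. Z k \<omega> * (x k \<omega> $ j * x k \<omega> $ i)) * c n \<omega> $ i)" .
      qed
      then show ?thesis using Ac[OF inv] by simp
    qed
    have Yk: "to_L2 (Y k \<omega>) = ?e k + ?b (x k \<omega>)" for k using eL_eq[OF w, of k] by simp
    have "(\<Sum>k<n. ((1 / real n) * ?y k) *\<^sub>R to_L2 (Y k \<omega>)) = (1 / real n) *\<^sub>R ((\<Sum>k<n. ?y k *\<^sub>R ?e k) + ?b (s n \<omega>))"
      unfolding yx[symmetric] b_sum b_scale Yk by (simp add: scaleR_sum_right scaleR_right_distrib sum.distrib)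
    then have "X n \<omega> = sqrt (real n) *\<^sub>R ((1 / real n) *\<^sub>R ((\<Sum>k<n. ?y k *\<^sub>R ?e k) + ?b (s n \<omega>)) - ?b \<mu>\<^sub>x)"
      unfolding X_eq[OF w] by simp
    also have "\<dots> = ?r *\<^sub>R ((\<Sum>k<n. ?y k *\<^sub>R ?e k) + ?b (s n \<omega>)) - (?r * real n) *\<^sub>R ?b \<mu>\<^sub>x"
      unfolding scaleR_right_diff_distrib scaleR_scaleR rr rn[symmetric] ..
    also have "\<dots> = ?r *\<^sub>R ((\<Sum>k<n. ?y k *\<^sub>R ?e k) + (?b (s n \<omega>) - real n *\<^sub>R ?b \<mu>\<^sub>x))"
      by (simp add: scaleR_right_diff_distrib scaleR_right_distrib)
    finally have X1: "X n \<omega> = ?r *\<^sub>R ((\<Sum>k<n. ?y k *\<^sub>R ?e k) + (?b (s n \<omega>) - real n *\<^sub>R ?b \<mu>\<^sub>x))" .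
    have "\<Psi> (W k \<omega>) = ?b (x k \<omega> - \<mu>\<^sub>x) + (x k \<omega> \<bullet> a * Z k \<omega>) *\<^sub>R ?e k" for k
      unfolding \<Psi>_def EW[OF w] by (simp add: W_def)
    then have "(\<Sum>k<n. \<Psi> (W k \<omega>)) = (\<Sum>k<n. ?b (x k \<omega>) - ?b \<mu>\<^sub>x) + (\<Sum>k<n. (x k \<omega> \<bullet> a * Z k \<omega>) *\<^sub>R ?e k)"
      by (simp only: b_diff sum.distrib)
    also have "(\<Sum>k<n. ?b (x k \<omega>) - ?b \<mu>\<^sub>x) = ?b (s n \<omega>) - real n *\<^sub>R ?b \<mu>\<^sub>x"
      unfolding s_def b_sum by (simp add: sum_subtractf scaleR_conv_of_real sum_constant_scaleR)
    finally have S1: "S n \<omega> = ?r *\<^sub>R ((\<Sum>k<n. (x k \<omega> \<bullet> a * Z k \<omega>) *\<^sub>R ?e k) + (?b (s n \<omega>) - real n *\<^sub>R ?b \<mu>\<^sub>x))"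
      unfolding S_def by (simp add: add.commute)
    have "X n \<omega> - S n \<omega> = ?r *\<^sub>R ((\<Sum>k<n. ?y k *\<^sub>R ?e k) - (\<Sum>k<n. (x k \<omega> \<bullet> a * Z k \<omega>) *\<^sub>R ?e k))"
      unfolding X1 S1 scaleR_right_diff_distrib[symmetric] by simp
    also have "(\<Sum>k<n. ?y k *\<^sub>R ?e k) - (\<Sum>k<n. (x k \<omega> \<bullet> a * Z k \<omega>) *\<^sub>R ?e k) =
        (\<Sum>k<n. \<Sum>j\<in>UNIV. (c n \<omega> $ j - a $ j) *\<^sub>R \<tau> j (W k \<omega>))"
      unfolding sum_subtractf[symmetric] scaleR_left_diff_distrib[symmetric] \<tau>W[OF w]
    proof (intro sum.cong refl)
      fix k
      have "?y k - x k \<omega> \<bullet> a * Z k \<omega> = (\<Sum>j\<in>UNIV. (c n \<omega> $ j - a $ j) * (x k \<omega> $ j * Z k \<omega>))"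
        unfolding inner_vec_sum sum_distrib_right sum_subtractf[symmetric]
        by (intro sum.cong refl) (simp add: algebra_simps)
      then show "(?y k - x k \<omega> \<bullet> a * Z k \<omega>) *\<^sub>R ?e k = (\<Sum>j\<in>UNIV. (c n \<omega> $ j - a $ j) *\<^sub>R (x k \<omega> $ j * Z k \<omega>) *\<^sub>R ?e k)"
        by (simp add: scaleR_sum_left)
    qed
    also have "\<dots> = (\<Sum>j\<in>UNIV. (c n \<omega> $ j - a $ j) *\<^sub>R (\<Sum>k<n. \<tau> j (W k \<omega>)))"
      unfolding scaleR_sum_right by (rule sum.swap)
    finally show ?thesis
      unfolding T_def by (simp add: scaleR_sum_right mult.commute)
  qed

  \<comment> \<open>Moment bounds for the remainder\<close>
  define v where "v j = expectation (\<lambda>\<omega>. (norm (\<tau> j (W 0 \<omega>)))\<^sup>2)" for j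
  have v0: "v j \<ge> 0" for j unfolding v_def by (rule integral_nonneg_AE) simp
  have T_moment: "integrable M (\<lambda>\<omega>. norm (T n j \<omega>))" "expectation (\<lambda>\<omega>. norm (T n j \<omega>)) \<le> 1 + v j" for n j
  proof -
    have sq: "integrable M (\<lambda>\<omega>. (norm (\<tau> j (W i \<omega>)))\<^sup>2)" for i
    proof -
      interpret Oi: missing_at_random M "Y i" "\<epsilon> i" "x i" "Z i" \<beta> \<mu>\<^sub>x \<sigma>\<^sub>\<epsilon> by (rule mar)
      have "sqi M (\<lambda>\<omega>. x i \<omega> $ j * Z i \<omega> * norm (to_L2 (\<epsilon> i \<omega>)))"
        by (rule Oi.Z_eL_sqi[of "\<lambda>v. v $ j"]) (auto intro: Oi.x_component_sqi)
      then have "integrable M (\<lambda>\<omega>. (x i \<omega> $ j * Z i \<omega> * norm (to_L2 (\<epsilon> i \<omega>)))\<^sup>2)" by (simp add: sqi_def)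
      then show ?thesis
        by (subst Bochner_Integration.integrable_cong[OF refl, of _ _ "\<lambda>\<omega>. (x i \<omega> $ j * Z i \<omega> * norm (to_L2 (\<epsilon> i \<omega>)))\<^sup>2"])
          (simp_all add: \<tau>W power_mult_distrib)
    qed
    have zero: "expectation (\<lambda>\<omega>. inner (\<tau> j (W i \<omega>)) h) = 0" for i h
    proof -
      interpret Oi: missing_at_random M "Y i" "\<epsilon> i" "x i" "Z i" \<beta> \<mu>\<^sub>x \<sigma>\<^sub>\<epsilon> by (rule mar)
      have "sqi M (\<lambda>\<omega>. x i \<omega> $ j * Z i \<omega> * norm (to_L2 (\<epsilon> i \<omega>)))"
        by (rule Oi.Z_eL_sqi[of "\<lambda>v. v $ j"]) (auto intro: Oi.x_component_sqi)
      then have "expectation (\<lambda>\<omega>. x i \<omega> $ j * Z i \<omega> * inner (to_L2 (\<epsilon> i \<omega>)) h) = 0"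
        by (intro Oi.expectation_Z_eL(2)[of "\<lambda>v. v $ j"] integrable_of_sqi) auto
      then show ?thesis
        by (subst Bochner_Integration.integral_cong[OF refl, of _ _ "\<lambda>\<omega>. x i \<omega> $ j * Z i \<omega> * inner (to_L2 (\<epsilon> i \<omega>)) h"])
          (simp_all add: \<tau>W)
    qed
    have vi: "expectation (\<lambda>\<omega>. (norm (\<tau> j (W i \<omega>)))\<^sup>2) = v j" for i
    proof -
      have m: "(\<lambda>p. (norm (\<tau> j p))\<^sup>2) \<in> borel_measurable ?K" by measurable
      have "(\<integral>z. z \<partial>distr M borel (\<lambda>\<omega>. (norm (\<tau> j (W i \<omega>)))\<^sup>2)) = (\<integral>z. z \<partial>distr M borel (\<lambda>\<omega>. (norm (\<tau> j (W 0 \<omega>)))\<^sup>2))"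
        by (simp only: indep_identical_image(2)[OF indepW identW m, of i 0])
      then show ?thesis by (simp add: integral_distr v_def)
    qed
    note m2 = hilbert_second_moment_sum[OF e indep_identical_image(1)[OF indepW identW \<tau>_meas] sq zero, of n]
    have nT: "(norm (T n j \<omega>))\<^sup>2 = (1 / real n) * (norm (\<Sum>i<n. \<tau> j (W i \<omega>)))\<^sup>2" for \<omega>
      unfolding T_def by (simp add: power_mult_distrib power_divide)
    have i2: "integrable M (\<lambda>\<omega>. (norm (T n j \<omega>))\<^sup>2)" unfolding nT using m2(1) by simp
    have E2: "expectation (\<lambda>\<omega>. (norm (T n j \<omega>))\<^sup>2) \<le> v j"
      unfolding nT integral_mult_right_zero m2(2) vi using v0[of j] by (cases "n = 0") auto
    have Tm: "T n j \<in> borel_measurable M" unfolding T_def[abs_def] by measurable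
    then show i1: "integrable M (\<lambda>\<omega>. norm (T n j \<omega>))"
      using i2 by (intro integrable_of_sqi) (simp add: sqi_def)
    \<comment> \<open>Passage from second to first moments, for use in Markov's inequality; the
      resulting bound is uniform in \<open>n\<close>.\<close>
    have "z \<le> 1 + z\<^sup>2" for z :: real
    proof -
      have "2 * z \<le> z\<^sup>2 + 1" using zero_le_power2[of "z - 1"] by (simp add: power2_diff)
      then show ?thesis using zero_le_power2[of z] by linarith
    qed
    then have "expectation (\<lambda>\<omega>. norm (T n j \<omega>)) \<le> expectation (\<lambda>\<omega>. 1 + (norm (T n j \<omega>))\<^sup>2)"
      using i1 i2 by (intro integral_mono) auto
    also have "\<dots> \<le> 1 + v j" using i2 E2 by (simp add: prob_space)
    finally show "expectation (\<lambda>\<omega>. norm (T n j \<omega>)) \<le> 1 + v j" .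
  qed

  \<comment> \<open>Laws of large numbers for the Gram matrix and the covariate mean\<close>
  define H where "H n \<omega> = (\<Sum>j\<in>UNIV. \<Sum>k\<in>UNIV. \<bar>(1 / real n) * A n \<omega> $ j $ k - P $ j $ k\<bar>) +
      (\<Sum>j\<in>UNIV. \<bar>(1 / real n) * s n \<omega> $ j - \<mu>\<^sub>x $ j\<bar>)" for n \<omega>
  have xs: "integrable M (\<lambda>\<omega>. x i \<omega> $ j)" for i j
    by (rule integrable_of_sqi[OF missing_at_random.x_component_sqi[OF mar]])
  have A_int: "integrable M (\<lambda>\<omega>. \<bar>(1 / real n) * A n \<omega> $ j $ k - P $ j $ k\<bar>)" for n j k
    unfolding A_comp using zxx_int by auto
  have s_int: "integrable M (\<lambda>\<omega>. \<bar>(1 / real n) * s n \<omega> $ j - \<mu>\<^sub>x $ j\<bar>)" for n j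
    unfolding s_def using xs by auto
  have H_int: "integrable M (H n)" for n
    unfolding H_def[abs_def] by (intro Bochner_Integration.integrable_add Bochner_Integration.integrable_sum A_int s_int)
  have H_lim: "(\<lambda>n. expectation (H n)) \<longlonglongrightarrow> 0"
  proof -
    have EH: "expectation (H n) = (\<Sum>j\<in>UNIV. \<Sum>k\<in>UNIV. expectation (\<lambda>\<omega>. \<bar>(1 / real n) * A n \<omega> $ j $ k - P $ j $ k\<bar>)) +
        (\<Sum>j\<in>UNIV. expectation (\<lambda>\<omega>. \<bar>(1 / real n) * s n \<omega> $ j - \<mu>\<^sub>x $ j\<bar>))" for n
      unfolding H_def using A_int s_int by (simp add: Bochner_Integration.integral_add Bochner_Integration.integral_sum Bochner_Integration.integrable_sum)
    have l1: "(\<lambda>n. expectation (\<lambda>\<omega>. \<bar>(1 / real n) * A n \<omega> $ j $ k - P $ j $ k\<bar>)) \<longlonglongrightarrow> 0" for j k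
    proof -
      have m: "(\<lambda>p :: L2 \<times> (real ^ 'p) \<times> real. snd (snd p) * (fst (snd p) $ j * fst (snd p) $ k)) \<in> borel_measurable ?K" by measurable
      have eq: "snd (snd (W i \<omega>)) * (fst (snd (W i \<omega>)) $ j * fst (snd (W i \<omega>)) $ k) = Z i \<omega> * (x i \<omega> $ j * x i \<omega> $ k)" for i \<omega>
        by (simp add: W_def)
      show ?thesis
        unfolding A_comp P_comp
        by (rule weak_law_L1[OF indep_identical_image(1)[OF indepW identW m, unfolded eq]
              indep_identical_image(2)[OF indepW identW m, unfolded eq] zxx_int])
    qed
    have l2: "(\<lambda>n. expectation (\<lambda>\<omega>. \<bar>(1 / real n) * s n \<omega> $ j - \<mu>\<^sub>x $ j\<bar>)) \<longlonglongrightarrow> 0" for j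
    proof -
      have m: "(\<lambda>p :: L2 \<times> (real ^ 'p) \<times> real. fst (snd p) $ j) \<in> borel_measurable ?K" by measurable
      have eq: "fst (snd (W i \<omega>)) $ j = x i \<omega> $ j" for i \<omega> by (simp add: W_def)
      show ?thesis
        unfolding s_def sum_component O.expectation_x_component[symmetric]
        by (rule weak_law_L1[OF indep_identical_image(1)[OF indepW identW m, unfolded eq]
              indep_identical_image(2)[OF indepW identW m, unfolded eq] xs])
    qed
    have "(\<lambda>n. expectation (H n)) \<longlonglongrightarrow> (\<Sum>j\<in>(UNIV :: 'p set). \<Sum>k\<in>(UNIV :: 'p set). 0) + (\<Sum>j\<in>(UNIV :: 'p set). 0)"
      unfolding EH by (intro tendsto_add tendsto_sum l1 l2)
    then show ?thesis by simp
  qed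
  \<comment> \<open>The sum of the absolute errors of the entries dominates the distance in the
    product space, in which continuity of Cramer's rule is formulated.\<close>
  have H_dist: "dist ((1 / real n) *\<^sub>R A n \<omega>, (1 / real n) *\<^sub>R s n \<omega>) (P, \<mu>\<^sub>x) \<le> H n \<omega>" for n \<omega>
  proof -
    let ?D = "(1 / real n) *\<^sub>R A n \<omega> - P" and ?d = "(1 / real n) *\<^sub>R s n \<omega> - \<mu>\<^sub>x"
    have nv: "norm u \<le> (\<Sum>j\<in>UNIV. norm (u $ j))" for u :: "'c::real_normed_vector ^ 'p"
      unfolding norm_vec_def by (rule L2_set_le_sum) simp
    have "dist ((1 / real n) *\<^sub>R A n \<omega>, (1 / real n) *\<^sub>R s n \<omega>) (P, \<mu>\<^sub>x) = norm (?D, ?d)" by (simp add: dist_norm)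
    also have "\<dots> \<le> norm ?D + norm ?d" by (rule norm_Pair_le)
    also have "norm ?D \<le> (\<Sum>j\<in>UNIV. \<Sum>k\<in>UNIV. norm (?D $ j $ k))"
      by (rule order_trans[OF nv sum_mono[OF nv]])
    also have "norm ?d \<le> (\<Sum>j\<in>UNIV. norm (?d $ j))" by (rule nv)
    finally show ?thesis by (simp add: H_def)
  qed

  \<comment> \<open>Negligibility of the remainder, and convergence\<close>
  have cram: "cramer_solution P \<mu>\<^sub>x = a"
    unfolding a_def by (rule matrix_inv_mult_cramer[OF invP, symmetric])
  have close: "(\<lambda>n. measure M {\<omega> \<in> space M. dist (X n \<omega>) (S n \<omega>) > \<eta>}) \<longlonglongrightarrow> 0" if \<eta>: "\<eta> > 0" for \<eta>
  proof (rule LIMSEQ_I)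
    fix r :: real assume r: "r > 0"
    define K where "K = (\<Sum>j\<in>(UNIV :: 'p set). 1 + v j)"
    have K0: "K > 0" unfolding K_def using v0 by (intro sum_pos) (auto simp: add_pos_nonneg)
    \<comment> \<open>Chosen so that Markov's inequality for \<open>Q n\<close> at the level
      \<open>\<eta> / \<rho>\<close> yields \<open>K / (\<eta> / \<rho>) = r / 2\<close>.\<close>
    define \<rho> where "\<rho> = \<eta> * r / (2 * K)"
    have \<rho>: "\<rho> > 0" using \<eta> r K0 by (simp add: \<rho>_def)
    have "isCont (\<lambda>w. cramer_solution (fst w) (snd w)) (P, \<mu>\<^sub>x)" by (rule isCont_cramer_solution[OF detP])
    then obtain \<delta>1 where \<delta>1: "\<delta>1 > 0"
      "\<And>w. dist w (P, \<mu>\<^sub>x) < \<delta>1 \<Longrightarrow> dist (cramer_solution (fst w) (snd w)) (cramer_solution P \<mu>\<^sub>x) < \<rho>"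
      using \<rho> unfolding continuous_at_eps_delta by fastforce
    \<comment> \<open>Within \<open>\<delta>2\<close> the determinant stays nonzero, so the
      normalized Gram matrix is invertible, and with it \<open>A n \<omega>\<close>.\<close>
    have "isCont (\<lambda>w :: (real ^ 'p ^ 'p) \<times> (real ^ 'p). det (fst w)) (P, \<mu>\<^sub>x)"
      by (rule continuous_det) (intro continuous_intros)
    then obtain \<delta>2 where \<delta>2: "\<delta>2 > 0" "\<And>w :: (real ^ 'p ^ 'p) \<times> (real ^ 'p). dist w (P, \<mu>\<^sub>x) < \<delta>2 \<Longrightarrow> dist (det (fst w)) (det P) < \<bar>det P\<bar>"
      using detP unfolding continuous_at_eps_delta by (metis fst_conv zero_less_abs_iff)
    define \<delta> where "\<delta> = min \<delta>1 \<delta>2"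
    have \<delta>: "\<delta> > 0" using \<delta>1 \<delta>2 by (simp add: \<delta>_def)
    define Q where "Q n \<omega> = (\<Sum>j\<in>UNIV. norm (T n j \<omega>))" for n \<omega>
    have Q_int: "integrable M (Q n)" for n unfolding Q_def[abs_def] by (intro Bochner_Integration.integrable_sum T_moment)
    have Q_le: "expectation (Q n) \<le> K" for n
      unfolding Q_def K_def using T_moment by (simp add: Bochner_Integration.integral_sum sum_mono)
    have Q0: "Q n \<omega> \<ge> 0" for n \<omega> unfolding Q_def by (simp add: sum_nonneg)
    have H0: "H n \<omega> \<ge> 0" for n \<omega> unfolding H_def by (simp add: sum_nonneg)
    have key: "dist (X n \<omega>) (S n \<omega>) \<le> \<rho> * Q n \<omega>" if w: "\<omega> \<in> space M" and n: "n > 0" and h: "H n \<omega> < \<delta>" for n \<omega>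
    proof -
      let ?B = "(1 / real n) *\<^sub>R A n \<omega>" and ?s = "(1 / real n) *\<^sub>R s n \<omega>"
      have d: "dist (?B, ?s) (P, \<mu>\<^sub>x) < \<delta>1" "dist (?B, ?s) (P, \<mu>\<^sub>x) < \<delta>2"
        using H_dist[of n \<omega>] h by (auto simp: \<delta>_def)
      have "dist (det ?B) (det P) < \<bar>det P\<bar>" using \<delta>2(2)[OF d(2)] by simp
      then have detB: "det ?B \<noteq> 0" by (auto simp: dist_real_def)
      have invB: "invertible ?B" using detB by (simp add: invertible_det_nz)
      have "invertible (A n \<omega>)"
      proof -
        have "?B *v u = 0" if "A n \<omega> *v u = 0" for u using that by (simp add: scaleR_matrix_vector_assoc[symmetric])
        then show ?thesis
          using invB unfolding invertible_left_inverse matrix_left_invertible_ker by blast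
      qed
      note inv = this
      have "?B *v c n \<omega> = ?s" using Ac[OF inv] by (simp add: scaleR_matrix_vector_assoc[symmetric])
      then have "c n \<omega> = cramer_solution ?B ?s"
        unfolding cramer_solution_def using cramer[OF detB] by simp
      then have ca: "dist (c n \<omega>) a < \<rho>" using \<delta>1(2)[OF d(1)] by (simp add: cram)
      have "dist (X n \<omega>) (S n \<omega>) = norm (\<Sum>j\<in>UNIV. (c n \<omega> $ j - a $ j) *\<^sub>R T n j \<omega>)"
        unfolding dist_norm diff[OF w inv n] ..
      also have "\<dots> \<le> (\<Sum>j\<in>UNIV. \<rho> * norm (T n j \<omega>))"
      proof (rule sum_norm_le)
        fix j
        have "\<bar>c n \<omega> $ j - a $ j\<bar> \<le> \<rho>"
          using component_le_norm_cart[of "c n \<omega> - a" j] ca by (simp add: dist_norm)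
        then show "norm ((c n \<omega> $ j - a $ j) *\<^sub>R T n j \<omega>) \<le> \<rho> * norm (T n j \<omega>)" by (simp add: mult_right_mono)
      qed
      finally show ?thesis by (simp add: Q_def sum_distrib_left)
    qed
    have bound: "measure M {\<omega> \<in> space M. dist (X n \<omega>) (S n \<omega>) > \<eta>} \<le> expectation (H n) / \<delta> + r / 2" if n: "n > 0" for n
    proof -
      have [measurable]: "H n \<in> borel_measurable M" "Q n \<in> borel_measurable M" using H_int Q_int by auto
      have q: "\<eta> / \<rho> > 0" using \<eta> \<rho> by simp
      \<comment> \<open>Beyond \<open>\<eta>\<close>, either the empirical moments are off by at
        least \<open>\<delta>\<close>, or the remainders are so large that a coefficient error below
        \<open>\<rho>\<close> does not compensate for them.\<close>
      have "{\<omega> \<in> space M. dist (X n \<omega>) (S n \<omega>) > \<eta>} \<subseteq> {\<omega> \<in> space M. H n \<omega> \<ge> \<delta>} \<union> {\<omega> \<in> space M. Q n \<omega> \<ge> \<eta> / \<rho>}"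
      proof
        fix \<omega> assume w: "\<omega> \<in> {\<omega> \<in> space M. dist (X n \<omega>) (S n \<omega>) > \<eta>}"
        show "\<omega> \<in> {\<omega> \<in> space M. H n \<omega> \<ge> \<delta>} \<union> {\<omega> \<in> space M. Q n \<omega> \<ge> \<eta> / \<rho>}"
        proof (cases "H n \<omega> < \<delta>")
          case True
          then have "\<eta> < \<rho> * Q n \<omega>" using key[of \<omega> n] w n by auto
          then show ?thesis using w \<rho> by (simp add: pos_divide_le_eq mult.commute)
        qed (use w in auto)
      qed
      then have "measure M {\<omega> \<in> space M. dist (X n \<omega>) (S n \<omega>) > \<eta>} \<le>
          measure M ({\<omega> \<in> space M. H n \<omega> \<ge> \<delta>} \<union> {\<omega> \<in> space M. Q n \<omega> \<ge> \<eta> / \<rho>})"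
        by (intro finite_measure_mono) measurable
      also have "\<dots> \<le> measure M {\<omega> \<in> space M. H n \<omega> \<ge> \<delta>} + measure M {\<omega> \<in> space M. Q n \<omega> \<ge> \<eta> / \<rho>}"
        by (rule measure_Un_le) measurable
      also have "\<dots> \<le> expectation (H n) / \<delta> + expectation (Q n) / (\<eta> / \<rho>)"
        using H0 Q0 \<delta> q H_int Q_int by (intro add_mono integral_Markov_inequality_measure[where A = "{}"]) auto
      also have "expectation (Q n) / (\<eta> / \<rho>) \<le> K / (\<eta> / \<rho>)" using Q_le q by (intro divide_right_mono) auto
      also have "K / (\<eta> / \<rho>) = r / 2" using K0 \<eta> by (simp add: \<rho>_def)
      finally show ?thesis by simp
    qed
    have "(\<lambda>n. expectation (H n) / \<delta>) \<longlonglongrightarrow> 0 / \<delta>" by (intro tendsto_divide H_lim tendsto_const) (use \<delta> in simp)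
    then have "eventually (\<lambda>n. expectation (H n) / \<delta> < r / 2) sequentially"
      using r by (intro order_tendstoD(2)) auto
    with eventually_gt_at_top[of 0]
    have "eventually (\<lambda>n. norm (measure M {\<omega> \<in> space M. dist (X n \<omega>) (S n \<omega>) > \<eta>} - 0) < r) sequentially"
    proof eventually_elim
      case (elim n)
      have "measure M {\<omega> \<in> space M. dist (X n \<omega>) (S n \<omega>) > \<eta>} < r"
        using bound[OF elim(1)] elim(2) by linarith
      then show ?case by simp
    qed
    then show "\<exists>no. \<forall>n\<ge>no. norm (measure M {\<omega> \<in> space M. dist (X n \<omega>) (S n \<omega>) > \<eta>} - 0) < r"
      by (simp add: eventually_sequentially)
  qed
  have "conv_in_distr M X white_noise (\<lambda>w. to_L2 (G w))"
  proof (rule conv_in_distr_of_lipschitz[OF prob prob_space_white_noise X_meas L2_process_measurable[OF G(1)]])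
    fix F :: "L2 \<Rightarrow> real" and C B assume F: "lip_bdd F C B"
    show "(\<lambda>n. expectation (\<lambda>\<omega>. F (X n \<omega>))) \<longlonglongrightarrow> WN.expectation (\<lambda>w. F (to_L2 (G w)))"
      by (rule slutsky_lipschitz[OF prob X_meas S_meas close F S_conv[OF F]])
  qed
  then show ?thesis
    using prob_space_white_noise G(1) gp unfolding X_def[abs_def] by blast
qed

end
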